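(* Let $a>0$, $\alpha>0$ and let $V_+,V_-\in L^\infty(\mathbb{R})$ be real-valued functions vanishing at infinity in the sense that $$\lim_{L\to\infty}\operatorname*{ess\,sup}_{\mathbb{R}\setminus[-L,L]}|V_\pm|=0 .$$ Then $\sigma_{\mathrm{ess}}(H_{\alpha,V_+,V_-})=[\xi_0,\infty)$.
   Context: $H_{\alpha,V_+,V_-}$ is the self-adjoint operator in $L^2(\mathbb{R}^2)$ associated with the closed, lower-bounded quadratic form $$\mathcal{E}_{\alpha,V_+,V_-}[\psi]=\int_{\mathbb{R}^2}|\nabla\psi|^2+\int_{\mathbb{R}}(V_+(x_1)-\alpha)|\psi(x_1,a)|^2\,dx_1+\int_{\mathbb{R}}(V_-(x_1)-\alpha)|\psi(x_1,-a)|^2\,dx_1,\qquad \psi\in W^{1,2}(\mathbb{R}^2),$$ where $\psi(\cdot,\pm a)$ denote the traces of $\psi$ on the lines $\mathbb{R}\times\{\pm a\}$. $-\Delta_\alpha^{\mathbb{R}}$ is the self-adjoint operator in $L^2(\mathbb{R})$ associated with the form $\varepsilon_\alpha[\phi]=\int_{\mathbb{R}}|\phi'|^2-\alpha|\phi(a)|^2-\alpha|\phi(-a)|^2$, $\phi\in W^{1,2}(\mathbb{R})$ (two point interactions of strength $\alpha$ at $\pm a$). It has at least one negative eigenvalue; $\xi_0<0$ denotes its lowest eigenvalue. *)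

theory Defs
  imports "HOL-Analysis.Analysis" "HOL-Probability.Essential_Supremum"
begin

section \<open>Function spaces (functions modulo nothing; a.e. equality handled explicitly)\<close>

definition L2 :: "('a::euclidean_space \<Rightarrow> complex) \<Rightarrow> bool" where
  "L2 f \<longleftrightarrow> f \<in> borel_measurable lebesgue \<and> integrable lebesgue (\<lambda>x. (cmod (f x))\<^sup>2)"

definition inner_L2 :: "('a::euclidean_space \<Rightarrow> complex) \<Rightarrow> ('a \<Rightarrow> complex) \<Rightarrow> complex" where
  "inner_L2 f g = integral\<^sup>L lebesgue (\<lambda>x. cnj (f x) * g x)"

definition norm_L2 :: "('a::euclidean_space \<Rightarrow> complex) \<Rightarrow> real" where
  "norm_L2 f = sqrt (integral\<^sup>L lebesgue (\<lambda>x. (cmod (f x))\<^sup>2))"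

definition partial :: "('a::euclidean_space \<Rightarrow> real) \<Rightarrow> 'a \<Rightarrow> 'a \<Rightarrow> real" where
  "partial g b x = deriv (\<lambda>t. g (x + t *\<^sub>R b)) 0"

text \<open>C-infinity: all iterated partial derivatives exist and are continuous.\<close>
definition smooth :: "('a::euclidean_space \<Rightarrow> real) \<Rightarrow> bool" where
  "smooth f \<longleftrightarrow> (\<exists>S. f \<in> S \<and> (\<forall>g\<in>S. continuous_on UNIV g \<and>
      (\<forall>b\<in>Basis. \<exists>g'\<in>S. \<forall>x. ((\<lambda>t. g (x + t *\<^sub>R b)) has_real_derivative g' x) (at 0))))"

definition test_fun :: "('a::euclidean_space \<Rightarrow> real) \<Rightarrow> bool" where
  "test_fun f \<longleftrightarrow> smooth f \<and> bounded {x. f x \<noteq> 0}"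

definition ctest_fun :: "('a::euclidean_space \<Rightarrow> complex) \<Rightarrow> bool" where
  "ctest_fun f \<longleftrightarrow> (\<exists>u v. test_fun u \<and> test_fun v \<and>
      f = (\<lambda>x. complex_of_real (u x) + \<i> * complex_of_real (v x)))"

definition weak_deriv :: "('a::euclidean_space \<Rightarrow> complex) \<Rightarrow> 'a \<Rightarrow> ('a \<Rightarrow> complex) \<Rightarrow> bool" where
  "weak_deriv f b g \<longleftrightarrow> (\<forall>\<eta>. test_fun \<eta> \<longrightarrow>
      integral\<^sup>L lebesgue (\<lambda>x. f x * complex_of_real (partial \<eta> b x))
      = - integral\<^sup>L lebesgue (\<lambda>x. g x * complex_of_real (\<eta> x)))"

definition W12 :: "('a::euclidean_space \<Rightarrow> complex) \<Rightarrow> bool" where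
  "W12 f \<longleftrightarrow> L2 f \<and> (\<forall>b\<in>Basis. \<exists>g. L2 g \<and> weak_deriv f b g)"

definition wgrad :: "('a::euclidean_space \<Rightarrow> complex) \<Rightarrow> 'a \<Rightarrow> ('a \<Rightarrow> complex)" where
  "wgrad f b = (SOME g. L2 g \<and> weak_deriv f b g)"

definition W12_dist2 :: "('a::euclidean_space \<Rightarrow> complex) \<Rightarrow> ('a \<Rightarrow> complex) \<Rightarrow> real" where
  "W12_dist2 f g = (norm_L2 (\<lambda>x. f x - g x))\<^sup>2
      + (\<Sum>b\<in>Basis. (norm_L2 (\<lambda>x. wgrad f b x - wgrad g b x))\<^sup>2)"

definition is_trace :: "(real \<times> real \<Rightarrow> complex) \<Rightarrow> real \<Rightarrow> (real \<Rightarrow> complex) \<Rightarrow> bool" where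
  "is_trace \<psi> c h \<longleftrightarrow> L2 h \<and> (\<exists>\<psi>s :: nat \<Rightarrow> real \<times> real \<Rightarrow> complex.
      (\<forall>n. ctest_fun (\<psi>s n)) \<and>
      (\<lambda>n. W12_dist2 (\<psi>s n) \<psi>) \<longlonglongrightarrow> 0 \<and>
      (\<lambda>n. norm_L2 (\<lambda>x1. \<psi>s n (x1, c) - h x1)) \<longlonglongrightarrow> 0)"

definition trace_line :: "(real \<times> real \<Rightarrow> complex) \<Rightarrow> real \<Rightarrow> (real \<Rightarrow> complex)" where
  "trace_line \<psi> c = (SOME h. is_trace \<psi> c h)"

definition cont_rep :: "(real \<Rightarrow> complex) \<Rightarrow> (real \<Rightarrow> complex)" where
  "cont_rep \<phi> = (SOME h. continuous_on UNIV h \<and> (AE x in lebesgue. h x = \<phi> x))"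

text \<open>Graph of the operator associated with the (closed, lower bounded) form with
  domain D and sesquilinear form s (representation theorem):
  psi in dom(H), H psi = f  iff  psi in D, f in L2, s(phi,psi) = <phi,f> for all phi in D.\<close>
definition assoc_op :: "(('a::euclidean_space \<Rightarrow> complex) \<Rightarrow> bool)
    \<Rightarrow> (('a \<Rightarrow> complex) \<Rightarrow> ('a \<Rightarrow> complex) \<Rightarrow> complex)
    \<Rightarrow> ('a \<Rightarrow> complex) \<Rightarrow> ('a \<Rightarrow> complex) \<Rightarrow> bool" where
  "assoc_op D s \<psi> f \<longleftrightarrow> D \<psi> \<and> L2 f \<and> (\<forall>\<phi>. D \<phi> \<longrightarrow> s \<phi> \<psi> = inner_L2 \<phi> f)"

definition resolvent_set :: "(('a::euclidean_space \<Rightarrow> complex) \<Rightarrow> ('a \<Rightarrow> complex) \<Rightarrow> bool) \<Rightarrow> complex set" where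
  "resolvent_set G = {z. (\<forall>f. L2 f \<longrightarrow> (\<exists>\<psi> g. G \<psi> g \<and> (AE x in lebesgue. g x - z * \<psi> x = f x)))
      \<and> (\<exists>C. \<forall>\<psi> g. G \<psi> g \<longrightarrow> norm_L2 \<psi> \<le> C * norm_L2 (\<lambda>x. g x - z * \<psi> x))}"

definition spectrum_op :: "(('a::euclidean_space \<Rightarrow> complex) \<Rightarrow> ('a \<Rightarrow> complex) \<Rightarrow> bool) \<Rightarrow> complex set" where
  "spectrum_op G = - resolvent_set G"

definition eigenfun :: "(('a::euclidean_space \<Rightarrow> complex) \<Rightarrow> ('a \<Rightarrow> complex) \<Rightarrow> bool) \<Rightarrow> complex \<Rightarrow> ('a \<Rightarrow> complex) \<Rightarrow> bool" where
  "eigenfun G z \<psi> \<longleftrightarrow> (\<exists>g. G \<psi> g \<and> (AE x in lebesgue. g x = z * \<psi> x))"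

definition is_eigenvalue :: "(('a::euclidean_space \<Rightarrow> complex) \<Rightarrow> ('a \<Rightarrow> complex) \<Rightarrow> bool) \<Rightarrow> complex \<Rightarrow> bool" where
  "is_eigenvalue G z \<longleftrightarrow> (\<exists>\<psi>. eigenfun G z \<psi> \<and> norm_L2 \<psi> \<noteq> 0)"

definition finite_multiplicity :: "(('a::euclidean_space \<Rightarrow> complex) \<Rightarrow> ('a \<Rightarrow> complex) \<Rightarrow> bool) \<Rightarrow> complex \<Rightarrow> bool" where
  "finite_multiplicity G z \<longleftrightarrow> \<not> (\<exists>e :: nat \<Rightarrow> 'a \<Rightarrow> complex. (\<forall>n. eigenfun G z (e n)) \<and>
      (\<forall>m n. inner_L2 (e m) (e n) = (if m = n then 1 else 0)))"

definition disc_spectrum :: "(('a::euclidean_space \<Rightarrow> complex) \<Rightarrow> ('a \<Rightarrow> complex) \<Rightarrow> bool) \<Rightarrow> complex set" where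
  "disc_spectrum G = {z\<in>spectrum_op G. is_eigenvalue G z \<and> finite_multiplicity G z \<and>
      (\<exists>\<epsilon>>0. spectrum_op G \<inter> ball z \<epsilon> = {z})}"

definition ess_spectrum :: "(('a::euclidean_space \<Rightarrow> complex) \<Rightarrow> ('a \<Rightarrow> complex) \<Rightarrow> bool) \<Rightarrow> complex set" where
  "ess_spectrum G = spectrum_op G - disc_spectrum G"

definition form_H :: "real \<Rightarrow> (real \<Rightarrow> real) \<Rightarrow> (real \<Rightarrow> real) \<Rightarrow> real
    \<Rightarrow> (real \<times> real \<Rightarrow> complex) \<Rightarrow> (real \<times> real \<Rightarrow> complex) \<Rightarrow> complex" where
  "form_H \<alpha> Vp Vm a \<phi> \<psi> =
     (\<Sum>b\<in>Basis. integral\<^sup>L lebesgue (\<lambda>x. cnj (wgrad \<phi> b x) * wgrad \<psi> b x))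
   + integral\<^sup>L lebesgue (\<lambda>x1. complex_of_real (Vp x1 - \<alpha>) * cnj (trace_line \<phi> a x1) * trace_line \<psi> a x1)
   + integral\<^sup>L lebesgue (\<lambda>x1. complex_of_real (Vm x1 - \<alpha>) * cnj (trace_line \<phi> (-a) x1) * trace_line \<psi> (-a) x1)"

definition H_op :: "real \<Rightarrow> (real \<Rightarrow> real) \<Rightarrow> (real \<Rightarrow> real) \<Rightarrow> real
    \<Rightarrow> (real \<times> real \<Rightarrow> complex) \<Rightarrow> (real \<times> real \<Rightarrow> complex) \<Rightarrow> bool" where
  "H_op \<alpha> Vp Vm a = assoc_op W12 (form_H \<alpha> Vp Vm a)"

definition form_1D :: "real \<Rightarrow> real \<Rightarrow> (real \<Rightarrow> complex) \<Rightarrow> (real \<Rightarrow> complex) \<Rightarrow> complex" where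
  "form_1D \<alpha> a \<phi> \<psi> =
     integral\<^sup>L lebesgue (\<lambda>x. cnj (wgrad \<phi> 1 x) * wgrad \<psi> 1 x)
   - complex_of_real \<alpha> * cnj (cont_rep \<phi> a) * cont_rep \<psi> a
   - complex_of_real \<alpha> * cnj (cont_rep \<phi> (-a)) * cont_rep \<psi> (-a)"

definition Delta_1D :: "real \<Rightarrow> real \<Rightarrow> (real \<Rightarrow> complex) \<Rightarrow> (real \<Rightarrow> complex) \<Rightarrow> bool" where
  "Delta_1D \<alpha> a = assoc_op W12 (form_1D \<alpha> a)"

definition xi0 :: "real \<Rightarrow> real \<Rightarrow> real" where
  "xi0 \<alpha> a = Inf {t::real. is_eigenvalue (Delta_1D \<alpha> a) (complex_of_real t)}"

end

theory Submission
  imports Defs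
begin

text \<open>
  Let \<open>\<kappa> > 0\<close> solve \<open>\<kappa> (1 + tanh (\<kappa> a)) = \<alpha>\<close>. Completing the square with the logarithmic derivative
  \<open>w\<close> of the ground state turns the form of the two point interactions plus \<open>\<kappa>\<^sup>2\<close> into
  \<open>\<integral> \<bar>\<phi>' - w \<phi>\<bar>\<^sup>2\<close>, so \<open>\<xi>\<^sub>0 = - \<kappa>\<^sup>2\<close>.

  For \<open>\<Lambda> = k\<^sup>2 - \<kappa>\<^sup>2\<close> a Weyl sequence is the product of \<open>cos (k x\<^sub>1 + p)\<close>, a wide bump that is moved to
  infinity in \<open>x\<^sub>1\<close>, where the potentials are small, and an approximate ground state in \<open>x\<^sub>2\<close>.
  Hence \<open>[- \<kappa>\<^sup>2, \<infinity>)\<close> lies in the spectrum, and none of its points is isolated.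

  For \<open>\<Lambda> < - \<kappa>\<^sup>2\<close> the same square, used in every fibre, makes the form without potentials coercive.
  A potential matters only on a bounded piece of its line, which is cut into finitely many small
  squares; a Poincare inequality on each square bounds the trace by a small multiple of the
  gradient plus the mean value. So the form is coercive up to finitely many functionals, and
  the spectrum below \<open>- \<kappa>\<^sup>2\<close> consists of isolated eigenvalues of finite multiplicity.
\<close>

text \<open>The equation for \<kappa> is the matching condition of the even bound state,
  \<open>cosh\<close> between the points and a decaying exponential outside: at \<open>a\<close> its
  logarithmic derivative drops from \<kappa> tanh (\<kappa> a) to -\<kappa>, a jump of -\<alpha>.

  Traces, weak gradients and continuous representatives are choices among functions that agree
  almost everywhere. Form identities and bounds are therefore phrased as statements about bounded
  Hermitian forms on W12, checked on real test functions by the fundamental theorem of calculus and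
  Fubini, and carried over by density.

  On the abstract side a point is in the resolvent set iff the weak equation is solvable and the
  solution is bounded by the data. Solvability starts from a minimisation at one point far to the
  left and spreads by Neumann series wherever such a bound holds. Coercivity up to finitely many
  functionals is used twice: it yields an eigenfunction wherever the bound fails, and with Bessel's
  inequality it excludes an infinite orthonormal system of eigenfunctions with nearby eigenvalues.
  The latter gives both finite multiplicity and isolation.\<close>

type_synonym plane = "real \<times> real"

abbreviation lebesgue_int :: "('a::euclidean_space \<Rightarrow> 'b::{banach, second_countable_topology}) \<Rightarrow> 'b" (binder "LEBINT " 10)
  where "LEBINT x. f x \<equiv> integral\<^sup>L lebesgue f"

abbreviation cr :: "('a \<Rightarrow> real) \<Rightarrow> 'a \<Rightarrow> complex" where
  "cr u x \<equiv> complex_of_real (u x)"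

abbreviation "rnorm u \<equiv> norm_L2 (cr u)"

abbreviation "L2_lim x f \<equiv> (\<lambda>n. norm_L2 (\<lambda>t. x n t - f t)) \<longlonglongrightarrow> 0"

section \<open>Hermitian forms and the operators they define\<close>

text \<open>Kept outside the locale so that differences formed for several forms over the same
  operations are one and the same term.\<close>

definition lsub :: "('v \<Rightarrow> 'v \<Rightarrow> 'v) \<Rightarrow> (complex \<Rightarrow> 'v \<Rightarrow> 'v) \<Rightarrow> 'v \<Rightarrow> 'v \<Rightarrow> 'v" where
  "lsub add scl u v = add u (scl (-1) v)"

text \<open>Elements are functions, not classes modulo null sets, so the vector space operations are
  parameters and the forms are only semidefinite.\<close>

locale herm_form =
  fixes P :: "'v \<Rightarrow> bool" and add :: "'v \<Rightarrow> 'v \<Rightarrow> 'v" and scl :: "complex \<Rightarrow> 'v \<Rightarrow> 'v"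
    and f :: "'v \<Rightarrow> 'v \<Rightarrow> complex"
  assumes add_closed: "P u \<Longrightarrow> P v \<Longrightarrow> P (add u v)"
    and scl_closed: "P u \<Longrightarrow> P (scl c u)"
    and f_add: "P u \<Longrightarrow> P v \<Longrightarrow> P w \<Longrightarrow> f u (add v w) = f u v + f u w"
    and f_scl: "P u \<Longrightarrow> P v \<Longrightarrow> f u (scl c v) = c * f u v"
    and f_cnj: "P u \<Longrightarrow> P v \<Longrightarrow> f v u = cnj (f u v)"
begin

abbreviation sub :: "'v \<Rightarrow> 'v \<Rightarrow> 'v" where "sub \<equiv> lsub add scl"

lemma sub_closed: "P u \<Longrightarrow> P v \<Longrightarrow> P (sub u v)"
  by (simp add: lsub_def add_closed scl_closed)

lemma f_add_left: "P u \<Longrightarrow> P v \<Longrightarrow> P w \<Longrightarrow> f (add v w) u = f v u + f w u"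
  using f_cnj[of u "add v w"] f_cnj[of u v] f_cnj[of u w]
  by (simp add: f_add add_closed)

lemma f_scl_left: "P u \<Longrightarrow> P v \<Longrightarrow> f (scl c v) u = cnj c * f v u"
  using f_cnj[of u "scl c v"] f_cnj[of u v]
  by (simp add: f_scl scl_closed)

lemma f_sub: "P u \<Longrightarrow> P v \<Longrightarrow> P w \<Longrightarrow> f u (sub v w) = f u v - f u w"
  by (simp add: lsub_def f_add f_scl scl_closed)

lemma f_sub_left: "P u \<Longrightarrow> P v \<Longrightarrow> P w \<Longrightarrow> f (sub v w) u = f v u - f w u"
  by (simp add: lsub_def f_add_left f_scl_left scl_closed)

lemmas lin = f_add f_add_left f_scl f_scl_left f_sub f_sub_left add_closed scl_closed sub_closed

lemma quad_real: "P u \<Longrightarrow> f u u = complex_of_real (Re (f u u))"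
  using f_cnj[of u u] by (simp add: complex_eq_iff)

lemma Re_comm: "P u \<Longrightarrow> P v \<Longrightarrow> Re (f v u) = Re (f u v)"
  using f_cnj[of u v] by simp

lemma quad_add: "P u \<Longrightarrow> P v \<Longrightarrow> Re (f (add u v) (add u v)) = Re (f u u) + Re (f v v) + 2 * Re (f u v)"
  by (simp add: lin Re_comm[of u v])

lemma quad_sub: "P u \<Longrightarrow> P v \<Longrightarrow> Re (f (sub u v) (sub u v)) = Re (f u u) + Re (f v v) - 2 * Re (f u v)"
  by (simp add: lin Re_comm[of u v])

lemma quad_scl: "P u \<Longrightarrow> Re (f (scl c u) (scl c u)) = (cmod c)\<^sup>2 * Re (f u u)"
proof -
  assume "P u"
  hence "f (scl c u) (scl c u) = (c * cnj c) * f u u"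
    by (simp add: lin)
  thus ?thesis
    by (simp add: complex_norm_square[symmetric] del: complex_cnj_cnj flip: of_real_power)
qed

end

section \<open>Semidefinite forms: Cauchy-Schwarz and Bessel inequalities\<close>

locale psd_form = herm_form +
  assumes pos: "P u \<Longrightarrow> 0 \<le> Re (f u u)"
begin

definition nrm :: "'a \<Rightarrow> real" where "nrm u = sqrt (Re (f u u))"

lemma nrm_nonneg [simp]: "0 \<le> nrm u" if "P u" using pos[OF that] by (simp add: nrm_def)

lemma nrm_sq: "P u \<Longrightarrow> (nrm u)\<^sup>2 = Re (f u u)" by (simp add: nrm_def pos)

lemma nrm_scl: "P u \<Longrightarrow> nrm (scl c u) = cmod c * nrm u"
  by (simp add: nrm_def quad_scl real_sqrt_mult)

text \<open>Positivity along the line v - t (f u v) u is a quadratic inequality in t. Its optimal t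
  needs f u u > 0; since the form is only semidefinite, f u u = 0 is treated apart, where a large t
  forces f u v = 0.\<close>

lemma cauchy_schwarz: assumes u: "P u" and v: "P v" shows "cmod (f u v) \<le> nrm u * nrm v"
proof -
  define c where "c = f u v"
  define A B C where "A = Re (f u u)" and "B = Re (f v v)" and "C = (cmod c)\<^sup>2"
  have ineq: "0 \<le> B - 2 * t * C + t\<^sup>2 * C * A" for t
  proof -
    define w where "w = scl (- (of_real t * c)) u"
    have w: "P w" by (simp add: w_def scl_closed u)
    have "Re (f w v) = - t * C"
    proof -
      have "f w v = - (of_real t * (c * cnj c))"
        by (simp add: w_def lin u v c_def)
      also have "\<dots> = - of_real (t * C)"
        using complex_norm_square[of c] by (simp add: C_def)
      finally show ?thesis by simp
    qed
    moreover have "Re (f w w) = t\<^sup>2 * C * A"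
      by (simp add: w_def quad_scl u A_def C_def norm_mult power_mult_distrib)
    ultimately have "Re (f (add v w) (add v w)) = B + t\<^sup>2 * C * A - 2 * t * C"
      using quad_add[OF v w] Re_comm[OF v w] by (simp add: B_def)
    thus ?thesis using pos[OF add_closed[OF v w]] by simp
  qed
  have "A \<ge> 0" "B \<ge> 0" "C \<ge> 0" using pos u v by (auto simp: A_def B_def C_def)
  have "C \<le> A * B"
  proof (cases "A = 0")
    case True
    have "C = 0"
    proof (rule ccontr)
      assume "C \<noteq> 0"
      hence "C > 0" using \<open>C \<ge> 0\<close> by simp
      have "2 * ((B + 1) / C) * C \<le> B" using ineq[of "(B + 1) / C"] True by simp
      thus False using \<open>C > 0\<close> \<open>B \<ge> 0\<close> by simp
    qed
    thus ?thesis using True by simp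
  next
    case False
    hence "A > 0" using \<open>A \<ge> 0\<close> by simp
    have "0 \<le> B - C / A"
      using ineq[of "1 / A"] \<open>A > 0\<close> by (simp add: power2_eq_square)
    thus ?thesis using \<open>A > 0\<close> by (simp add: field_simps)
  qed
  hence "sqrt C \<le> sqrt A * sqrt B"
    by (metis real_sqrt_le_iff real_sqrt_mult)
  thus ?thesis by (simp add: C_def c_def A_def B_def nrm_def)
qed

lemma nrm_add: assumes u: "P u" and v: "P v" shows "nrm (add u v) \<le> nrm u + nrm v"
proof (rule power2_le_imp_le)
  have "(nrm (add u v))\<^sup>2 = (nrm u)\<^sup>2 + (nrm v)\<^sup>2 + 2 * Re (f u v)"
    by (simp add: nrm_sq quad_add add_closed u v)
  also have "Re (f u v) \<le> nrm u * nrm v"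
    using cauchy_schwarz[OF u v] complex_Re_le_cmod order_trans by blast
  finally show "(nrm (add u v))\<^sup>2 \<le> (nrm u + nrm v)\<^sup>2"
    by (simp add: power2_sum algebra_simps)
qed (use u v in auto)

text \<open>After subtracting the first M projections, the residual of \<open>e\<close> has square f
  e e minus the sum, and its products with the later \<open>u m\<close> are unchanged. Carrying this
  residual through the induction avoids expanding double sums; positivity of its square is the
  claim.\<close>

lemma bessel:
  fixes u :: "nat \<Rightarrow> 'a"
  assumes e: "P e" and u: "\<And>n. P (u n)"
    and on: "\<And>m n. f (u m) (u n) = (if m = n then 1 else 0)"
  shows "(\<Sum>n<M. (cmod (f e (u n)))\<^sup>2) \<le> Re (f e e)"
proof -
  define S where "S = (\<Sum>n<M. (cmod (f e (u n)))\<^sup>2)"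
  have "\<exists>w. P w \<and> (\<forall>m\<ge>M. f (u m) w = f (u m) e) \<and> Re (f w w) = Re (f e e) - S"
    unfolding S_def
  proof (induction M)
    case 0 thus ?case using e by auto
  next
    case (Suc M)
    then obtain w where w: "P w" and wm: "\<And>m. m \<ge> M \<Longrightarrow> f (u m) w = f (u m) e"
      and wq: "Re (f w w) = Re (f e e) - (\<Sum>n<M. (cmod (f e (u n)))\<^sup>2)" by blast
    define c where "c = f (u M) w"
    define w' where "w' = sub w (scl c (u M))"
    have ce: "cmod (f e (u M)) = cmod c"
      using wm[of M] f_cnj[OF e u, of M] by (simp add: c_def complex_mod_cnj)
    have "Re (f w (scl c (u M))) = (cmod c)\<^sup>2"
    proof -
      have "f w (scl c (u M)) = c * cnj c"
        using f_cnj[OF u w, of M] by (simp add: lin u w c_def)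
      also have "\<dots> = of_real ((cmod c)\<^sup>2)" using complex_norm_square[of c] by simp
      finally show ?thesis by simp
    qed
    moreover have "Re (f (scl c (u M)) (scl c (u M))) = (cmod c)\<^sup>2"
      by (simp add: quad_scl u on)
    ultimately have "Re (f w' w') = Re (f e e) - (\<Sum>n<Suc M. (cmod (f e (u n)))\<^sup>2)"
      by (simp add: w'_def quad_sub w scl_closed u wq ce)
    moreover have "f (u m) w' = f (u m) e" if "m \<ge> Suc M" for m
      using that wm[of m] by (simp add: w'_def lin u w on)
    moreover have "P w'" by (simp add: w'_def w u scl_closed sub_closed)
    ultimately show ?case by blast
  qed
  thus ?thesis using pos by (fastforce simp: S_def)
qed

end

text \<open>With finitely many sequences no diagonal argument arises: Bolzano-Weierstrass is applied
  once per sequence, inside the subsequence found so far. It supplies the compactness in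
  \<open>eigen_or_lower\<close>, where finitely many functionals stand in for a compact
  embedding.\<close>

lemma common_convergent_subsequence:
  fixes z :: "nat \<Rightarrow> nat \<Rightarrow> complex"
  assumes "\<And>i. i < N \<Longrightarrow> bounded (range (z i))"
  shows "\<exists>r. strict_mono r \<and> (\<forall>i<N. convergent (\<lambda>n. z i (r n)))"
  using assms
proof (induction N)
  case 0
  show ?case by (rule exI[of _ id]) (auto simp: strict_mono_def)
next
  case (Suc N)
  then obtain r where r: "strict_mono r" "\<And>i. i < N \<Longrightarrow> convergent (\<lambda>n. z i (r n))" by auto
  have "bounded (range (z N \<circ> r))"
    using Suc.prems[of N] by (rule bounded_subset) auto
  then obtain l r' where r': "strict_mono r'" "((z N \<circ> r) \<circ> r') \<longlonglongrightarrow> l"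
    using bounded_imp_convergent_subsequence by blast
  have "convergent (\<lambda>n. z i ((r \<circ> r') n))" if "i < Suc N" for i
  proof (cases "i < N")
    case True
    then obtain l' where "(\<lambda>n. z i (r n)) \<longlonglongrightarrow> l'" using r(2) convergent_def by blast
    from LIMSEQ_subseq_LIMSEQ[OF this r'(1)] show ?thesis
      by (auto simp: convergent_def o_def)
  next
    case False
    hence "i = N" using that by simp
    thus ?thesis using r'(2) by (auto simp: convergent_def o_def)
  qed
  thus ?case using strict_mono_o[OF r(1) r'(1)] by blast
qed

text \<open>A closed form bounded from below, in the abstract: \<open>b\<close> is the ambient
  scalar product on \<open>E\<close>, \<open>s\<close> the form on its domain \<open>D\<close>. The
  shift \<mu> makes s + \<mu> b dominate \<open>b\<close> itself, so the form norm controls the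
  ambient norm with constant 1; \<open>complete\<close> expresses closedness.\<close>

locale form_space = b: psd_form E add scl b + s: herm_form D add scl s
  for E :: "'v \<Rightarrow> bool" and D add scl b s +
  fixes \<mu> :: real
  assumes D_E: "D u \<Longrightarrow> E u"
    and ex_D: "\<exists>u. D u"
    and garding: "D u \<Longrightarrow> Re (b u u) \<le> Re (s u u) + \<mu> * Re (b u u)"
    and complete: "(\<And>n. D (x n)) \<Longrightarrow>
       (\<And>e. e > 0 \<Longrightarrow> \<exists>N. \<forall>m\<ge>N. \<forall>n\<ge>N.
          Re (s (lsub add scl (x m) (x n)) (lsub add scl (x m) (x n)))
           + \<mu> * Re (b (lsub add scl (x m) (x n)) (lsub add scl (x m) (x n))) < e) \<Longrightarrow>
       \<exists>u. D u \<and> (\<lambda>n. Re (s (lsub add scl (x n) u) (lsub add scl (x n) u))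
           + \<mu> * Re (b (lsub add scl (x n) u) (lsub add scl (x n) u))) \<longlonglongrightarrow> 0"
begin

definition q :: "'v \<Rightarrow> 'v \<Rightarrow> complex" where "q u v = s u v + of_real \<mu> * b u v"

sublocale q: psd_form D add scl q
proof
  fix u v w c
  show "D u \<Longrightarrow> D v \<Longrightarrow> D (add u v)" "D u \<Longrightarrow> D (scl c u)"
    by (auto simp: s.lin)
  show "D u \<Longrightarrow> D v \<Longrightarrow> D w \<Longrightarrow> q u (add v w) = q u v + q u w"
    by (simp add: q_def s.lin b.lin D_E algebra_simps)
  show "D u \<Longrightarrow> D v \<Longrightarrow> q u (scl c v) = c * q u v"
    by (simp add: q_def s.lin b.lin D_E algebra_simps)
  show "D u \<Longrightarrow> D v \<Longrightarrow> q v u = cnj (q u v)"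
    using s.f_cnj[of u v] b.f_cnj[of u v] by (simp add: q_def D_E)
  show "D u \<Longrightarrow> 0 \<le> Re (q u u)"
    using garding[of u] b.pos[of u] by (simp add: q_def D_E)
qed

lemma b_le_q: "D u \<Longrightarrow> b.nrm u \<le> q.nrm u"
  using garding[of u] by (simp add: b.nrm_def q.nrm_def q_def)

lemma q_complete:
  assumes "\<And>n. D (x n)" "\<And>e. e > 0 \<Longrightarrow> \<exists>N. \<forall>m\<ge>N. \<forall>n\<ge>N. q.nrm (q.sub (x m) (x n)) < e"
  obtains u where "D u" "(\<lambda>n. q.nrm (q.sub (x n) u)) \<longlonglongrightarrow> 0"
proof -
  have eq: "Re (s u u) + \<mu> * Re (b u u) = (q.nrm u)\<^sup>2" if "D u" for u
    using that by (simp add: q.nrm_sq) (simp add: q_def)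
  have "\<exists>u. D u \<and> (\<lambda>n. Re (s (q.sub (x n) u) (q.sub (x n) u))
           + \<mu> * Re (b (q.sub (x n) u) (q.sub (x n) u))) \<longlonglongrightarrow> 0"
  proof (rule complete)
    fix e :: real assume "e > 0"
    then obtain N where N: "\<And>m n. m \<ge> N \<Longrightarrow> n \<ge> N \<Longrightarrow> q.nrm (q.sub (x m) (x n)) < sqrt e"
      using assms(2)[of "sqrt e"] by auto
    have "(q.nrm (q.sub (x m) (x n)))\<^sup>2 < e" if "m \<ge> N" "n \<ge> N" for m n
      using power_strict_mono[OF N[OF that], of 2] \<open>e > 0\<close> assms(1) by (simp add: q.sub_closed)
    thus "\<exists>N. \<forall>m\<ge>N. \<forall>n\<ge>N.
          Re (s (q.sub (x m) (x n)) (q.sub (x m) (x n)))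
           + \<mu> * Re (b (q.sub (x m) (x n)) (q.sub (x m) (x n))) < e"
      using assms(1) by (auto simp: eq q.sub_closed)
  qed (use assms in auto)
  then obtain u where u: "D u" "(\<lambda>n. (q.nrm (q.sub (x n) u))\<^sup>2) \<longlonglongrightarrow> 0"
    using assms(1) by (auto simp: eq q.sub_closed)
  have "(\<lambda>n. sqrt ((q.nrm (q.sub (x n) u))\<^sup>2)) \<longlonglongrightarrow> sqrt 0"
    by (intro tendsto_intros u)
  hence "(\<lambda>n. q.nrm (q.sub (x n) u)) \<longlonglongrightarrow> 0"
    using assms(1) u(1) by (simp add: q.sub_closed)
  with u(1) that show ?thesis by blast
qed

context
  fixes x :: "nat \<Rightarrow> 'v" and u :: 'v
  assumes x: "\<And>n. D (x n)" and u: "D u" and lim: "(\<lambda>n. q.nrm (q.sub (x n) u)) \<longlonglongrightarrow> 0"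
begin

lemma q_tendsto: "D v \<Longrightarrow> (\<lambda>n. q v (x n)) \<longlonglongrightarrow> q v u"
proof -
  assume v: "D v"
  have "(\<lambda>n. q v (x n) - q v u) \<longlonglongrightarrow> 0"
  proof (rule Lim_null_comparison)
    show "\<forall>\<^sub>F n in sequentially. cmod (q v (x n) - q v u) \<le> q.nrm v * q.nrm (q.sub (x n) u)"
      using q.cauchy_schwarz[OF v q.sub_closed[OF x u]]
      by (auto simp: q.f_sub v x u)
    show "(\<lambda>n. q.nrm v * q.nrm (q.sub (x n) u)) \<longlonglongrightarrow> 0"
      using tendsto_mult_right_zero[OF lim] by simp
  qed
  thus ?thesis by (simp add: LIM_zero_iff)
qed

lemma b_tendsto: "E v \<Longrightarrow> (\<lambda>n. b v (x n)) \<longlonglongrightarrow> b v u"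
proof -
  assume v: "E v"
  have "(\<lambda>n. b v (x n) - b v u) \<longlonglongrightarrow> 0"
  proof (rule Lim_null_comparison)
    have "cmod (b v (x n) - b v u) \<le> b.nrm v * q.nrm (q.sub (x n) u)" for n
    proof -
      have "cmod (b v (x n) - b v u) \<le> b.nrm v * b.nrm (b.sub (x n) u)"
        using b.cauchy_schwarz[OF v b.sub_closed[OF D_E D_E, OF x u]]
        by (auto simp: b.f_sub v x u D_E)
      also have "\<dots> \<le> b.nrm v * q.nrm (q.sub (x n) u)"
        by (intro mult_left_mono b_le_q) (auto simp: x u q.sub_closed v)
      finally show ?thesis .
    qed
    thus "\<forall>\<^sub>F n in sequentially. cmod (b v (x n) - b v u) \<le> b.nrm v * q.nrm (q.sub (x n) u)"
      by simp
    show "(\<lambda>n. b.nrm v * q.nrm (q.sub (x n) u)) \<longlonglongrightarrow> 0"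
      using tendsto_mult_right_zero[OF lim] by simp
  qed
  thus ?thesis by (simp add: LIM_zero_iff)
qed

lemma s_tendsto: "D v \<Longrightarrow> (\<lambda>n. s v (x n)) \<longlonglongrightarrow> s v u"
proof -
  assume v: "D v"
  have "(\<lambda>n. q v (x n) - of_real \<mu> * b v (x n)) \<longlonglongrightarrow> q v u - of_real \<mu> * b v u"
    by (intro tendsto_intros q_tendsto b_tendsto v D_E)
  thus ?thesis by (simp add: q_def)
qed

lemma nrm_tendsto: "(\<lambda>n. b.nrm (x n)) \<longlonglongrightarrow> b.nrm u"
proof -
  have tri: "\<bar>b.nrm (x n) - b.nrm u\<bar> \<le> q.nrm (q.sub (x n) u)" for n
  proof -
    have xn: "E (x n)" "E u" "E (q.sub (x n) u)" using x u D_E q.sub_closed by auto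
    have "b.nrm (q.sub (x n) u) \<le> q.nrm (q.sub (x n) u)"
      by (simp add: b_le_q q.sub_closed x u)
    moreover have "\<bar>b.nrm (x n) - b.nrm u\<bar> \<le> b.nrm (b.sub (x n) u)"
    proof (rule abs_le_square_iff[THEN iffD2, of _ "b.nrm (b.sub (x n) u)", simplified abs_of_nonneg[OF b.nrm_nonneg[OF xn(3)]]])
      have "Re (b (x n) u) \<le> b.nrm (x n) * b.nrm u"
        using b.cauchy_schwarz[OF xn(1,2)] complex_Re_le_cmod order_trans by blast
      thus "(b.nrm (x n) - b.nrm u)\<^sup>2 \<le> (b.nrm (b.sub (x n) u))\<^sup>2"
        using xn by (simp add: b.nrm_sq[OF xn(3)] b.quad_sub power2_diff b.nrm_sq)
    qed
    ultimately show ?thesis by simp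
  qed
  have "(\<lambda>n. b.nrm (x n) - b.nrm u) \<longlonglongrightarrow> 0"
    by (rule Lim_null_comparison[OF _ lim]) (use tri in auto)
  thus ?thesis by (simp add: LIM_zero_iff)
qed

end

section \<open>Solvability of the weak equation and lower bounds\<close>

text \<open>The weak form of \<open>(H - z) \<psi> = g\<close>; \<open>lower\<close> and \<open>onto\<close> together say that \<open>z\<close> is in the resolvent set.\<close>

definition sol :: "complex \<Rightarrow> 'v \<Rightarrow> 'v \<Rightarrow> bool" where
  "sol z \<psi> g \<longleftrightarrow> D \<psi> \<and> E g \<and> (\<forall>\<phi>. D \<phi> \<longrightarrow> s \<phi> \<psi> - z * b \<phi> \<psi> = b \<phi> g)"

definition lower :: "complex \<Rightarrow> real \<Rightarrow> bool" where
  "lower z c \<longleftrightarrow> (\<forall>\<psi> g. sol z \<psi> g \<longrightarrow> c * b.nrm \<psi> \<le> b.nrm g)"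

definition onto :: "complex \<Rightarrow> bool" where
  "onto z \<longleftrightarrow> (\<forall>g. E g \<longrightarrow> (\<exists>\<psi>. sol z \<psi> g))"

lemma sol_shift: "sol z \<psi> g \<Longrightarrow> sol w \<psi> (add g (scl (z - w) \<psi>))"
  by (auto simp: sol_def b.lin D_E algebra_simps)

lemma sol_sub: "sol z \<psi> g \<Longrightarrow> sol z \<psi>' g' \<Longrightarrow> sol z (b.sub \<psi> \<psi>') (b.sub g g')"
  unfolding sol_def by (auto simp: b.lin s.lin D_E algebra_simps)

lemma sol_scl: "sol z \<psi> g \<Longrightarrow> sol z (scl c \<psi>) (scl c g)"
  unfolding sol_def by (auto simp: b.lin s.lin D_E algebra_simps)

text \<open>The equation tested with \<psi> itself. It turns bounds in the ambient norm into bounds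
  in the form norm, in which limits stay in the domain.\<close>

lemma sol_q: assumes "sol z \<psi> g"
  shows "(q.nrm \<psi>)\<^sup>2 \<le> b.nrm \<psi> * b.nrm g + cmod (z + of_real \<mu>) * (b.nrm \<psi>)\<^sup>2"
proof -
  have D: "D \<psi>" "E g" "E \<psi>" using assms D_E by (auto simp: sol_def)
  have "q \<psi> \<psi> = b \<psi> g + (z + of_real \<mu>) * b \<psi> \<psi>"
    using assms D by (auto simp: sol_def q_def algebra_simps)
  hence "(q.nrm \<psi>)\<^sup>2 \<le> cmod (b \<psi> g + (z + of_real \<mu>) * b \<psi> \<psi>)"
    using complex_Re_le_cmod[of "q \<psi> \<psi>"] by (simp add: q.nrm_sq D)
  also have "\<dots> \<le> cmod (b \<psi> g) + cmod (z + of_real \<mu>) * cmod (b \<psi> \<psi>)"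
    by (metis norm_mult norm_triangle_ineq)
  also have "\<dots> \<le> b.nrm \<psi> * b.nrm g + cmod (z + of_real \<mu>) * (b.nrm \<psi> * b.nrm \<psi>)"
    by (intro add_mono mult_left_mono b.cauchy_schwarz D) auto
  finally show ?thesis by (simp add: power2_eq_square)
qed

text \<open>At z = -\<mu> the weak equation is q \<phi> \<psi> = b \<phi> g, the Euler equation of J
  u = q u u - 2 Re (b u g). This functional is bounded below, a minimising sequence is Cauchy in the
  form norm, and its limit is the solution.\<close>

lemma riesz: "onto (- of_real \<mu>)"
  unfolding onto_def
proof (intro allI impI)
  fix g assume g: "E g"
  define J where "J u = Re (q u u) - 2 * Re (b u g)" for u
  have low: "- (b.nrm g)\<^sup>2 \<le> J u" if u: "D u" for u
  proof -
    have "Re (b u g) \<le> b.nrm u * b.nrm g"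
      using b.cauchy_schwarz[OF D_E[OF u] g] complex_Re_le_cmod order_trans by blast
    also have "\<dots> \<le> q.nrm u * b.nrm g"
      by (intro mult_right_mono b_le_q) (auto simp: u g)
    finally have "J u \<ge> (q.nrm u)\<^sup>2 - 2 * (q.nrm u * b.nrm g)" by (simp add: J_def q.nrm_sq u)
    moreover have "0 \<le> (q.nrm u - b.nrm g)\<^sup>2" by simp
    ultimately show ?thesis by (simp add: power2_diff)
  qed
  define d where "d = Inf (J ` Collect D)"
  have bdd: "bdd_below (J ` Collect D)" using low by (intro bdd_belowI2) auto
  have d_le: "d \<le> J u" if "D u" for u
    unfolding d_def using that by (intro cInf_lower bdd) auto
  have "\<exists>u. D u \<and> J u < d + 1 / (real n + 1)" for n
  proof -
    have "Inf (J ` Collect D) < d + 1 / (real n + 1)" by (simp add: d_def)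
    thus ?thesis using cInf_lessD[of "J ` Collect D" "d + 1 / (real n + 1)"] ex_D by auto
  qed
  then obtain x where x: "\<And>n. D (x n)" "\<And>n. J (x n) < d + 1 / (real n + 1)" by metis
  \<comment> \<open>Parallelogram identity: d bounds J from below also at the midpoint, so two
    almost minimisers are close to each other.\<close>
  have para: "(q.nrm (q.sub u v))\<^sup>2 \<le> 2 * (J u - d) + 2 * (J v - d)" if u: "D u" and v: "D v" for u v
  proof -
    define m where "m = scl (1/2) (add u v)"
    have "d \<le> J m" by (rule d_le) (simp add: m_def q.lin u v)
    also have "J m = (Re (q u u) + Re (q v v) + 2 * Re (q u v)) / 4 - (Re (b u g) + Re (b v g))"
      using q.Re_comm[OF u v]
      by (simp add: J_def m_def q.quad_scl q.quad_add q.lin u v b.lin D_E g power2_eq_square field_simps)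
    finally show ?thesis
      using u v by (simp add: q.nrm_sq q.sub_closed q.quad_sub J_def algebra_simps)
  qed
  obtain u where u: "D u" "(\<lambda>n. q.nrm (q.sub (x n) u)) \<longlonglongrightarrow> 0"
  proof (rule q_complete[of x])
    show "\<exists>N. \<forall>m\<ge>N. \<forall>n\<ge>N. q.nrm (q.sub (x m) (x n)) < e" if "e > 0" for e
    proof -
      obtain N :: nat where N: "4 / e\<^sup>2 < real N" using reals_Archimedean2 by blast
      have "q.nrm (q.sub (x m) (x n)) < e" if "m \<ge> N" "n \<ge> N" for m n
      proof -
        have *: "J (x k) - d < e\<^sup>2 / 4" if "k \<ge> N" for k
        proof -
          have "4 / e\<^sup>2 < real k + 1" using N that by linarith
          hence "1 / (real k + 1) < e\<^sup>2 / 4" using \<open>e > 0\<close> by (simp add: field_simps)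
          thus ?thesis using x(2)[of k] by linarith
        qed
        have "(q.nrm (q.sub (x m) (x n)))\<^sup>2 < e\<^sup>2"
          using para[OF x(1) x(1), of m n] *[OF that(1)] *[OF that(2)] unfolding right_diff_distrib by linarith
        thus ?thesis using \<open>e > 0\<close> by (simp add: power2_less_imp_less)
      qed
      thus ?thesis by blast
    qed
  qed (use x in auto)
  have re: "Re (q v u - b v g) = 0" if v: "D v" for v
  proof -
    have ineq: "0 \<le> t\<^sup>2 * Re (q v v) + 2 * t * Re (q v u - b v g)" for t :: real
    proof -
      have 1: "- (1 / (real n + 1)) \<le> t\<^sup>2 * Re (q v v) + 2 * t * Re (q v (x n) - b v g)" for n
      proof -
        have "d \<le> J (add (x n) (scl (of_real t) v))" by (rule d_le) (simp add: x v q.lin)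
        also have "\<dots> = J (x n) + (t\<^sup>2 * Re (q v v) + 2 * t * Re (q v (x n) - b v g))"
          using q.Re_comm[OF x(1)[of n] v]
          by (simp add: J_def q.quad_add q.quad_scl q.lin b.lin x v D_E g algebra_simps power2_eq_square)
        finally show ?thesis using x(2)[of n] by linarith
      qed
      have "(\<lambda>n. - (1 / (real n + 1))) \<longlonglongrightarrow> 0"
        using tendsto_minus[OF LIMSEQ_inverse_real_of_nat] by (simp add: inverse_eq_divide add.commute)
      moreover have "(\<lambda>n. t\<^sup>2 * Re (q v v) + 2 * t * Re (q v (x n) - b v g))
          \<longlonglongrightarrow> t\<^sup>2 * Re (q v v) + 2 * t * Re (q v u - b v g)"
        using q_tendsto[OF x(1) u v] by (intro tendsto_intros)
      ultimately show ?thesis by (rule LIMSEQ_le) (use 1 in auto)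
    qed
    define r A where "r = Re (q v u - b v g)" and "A = Re (q v v)"
    have "A \<ge> 0" using q.pos[OF v] by (simp add: A_def)
    \<comment> \<open>The best t would be -r / A. With A + 1 the quotient is defined even if the
      form vanishes on v, and the value is still negative unless r = 0.\<close>
    have "0 \<le> (- r / (A + 1))\<^sup>2 * A + 2 * (- r / (A + 1)) * r" using ineq[of "- r / (A + 1)"] by (simp add: r_def A_def)
    also have "\<dots> = - (r\<^sup>2 * (A + 2) / (A + 1)\<^sup>2)"
      using \<open>A \<ge> 0\<close> by (simp add: power2_eq_square divide_simps) (simp add: algebra_simps)
    finally have "r\<^sup>2 * (A + 2) / (A + 1)\<^sup>2 \<le> 0" by simp
    hence "r\<^sup>2 * (A + 2) \<le> 0" using \<open>A \<ge> 0\<close> by (simp add: divide_le_0_iff mult_le_0_iff)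
    thus ?thesis using \<open>A \<ge> 0\<close> by (simp add: r_def mult_le_0_iff)
  qed
  have "q v u = b v g" if v: "D v" for v
  proof -
    have "Re (q (scl \<i> v) u - b (scl \<i> v) g) = 0" by (rule re) (simp add: q.lin v)
    hence "Im (q v u - b v g) = 0" by (simp add: q.lin b.lin v u g D_E)
    thus ?thesis using re[OF v] by (simp add: complex_eq_iff)
  qed
  hence "sol (- of_real \<mu>) u g"
    using u g by (auto simp: sol_def q_def)
  thus "\<exists>\<psi>. sol (- complex_of_real \<mu>) \<psi> g" by blast
qed

text \<open>Neumann series. The bound \<open>lower z c\<close> makes x = R (g + (w - z) x), with R
  solving at z, a contraction of ratio cmod (w - z) / c in the ambient norm. Through
  \<open>sol_q\<close> the increments also decay geometrically in the form norm, so the limit lies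
  in the domain and solves the equation at w.\<close>

lemma onto_step:
  assumes o: "onto z" and l: "lower z c" and w: "cmod (w - z) < c"
  shows "onto w"
  unfolding onto_def
proof (intro allI impI)
  fix g assume g: "E g"
  have c: "c > 0" using w norm_ge_zero[of "w - z"] by linarith
  define r where "r = cmod (w - z) / c"
  have r: "0 \<le> r" "r < 1" using c w by (auto simp: r_def)
  \<comment> \<open>R is a mere selection of solutions with no linearity; differences of iterates
    are estimated through \<open>sol_sub\<close> and \<open>lower\<close>.\<close>
  obtain R where R: "\<And>h. E h \<Longrightarrow> sol z (R h) h" using o unfolding onto_def by metis
  define x where "x = rec_nat (R g) (\<lambda>_ y. R (add g (scl (w - z) y)))"
  have x0: "x 0 = R g" and xS: "\<And>n. x (Suc n) = R (add g (scl (w - z) (x n)))" by (simp_all add: x_def)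
  have x: "D (x n)" for n
  proof (induction n)
    case 0 show ?case using R[OF g] by (simp add: x0 sol_def)
  next
    case (Suc n)
    thus ?case using R[of "add g (scl (w - z) (x n))"] g by (simp add: xS sol_def b.lin D_E)
  qed
  have solx: "sol z (x (Suc n)) (add g (scl (w - z) (x n)))" for n
    unfolding xS by (rule R) (simp add: b.lin D_E g x)
  define d where "d n = q.sub (x (Suc n)) (x n)" for n
  have dD: "D (d n)" for n by (simp add: d_def x q.sub_closed)
  have dsol: "\<exists>h. sol z (d (Suc n)) h \<and> b.nrm h = cmod (w - z) * b.nrm (d n)" for n
  proof (intro exI conjI)
    let ?h = "b.sub (add g (scl (w - z) (x (Suc n)))) (add g (scl (w - z) (x n)))"
    show "sol z (d (Suc n)) ?h" unfolding d_def by (rule sol_sub[OF solx solx])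
    have "b.nrm ?h = b.nrm (scl (w - z) (d n))"
      unfolding b.nrm_def d_def by (simp add: b.lin D_E x g algebra_simps)
    thus "b.nrm ?h = cmod (w - z) * b.nrm (d n)" by (simp add: b.nrm_scl D_E dD)
  qed
  have bd: "b.nrm (d n) \<le> b.nrm (d 0) * r ^ n" for n
  proof (induction n)
    case (Suc n)
    obtain h where h: "sol z (d (Suc n)) h" "b.nrm h = cmod (w - z) * b.nrm (d n)" using dsol by blast
    have "c * b.nrm (d (Suc n)) \<le> cmod (w - z) * b.nrm (d n)" using l h unfolding lower_def by metis
    hence "b.nrm (d (Suc n)) \<le> r * b.nrm (d n)" using c by (simp add: r_def field_simps)
    also have "\<dots> \<le> r * (b.nrm (d 0) * r ^ n)" using Suc r by (intro mult_left_mono) auto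
    finally show ?case by (simp add: algebra_simps)
  qed simp
  define K where "K = cmod (w - z) + cmod (z + of_real \<mu>)"
  have qd: "q.nrm (d (Suc n)) \<le> sqrt K * b.nrm (d 0) * r ^ n" for n
  proof -
    obtain h where h: "sol z (d (Suc n)) h" "b.nrm h = cmod (w - z) * b.nrm (d n)" using dsol by blast
    have nn: "0 \<le> b.nrm (d n)" for n using D_E[OF dD] by simp
    have "r ^ Suc n \<le> r ^ n" using r by (intro power_decreasing) auto
    hence b1: "b.nrm (d (Suc n)) \<le> b.nrm (d 0) * r ^ n"
      using bd[of "Suc n"] nn[of 0] by (meson mult_left_mono order_trans)
    have "(q.nrm (d (Suc n)))\<^sup>2 \<le> b.nrm (d (Suc n)) * (cmod (w - z) * b.nrm (d n)) + cmod (z + of_real \<mu>) * (b.nrm (d (Suc n)))\<^sup>2"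
      using sol_q[OF h(1)] h(2) by simp
    also have "\<dots> \<le> (b.nrm (d 0) * r ^ n) * (cmod (w - z) * (b.nrm (d 0) * r ^ n)) + cmod (z + of_real \<mu>) * (b.nrm (d 0) * r ^ n)\<^sup>2"
      by (intro add_mono mult_mono mult_left_mono power_mono b1 bd) (auto simp: nn r)
    also have "\<dots> = K * (b.nrm (d 0) * r ^ n)\<^sup>2" by (simp add: K_def power2_eq_square algebra_simps)
    finally have "sqrt ((q.nrm (d (Suc n)))\<^sup>2) \<le> sqrt (K * (b.nrm (d 0) * r ^ n)\<^sup>2)"
      by (rule real_sqrt_le_mono)
    thus ?thesis using dD nn r by (simp add: real_sqrt_mult algebra_simps)
  qed
  define B where "B = sqrt K * b.nrm (d 0)"
  have B0: "B \<ge> 0" using D_E[OF dD, of 0] by (simp add: B_def K_def)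
  have tail: "q.nrm (q.sub (x (Suc (n + k))) (x (Suc n))) \<le> B * r ^ n / (1 - r)" for n k
  proof -
    have "q.nrm (q.sub (x (Suc (n + k))) (x (Suc n))) \<le> (\<Sum>i<k. B * r ^ (n + i))"
    proof (induction k)
      case 0
      have "q.nrm (q.sub (x (Suc n)) (x (Suc n))) = 0"
        by (simp add: q.nrm_def q.quad_sub x)
      thus ?case by simp
    next
      case (Suc k)
      have "q.nrm (q.sub (x (Suc (n + Suc k))) (x (Suc n))) = q.nrm (add (d (Suc (n + k))) (q.sub (x (Suc (n + k))) (x (Suc n))))"
        unfolding d_def q.nrm_def by (simp add: q.lin x algebra_simps)
      also have "\<dots> \<le> q.nrm (d (Suc (n + k))) + q.nrm (q.sub (x (Suc (n + k))) (x (Suc n)))"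
        by (rule q.nrm_add) (auto simp: dD x q.sub_closed)
      also have "\<dots> \<le> B * r ^ (n + k) + (\<Sum>i<k. B * r ^ (n + i))"
        using Suc qd[of "n + k"] by (simp add: B_def)
      finally show ?case by simp
    qed
    also have "\<dots> = B * r ^ n * (\<Sum>i<k. r ^ i)"
      by (simp add: power_add sum_distrib_left algebra_simps)
    also have "\<dots> \<le> B * r ^ n * (1 / (1 - r))"
    proof (intro mult_left_mono)
      show "(\<Sum>i<k. r ^ i) \<le> 1 / (1 - r)"
        using r by (simp add: sum_gp_strict divide_right_mono)
    qed (use B0 r in auto)
    finally show ?thesis by simp
  qed
  have "(\<lambda>n. B * r ^ n / (1 - r)) \<longlonglongrightarrow> B * 0 / (1 - r)"
    by (intro tendsto_intros LIMSEQ_power_zero) (use r in auto)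
  hence tail0: "(\<lambda>n. B * r ^ n / (1 - r)) \<longlonglongrightarrow> 0" by simp
  have sym: "q.nrm (q.sub u v) = q.nrm (q.sub v u)" if "D u" "D v" for u v
    using q.Re_comm[OF that] that by (simp add: q.nrm_def q.quad_sub)
  obtain u where u: "D u" "(\<lambda>n. q.nrm (q.sub (x (Suc n)) u)) \<longlonglongrightarrow> 0"
  proof (rule q_complete[of "\<lambda>n. x (Suc n)"])
    fix e :: real assume "e > 0"
    then obtain N where N: "\<And>n. n \<ge> N \<Longrightarrow> B * r ^ n / (1 - r) < e"
      using order_tendstoD(2)[OF tail0] by (auto simp: eventually_sequentially)
    have 1: "q.nrm (q.sub (x (Suc m)) (x (Suc n))) < e" if "n \<ge> N" "m \<ge> n" for m n
      using tail[of n "m - n"] N[OF that(1)] that by simp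
    have "q.nrm (q.sub (x (Suc m)) (x (Suc n))) < e" if "m \<ge> N" "n \<ge> N" for m n
    proof (cases "m \<ge> n")
      case False
      thus ?thesis using 1[of m n] sym[of "x (Suc m)" "x (Suc n)"] that x by simp
    qed (use 1 that in auto)
    thus "\<exists>N. \<forall>m\<ge>N. \<forall>n\<ge>N. q.nrm (q.sub (x (Suc m)) (x (Suc n))) < e" by blast
  qed (use x in auto)
  have "s \<phi> u - w * b \<phi> u = b \<phi> g" if p: "D \<phi>" for \<phi>
  proof -
    note X = x u(1) u(2)
    have X2: "(\<lambda>n. q.nrm (q.sub (x (Suc (Suc n))) u)) \<longlonglongrightarrow> 0"
      using LIMSEQ_Suc[OF u(2)] by simp
    have "(\<lambda>n. s \<phi> (x (Suc (Suc n))) - z * b \<phi> (x (Suc (Suc n)))) \<longlonglongrightarrow> s \<phi> u - z * b \<phi> u"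
      using s_tendsto[OF x u(1) X2 p] b_tendsto[OF x u(1) X2 D_E[OF p]] by (intro tendsto_intros)
    moreover have "s \<phi> (x (Suc (Suc n))) - z * b \<phi> (x (Suc (Suc n))) = b \<phi> g + (w - z) * b \<phi> (x (Suc n))" for n
      using solx[of "Suc n"] p by (auto simp: sol_def b.lin D_E x g)
    moreover have "(\<lambda>n. b \<phi> g + (w - z) * b \<phi> (x (Suc n))) \<longlonglongrightarrow> b \<phi> g + (w - z) * b \<phi> u"
      using b_tendsto[OF x u(1) u(2) D_E[OF p]] by (intro tendsto_intros)
    ultimately have "s \<phi> u - z * b \<phi> u = b \<phi> g + (w - z) * b \<phi> u"
      using LIMSEQ_unique by auto
    thus ?thesis by (simp add: algebra_simps)
  qed
  thus "\<exists>\<psi>. sol w \<psi> g" using u(1) g by (auto simp: sol_def)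
qed

text \<open>The imaginary part of z contributes only an imaginary number to the equation tested with
  \<psi>, so its real part reads q \<psi> \<psi> = Re (b \<psi> g) whatever y is. Hence one lower
  bound serves the whole vertical line through -\<mu>.\<close>

lemma lower_vertical: "lower (Complex (- \<mu>) y) 1"
  unfolding lower_def
proof (intro allI impI)
  fix \<psi> g assume S: "sol (Complex (- \<mu>) y) \<psi> g"
  hence D: "D \<psi>" "E g" "E \<psi>" by (auto simp: sol_def D_E)
  have "Im (b \<psi> \<psi>) = 0" using b.quad_real[OF D(3)] by (metis Im_complex_of_real)
  hence "Re (q \<psi> \<psi>) = Re (b \<psi> g)"
    using S D by (auto simp: sol_def q_def dest!: spec[of _ \<psi>] arg_cong[where f = Re])
  hence "(b.nrm \<psi>)\<^sup>2 \<le> Re (b \<psi> g)"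
    using b_le_q[OF D(1)] power_mono[of "b.nrm \<psi>" "q.nrm \<psi>" 2] D by (simp add: q.nrm_sq)
  also have "\<dots> \<le> b.nrm \<psi> * b.nrm g"
    using b.cauchy_schwarz[OF D(3,2)] complex_Re_le_cmod order_trans by blast
  finally have "b.nrm \<psi> * b.nrm \<psi> \<le> b.nrm \<psi> * b.nrm g" by (simp add: power2_eq_square)
  thus "1 * b.nrm \<psi> \<le> b.nrm g"
    using b.nrm_nonneg[OF D(3)] b.nrm_nonneg[OF D(2)] by (cases "b.nrm \<psi> = 0") (auto simp: mult_le_cancel_left)
qed

text \<open>Imaginary part of the equation tested with \<psi>, in which s \<psi> \<psi> and b \<psi>
  \<psi> are real.\<close>

lemma lower_nonreal: "lower z \<bar>Im z\<bar>"
  unfolding lower_def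
proof (intro allI impI)
  fix \<psi> g assume S: "sol z \<psi> g"
  hence D: "D \<psi>" "E g" "E \<psi>" by (auto simp: sol_def D_E)
  have im: "Im (b \<psi> \<psi>) = 0" "Im (s \<psi> \<psi>) = 0"
    using b.quad_real[OF D(3)] s.quad_real[OF D(1)] by (metis Im_complex_of_real)+
  have "s \<psi> \<psi> - z * b \<psi> \<psi> = b \<psi> g" using S D by (auto simp: sol_def)
  hence "Im (b \<psi> g) = - Im z * (b.nrm \<psi>)\<^sup>2"
    using im by (auto simp: b.nrm_sq D dest!: arg_cong[where f = Im])
  hence "\<bar>Im z\<bar> * (b.nrm \<psi>)\<^sup>2 \<le> cmod (b \<psi> g)"
    using abs_Im_le_cmod[of "b \<psi> g"] by (simp add: abs_mult)
  also have "\<dots> \<le> b.nrm \<psi> * b.nrm g" by (rule b.cauchy_schwarz[OF D(3,2)])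
  finally have "b.nrm \<psi> * (\<bar>Im z\<bar> * b.nrm \<psi>) \<le> b.nrm \<psi> * b.nrm g"
    by (simp add: power2_eq_square algebra_simps)
  thus "\<bar>Im z\<bar> * b.nrm \<psi> \<le> b.nrm g"
    using b.nrm_nonneg[OF D(3)] b.nrm_nonneg[OF D(2)] by (cases "b.nrm \<psi> = 0") (auto simp: mult_le_cancel_left)
qed

lemma onto_path:
  assumes "onto z" "\<And>n. lower (z + of_nat n * h) c" "cmod h < c"
  shows "onto (z + of_nat n * h)"
proof (induction n)
  case (Suc n)
  show ?case by (rule onto_step[OF Suc assms(2)]) (use assms(3) in \<open>simp add: algebra_simps\<close>)
qed (use assms in simp)

text \<open>From -\<mu>, where \<open>riesz\<close> applies, go vertically to the height Im z and
  then horizontally to z. The lower bound is at least 1 along the first leg and |Im z| along the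
  second, so each leg is covered by finitely many Neumann steps shorter than that.\<close>

lemma onto_nonreal: assumes "Im z \<noteq> 0" shows "onto z"
proof -
  obtain N :: nat where N: "N > 0" "\<bar>Im z\<bar> < real N"
    using reals_Archimedean2[of "\<bar>Im z\<bar>"] by (metis abs_ge_zero not_gr_zero of_nat_0 order_le_less_trans less_irrefl)
  let ?h = "Complex 0 (Im z / real N)"
  have "onto (- of_real \<mu> + of_nat N * ?h)"
  proof (rule onto_path[where c = 1])
    fix n
    have "- of_real \<mu> + of_nat n * ?h = Complex (- \<mu>) (real n * (Im z / real N))"
      by (simp add: complex_eq_iff)
    thus "lower (- of_real \<mu> + of_nat n * ?h) 1" using lower_vertical by metis
  qed (use N riesz in \<open>auto simp: cmod_def\<close>)
  also have "- of_real \<mu> + of_nat N * ?h = Complex (- \<mu>) (Im z)"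
    using N by (simp add: complex_eq_iff)
  finally have o: "onto (Complex (- \<mu>) (Im z))" .
  obtain M :: nat where M: "M > 0" "\<bar>Re z + \<mu>\<bar> / \<bar>Im z\<bar> < real M"
    using reals_Archimedean2[of "\<bar>Re z + \<mu>\<bar> / \<bar>Im z\<bar>"]
    by (metis abs_ge_zero divide_nonneg_nonneg not_gr_zero of_nat_0 order_le_less_trans less_irrefl)
  let ?k = "Complex ((Re z + \<mu>) / real M) 0"
  have "onto (Complex (- \<mu>) (Im z) + of_nat M * ?k)"
  proof (rule onto_path[where c = "\<bar>Im z\<bar>"])
    fix n
    show "lower (Complex (- \<mu>) (Im z) + of_nat n * ?k) \<bar>Im z\<bar>"
      using lower_nonreal[of "Complex (- \<mu>) (Im z) + of_nat n * ?k"] by simp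
    show "cmod ?k < \<bar>Im z\<bar>" using M assms by (simp add: cmod_def real_sqrt_abs field_simps real_sqrt_divide)
  qed (rule o)
  also have "Complex (- \<mu>) (Im z) + of_nat M * ?k = z"
    using M by (simp add: complex_eq_iff)
  finally show ?thesis .
qed

text \<open>A lower bound c at \<Lambda> survives as c / 2 at the nonreal point at distance c / 4,
  where solvability is known; one Neumann step of length c / 4 leads back. So a real point is in the
  spectrum exactly when every lower bound fails there.\<close>

lemma onto_real_if_lower:
  assumes l: "lower (of_real \<Lambda>) c" and c: "c > 0"
  shows "onto (of_real \<Lambda>)"
proof (rule onto_step)
  let ?z = "Complex \<Lambda> (c / 4)"
  show "onto ?z" using c by (intro onto_nonreal) auto
  show "lower ?z (c / 2)"
    unfolding lower_def
  proof (intro allI impI)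
    fix \<psi> g assume S: "sol ?z \<psi> g"
    hence D: "D \<psi>" "E g" "E \<psi>" by (auto simp: sol_def D_E)
    have "c * b.nrm \<psi> \<le> b.nrm (add g (scl (?z - of_real \<Lambda>) \<psi>))"
      using l sol_shift[OF S] by (auto simp: lower_def)
    also have "\<dots> \<le> b.nrm g + cmod (?z - of_real \<Lambda>) * b.nrm \<psi>"
      using b.nrm_add[of g "scl (?z - of_real \<Lambda>) \<psi>"] D by (simp add: b.nrm_scl b.scl_closed)
    also have "cmod (?z - of_real \<Lambda>) = c / 4"
      using c by (simp add: cmod_def)
    finally have "c * b.nrm \<psi> \<le> b.nrm g + c / 4 * b.nrm \<psi>" .
    moreover have "0 \<le> c * b.nrm \<psi>" using c D by simp
    ultimately show "c / 2 * b.nrm \<psi> \<le> b.nrm g" by simp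
  qed
  show "cmod (of_real \<Lambda> - ?z) < c / 2" using c by (simp add: cmod_def)
qed

text \<open>Duality: let \<phi> solve the equation at \<Lambda> with right-hand side \<psi>. Then
  the square of the norm of \<psi> is the defect of \<psi> tested with \<phi>, and
  \<open>sol_q\<close> bounds the form norm of \<phi> by the norm of \<psi>. Approximate
  eigenfunctions thus have to be small only as functionals on the form domain, and may be smooth
  functions that violate the jump conditions on the lines.\<close>

lemma weyl_bound:
  assumes o: "onto (of_real \<Lambda>)" and l: "lower (of_real \<Lambda>) c" and c: "c > 0"
  obtains K where "\<And>\<psi> \<epsilon>. \<epsilon> \<ge> 0 \<Longrightarrow> D \<psi> \<Longrightarrow>
      (\<And>\<phi>. D \<phi> \<Longrightarrow> cmod (s \<phi> \<psi> - of_real \<Lambda> * b \<phi> \<psi>) \<le> \<epsilon> * q.nrm \<phi>) \<Longrightarrow> b.nrm \<psi> \<le> K * \<epsilon>"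
proof -
  define K where "K = sqrt (1 / c + cmod (of_real \<Lambda> + of_real \<mu>) / c\<^sup>2)"
  have "b.nrm \<psi> \<le> K * \<epsilon>" if "\<epsilon> \<ge> 0" and p: "D \<psi>"
    and e: "\<And>\<phi>. D \<phi> \<Longrightarrow> cmod (s \<phi> \<psi> - of_real \<Lambda> * b \<phi> \<psi>) \<le> \<epsilon> * q.nrm \<phi>" for \<psi> \<epsilon>
  proof -
    note pE = D_E[OF p]
    obtain \<phi> where S: "sol (of_real \<Lambda>) \<phi> \<psi>" using o pE by (auto simp: onto_def)
    hence D: "D \<phi>" "E \<phi>" by (auto simp: sol_def D_E)
    have "s \<psi> \<phi> - of_real \<Lambda> * b \<psi> \<phi> = b \<psi> \<psi>" using S p by (auto simp: sol_def)
    hence "s \<phi> \<psi> - of_real \<Lambda> * b \<phi> \<psi> = cnj (b \<psi> \<psi>)"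
      using s.f_cnj[OF p D(1)] b.f_cnj[OF pE D(2)] by (metis complex_cnj_complex_of_real complex_cnj_diff complex_cnj_mult)
    hence "cmod (s \<phi> \<psi> - of_real \<Lambda> * b \<phi> \<psi>) = cmod (b \<psi> \<psi>)" by simp
    hence *: "(b.nrm \<psi>)\<^sup>2 \<le> \<epsilon> * q.nrm \<phi>"
      using e[OF D(1)] complex_Re_le_cmod[of "b \<psi> \<psi>"] by (simp add: b.nrm_sq pE)
    have c1: "b.nrm \<phi> \<le> b.nrm \<psi> / c" using l S c by (auto simp: lower_def field_simps)
    have "(q.nrm \<phi>)\<^sup>2 \<le> b.nrm \<phi> * b.nrm \<psi> + cmod (of_real \<Lambda> + of_real \<mu>) * (b.nrm \<phi>)\<^sup>2"
      by (rule sol_q[OF S])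
    also have "\<dots> \<le> (b.nrm \<psi> / c) * b.nrm \<psi> + cmod (of_real \<Lambda> + of_real \<mu>) * (b.nrm \<psi> / c)\<^sup>2"
      by (intro add_mono mult_right_mono mult_left_mono power_mono c1) (auto simp: pE D)
    also have "\<dots> = K\<^sup>2 * (b.nrm \<psi>)\<^sup>2"
    proof -
      have "K\<^sup>2 = 1 / c + cmod (of_real \<Lambda> + of_real \<mu>) / c\<^sup>2"
        unfolding K_def using c by (intro real_sqrt_pow2 add_nonneg_nonneg divide_nonneg_nonneg) auto
      thus ?thesis by (simp add: distrib_right power_divide power2_eq_square)
    qed
    finally have sq: "(q.nrm \<phi>)\<^sup>2 \<le> (K * b.nrm \<psi>)\<^sup>2" by (simp only: power_mult_distrib)
    have K0: "K \<ge> 0"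
      unfolding K_def using c by (intro real_sqrt_ge_zero add_nonneg_nonneg divide_nonneg_nonneg) auto
    hence "q.nrm \<phi> \<le> K * b.nrm \<psi>"
      by (intro power2_le_imp_le[OF sq] mult_nonneg_nonneg b.nrm_nonneg pE)
    have "(b.nrm \<psi>)\<^sup>2 \<le> \<epsilon> * (K * b.nrm \<psi>)"
      using * \<open>q.nrm \<phi> \<le> K * b.nrm \<psi>\<close> \<open>\<epsilon> \<ge> 0\<close> by (meson mult_left_mono order_trans)
    thus ?thesis
      using b.nrm_nonneg[OF pE] \<open>\<epsilon> \<ge> 0\<close> K0
      by (cases "b.nrm \<psi> = 0") (auto simp: power2_eq_square mult.assoc[symmetric] mult.commute[of \<epsilon>])
  qed
  with that show ?thesis by blast
qed

text \<open>If every lower bound fails, there are normalised x n whose right-hand sides tend to 0.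
  Along a subsequence the N functionals converge; the coercivity inequality, applied to differences,
  then makes the subsequence Cauchy in the form norm. Its limit has norm 1 and solves the
  homogeneous equation, against \<open>ne\<close>.\<close>

lemma eigen_or_lower:
  assumes e: "\<And>i. i < N \<Longrightarrow> E (e i)" and c: "c > 0"
    and co: "\<And>\<psi>. D \<psi> \<Longrightarrow> c * (q.nrm \<psi>)\<^sup>2 - C * (\<Sum>i<(N::nat). (cmod (b (e i) \<psi>))\<^sup>2) \<le> Re (s \<psi> \<psi>) - \<Lambda> * Re (b \<psi> \<psi>)"
    and ne: "\<And>\<psi> g. sol (of_real \<Lambda>) \<psi> g \<Longrightarrow> b.nrm g = 0 \<Longrightarrow> b.nrm \<psi> = 0"
  shows "\<exists>c>0. lower (of_real \<Lambda>) c"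
proof (rule ccontr)
  assume no: "\<not> ?thesis"
  have "\<exists>\<psi> g. sol (of_real \<Lambda>) \<psi> g \<and> b.nrm \<psi> = 1 \<and> b.nrm g < 1 / (real n + 1)" for n
  proof -
    have "\<not> lower (of_real \<Lambda>) (1 / (real n + 1))" using no by (auto dest: spec[of _ "1 / (real n + 1)"])
    then obtain \<psi> g where S: "sol (of_real \<Lambda>) \<psi> g" and lt: "b.nrm g < 1 / (real n + 1) * b.nrm \<psi>"
      by (auto simp: lower_def not_le)
    hence D: "D \<psi>" "E g" "E \<psi>" by (auto simp: sol_def D_E)
    have p: "b.nrm \<psi> > 0"
    proof (rule ccontr)
      assume "\<not> b.nrm \<psi> > 0"
      hence "b.nrm \<psi> = 0" using b.nrm_nonneg[OF D(3)] by simp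
      thus False using lt b.nrm_nonneg[OF D(2)] by simp
    qed
    let ?k = "complex_of_real (1 / b.nrm \<psi>)"
    have "b.nrm (scl ?k \<psi>) = 1" "b.nrm (scl ?k g) = b.nrm g / b.nrm \<psi>"
      using p by (auto simp: b.nrm_scl D norm_divide)
    moreover have "b.nrm g / b.nrm \<psi> < 1 / (real n + 1)" using lt p by (simp add: field_simps)
    ultimately show ?thesis using sol_scl[OF S, of ?k] by metis
  qed
  then obtain x h where S: "\<And>n. sol (of_real \<Lambda>) (x n) (h n)" and x1: "\<And>n. b.nrm (x n) = 1"
    and h: "\<And>n. b.nrm (h n) < 1 / (real n + 1)" by metis
  have xD: "D (x n)" "E (x n)" "E (h n)" for n using S[of n] by (auto simp: sol_def D_E)
  have "bounded (range (\<lambda>n. b (e i) (x n)))" if "i < N" for i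
    by (rule boundedI[of _ "b.nrm (e i)"]) (use b.cauchy_schwarz[OF e[OF that] xD(2)] x1 in auto)
  then obtain r where r: "strict_mono r" and conv: "\<And>i. i < N \<Longrightarrow> convergent (\<lambda>n. b (e i) (x (r n)))"
    using common_convergent_subsequence[of N "\<lambda>i n. b (e i) (x n)"] by auto
  define y k where "y n = x (r n)" and "k n = h (r n)" for n
  have y: "sol (of_real \<Lambda>) (y n) (k n)" "b.nrm (y n) = 1" "D (y n)" "E (y n)" "E (k n)" for n
    using S x1 xD by (auto simp: y_def k_def)
  have k0: "(\<lambda>n. b.nrm (k n)) \<longlonglongrightarrow> 0"
  proof -
    have "(\<lambda>n. b.nrm (h n)) \<longlonglongrightarrow> 0"
    proof (rule Lim_null_comparison)
      show "\<forall>\<^sub>F n in sequentially. norm (b.nrm (h n)) \<le> inverse (real (Suc n))"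
        using h xD(3) by (auto simp: inverse_eq_divide intro!: always_eventually less_imp_le simp: add.commute)
    qed (rule LIMSEQ_inverse_real_of_nat)
    from LIMSEQ_subseq_LIMSEQ[OF this r] show ?thesis by (simp add: k_def o_def)
  qed
  define sg where "sg m n = (\<Sum>i<N. (cmod (b (e i) (y m) - b (e i) (y n)))\<^sup>2)" for m n
  have ineq: "c * (q.nrm (q.sub (y m) (y n)))\<^sup>2 \<le> 2 * (b.nrm (k m) + b.nrm (k n)) + \<bar>C\<bar> * sg m n" for m n
  proof -
    let ?d = "q.sub (y m) (y n)" and ?g = "q.sub (k m) (k n)"
    have sd: "sol (of_real \<Lambda>) ?d ?g" by (rule sol_sub[OF y(1) y(1)])
    hence dD: "D ?d" "E ?g" "E ?d" by (auto simp: sol_def D_E)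
    have lowerE: "b.nrm (b.sub u v) \<le> b.nrm u + b.nrm v" if "E u" "E v" for u v
      using b.nrm_add[OF that(1) b.scl_closed[OF that(2)], of "-1"] that by (simp add: lsub_def b.nrm_scl)
    have "Re (s ?d ?d) - \<Lambda> * Re (b ?d ?d) = Re (b ?d ?g)"
      using sd dD by (auto simp: sol_def dest!: spec[of _ ?d] arg_cong[where f = Re])
    also have "\<dots> \<le> b.nrm ?d * b.nrm ?g"
      using b.cauchy_schwarz[OF dD(3,2)] complex_Re_le_cmod order_trans by blast
    also have "\<dots> \<le> 2 * (b.nrm (k m) + b.nrm (k n))"
      using lowerE[OF y(4) y(4), of m n] lowerE[OF y(5) y(5), of m n] y(2) dD
      by (intro mult_mono) auto
    finally have "c * (q.nrm ?d)\<^sup>2 - C * (\<Sum>i<N. (cmod (b (e i) ?d))\<^sup>2) \<le> 2 * (b.nrm (k m) + b.nrm (k n))"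
      using co[OF dD(1)] by linarith
    moreover have "(\<Sum>i<N. (cmod (b (e i) ?d))\<^sup>2) = sg m n"
      unfolding sg_def by (intro sum.cong) (auto simp: b.lin e y)
    moreover have "C * sg m n \<le> \<bar>C\<bar> * sg m n" by (intro mult_right_mono) (auto simp: sg_def sum_nonneg)
    ultimately show ?thesis by simp
  qed
  obtain u where u: "D u" "(\<lambda>n. q.nrm (q.sub (y n) u)) \<longlonglongrightarrow> 0"
  proof (rule q_complete[of y])
    fix \<epsilon> :: real assume "\<epsilon> > 0"
    \<comment> \<open>The denominator collects the final estimate: 4 from the right-hand sides of
      the two equations, |C| N from the functionals, and 1 to make the inequality strict.\<close>
    define \<delta> where "\<delta> = c * \<epsilon>\<^sup>2 / (4 + \<bar>C\<bar> * real N + 1)"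
    have den: "4 + \<bar>C\<bar> * real N + 1 > 0" by (smt (verit) mult_nonneg_nonneg of_nat_0_le_iff)
    have dl: "\<delta> > 0" using c \<open>\<epsilon> > 0\<close> den by (simp add: \<delta>_def)
    obtain N1 where N1: "\<And>n. n \<ge> N1 \<Longrightarrow> b.nrm (k n) < \<delta>"
      using order_tendstoD(2)[OF k0 dl] by (auto simp: eventually_sequentially)
    have "\<exists>M. \<forall>m\<ge>M. \<forall>n\<ge>M. cmod (b (e i) (y m) - b (e i) (y n)) < sqrt \<delta>" if "i < N" for i
    proof -
      have "Cauchy (\<lambda>n. b (e i) (y n))" using conv[OF that] convergent_Cauchy by (auto simp: y_def)
      thus ?thesis using dl unfolding Cauchy_def dist_norm by simp
    qed
    then obtain M where M: "\<And>i m n. i < N \<Longrightarrow> m \<ge> M i \<Longrightarrow> n \<ge> M i \<Longrightarrow> cmod (b (e i) (y m) - b (e i) (y n)) < sqrt \<delta>"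
      by metis
    define L where "L = Max (insert N1 (M ` {..<N}))"
    have L: "N1 \<le> L" "\<And>i. i < N \<Longrightarrow> M i \<le> L" by (auto simp: L_def)
    have "q.nrm (q.sub (y m) (y n)) < \<epsilon>" if "m \<ge> L" "n \<ge> L" for m n
    proof -
      have "sg m n \<le> (\<Sum>i<N. \<delta>)"
        unfolding sg_def
      proof (rule sum_mono)
        fix i assume "i \<in> {..<N}"
        hence "cmod (b (e i) (y m) - b (e i) (y n)) < sqrt \<delta>" using M L(2) that by (meson lessThan_iff order_trans)
        thus "(cmod (b (e i) (y m) - b (e i) (y n)))\<^sup>2 \<le> \<delta>"
          using dl by (smt (verit) norm_ge_zero power2_less_imp_less real_sqrt_pow2)
      qed
      hence "\<bar>C\<bar> * sg m n \<le> \<bar>C\<bar> * (real N * \<delta>)" by (intro mult_left_mono) auto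
      moreover have "A \<le> B \<Longrightarrow> X \<le> 2 * (p + p') + A \<Longrightarrow> p < \<delta> \<Longrightarrow> p' < \<delta> \<Longrightarrow> X < 4 * \<delta> + B + \<delta>"
        for A B X p p' using dl unfolding distrib_left by linarith
      ultimately have "c * (q.nrm (q.sub (y m) (y n)))\<^sup>2 < 4 * \<delta> + \<bar>C\<bar> * (real N * \<delta>) + \<delta>"
        using ineq[of m n] N1[OF order_trans[OF L(1) that(1)]] N1[OF order_trans[OF L(1) that(2)]]
        by blast
      also have "\<dots> = (4 + \<bar>C\<bar> * real N + 1) * \<delta>" by (simp add: algebra_simps)
      also have "\<dots> = c * \<epsilon>\<^sup>2" using den by (simp add: \<delta>_def)
      finally show ?thesis using c \<open>\<epsilon> > 0\<close> by (simp add: power2_less_imp_less)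
    qed
    thus "\<exists>L. \<forall>m\<ge>L. \<forall>n\<ge>L. q.nrm (q.sub (y m) (y n)) < \<epsilon>" by blast
  qed (use y in auto)
  have "b.nrm u = 1"
    using nrm_tendsto[OF y(3) u] y(2) LIMSEQ_unique[OF _ tendsto_const] by auto
  \<comment> \<open>The locale has no zero vector; 0 times u takes its place.\<close>
  let ?z = "scl 0 u"
  have z: "E ?z" "b.nrm ?z = 0" using u by (auto simp: b.scl_closed D_E b.nrm_scl)
  have "s \<phi> u - of_real \<Lambda> * b \<phi> u = b \<phi> ?z" if p: "D \<phi>" for \<phi>
  proof -
    have "(\<lambda>n. s \<phi> (y n) - of_real \<Lambda> * b \<phi> (y n)) \<longlonglongrightarrow> s \<phi> u - of_real \<Lambda> * b \<phi> u"
      using s_tendsto[OF y(3) u p] b_tendsto[OF y(3) u D_E[OF p]] by (intro tendsto_intros)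
    moreover have "s \<phi> (y n) - of_real \<Lambda> * b \<phi> (y n) = b \<phi> (k n)" for n
      using y(1)[of n] p by (auto simp: sol_def)
    moreover have "(\<lambda>n. b \<phi> (k n)) \<longlonglongrightarrow> 0"
    proof (rule Lim_null_comparison)
      show "\<forall>\<^sub>F n in sequentially. norm (b \<phi> (k n)) \<le> b.nrm \<phi> * b.nrm (k n)"
        using b.cauchy_schwarz[OF D_E[OF p] y(5)] by auto
      show "(\<lambda>n. b.nrm \<phi> * b.nrm (k n)) \<longlonglongrightarrow> 0" using tendsto_mult_right_zero[OF k0] by simp
    qed
    ultimately have "s \<phi> u - of_real \<Lambda> * b \<phi> u = 0" by (metis (no_types, lifting) LIMSEQ_unique ext)
    thus ?thesis by (simp add: b.lin D_E p u)
  qed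
  hence "sol (of_real \<Lambda>) u ?z" using u z by (auto simp: sol_def)
  thus False using ne z \<open>b.nrm u = 1\<close> by fastforce
qed

text \<open>By coercivity each x n carries a fixed amount of mass on the finitely many e i, at least
  c / 2 after multiplication with |C|, whereas Bessel's inequality bounds the total mass. The
  eigenvalues \<open>l n\<close> may vary: constant \<open>l\<close> gives finite multiplicity,
  distinct values give isolation.\<close>

lemma no_orthonormal_eigen:
  assumes e: "\<And>i. i < N \<Longrightarrow> E (e i)" and c: "c > 0"
    and co: "\<And>\<psi>. D \<psi> \<Longrightarrow> c * (q.nrm \<psi>)\<^sup>2 - C * (\<Sum>i<(N::nat). (cmod (b (e i) \<psi>))\<^sup>2) \<le> Re (s \<psi> \<psi>) - \<Lambda> * Re (b \<psi> \<psi>)"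
    and S: "\<And>n::nat. sol (of_real (l n)) (x n) (g n)" "\<And>n. b.nrm (g n) = 0" "\<And>n. \<bar>l n - \<Lambda>\<bar> \<le> c / 2"
    and on: "\<And>m n. b (x m) (x n) = (if m = n then 1 else 0)"
  shows False
proof -
  have xD: "D (x n)" "E (x n)" "E (g n)" for n using S(1)[of n] by (auto simp: sol_def D_E)
  have 1: "c / 2 \<le> \<bar>C\<bar> * (\<Sum>i<N. (cmod (b (e i) (x n)))\<^sup>2)" for n
  proof -
    have "b (x n) (g n) = 0" using b.cauchy_schwarz[OF xD(2,3), of n n] S(2) by simp
    hence "Re (s (x n) (x n)) - l n * Re (b (x n) (x n)) = 0"
      using S(1)[of n] xD by (auto simp: sol_def dest!: spec[of _ "x n"] arg_cong[where f = Re])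
    hence "Re (s (x n) (x n)) - \<Lambda> * Re (b (x n) (x n)) = l n - \<Lambda>" by (simp add: on algebra_simps)
    moreover have "1 \<le> (q.nrm (x n))\<^sup>2"
      using b_le_q[OF xD(1), of n] by (simp add: b.nrm_def on)
    hence "c * 1 \<le> c * (q.nrm (x n))\<^sup>2" using c by (intro mult_left_mono) auto
    moreover have "C * (\<Sum>i<N. (cmod (b (e i) (x n)))\<^sup>2) \<le> \<bar>C\<bar> * (\<Sum>i<N. (cmod (b (e i) (x n)))\<^sup>2)"
      by (intro mult_right_mono sum_nonneg) auto
    ultimately show ?thesis using co[OF xD(1), of n] S(3)[of n] by linarith
  qed
  have "real M * (c / 2) \<le> \<bar>C\<bar> * (\<Sum>i<N. Re (b (e i) (e i)))" for M
  proof -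
    have "real M * (c / 2) = (\<Sum>n<M. c / 2)" by simp
    also have "\<dots> \<le> (\<Sum>n<M. \<bar>C\<bar> * (\<Sum>i<N. (cmod (b (e i) (x n)))\<^sup>2))" by (intro sum_mono 1)
    also have "\<dots> = \<bar>C\<bar> * (\<Sum>i<N. \<Sum>n<M. (cmod (b (e i) (x n)))\<^sup>2)"
      by (subst sum.swap) (simp add: sum_distrib_left)
    also have "\<dots> \<le> \<bar>C\<bar> * (\<Sum>i<N. Re (b (e i) (e i)))"
      by (intro mult_left_mono sum_mono b.bessel) (auto simp: e xD on)
    finally show ?thesis .
  qed
  moreover obtain M :: nat where "\<bar>C\<bar> * (\<Sum>i<N. Re (b (e i) (e i))) / (c / 2) < real M"
    using reals_Archimedean2 by blast
  ultimately show False using c by (smt (verit) pos_divide_less_eq half_gt_zero)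
qed

end

section \<open>The space L2\<close>

lemma L2_measurable: "L2 f \<Longrightarrow> f \<in> borel_measurable lebesgue"
  and L2_integrable: "L2 f \<Longrightarrow> integrable lebesgue (\<lambda>x. (cmod (f x))\<^sup>2)"
  by (auto simp: L2_def)

lemma L2_I_bound:
  fixes f :: "'a::euclidean_space \<Rightarrow> complex"
  assumes "f \<in> borel_measurable lebesgue" "integrable lebesgue g" "\<And>x. (cmod (f x))\<^sup>2 \<le> g x"
  shows "L2 f"
  unfolding L2_def
proof
  show "integrable lebesgue (\<lambda>x. (cmod (f x))\<^sup>2)"
    by (rule Bochner_Integration.integrable_bound[OF assms(2)])
      (use assms in \<open>auto intro!: AE_I2 intro: order_trans[OF _ abs_ge_self]\<close>)
qed (use assms in auto)

lemma L2_mult_integrable: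
  assumes "L2 f" "L2 g" shows "integrable lebesgue (\<lambda>x. f x * g x)"
proof (rule Bochner_Integration.integrable_bound)
  show "integrable lebesgue (\<lambda>x. (cmod (f x))\<^sup>2 + (cmod (g x))\<^sup>2)"
    using assms by (auto simp: L2_def)
  have "cmod (f x * g x) \<le> (cmod (f x))\<^sup>2 + (cmod (g x))\<^sup>2" for x
  proof -
    have "0 \<le> (cmod (f x) - cmod (g x))\<^sup>2 + (cmod (f x))\<^sup>2 + (cmod (g x))\<^sup>2" by simp
    thus ?thesis by (simp add: norm_mult power2_diff)
  qed
  thus "AE x in lebesgue. norm (f x * g x) \<le> norm ((cmod (f x))\<^sup>2 + (cmod (g x))\<^sup>2)"
    by auto
qed (use assms in \<open>auto simp: L2_def\<close>)

lemma L2_cnj: "L2 f \<Longrightarrow> L2 (\<lambda>x. cnj (f x))"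
  by (auto simp: L2_def intro!: borel_measurable_continuous_on[where f = cnj] continuous_intros)

lemma L2_add: assumes "L2 f" "L2 g" shows "L2 (\<lambda>x. f x + g x)"
proof (rule L2_I_bound)
  show "integrable lebesgue (\<lambda>x. 2 * (cmod (f x))\<^sup>2 + 2 * (cmod (g x))\<^sup>2)"
    using assms by (auto simp: L2_def)
  show "(cmod (f x + g x))\<^sup>2 \<le> 2 * (cmod (f x))\<^sup>2 + 2 * (cmod (g x))\<^sup>2" for x
  proof -
    have "(cmod (f x + g x))\<^sup>2 \<le> (cmod (f x) + cmod (g x))\<^sup>2"
      by (intro power_mono norm_triangle_ineq) auto
    also have "\<dots> \<le> 2 * (cmod (f x))\<^sup>2 + 2 * (cmod (g x))\<^sup>2"
      using sum_squares_bound[of "cmod (f x)" "cmod (g x)"] by (simp add: power2_sum)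
    finally show ?thesis .
  qed
qed (use assms in \<open>auto simp: L2_def\<close>)

lemma L2_scale: "L2 f \<Longrightarrow> L2 (\<lambda>x. c * f x)"
  by (auto simp: L2_def norm_mult power_mult_distrib)

lemma L2_diff: "L2 f \<Longrightarrow> L2 g \<Longrightarrow> L2 (\<lambda>x. f x - g x)"
  using L2_add[of f "\<lambda>x. (-1) * g x"] L2_scale[of g "-1"] by simp

lemma L2_zero: "L2 (\<lambda>x. 0)" by (simp add: L2_def)

lemma L2_mult_bounded:
  assumes "L2 f" "h \<in> borel_measurable lebesgue" "\<And>x. cmod (h x) \<le> B"
  shows "L2 (\<lambda>x. h x * f x)"
proof (rule L2_I_bound)
  show "integrable lebesgue (\<lambda>x. B\<^sup>2 * (cmod (f x))\<^sup>2)" using assms by (auto simp: L2_def)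
  show "(cmod (h x * f x))\<^sup>2 \<le> B\<^sup>2 * (cmod (f x))\<^sup>2" for x
    using assms(3)[of x] by (auto simp: norm_mult power_mult_distrib intro!: mult_right_mono power_mono)
qed (use assms in \<open>auto simp: L2_def\<close>)

lemma inner_L2_integrable: "L2 f \<Longrightarrow> L2 g \<Longrightarrow> integrable lebesgue (\<lambda>x. cnj (f x) * g x)"
  using L2_mult_integrable[OF L2_cnj] by blast

lemma norm_L2_sq: "(norm_L2 f)\<^sup>2 = integral\<^sup>L lebesgue (\<lambda>x. (cmod (f x))\<^sup>2)"
  unfolding norm_L2_def by (simp add: integral_nonneg_AE)

lemma inner_L2_self: "inner_L2 f f = complex_of_real ((norm_L2 f)\<^sup>2)"
proof -
  have "cnj z * z = complex_of_real ((cmod z)\<^sup>2)" for z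
    by (metis complex_norm_square mult.commute of_real_power)
  hence "inner_L2 f f = (LEBINT x. complex_of_real ((cmod (f x))\<^sup>2))"
    unfolding inner_L2_def by (simp del: of_real_power)
  thus ?thesis by (simp only: integral_complex_of_real norm_L2_sq)
qed

interpretation L2: psd_form L2 "\<lambda>f g x. f x + g x" "\<lambda>c f x. c * f x" inner_L2
proof
  fix u v w :: "'a \<Rightarrow> complex" and c :: complex
  assume u: "L2 u"
  show "L2 (\<lambda>x. c * u x)" by (rule L2_scale[OF u])
  show "0 \<le> Re (inner_L2 u u)" by (simp add: inner_L2_self)
  assume v: "L2 v"
  show "L2 (\<lambda>x. u x + v x)" by (rule L2_add[OF u v])
  show "inner_L2 u (\<lambda>x. c * v x) = c * inner_L2 u v"
    unfolding inner_L2_def by (simp add: mult.left_commute)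
  show "inner_L2 v u = cnj (inner_L2 u v)"
    unfolding inner_L2_def by (subst Bochner_Integration.integral_cnj[symmetric]) (simp add: mult.commute del: Bochner_Integration.integral_cnj)
  assume w: "L2 w"
  show "inner_L2 u (\<lambda>x. v x + w x) = inner_L2 u v + inner_L2 u w"
    unfolding inner_L2_def using inner_L2_integrable[OF u v] inner_L2_integrable[OF u w]
    by (simp add: distrib_left)
qed

lemma L2_nrm [simp]: "L2.nrm = norm_L2"
  by (auto simp: L2.nrm_def inner_L2_self fun_eq_iff norm_L2_def integral_nonneg_AE)

lemma L2_lsub [simp]: "lsub (\<lambda>f g x. f x + g x) (\<lambda>c f x. c * f x) f g = (\<lambda>x. (f x - g x :: complex))"
  by (simp add: lsub_def)

lemma norm_L2_nonneg [simp]: "0 \<le> norm_L2 f"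
  by (simp add: norm_L2_def integral_nonneg_AE)

lemma norm_L2_triangle: "L2 f \<Longrightarrow> L2 g \<Longrightarrow> norm_L2 (\<lambda>x. f x + g x) \<le> norm_L2 f + norm_L2 g"
  using L2.nrm_add[of f g] by simp

lemma norm_L2_scale: "norm_L2 (\<lambda>x. c * f x) = cmod c * norm_L2 f"
  by (simp add: norm_L2_def norm_mult power_mult_distrib real_sqrt_mult)

lemma norm_L2_commute: "norm_L2 (\<lambda>x. f x - g x) = norm_L2 (\<lambda>x. g x - f x)"
  by (simp add: norm_L2_def norm_minus_commute)

lemma norm_L2_triangle_diff: "L2 f \<Longrightarrow> L2 g \<Longrightarrow> norm_L2 (\<lambda>x. f x - g x) \<le> norm_L2 f + norm_L2 g"
  using norm_L2_triangle[of f "\<lambda>x. (-1) * g x"] L2_scale[of g "-1"] norm_L2_scale[of "-1" g] by simp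

lemma norm_L2_triangle3:
  "L2 f \<Longrightarrow> L2 g \<Longrightarrow> L2 h \<Longrightarrow> norm_L2 (\<lambda>x. f x - h x) \<le> norm_L2 (\<lambda>x. f x - g x) + norm_L2 (\<lambda>x. g x - h x)"
  using norm_L2_triangle[of "\<lambda>x. f x - g x" "\<lambda>x. g x - h x"] by (simp add: L2_diff)

lemma cauchy_schwarz_L2: "L2 f \<Longrightarrow> L2 g \<Longrightarrow> cmod (inner_L2 f g) \<le> norm_L2 f * norm_L2 g"
  using L2.cauchy_schwarz[of f g] by simp

lemma norm_L2_cong_AE:
  assumes "L2 f" "L2 g" "AE x in lebesgue. f x = g x" shows "norm_L2 f = norm_L2 g"
proof -
  have "(LEBINT x. (cmod (f x))\<^sup>2) = (LEBINT x. (cmod (g x))\<^sup>2)"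
    by (rule integral_cong_AE) (use assms in \<open>auto simp: L2_def\<close>)
  thus ?thesis by (simp add: norm_L2_def)
qed

lemma inner_L2_cong_AE:
  assumes "L2 f" "L2 f'" "L2 g" "L2 g'" "AE x in lebesgue. f x = f' x" "AE x in lebesgue. g x = g' x"
  shows "inner_L2 f g = inner_L2 f' g'"
  unfolding inner_L2_def
  by (rule integral_cong_AE)
    (use assms in \<open>auto simp: L2_def intro!: borel_measurable_times dest: L2_measurable[OF L2_cnj] intro: L2_measurable[OF L2_cnj]\<close>)

lemma norm_L2_eq_0_iff: assumes "L2 f" shows "norm_L2 f = 0 \<longleftrightarrow> (AE x in lebesgue. f x = 0)"
proof -
  have "norm_L2 f = 0 \<longleftrightarrow> (LEBINT x. (cmod (f x))\<^sup>2) = 0"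
    by (simp add: norm_L2_def)
  also have "\<dots> \<longleftrightarrow> (AE x in lebesgue. (cmod (f x))\<^sup>2 = 0)"
    by (rule integral_nonneg_eq_0_iff_AE) (use assms in \<open>auto simp: L2_def\<close>)
  finally show ?thesis by simp
qed

lemma nn_integral_L2:
  assumes "L2 f" shows "(\<integral>\<^sup>+x. ennreal ((cmod (f x))\<^sup>2) \<partial>lebesgue) = ennreal ((norm_L2 f)\<^sup>2)"
  unfolding norm_L2_sq by (rule nn_integral_eq_integral[OF L2_integrable[OF assms]]) simp

lemma L2_nn_integralI:
  assumes "f \<in> borel_measurable lebesgue" "(\<integral>\<^sup>+x. ennreal ((cmod (f x))\<^sup>2) \<partial>lebesgue) \<le> ennreal (c\<^sup>2)" "c \<ge> 0"
  shows "L2 f \<and> norm_L2 f \<le> c"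
proof
  show L: "L2 f" unfolding L2_def
    using assms by (auto intro!: integrableI_nonneg simp: order_le_less_trans)
  have "ennreal ((norm_L2 f)\<^sup>2) \<le> ennreal (c\<^sup>2)" using nn_integral_L2[OF L] assms by simp
  hence "(norm_L2 f)\<^sup>2 \<le> c\<^sup>2" by (simp add: ennreal_le_iff)
  thus "norm_L2 f \<le> c" using assms(3) by (rule power2_le_imp_le)
qed

text \<open>Fatou's lemma: an almost everywhere limit inherits a norm bound. The bound is asked for
  from index N on only, as it is available for tails of Cauchy sequences.\<close>

lemma L2_fatou:
  assumes x: "\<And>n. L2 (x n)" and f: "f \<in> borel_measurable lebesgue"
    and lim: "AE t in lebesgue. (\<lambda>n. x n t) \<longlonglongrightarrow> f t"
    and b: "\<And>n. n \<ge> N \<Longrightarrow> norm_L2 (x n) \<le> c"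
  shows "L2 f \<and> norm_L2 f \<le> c"
proof (rule L2_nn_integralI[OF f])
  show c: "c \<ge> 0" using order_trans[OF norm_L2_nonneg b[OF order_refl]] .
  have m: "x n \<in> borel_measurable lebesgue" for n using x by (rule L2_measurable)
  have "(\<integral>\<^sup>+t. ennreal ((cmod (f t))\<^sup>2) \<partial>lebesgue) = (\<integral>\<^sup>+t. liminf (\<lambda>n. ennreal ((cmod (x n t))\<^sup>2)) \<partial>lebesgue)"
  proof (rule nn_integral_cong_AE)
    show "AE t in lebesgue. ennreal ((cmod (f t))\<^sup>2) = liminf (\<lambda>n. ennreal ((cmod (x n t))\<^sup>2))"
      using lim
    proof eventually_elim
      case (elim t)
      have "(\<lambda>n. ennreal ((cmod (x n t))\<^sup>2)) \<longlonglongrightarrow> ennreal ((cmod (f t))\<^sup>2)"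
        using elim by (intro tendsto_ennrealI tendsto_intros)
      from lim_imp_Liminf[OF sequentially_bot this] show ?case by simp
    qed
  qed
  also have "\<dots> \<le> liminf (\<lambda>n. \<integral>\<^sup>+t. ennreal ((cmod (x n t))\<^sup>2) \<partial>lebesgue)"
    by (rule nn_integral_liminf) (use m in measurable)
  also have "\<dots> = liminf (\<lambda>n. ennreal ((norm_L2 (x n))\<^sup>2))" by (simp add: nn_integral_L2 x)
  also have "\<dots> \<le> liminf (\<lambda>n::nat. ennreal (c\<^sup>2))"
    by (rule Liminf_mono) (auto simp: eventually_sequentially intro!: exI[of _ N] ennreal_leI power_mono b)
  finally show "(\<integral>\<^sup>+t. ennreal ((cmod (f t))\<^sup>2) \<partial>lebesgue) \<le> ennreal (c\<^sup>2)" by (simp add: Liminf_const)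
qed

lemma ennreal_term_le_suminf: "g k \<le> (\<Sum>k. g k)" for g :: "nat \<Rightarrow> ennreal"
  using sum_le_suminf[of g "{k}"] by simp

text \<open>Riesz-Fischer. A subsequence has increments d k of norm at most 2^-k, so the sum of 2^k
  |d k|^2 has finite integral and is finite almost everywhere. There |d k| is bounded by a multiple
  of 2^(-k/2), so the subsequence converges pointwise, and Fatou's lemma turns this into convergence
  of the whole sequence in norm.\<close>

lemma L2_complete:
  fixes x :: "nat \<Rightarrow> 'a::euclidean_space \<Rightarrow> complex"
  assumes x: "\<And>n. L2 (x n)"
    and C: "\<And>e. e > 0 \<Longrightarrow> \<exists>N. \<forall>m\<ge>N. \<forall>n\<ge>N. norm_L2 (\<lambda>t. x m t - x n t) < e"
  shows "\<exists>f. L2 f \<and> L2_lim x f"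
proof -
  have "\<exists>N. \<forall>m\<ge>N. \<forall>n\<ge>N. norm_L2 (\<lambda>t. x m t - x n t) < (1/2) ^ k" for k by (rule C) simp
  then obtain M where M: "\<And>k m n. m \<ge> M k \<Longrightarrow> n \<ge> M k \<Longrightarrow> norm_L2 (\<lambda>t. x m t - x n t) < (1/2) ^ k" by metis
  \<comment> \<open>Sums of the thresholds are monotone in k and at least M k, which avoids a
    recursive choice of the subsequence.\<close>
  define r where "r k = (\<Sum>i\<le>k. M i) + k" for k
  have rM: "M k \<le> r k" for k unfolding r_def using member_le_sum[of k "{..k}" M] by simp
  have rr: "r k \<le> r (Suc k)" for k by (simp add: r_def)
  have rk: "k \<le> r k" for k by (simp add: r_def)
  have r_ge: "M k \<le> r j" if "k \<le> j" for j k
    using lift_Suc_mono_le[of r, OF rr that] rM[of k] by simp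
  define d where "d k t = x (r (Suc k)) t - x (r k) t" for k t
  have dL: "L2 (d k)" for k unfolding d_def by (intro L2_diff x)
  have dn: "norm_L2 (d k) \<le> (1/2) ^ k" for k
    unfolding d_def using M[OF r_ge r_ge, of k "Suc k" k] by (simp add: less_imp_le)
  have mx: "x n \<in> borel_measurable lebesgue" for n using x by (rule L2_measurable)
  have md[measurable]: "d n \<in> borel_measurable lebesgue" for n using dL by (rule L2_measurable)
  have "(\<integral>\<^sup>+t. (\<Sum>k. ennreal (2 ^ k * (cmod (d k t))\<^sup>2)) \<partial>lebesgue) = (\<Sum>k. \<integral>\<^sup>+t. ennreal (2 ^ k * (cmod (d k t))\<^sup>2) \<partial>lebesgue)"
    by (rule nn_integral_suminf) measurable
  also have "\<dots> \<le> (\<Sum>k. ennreal ((1/2) ^ k))"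
  proof (rule suminf_le)
    fix k
    have "(\<integral>\<^sup>+t. ennreal (2 ^ k * (cmod (d k t))\<^sup>2) \<partial>lebesgue) = ennreal (2 ^ k) * (\<integral>\<^sup>+t. ennreal ((cmod (d k t))\<^sup>2) \<partial>lebesgue)"
      by (simp add: ennreal_mult nn_integral_cmult)
    also have "\<dots> = ennreal (2 ^ k * (norm_L2 (d k))\<^sup>2)"
      by (simp add: nn_integral_L2[OF dL] ennreal_mult)
    also have "\<dots> \<le> ennreal (2 ^ k * ((1/2) ^ k)\<^sup>2)"
      by (intro ennreal_leI mult_left_mono power_mono dn) auto
    also have "2 ^ k * ((1/2) ^ k)\<^sup>2 = ((1/2) ^ k :: real)"
      by (simp add: power2_eq_square power_divide)
    finally show "(\<integral>\<^sup>+t. ennreal (2 ^ k * (cmod (d k t))\<^sup>2) \<partial>lebesgue) \<le> ennreal ((1/2) ^ k)" .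
  qed auto
  also have "\<dots> = ennreal (\<Sum>k. (1/2) ^ k)"
    by (rule suminf_ennreal2) (auto intro: summable_geometric)
  also have "\<dots> < \<infinity>" by simp
  finally have "(\<integral>\<^sup>+t. (\<Sum>k. ennreal (2 ^ k * (cmod (d k t))\<^sup>2)) \<partial>lebesgue) \<noteq> \<infinity>" by simp
  hence AEfin: "AE t in lebesgue. (\<Sum>k. ennreal (2 ^ k * (cmod (d k t))\<^sup>2)) \<noteq> \<infinity>"
    by (intro nn_integral_PInf_AE) measurable
  define f where "f t = lim (\<lambda>k. x (r k) t)" for t
  have mf: "f \<in> borel_measurable lebesgue"
    unfolding f_def by (rule borel_measurable_lim_metric[OF mx])
  have lim: "AE t in lebesgue. (\<lambda>k. x (r k) t) \<longlonglongrightarrow> f t"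
    using AEfin
  proof eventually_elim
    case (elim t)
    define B where "B = enn2real (\<Sum>k. ennreal (2 ^ k * (cmod (d k t))\<^sup>2))"
    have eB: "ennreal B = (\<Sum>k. ennreal (2 ^ k * (cmod (d k t))\<^sup>2))"
      unfolding B_def by (rule ennreal_enn2real) (use elim less_top infinity_ennreal_def in metis)
    have B0: "B \<ge> 0" unfolding B_def by (rule enn2real_nonneg)
    have B: "2 ^ k * (cmod (d k t))\<^sup>2 \<le> B" for k
      using ennreal_term_le_suminf[of "\<lambda>k. ennreal (2 ^ k * (cmod (d k t))\<^sup>2)" k]
      unfolding eB[symmetric] ennreal_le_iff[OF B0] .
    have bd: "cmod (d k t) \<le> sqrt B * sqrt (1/2) ^ k" for k
    proof -
      have "(cmod (d k t))\<^sup>2 \<le> B * (1/2) ^ k" using B[of k] by (simp add: field_simps)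
      hence "sqrt ((cmod (d k t))\<^sup>2) \<le> sqrt (B * (1/2) ^ k)" by (rule real_sqrt_le_mono)
      thus ?thesis by (simp only: real_sqrt_mult real_sqrt_abs abs_norm_cancel real_sqrt_power[of "1/2"])
    qed
    have "summable (\<lambda>k. d k t)"
    proof (rule summable_comparison_test)
      show "\<exists>N. \<forall>n\<ge>N. cmod (d n t) \<le> sqrt B * sqrt (1/2) ^ n" using bd by blast
      have "sqrt (1/2) < sqrt 1" by (rule real_sqrt_less_mono) simp
      thus "summable (\<lambda>n. sqrt B * sqrt (1/2) ^ n)" by (intro summable_mult summable_geometric) simp
    qed
    hence "convergent (\<lambda>n. \<Sum>k<n. d k t)" by (simp add: summable_iff_convergent)
    moreover have "(\<Sum>k<n. d k t) = x (r n) t - x (r 0) t" for n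
      unfolding d_def by (rule sum_lessThan_telescope)
    ultimately have "convergent (\<lambda>n. x (r n) t)"
      using convergent_diff_const_right_iff[of "\<lambda>n. x (r n) t" "x (r 0) t"] by simp
    thus ?case by (simp add: f_def convergent_LIMSEQ_iff)
  qed
  have est: "L2 (\<lambda>t. x (r j) t - x n t) \<and> norm_L2 (\<lambda>t. x (r j) t - x n t) \<le> (1/2) ^ k" if "n \<ge> M k" "j \<ge> k" for n j k
    using M[OF r_ge[OF that(2)] that(1)] x by (auto intro: L2_diff)
  have close: "L2 (\<lambda>t. f t - x n t) \<and> norm_L2 (\<lambda>t. f t - x n t) \<le> (1/2) ^ k" if n: "n \<ge> M k" for n k
  proof (rule L2_fatou[where x = "\<lambda>j t. x (r j) t - x n t" and N = k])
    show "(\<lambda>t. f t - x n t) \<in> borel_measurable lebesgue" using mf mx by auto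
    show "AE t in lebesgue. (\<lambda>j. x (r j) t - x n t) \<longlonglongrightarrow> f t - x n t"
      using lim by eventually_elim (intro tendsto_intros)
  qed (use est n x in \<open>auto intro: L2_diff\<close>)
  have "L2 (\<lambda>t. (f t - x (M 0) t) + x (M 0) t)" using close[of 0 "M 0"] x by (intro L2_add) auto
  hence fL: "L2 f" by simp
  have "L2_lim x f"
  proof (rule LIMSEQ_I)
    fix e :: real assume "e > 0"
    then obtain k where k: "(1/2) ^ k < e" using real_arch_pow_inv[of e "1/2"] by auto
    show "\<exists>N. \<forall>n\<ge>N. norm (norm_L2 (\<lambda>t. x n t - f t) - 0) < e"
      using close[of k] k norm_L2_commute[of f] by (intro exI[of _ "M k"]) (auto intro: order_le_less_trans)
  qed
  with fL show ?thesis by blast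
qed

lemma norm_L2_tendsto:
  assumes "\<And>n. L2 (x n)" "L2 f" "L2_lim x f"
  shows "(\<lambda>n. norm_L2 (x n)) \<longlonglongrightarrow> norm_L2 f"
proof -
  have "\<bar>norm_L2 (x n) - norm_L2 f\<bar> \<le> norm_L2 (\<lambda>t. x n t - f t)" for n
    using norm_L2_triangle3[OF assms(1,2) L2_zero, of n] norm_L2_triangle3[OF assms(2,1) L2_zero, of n] norm_L2_commute[of f "x n"]
    by simp
  hence "(\<lambda>n. norm_L2 (x n) - norm_L2 f) \<longlonglongrightarrow> 0"
    by (intro Lim_null_comparison[OF _ assms(3)]) auto
  thus ?thesis by (simp add: LIM_zero_iff)
qed

lemma inner_L2_tendsto:
  assumes x: "\<And>n. L2 (x n)" "L2 f" "L2_lim x f"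
    and y: "\<And>n. L2 (y n)" "L2 g" "L2_lim y g"
  shows "(\<lambda>n. inner_L2 (x n) (y n)) \<longlonglongrightarrow> inner_L2 f g"
proof -
  have eq: "inner_L2 (x n) (y n) - inner_L2 f g = inner_L2 (\<lambda>t. x n t - f t) (y n) + inner_L2 f (\<lambda>t. y n t - g t)" for n
    using L2.f_sub[OF x(2) y(1) y(2), of n] L2.f_sub_left[OF y(1) x(1) x(2), of n n] by simp
  have "(\<lambda>n. inner_L2 (x n) (y n) - inner_L2 f g) \<longlonglongrightarrow> 0"
  proof (rule Lim_null_comparison)
    show "\<forall>\<^sub>F n in sequentially. cmod (inner_L2 (x n) (y n) - inner_L2 f g)
      \<le> norm_L2 (\<lambda>t. x n t - f t) * norm_L2 (y n) + norm_L2 f * norm_L2 (\<lambda>t. y n t - g t)"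
      unfolding eq by (intro always_eventually allI order_trans[OF norm_triangle_ineq] add_mono cauchy_schwarz_L2 L2_diff x y)
    have "(\<lambda>n. norm_L2 (\<lambda>t. x n t - f t) * norm_L2 (y n) + norm_L2 f * norm_L2 (\<lambda>t. y n t - g t))
       \<longlonglongrightarrow> 0 * norm_L2 g + norm_L2 f * 0"
      by (intro tendsto_intros x y norm_L2_tendsto)
    thus "(\<lambda>n. norm_L2 (\<lambda>t. x n t - f t) * norm_L2 (y n) + norm_L2 f * norm_L2 (\<lambda>t. y n t - g t)) \<longlonglongrightarrow> 0" by simp
  qed
  thus ?thesis by (simp add: LIM_zero_iff)
qed

lemma L2_lim_unique:
  assumes x: "\<And>n. L2 (x n)" and f: "L2 f" "L2_lim x f"
    and g: "L2 g" "L2_lim x g"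
  shows "AE t in lebesgue. f t = g t"
proof -
  have "norm_L2 (\<lambda>t. f t - g t) \<le> norm_L2 (\<lambda>t. x n t - f t) + norm_L2 (\<lambda>t. x n t - g t)" for n
    using norm_L2_triangle3[OF f(1) x g(1), of n] norm_L2_commute[of f "x n"] by simp
  moreover have "(\<lambda>n. norm_L2 (\<lambda>t. x n t - f t) + norm_L2 (\<lambda>t. x n t - g t)) \<longlonglongrightarrow> 0 + 0"
    by (intro tendsto_intros f g)
  ultimately have "norm_L2 (\<lambda>t. f t - g t) \<le> 0"
    by (intro LIMSEQ_le_const[where X = "\<lambda>n. norm_L2 (\<lambda>t. x n t - f t) + norm_L2 (\<lambda>t. x n t - g t)"]) auto
  hence "norm_L2 (\<lambda>t. f t - g t) = 0" using norm_L2_nonneg[of "\<lambda>t. f t - g t"] by simp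
  thus ?thesis using norm_L2_eq_0_iff[OF L2_diff[OF f(1) g(1)]] by simp
qed

lemma L2_tendsto_dominated:
  fixes f :: "'a::euclidean_space \<Rightarrow> complex"
  assumes x: "\<And>n. x n \<in> borel_measurable lebesgue" and f: "f \<in> borel_measurable lebesgue" and g: "L2 g"
    and lim: "AE t in lebesgue. (\<lambda>n. x n t) \<longlonglongrightarrow> f t"
    and b: "\<And>n t. cmod (x n t - f t) \<le> cmod (g t)"
  shows "L2_lim x f"
proof -
  have "(\<lambda>n. \<integral>t. (cmod (x n t - f t))\<^sup>2 \<partial>lebesgue) \<longlonglongrightarrow> (\<integral>t. 0 \<partial>(lebesgue :: 'a measure))"
  proof (rule integral_dominated_convergence[where w = "\<lambda>t. (cmod (g t))\<^sup>2"])
    show "integrable lebesgue (\<lambda>t. (cmod (g t))\<^sup>2)" by (rule L2_integrable[OF g])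
    show "AE t in lebesgue. (\<lambda>n. (cmod (x n t - f t))\<^sup>2) \<longlonglongrightarrow> 0"
      using lim
    proof eventually_elim
      case (elim t)
      have "(\<lambda>n. (cmod (x n t - f t))\<^sup>2) \<longlonglongrightarrow> (cmod (f t - f t))\<^sup>2" by (intro tendsto_intros elim)
      thus ?case by simp
    qed
    show "AE t in lebesgue. norm ((cmod (x n t - f t))\<^sup>2) \<le> (cmod (g t))\<^sup>2" for n
      using b by (auto intro!: power_mono)
  qed (use x f in auto)
  hence "(\<lambda>n. sqrt (LEBINT t. (cmod (x n t - f t))\<^sup>2)) \<longlonglongrightarrow> sqrt 0"
    by (intro tendsto_intros) simp
  thus ?thesis by (simp add: norm_L2_def)
qed

section \<open>Test functions\<close>

text \<open>\<open>smooth\<close> is defined by coinduction: f has to lie in some family of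
  continuous functions that is closed under partial derivatives. The basic smoothness results below
  exhibit such a family.\<close>

lemma smoothI:
  assumes "f \<in> S" "\<And>g. g \<in> S \<Longrightarrow> continuous_on UNIV g"
    "\<And>g b. g \<in> S \<Longrightarrow> b \<in> Basis \<Longrightarrow> \<exists>g'\<in>S. \<forall>x. ((\<lambda>t. g (x + t *\<^sub>R b)) has_real_derivative g' x) (at 0)"
  shows "smooth f"
  unfolding smooth_def using assms by blast

lemma smooth_continuous: "smooth f \<Longrightarrow> continuous_on UNIV f"
  unfolding smooth_def by blast

lemma smooth_ex_deriv:
  assumes "smooth f" "b \<in> Basis"
  shows "\<exists>f'. smooth f' \<and> (\<forall>x. ((\<lambda>t. f (x + t *\<^sub>R b)) has_real_derivative f' x) (at 0))"
proof -
  obtain S where S: "f \<in> S" "\<And>g. g \<in> S \<Longrightarrow> continuous_on UNIV g"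
    "\<And>g b. g \<in> S \<Longrightarrow> b \<in> Basis \<Longrightarrow> \<exists>g'\<in>S. \<forall>x. ((\<lambda>t. g (x + t *\<^sub>R b)) has_real_derivative g' x) (at 0)"
    using assms(1) unfolding smooth_def by blast
  obtain f' where f': "f' \<in> S" "\<forall>x. ((\<lambda>t. f (x + t *\<^sub>R b)) has_real_derivative f' x) (at 0)"
    using S(3)[OF S(1) assms(2)] by blast
  have "smooth f'" by (rule smoothI[of _ S]) (use S f' in auto)
  thus ?thesis using f' by blast
qed

lemma partial_eq:
  "(\<And>x. ((\<lambda>t. f (x + t *\<^sub>R b)) has_real_derivative f' x) (at 0)) \<Longrightarrow> partial f b = f'"
  by (auto simp: partial_def fun_eq_iff DERIV_imp_deriv)

lemma smooth_partial: "smooth f \<Longrightarrow> b \<in> Basis \<Longrightarrow> smooth (partial f b)"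
  and smooth_partial_deriv0: "smooth f \<Longrightarrow> b \<in> Basis \<Longrightarrow> ((\<lambda>t. f (x + t *\<^sub>R b)) has_real_derivative partial f b x) (at 0)"
  using smooth_ex_deriv[of f b] partial_eq[of f b] by metis+

lemma smooth_partial_deriv:
  assumes "smooth f" "b \<in> Basis"
  shows "((\<lambda>t. f (x + t *\<^sub>R b)) has_real_derivative partial f b (x + t *\<^sub>R b)) (at t)"
proof -
  have "((\<lambda>u. f (x + (u + t) *\<^sub>R b)) has_real_derivative partial f b (x + t *\<^sub>R b)) (at 0)"
    using smooth_partial_deriv0[OF assms, of "x + t *\<^sub>R b"] by (simp add: algebra_simps)
  thus ?thesis using DERIV_shift[of "\<lambda>t. f (x + t *\<^sub>R b)" "partial f b (x + t *\<^sub>R b)" 0 t] by simp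
qed

text \<open>The products alone are not closed under derivatives, because the product rule produces
  sums. The algebra generated by the smooth functions is, and so serves as the family for sums and
  products at once.\<close>

inductive_set smooth_alg :: "('a::euclidean_space \<Rightarrow> real) set" where
  base: "smooth f \<Longrightarrow> f \<in> smooth_alg"
| add: "f \<in> smooth_alg \<Longrightarrow> g \<in> smooth_alg \<Longrightarrow> (\<lambda>x. f x + g x) \<in> smooth_alg"
| mult: "f \<in> smooth_alg \<Longrightarrow> g \<in> smooth_alg \<Longrightarrow> (\<lambda>x. f x * g x) \<in> smooth_alg"

lemma smooth_alg_smooth: assumes "f \<in> smooth_alg" shows "smooth f"
proof (rule smoothI[OF assms])
  show "continuous_on UNIV g" if "g \<in> smooth_alg" for g :: "'a \<Rightarrow> real"
    using that by induction (auto intro: continuous_on_add continuous_on_mult smooth_continuous)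
  show "\<exists>g'\<in>smooth_alg. \<forall>x. ((\<lambda>t. g (x + t *\<^sub>R b)) has_real_derivative g' x) (at 0)"
    if "g \<in> smooth_alg" "b \<in> Basis" for g and b :: 'a
    using that(1)
  proof induction
    case (base f)
    thus ?case using smooth_ex_deriv[OF base that(2)] smooth_alg.base by blast
  next
    case (add f g)
    then obtain f' g' where *: "f' \<in> smooth_alg" "g' \<in> smooth_alg"
      "\<And>x. ((\<lambda>t. f (x + t *\<^sub>R b)) has_real_derivative f' x) (at 0)"
      "\<And>x. ((\<lambda>t. g (x + t *\<^sub>R b)) has_real_derivative g' x) (at 0)" by blast
    show ?case by (rule bexI[of _ "\<lambda>x. f' x + g' x"]) (auto intro!: DERIV_add * smooth_alg.add)
  next
    case (mult f g)
    then obtain f' g' where *: "f' \<in> smooth_alg" "g' \<in> smooth_alg"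
      "\<And>x. ((\<lambda>t. f (x + t *\<^sub>R b)) has_real_derivative f' x) (at 0)"
      "\<And>x. ((\<lambda>t. g (x + t *\<^sub>R b)) has_real_derivative g' x) (at 0)" by blast
    show ?case
    proof (rule bexI[of _ "\<lambda>x. f' x * g x + g' x * f x"])
      show "\<forall>x. ((\<lambda>t. f (x + t *\<^sub>R b) * g (x + t *\<^sub>R b)) has_real_derivative f' x * g x + g' x * f x) (at 0)"
        using DERIV_mult[OF *(3) *(4)] by simp
      show "(\<lambda>x. f' x * g x + g' x * f x) \<in> smooth_alg"
        by (rule smooth_alg.add; rule smooth_alg.mult) (use * mult in auto)
    qed
  qed
qed

lemma smooth_add: "smooth f \<Longrightarrow> smooth g \<Longrightarrow> smooth (\<lambda>x. f x + g x)"
  and smooth_mult: "smooth f \<Longrightarrow> smooth g \<Longrightarrow> smooth (\<lambda>x. f x * g x)"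
  by (rule smooth_alg_smooth, rule smooth_alg.intros; rule smooth_alg.base; assumption)+

lemma smooth_const: "smooth (\<lambda>_. c)"
  by (rule smoothI[of _ "{f. \<exists>c. f = (\<lambda>_. c)}"]) (auto intro!: exI[of _ "\<lambda>_. 0"])

lemma smooth_cmult: "smooth f \<Longrightarrow> smooth (\<lambda>x. c * f x)"
  by (intro smooth_mult smooth_const)

lemma smooth_prod: "finite I \<Longrightarrow> (\<And>i. i \<in> I \<Longrightarrow> smooth (f i)) \<Longrightarrow> smooth (\<lambda>x. \<Prod>i\<in>I. f i x)"
  by (induction I rule: finite_induct) (auto intro: smooth_const smooth_mult)

lemma deriv_real_iff:
  "((\<lambda>t. f (x + t *\<^sub>R (1::real))) has_real_derivative D) (at 0) \<longleftrightarrow> (f has_real_derivative D) (at x)"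
  using DERIV_shift[of f D 0 x] by (simp add: add.commute)

lemma smooth_realI:
  fixes f :: "real \<Rightarrow> real"
  assumes "f \<in> S" "\<And>g. g \<in> S \<Longrightarrow> \<exists>g'\<in>S. \<forall>x. (g has_real_derivative g' x) (at x)"
  shows "smooth f"
proof (rule smoothI[OF assms(1)])
  fix g assume g: "g \<in> S"
  show "continuous_on UNIV g" using assms(2)[OF g] by (auto intro!: continuous_at_imp_continuous_on dest: DERIV_isCont)
  show "\<exists>g'\<in>S. \<forall>x. ((\<lambda>t. g (x + t *\<^sub>R b)) has_real_derivative g' x) (at 0)" if "b \<in> Basis" for b
    using that assms(2)[OF g] by (simp add: deriv_real_iff del: scaleR_one mult.right_neutral real_scaleR_def)
qed

lemma smooth_real_deriv: "smooth f \<Longrightarrow> (f has_real_derivative partial f 1 x) (at x)"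
  using smooth_partial_deriv0[of f 1 x] by (simp add: deriv_real_iff del: scaleR_one mult.right_neutral real_scaleR_def)

lemma smooth_affine:
  fixes g :: "real \<Rightarrow> real" and v :: "'a::euclidean_space"
  assumes "smooth g" shows "smooth (\<lambda>x. g (c + x \<bullet> v))"
proof (rule smoothI[of _ "{f. \<exists>k h. smooth h \<and> f = (\<lambda>x. k * h (c + x \<bullet> v))}"])
  show "(\<lambda>x. g (c + x \<bullet> v)) \<in> {f. \<exists>k h. smooth h \<and> f = (\<lambda>x. k * h (c + x \<bullet> v))}"
    using assms by (auto intro!: exI[of _ 1] exI[of _ g])
next
  fix f :: "'a \<Rightarrow> real" assume "f \<in> {f. \<exists>k h. smooth h \<and> f = (\<lambda>x. k * h (c + x \<bullet> v))}"
  then obtain k h where h: "smooth h" and f: "f = (\<lambda>x. k * h (c + x \<bullet> v))" by auto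
  show "continuous_on UNIV f" unfolding f
    by (intro continuous_intros continuous_on_compose2[OF smooth_continuous[OF h]]) auto
  fix b :: 'a assume "b \<in> Basis"
  have "((\<lambda>t. f (x + t *\<^sub>R b)) has_real_derivative k * (b \<bullet> v) * partial h 1 (c + x \<bullet> v)) (at 0)" for x
  proof -
    have "((\<lambda>t. c + (x + t *\<^sub>R b) \<bullet> v) has_real_derivative (b \<bullet> v)) (at 0)"
      by (auto intro!: derivative_eq_intros simp: inner_add_left)
    moreover have "(h has_real_derivative partial h 1 (c + x \<bullet> v)) (at (c + (x + 0 *\<^sub>R b) \<bullet> v))"
      using smooth_real_deriv[OF h, of "c + x \<bullet> v"] by simp
    ultimately have "((\<lambda>t. h (c + (x + t *\<^sub>R b) \<bullet> v)) has_real_derivative partial h 1 (c + x \<bullet> v) * (b \<bullet> v)) (at 0)"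
      using DERIV_chain2 by fastforce
    from DERIV_cmult[OF this, of k] show ?thesis by (simp add: f mult_ac)
  qed
  moreover have "smooth (partial h 1)" by (rule smooth_partial[OF h]) simp
  ultimately show "\<exists>g'\<in>{f. \<exists>k h. smooth h \<and> f = (\<lambda>x. k * h (c + x \<bullet> v))}.
      \<forall>x. ((\<lambda>t. f (x + t *\<^sub>R b)) has_real_derivative g' x) (at 0)"
    by (intro bexI[of _ "\<lambda>x. k * (b \<bullet> v) * partial h 1 (c + x \<bullet> v)"]) auto
qed

text \<open>A family closed under differentiation that contains the flat function exp (-1 / t),
  extended by 0, as the case p = 1. The bumps are built from this one function.\<close>

definition expinv :: "real poly \<Rightarrow> real \<Rightarrow> real" where
  "expinv p t = (if t > 0 then poly p (1 / t) * exp (- 1 / t) else 0)"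

lemma poly_exp_tendsto_0: "((\<lambda>y. poly p y * exp (- y)) \<longlongrightarrow> (0::real)) at_top"
proof -
  have "((\<lambda>y. \<Sum>i\<le>degree p. coeff p i * (y ^ i / exp y)) \<longlongrightarrow> (\<Sum>i\<le>degree p. coeff p i * 0)) at_top"
    by (intro tendsto_intros tendsto_power_div_exp_0)
  moreover have "poly p y * exp (- y) = (\<Sum>i\<le>degree p. coeff p i * (y ^ i / exp y))" for y
    by (simp add: poly_altdef sum_distrib_right exp_minus divide_inverse mult.assoc)
  ultimately show ?thesis by simp
qed

lemma expinv_tendsto_0: "(expinv p \<longlongrightarrow> 0) (at 0)"
proof -
  have "(expinv p \<longlongrightarrow> 0) (at_left 0)"
    by (rule tendsto_eventually) (auto simp: expinv_def eventually_at_filter)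
  moreover have "(expinv p \<longlongrightarrow> 0) (at_right 0)"
  proof -
    have "((\<lambda>t. poly p (inverse t) * exp (- inverse t)) \<longlongrightarrow> 0) (at_right 0)"
      by (rule filterlim_compose[OF poly_exp_tendsto_0 filterlim_inverse_at_top_right])
    thus ?thesis
      by (rule Lim_transform_eventually) (auto simp: expinv_def eventually_at_filter inverse_eq_divide)
  qed
  ultimately show ?thesis by (rule filterlim_split_at)
qed

text \<open>With y = 1 / t the chain rule gives y^2 (p y - p' y) exp (-y), and
  \<open>[:0, 0, 1:]\<close> is y^2. At 0 the difference quotient is again a member of the family,
  for the polynomial y p(y), and therefore tends to 0.\<close>

lemma expinv_deriv: "(expinv p has_real_derivative expinv ([:0, 0, 1:] * (p - pderiv p)) t) (at t)"
proof -
  consider "t > 0" | "t < 0" | "t = 0" by linarith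
  thus ?thesis
  proof cases
    case 1
    have der: "((\<lambda>t. poly p (1 / t) * exp (- 1 / t)) has_real_derivative
        expinv ([:0, 0, 1:] * (p - pderiv p)) t) (at t)"
    proof -
      have i: "((\<lambda>t. 1 / t) has_real_derivative - (1 / t\<^sup>2)) (at t)"
        using 1 by (auto intro!: derivative_eq_intros simp: power2_eq_square)
      have e: "((\<lambda>t. exp (- 1 / t)) has_real_derivative exp (- 1 / t) * (1 / t\<^sup>2)) (at t)"
        using 1 by (auto intro!: derivative_eq_intros simp: power2_eq_square)
      from DERIV_mult[OF DERIV_chain2[OF poly_DERIV i] e]
      show ?thesis by (rule DERIV_cong) (use 1 in \<open>simp add: expinv_def algebra_simps power2_eq_square\<close>)
    qed
    have ev: "\<forall>\<^sub>F s in nhds t. expinv p s = poly p (1 / s) * exp (- 1 / s)"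
      using eventually_nhds_in_open[of "{0<..}" t] 1 by (auto elim!: eventually_mono simp: expinv_def)
    show ?thesis by (rule iffD2[OF DERIV_cong_ev[OF refl ev refl] der])
  next
    case 2
    have "expinv ([:0, 0, 1:] * (p - pderiv p)) t = 0" using 2 by (simp only: expinv_def) simp
    hence der: "((\<lambda>t. 0) has_real_derivative expinv ([:0, 0, 1:] * (p - pderiv p)) t) (at t)"
      by (simp only: DERIV_const)
    have ev: "\<forall>\<^sub>F s in nhds t. expinv p s = 0"
      using eventually_nhds_in_open[of "{..<0}" t] 2 by (auto elim!: eventually_mono simp: expinv_def)
    show ?thesis by (rule iffD2[OF DERIV_cong_ev[OF refl ev refl] der])
  next
    case 3
    have "((\<lambda>h. expinv (pCons 0 p) h) \<longlongrightarrow> 0) (at 0)" by (rule expinv_tendsto_0)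
    moreover have "expinv (pCons 0 p) h = (expinv p (0 + h) - expinv p 0) / h" for h
      by (auto simp: expinv_def)
    ultimately have "(expinv p has_real_derivative 0) (at 0)" by (simp add: DERIV_def)
    thus ?thesis using 3 by (simp add: expinv_def)
  qed
qed

lemma smooth_expinv: "smooth (expinv p)"
  by (rule smooth_realI[of _ "range expinv"]) (auto intro: expinv_deriv)

lemma expinv_1_pos: "t > 0 \<Longrightarrow> expinv 1 t > 0"
  and expinv_1_nonneg: "expinv 1 t \<ge> 0"
  and expinv_1_zero: "t \<le> 0 \<Longrightarrow> expinv 1 t = 0"
  by (auto simp: expinv_def)

section \<open>Test functions and integration by parts\<close>

lemma test_fun_smooth: "test_fun f \<Longrightarrow> smooth f" by (simp add: test_fun_def)

lemma test_fun_continuous: "test_fun f \<Longrightarrow> continuous_on UNIV f" by (simp add: test_fun_def smooth_continuous)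

lemma test_fun_support:
  assumes "test_fun f" obtains R where "R > 0" "\<And>x. norm x > R \<Longrightarrow> f x = 0"
proof -
  obtain R where "R > 0" "\<And>x. f x \<noteq> 0 \<Longrightarrow> norm x \<le> R"
    using assms by (auto simp: test_fun_def bounded_pos)
  thus ?thesis by (intro that[of R]) force+
qed

lemma test_funI: "smooth f \<Longrightarrow> (\<And>x. norm x > R \<Longrightarrow> f x = 0) \<Longrightarrow> test_fun f"
  unfolding test_fun_def by (auto intro!: boundedI[of _ R] simp: not_less[symmetric])

lemma test_fun_add: "test_fun f \<Longrightarrow> test_fun g \<Longrightarrow> test_fun (\<lambda>x. f x + g x)"
proof -
  assume f: "test_fun f" and g: "test_fun g"
  have "bounded ({x. f x \<noteq> 0} \<union> {x. g x \<noteq> 0})" using f g by (simp add: test_fun_def)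
  hence "bounded {x. f x + g x \<noteq> 0}" by (rule bounded_subset) auto
  thus ?thesis using f g by (simp add: test_fun_def smooth_add)
qed

lemma test_fun_mult: "smooth f \<Longrightarrow> test_fun g \<Longrightarrow> test_fun (\<lambda>x. f x * g x)"
proof -
  assume f: "smooth f" and g: "test_fun g"
  have "bounded {x. g x \<noteq> 0}" using g by (simp add: test_fun_def)
  hence "bounded {x. f x * g x \<noteq> 0}" by (rule bounded_subset) auto
  thus ?thesis using f g by (simp add: test_fun_def smooth_mult)
qed

lemma test_fun_cmult: "test_fun g \<Longrightarrow> test_fun (\<lambda>x. c * g x)"
  by (intro test_fun_mult smooth_const)

lemma test_fun_diff: "test_fun f \<Longrightarrow> test_fun g \<Longrightarrow> test_fun (\<lambda>x. f x - g x)"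
  using test_fun_add[of f "\<lambda>x. (-1) * g x"] test_fun_cmult[of g "-1"] by simp

lemma test_fun_zero: "test_fun (\<lambda>_. 0)"
  by (rule test_funI[of _ 0]) (auto intro: smooth_const)

lemma partial_support:
  assumes "\<And>x. norm x > R \<Longrightarrow> f x = 0" "norm x > R" shows "partial f b x = 0"
proof -
  have "open {x. norm x > R}" by (simp add: open_Collect_less continuous_intros)
  hence "\<forall>\<^sub>F t in nhds 0. x + t *\<^sub>R b \<in> {x. norm x > R}"
    using assms(2) by (intro topological_tendstoD[of "\<lambda>t. x + t *\<^sub>R b" x]) (auto intro!: tendsto_eq_intros filterlim_ident)
  hence "\<forall>\<^sub>F t in nhds 0. f (x + t *\<^sub>R b) = 0"
    by eventually_elim (use assms in auto)
  hence "((\<lambda>t. f (x + t *\<^sub>R b)) has_real_derivative 0) (at 0)"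
    using DERIV_cong_ev[of 0 0 "\<lambda>t. f (x + t *\<^sub>R b)" "\<lambda>_. 0" 0 0] by simp
  thus ?thesis by (simp add: partial_def DERIV_imp_deriv)
qed

lemma test_fun_partial: assumes "test_fun f" "b \<in> Basis" shows "test_fun (partial f b)"
proof -
  obtain R where R: "\<And>x. norm x > R \<Longrightarrow> f x = 0" using test_fun_support[OF assms(1)] by metis
  show ?thesis
    by (rule test_funI[OF smooth_partial[OF test_fun_smooth]]) (use assms partial_support[OF R] in auto)
qed

lemma partial_add: "smooth f \<Longrightarrow> smooth g \<Longrightarrow> b \<in> Basis \<Longrightarrow> partial (\<lambda>x. f x + g x) b = (\<lambda>x. partial f b x + partial g b x)"
  by (intro partial_eq DERIV_add smooth_partial_deriv0)

lemma partial_mult: "smooth f \<Longrightarrow> smooth g \<Longrightarrow> b \<in> Basis \<Longrightarrow> partial (\<lambda>x. f x * g x) b = (\<lambda>x. partial f b x * g x + partial g b x * f x)"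
  using DERIV_mult[OF smooth_partial_deriv0[of f b] smooth_partial_deriv0[of g b]] by (intro partial_eq) simp

lemma partial_cmult: "smooth f \<Longrightarrow> b \<in> Basis \<Longrightarrow> partial (\<lambda>x. c * f x) b = (\<lambda>x. c * partial f b x)"
  by (intro partial_eq DERIV_cmult smooth_partial_deriv0)

lemma cc_integrable:
  fixes f :: "'a::euclidean_space \<Rightarrow> 'b::{banach, second_countable_topology}"
  assumes "continuous_on UNIV f" "\<And>x. norm x > R \<Longrightarrow> f x = 0"
  shows "integrable lborel f" "integrable lebesgue f" "integral\<^sup>L lebesgue f = integral\<^sup>L lborel f"
proof -
  have "integrable lborel (\<lambda>x. indicator (cball 0 R) x *\<^sub>R f x)"
    by (rule borel_integrable_compact) (auto intro: continuous_on_subset[OF assms(1)])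
  also have "(\<lambda>x. indicator (cball 0 R) x *\<^sub>R f x) = f"
    using assms(2) by (auto simp: fun_eq_iff indicator_def not_le)
  finally show "integrable lborel f" .
  moreover have m: "f \<in> borel_measurable lborel"
    using borel_measurable_continuous_onI[OF assms(1)] by simp
  ultimately show "integrable lebesgue f" by (simp add: integrable_completion)
  show "integral\<^sup>L lebesgue f = integral\<^sup>L lborel f" by (rule integral_completion[OF m])
qed

lemma test_fun_integrable: assumes "test_fun f" shows "integrable lebesgue f"
  using test_fun_support[OF assms] cc_integrable(2)[OF test_fun_continuous[OF assms]] by metis

lemma cc_bounded:
  fixes f :: "'a::euclidean_space \<Rightarrow> real"
  assumes "continuous_on UNIV f" "\<And>x. norm x > R \<Longrightarrow> f x = 0"
  obtains B where "B > 0" "\<And>x. \<bar>f x\<bar> \<le> B"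
proof -
  have "bounded (f ` cball 0 R)"
    by (intro compact_imp_bounded compact_continuous_image continuous_on_subset[OF assms(1)]) auto
  then obtain B where B: "B > 0" "\<And>x. x \<in> cball 0 R \<Longrightarrow> \<bar>f x\<bar> \<le> B" by (auto simp: bounded_pos)
  have "\<bar>f x\<bar> \<le> B" for x
    using B assms(2)[of x] by (cases "norm x \<le> R") auto
  thus ?thesis using B that by blast
qed

lemma test_fun_bounded: assumes "test_fun f" obtains B where "B > 0" "\<And>x. \<bar>f x\<bar> \<le> B"
  using test_fun_support[OF assms] cc_bounded[OF test_fun_continuous[OF assms]] by metis

lemma test_fun_L2: assumes "test_fun f" shows "L2 (cr f)"
proof -
  obtain R where R: "\<And>x. norm x > R \<Longrightarrow> f x = 0" using test_fun_support[OF assms] by metis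
  have "integrable lebesgue (\<lambda>x. (f x)\<^sup>2)"
    by (rule cc_integrable(2)[OF continuous_on_power[OF test_fun_continuous[OF assms]]]) (use R in auto)
  moreover have "f \<in> borel_measurable lebesgue" using test_fun_integrable[OF assms] by auto
  ultimately show ?thesis by (auto simp: L2_def)
qed

lemma integral_translate_lborel:
  fixes f :: "'a::euclidean_space \<Rightarrow> 'b::{banach, second_countable_topology}"
  assumes "f \<in> borel_measurable borel"
  shows "(LBINT x. f (c + x)) = (LBINT x. f x)"
  using integral_distr[of "(+) c" lborel borel f] assms by (simp add: lborel_distr_plus)

text \<open>Difference quotients have integral 0 by translation invariance. The mean value theorem
  bounds them uniformly on a fixed ball, so dominated convergence passes to the derivative.\<close>

lemma integral_partial_0:
  fixes f :: "'a::euclidean_space \<Rightarrow> real"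
  assumes "test_fun f" "b \<in> Basis" shows "integral\<^sup>L lebesgue (partial f b) = 0"
proof -
  note sm = test_fun_smooth[OF assms(1)]
  obtain R where R: "R > 0" "\<And>x. norm x > R \<Longrightarrow> f x = 0" using test_fun_support[OF assms(1)] by metis
  obtain B where B: "B > 0" "\<And>x. \<bar>partial f b x\<bar> \<le> B"
    using test_fun_bounded[OF test_fun_partial[OF assms]] by metis
  have nb: "norm b = 1" using assms(2) by simp
  define D where "D n x = (f (inverse (Suc n) *\<^sub>R b + x) - f x) / inverse (real (Suc n))" for n x
  have cf: "continuous_on UNIV (\<lambda>x. f (c + x))" for c
    by (intro continuous_on_compose2[OF smooth_continuous[OF sm]] continuous_intros) auto
  have mf: "(\<lambda>x. f (c + x)) \<in> borel_measurable borel" for c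
    using borel_measurable_continuous_onI[OF cf] .
  have mf0: "f \<in> borel_measurable borel" using mf[of 0] by simp
  have int0: "integral\<^sup>L lborel (D n) = 0" for n
  proof -
    have i1: "integrable lborel f" by (rule cc_integrable(1)[OF smooth_continuous[OF sm]]) (use R in auto)
    have i2: "integrable lborel (\<lambda>x. f (inverse (Suc n) *\<^sub>R b + x))"
    proof (rule cc_integrable(1)[OF cf, where R = "R + 1"])
      fix x :: 'a assume "norm x > R + 1"
      moreover have "norm x \<le> norm (inverse (Suc n) *\<^sub>R b + x) + norm (inverse (Suc n) *\<^sub>R b)"
        by (metis add.commute add_diff_cancel norm_triangle_ineq4)
      moreover have "norm (inverse (Suc n) *\<^sub>R b) \<le> 1" using nb by (simp add: inverse_le_1_iff)
      ultimately show "f (inverse (Suc n) *\<^sub>R b + x) = 0" by (intro R(2)) linarith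
    qed
    show ?thesis unfolding D_def using i1 i2 integral_translate_lborel[OF mf0, of "inverse (Suc n) *\<^sub>R b"] by simp
  qed
  have "(\<lambda>n. integral\<^sup>L lborel (D n)) \<longlonglongrightarrow> integral\<^sup>L lborel (partial f b)"
  proof (rule integral_dominated_convergence[where w = "\<lambda>x. indicator (cball 0 (R + 1)) x * B"])
    show "D n \<in> borel_measurable lborel" for n unfolding D_def using mf mf0 by measurable
    show "partial f b \<in> borel_measurable lborel"
      using borel_measurable_continuous_onI[OF smooth_continuous[OF smooth_partial[OF sm assms(2)]]] by simp
    show "integrable lborel (\<lambda>x. indicator (cball 0 (R + 1)) x * B)"
      by (intro integrable_mult_left integrable_real_indicator) (auto simp: emeasure_bounded_finite[OF bounded_cball, unfolded infinity_ennreal_def])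
    show "AE x in lborel. (\<lambda>n. D n x) \<longlonglongrightarrow> partial f b x"
    proof (rule AE_I2)
      fix x
      have "((\<lambda>h. (f (x + h *\<^sub>R b) - f x) / h) \<longlongrightarrow> partial f b x) (at 0)"
        using smooth_partial_deriv0[OF sm assms(2), of x] by (simp add: DERIV_def)
      hence "(\<lambda>n. (f (x + inverse (real (Suc n)) *\<^sub>R b) - f x) / inverse (real (Suc n))) \<longlonglongrightarrow> partial f b x"
        by (rule filterlim_compose) (use LIMSEQ_inverse_real_of_nat in \<open>auto simp: filterlim_at\<close>)
      thus "(\<lambda>n. D n x) \<longlonglongrightarrow> partial f b x" by (simp add: D_def add.commute)
    qed
    show "AE x in lborel. norm (D n x) \<le> indicator (cball 0 (R + 1)) x * B" for n
    proof (rule AE_I2)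
      fix x
      let ?h = "inverse (real (Suc n))"
      have h: "?h > 0" "?h \<le> 1" by (auto simp: inverse_le_1_iff)
      show "norm (D n x) \<le> indicator (cball 0 (R + 1)) x * B"
      proof (cases "norm x \<le> R + 1")
        case True
        obtain z where z: "0 < z" "z < ?h" "f (x + ?h *\<^sub>R b) - f (x + 0 *\<^sub>R b) = (?h - 0) * partial f b (x + z *\<^sub>R b)"
          using MVT2[of 0 ?h "\<lambda>t. f (x + t *\<^sub>R b)" "\<lambda>t. partial f b (x + t *\<^sub>R b)"] smooth_partial_deriv[OF sm assms(2)] h
          by metis
        have "D n x = (?h * partial f b (x + z *\<^sub>R b)) / ?h"
          using z(3) unfolding D_def by (simp only: add.commute[of x] scaleR_zero_left add_0 diff_0_right)
        hence "D n x = partial f b (x + z *\<^sub>R b)" using h by simp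
        thus ?thesis using True B by simp
      next
        case False
        have "norm x \<le> norm (?h *\<^sub>R b + x) + norm (?h *\<^sub>R b)"
          by (metis add.commute add_diff_cancel norm_triangle_ineq4)
        moreover have "norm (?h *\<^sub>R b) \<le> 1" using nb h by simp
        ultimately have "f (?h *\<^sub>R b + x) = 0" "f x = 0" using False by (auto intro!: R(2))
        thus ?thesis using False by (simp add: D_def)
      qed
    qed
  qed
  hence "integral\<^sup>L lborel (partial f b) = 0" using int0 by (simp add: LIMSEQ_const_iff)
  moreover have "partial f b \<in> borel_measurable lborel"
    using borel_measurable_continuous_onI[OF smooth_continuous[OF smooth_partial[OF sm assms(2)]]] by simp
  ultimately show ?thesis by (simp add: integral_completion)
qed

lemma integral_by_parts_test:
  fixes f g :: "'a::euclidean_space \<Rightarrow> real"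
  assumes "smooth f" "test_fun g" "b \<in> Basis"
  shows "integral\<^sup>L lebesgue (\<lambda>x. f x * partial g b x) = - integral\<^sup>L lebesgue (\<lambda>x. partial f b x * g x)"
proof -
  note g = test_fun_smooth[OF assms(2)]
  have i1: "integrable lebesgue (\<lambda>x. f x * partial g b x)"
    by (rule test_fun_integrable[OF test_fun_mult[OF assms(1) test_fun_partial[OF assms(2,3)]]])
  have i2: "integrable lebesgue (\<lambda>x. partial f b x * g x)"
    by (rule test_fun_integrable[OF test_fun_mult[OF smooth_partial[OF assms(1,3)] assms(2)]])
  have "0 = integral\<^sup>L lebesgue (partial (\<lambda>x. f x * g x) b)"
    by (rule integral_partial_0[OF test_fun_mult assms(3), symmetric]) (use assms in auto)
  also have "\<dots> = integral\<^sup>L lebesgue (\<lambda>x. partial f b x * g x + f x * partial g b x)"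
    by (simp add: partial_mult[OF assms(1) g assms(3)] mult.commute)
  finally show ?thesis using i1 i2 by simp
qed

text \<open>Positive exactly where all coordinates are smaller than d in modulus. The second factor
  uses \<open>- b\<close> rather than a minus sign in front of the product, so that
  \<open>smooth_affine\<close> covers both factors.\<close>

definition bump :: "real \<Rightarrow> 'a::euclidean_space \<Rightarrow> real" where
  "bump d x = (\<Prod>b\<in>Basis. expinv 1 (d + x \<bullet> b) * expinv 1 (d + x \<bullet> (- b)))"

lemma smooth_bump: "smooth (bump d)"
  unfolding bump_def[abs_def] by (intro smooth_prod smooth_mult smooth_affine smooth_expinv) auto

lemma bump_nonneg: "bump d x \<ge> 0"
  unfolding bump_def by (intro prod_nonneg mult_nonneg_nonneg expinv_1_nonneg)

lemma bump_zero: fixes d :: real assumes "norm (x :: 'a::euclidean_space) > d * DIM('a)" shows "bump d x = 0"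
proof -
  have "\<exists>b\<in>Basis. \<bar>x \<bullet> b\<bar> > d"
  proof (rule ccontr)
    assume "\<not> ?thesis"
    hence "(\<Sum>b\<in>Basis. \<bar>x \<bullet> b\<bar>) \<le> (\<Sum>b\<in>(Basis::'a set). d)" by (intro sum_mono) auto
    thus False using norm_le_l1[of x] assms by (simp add: mult.commute)
  qed
  then obtain b where b: "b \<in> Basis" "\<bar>x \<bullet> b\<bar> > d" by blast
  hence "expinv 1 (d + x \<bullet> b) * expinv 1 (d + x \<bullet> (- b)) = 0"
    using expinv_1_zero[of "d + x \<bullet> b"] expinv_1_zero[of "d + x \<bullet> (- b)"] by (auto simp: abs_if split: if_splits)
  thus ?thesis unfolding bump_def using b(1) by (intro prod_zero) auto
qed

lemma test_fun_bump: "test_fun (bump d)"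
  by (rule test_funI[OF smooth_bump bump_zero])

lemma integral_bump_pos: assumes "d > 0" shows "integral\<^sup>L lebesgue (bump d :: 'a::euclidean_space \<Rightarrow> real) > 0"
proof (rule ccontr)
  let ?f = "bump d :: 'a \<Rightarrow> real"
  have int: "integrable lebesgue ?f" by (rule test_fun_integrable[OF test_fun_bump])
  assume "\<not> ?thesis"
  moreover have "integral\<^sup>L lebesgue ?f \<ge> 0" by (intro integral_nonneg_AE) (simp add: bump_nonneg)
  ultimately have "AE x in lebesgue. ?f x = 0"
    using integral_nonneg_eq_0_iff_AE[OF int] by (simp add: bump_nonneg)
  hence "negligible {x. ?f x \<noteq> 0}"
    by (simp add: negligible_iff_null_sets AE_iff_null_sets eventually_ae_filter)
      (metis (no_types, lifting) completion.complete2 mem_Collect_eq subsetI)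
  moreover have "open {x. ?f x \<noteq> 0}"
    by (intro open_Collect_neq smooth_continuous smooth_bump continuous_on_const)
  moreover have "0 \<in> {x. ?f x \<noteq> 0}"
    using assms expinv_1_pos[OF assms] by (simp add: bump_def)
  ultimately show False using open_not_negligible by blast
qed

text \<open>The bump parameter is divided by the dimension so that the supporting cube lies in the
  ball of radius d.\<close>

definition moll :: "real \<Rightarrow> 'a::euclidean_space \<Rightarrow> real" where
  "moll d x = (1 / integral\<^sup>L lebesgue (bump (d / DIM('a)) :: 'a \<Rightarrow> real)) * bump (d / DIM('a)) x"

lemma test_fun_moll: "test_fun (moll d)"
  unfolding moll_def[abs_def] by (intro test_fun_cmult test_fun_bump)

lemma moll_support: "norm x > d \<Longrightarrow> moll d x = 0"
  by (simp add: moll_def bump_zero)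

lemma moll_nonneg: "moll d x \<ge> 0"
  by (simp add: moll_def bump_nonneg integral_nonneg_AE)

lemma integral_moll: assumes "d > 0" shows "integral\<^sup>L lebesgue (moll d :: 'a::euclidean_space \<Rightarrow> real) = 1"
  using integral_bump_pos[where 'a = 'a, of "d / DIM('a)"] assms unfolding moll_def[abs_def] by simp

section \<open>Convolution\<close>

lemma lebesgue_translate:
  fixes c :: "'a::euclidean_space"
  shows lebesgue_translate_measurable: "(+) c \<in> lebesgue \<rightarrow>\<^sub>M lebesgue"
    and lebesgue_translate_distr: "distr lebesgue lebesgue ((+) c) = lebesgue"
proof -
  have T: "(\<lambda>x. c + (\<Sum>j\<in>Basis. (1 * (x \<bullet> j)) *\<^sub>R j)) = (+) c"
    by (simp add: fun_eq_iff euclidean_representation)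
  show "(+) c \<in> lebesgue \<rightarrow>\<^sub>M lebesgue"
    using lebesgue_affine_measurable[of "\<lambda>_. 1" c] unfolding T by simp
  show "distr lebesgue lebesgue ((+) c) = lebesgue"
    using lebesgue_affine_euclidean[of "\<lambda>_. 1" c] unfolding T by (simp add: density_1)
qed

lemma integral_translate_lebesgue:
  fixes f :: "'a::euclidean_space \<Rightarrow> 'b::{banach, second_countable_topology}"
  assumes "f \<in> borel_measurable lebesgue"
  shows "(LEBINT x. f (c + x)) = (LEBINT x. f x)"
  using integral_distr[OF lebesgue_translate_measurable assms, of c] by (simp add: lebesgue_translate_distr)

lemma integrable_translate_lebesgue:
  fixes f :: "'a::euclidean_space \<Rightarrow> 'b::{banach, second_countable_topology}"
  assumes "integrable lebesgue f"
  shows "integrable lebesgue (\<lambda>x. f (c + x))"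
  using integrable_distr[OF lebesgue_translate_measurable, of c f] assms by (simp add: lebesgue_translate_distr)

lemma L2_translate:
  fixes f :: "'a::euclidean_space \<Rightarrow> complex"
  assumes "L2 f" shows "L2 (\<lambda>x. f (c + x))" "norm_L2 (\<lambda>x. f (c + x)) = norm_L2 f"
proof -
  show "L2 (\<lambda>x. f (c + x))"
    using assms integrable_translate_lebesgue[of "\<lambda>x. (cmod (f x))\<^sup>2" c] measurable_compose[OF lebesgue_translate_measurable, of f borel c]
    by (auto simp: L2_def)
  have "(LEBINT x. (cmod (f (c + x)))\<^sup>2) = (LEBINT x. (cmod (f x))\<^sup>2)"
    by (rule integral_translate_lebesgue) (use assms in \<open>auto simp: L2_def\<close>)
  thus "norm_L2 (\<lambda>x. f (c + x)) = norm_L2 f" by (simp add: norm_L2_def)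
qed

section \<open>Continuity of translations in L2\<close>

definition transl_cont :: "('a::euclidean_space \<Rightarrow> complex) \<Rightarrow> bool" where
  "transl_cont f \<longleftrightarrow> (\<forall>e>0. \<exists>d>0. \<forall>y. norm y < d \<longrightarrow> norm_L2 (\<lambda>x. f (y + x) - f x) < e)"

lemma transl_cont_add:
  assumes f: "L2 f" "transl_cont f" and g: "L2 g" "transl_cont g"
  shows "transl_cont (\<lambda>x. f x + g x)"
  unfolding transl_cont_def
proof (intro allI impI)
  fix e :: real assume "e > 0"
  hence "e / 2 > 0" by simp
  then obtain d1 d2 where d: "d1 > 0" "\<And>y. norm y < d1 \<Longrightarrow> norm_L2 (\<lambda>x. f (y + x) - f x) < e / 2"
    "d2 > 0" "\<And>y. norm y < d2 \<Longrightarrow> norm_L2 (\<lambda>x. g (y + x) - g x) < e / 2"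
    using f(2) g(2) unfolding transl_cont_def by metis
  have "norm_L2 (\<lambda>x. (f (y + x) + g (y + x)) - (f x + g x)) < e" if "norm y < min d1 d2" for y
  proof -
    have "norm_L2 (\<lambda>x. (f (y + x) - f x) + (g (y + x) - g x)) \<le> norm_L2 (\<lambda>x. f (y + x) - f x) + norm_L2 (\<lambda>x. g (y + x) - g x)"
      by (intro norm_L2_triangle L2_diff L2_translate f g)
    thus ?thesis using d(2)[of y] d(4)[of y] that by (simp add: algebra_simps)
  qed
  thus "\<exists>d>0. \<forall>y. norm y < d \<longrightarrow> norm_L2 (\<lambda>x. (f (y + x) + g (y + x)) - (f x + g x)) < e"
    using d by (intro exI[of _ "min d1 d2"]) auto
qed

lemma transl_cont_scale: assumes "transl_cont f" shows "transl_cont (\<lambda>x. c * f x)"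
  unfolding transl_cont_def
proof (intro allI impI)
  fix e :: real assume "e > 0"
  hence "e / (cmod c + 1) > 0" by (simp add: add_nonneg_pos)
  then obtain d where d: "d > 0" "\<And>y. norm y < d \<Longrightarrow> norm_L2 (\<lambda>x. f (y + x) - f x) < e / (cmod c + 1)"
    using assms unfolding transl_cont_def by metis
  have "norm_L2 (\<lambda>x. c * f (y + x) - c * f x) < e" if "norm y < d" for y
  proof -
    have "norm_L2 (\<lambda>x. c * f (y + x) - c * f x) = cmod c * norm_L2 (\<lambda>x. f (y + x) - f x)"
      using norm_L2_scale[of c "\<lambda>x. f (y + x) - f x"] by (simp add: right_diff_distrib)
    also have "\<dots> \<le> (cmod c + 1) * norm_L2 (\<lambda>x. f (y + x) - f x)" by (simp add: mult_right_mono)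
    also have "\<dots> < e" using d(2)[OF that] by (simp add: pos_less_divide_eq add_nonneg_pos mult.commute)
    finally show ?thesis .
  qed
  thus "\<exists>d>0. \<forall>y. norm y < d \<longrightarrow> norm_L2 (\<lambda>x. c * f (y + x) - c * f x) < e" using d by blast
qed

lemma transl_cont_lim:
  assumes g: "\<And>n. L2 (g n)" "\<And>n. transl_cont (g n)" and f: "L2 f" and lim: "L2_lim g f"
  shows "transl_cont f"
  unfolding transl_cont_def
proof (intro allI impI)
  fix e :: real assume "e > 0"
  hence e3: "e / 3 > 0" by simp
  obtain n where n: "norm_L2 (\<lambda>x. g n x - f x) < e / 3"
    using order_tendstoD(2)[OF lim e3] by (auto simp: eventually_sequentially)
  obtain d where d: "d > 0" "\<And>y. norm y < d \<Longrightarrow> norm_L2 (\<lambda>x. g n (y + x) - g n x) < e / 3"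
    using g(2)[of n] e3 unfolding transl_cont_def by metis
  have "norm_L2 (\<lambda>x. f (y + x) - f x) < e" if y: "norm y < d" for y
  proof -
    note L = f g(1)[of n] L2_translate(1)[OF f, of y] L2_translate(1)[OF g(1)[of n], of y]
    have "norm_L2 (\<lambda>x. f (y + x) - f x) \<le> norm_L2 (\<lambda>x. f (y + x) - g n (y + x)) + norm_L2 (\<lambda>x. g n (y + x) - f x)"
      by (rule norm_L2_triangle3) (use L in auto)
    also have "norm_L2 (\<lambda>x. g n (y + x) - f x) \<le> norm_L2 (\<lambda>x. g n (y + x) - g n x) + norm_L2 (\<lambda>x. g n x - f x)"
      by (rule norm_L2_triangle3) (use L in auto)
    also have "norm_L2 (\<lambda>x. f (y + x) - g n (y + x)) = norm_L2 (\<lambda>x. g n x - f x)"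
      using L2_translate(2)[OF L2_diff[OF f g(1)[of n]], of y] norm_L2_commute[of f "g n"] by simp
    finally show ?thesis using n d(2)[OF y] by linarith
  qed
  thus "\<exists>d>0. \<forall>y. norm y < d \<longrightarrow> norm_L2 (\<lambda>x. f (y + x) - f x) < e" using d by blast
qed

lemma L2_indicator:
  assumes "A \<in> sets lebesgue" "bounded (A :: 'a::euclidean_space set)"
  shows "L2 (\<lambda>x. indicator A x :: complex)"
proof (rule L2_I_bound)
  have "integrable lebesgue (indicator A :: 'a \<Rightarrow> real)"
  proof (rule integrable_real_indicator[OF assms(1)])
    have "A \<in> lmeasurable" using assms by (simp add: bounded_set_imp_lmeasurable)
    thus "emeasure lebesgue A < \<infinity>" unfolding fmeasurable_def by blast
  qed
  thus "integrable lebesgue (indicator A :: 'a \<Rightarrow> real)" .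
qed (use assms in \<open>auto simp: indicator_def\<close>)

text \<open>Enclose A between a compact K and an open U up to measure r. A shift shorter than the
  distance from K to the complement of U keeps K inside U, so the shifted and the original indicator
  differ only on A - K, on U - A, and on the shifts of these sets.\<close>

lemma transl_cont_indicator:
  assumes A: "A \<in> sets lebesgue" "bounded (A :: 'a::euclidean_space set)"
  shows "transl_cont (\<lambda>x. indicator A x :: complex)"
  unfolding transl_cont_def
proof (intro allI impI)
  fix e :: real assume "e > 0"
  \<comment> \<open>The square of the norm is below 4 r, the integral of h and of its translate,
    each at most 2 r; with this r it is half of e^2.\<close>
  define r where "r = e\<^sup>2 / 8"
  have r: "r > 0" using \<open>e > 0\<close> by (simp add: r_def)
  obtain K where K: "closed K" "K \<subseteq> A" "A - K \<in> lmeasurable" "emeasure lebesgue (A - K) < ennreal r"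
    using sets_lebesgue_inner_closed[OF A(1) r] by blast
  obtain U where U: "open U" "A \<subseteq> U" "U - A \<in> lmeasurable" "emeasure lebesgue (U - A) < ennreal r"
    using sets_lebesgue_outer_open[OF A(1) r] by blast
  have "compact K" using K A(2) by (meson bounded_subset compact_eq_bounded_closed)
  then obtain d where d: "d > 0" "(\<Union>x\<in>K. ball x d) \<subseteq> U"
    using compact_subset_open_imp_ball_epsilon_subset[of K U] K U by blast
  have m: "measure lebesgue (A - K) < r" "measure lebesgue (U - A) < r"
    using K(3,4) U(3,4) r by (auto simp: emeasure_eq_measure2 ennreal_less_iff)
  define h where "h x = indicator (A - K) x + (indicator (U - A) x :: real)" for x
  have hi: "integrable lebesgue h" "integral\<^sup>L lebesgue h \<le> 2 * r"
    using K U m unfolding h_def[abs_def] by (auto simp: fmeasurable_def)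
  have "norm_L2 (\<lambda>x. indicator A (y + x) - indicator A x) < e" if y: "norm y < d" for y
  proof -
    have pt: "(cmod (indicator A (y + x) - indicator A x))\<^sup>2 \<le> h (y + x) + h x" for x
    proof (cases "y + x \<in> A \<longleftrightarrow> x \<in> A")
      case True
      thus ?thesis by (auto simp: h_def indicator_def)
    next
      case False
      have "dist (y + x) x < d" "dist x (y + x) < d" using y by (simp_all add: dist_norm)
      hence "y + x \<in> K \<Longrightarrow> x \<in> U" "x \<in> K \<Longrightarrow> y + x \<in> U" using d(2) by (auto simp: ball_def)
      thus ?thesis using False by (auto simp: h_def indicator_def)
    qed
    have hi2: "integrable lebesgue (\<lambda>x. h (y + x))" by (rule integrable_translate_lebesgue[OF hi(1)])
    have "(norm_L2 (\<lambda>x. indicator A (y + x) - indicator A x))\<^sup>2 \<le> (LEBINT x. h (y + x) + h x)"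
      unfolding norm_L2_sq
    proof (rule integral_mono)
      show "integrable lebesgue (\<lambda>x. (cmod (indicator A (y + x) - indicator A x))\<^sup>2)"
        using L2_integrable[OF L2_diff[OF L2_translate(1)[OF L2_indicator[OF A]] L2_indicator[OF A]]] .
    qed (use hi hi2 pt in auto)
    also have "\<dots> = integral\<^sup>L lebesgue h + integral\<^sup>L lebesgue h"
      using hi hi2 integral_translate_lebesgue[of h y] by auto
    also have "\<dots> \<le> 4 * r" using hi(2) by simp
    also have "\<dots> < e\<^sup>2" using \<open>e > 0\<close> by (simp add: r_def)
    finally show ?thesis using \<open>e > 0\<close> by (simp add: power2_less_imp_less)
  qed
  thus "\<exists>d>0. \<forall>y. norm y < d \<longrightarrow> norm_L2 (\<lambda>x. indicator A (y + x) - indicator A x) < e" using d by blast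
qed

lemma transl_cont_sum:
  assumes "finite I" "\<And>i. i \<in> I \<Longrightarrow> L2 (f i) \<and> transl_cont (f i)"
  shows "L2 (\<lambda>x. \<Sum>i\<in>I. f i x) \<and> transl_cont (\<lambda>x. \<Sum>i\<in>I. f i x)"
  using assms
proof (induction I rule: finite_induct)
  case empty
  have "norm_L2 (\<lambda>x::'b. 0) = 0" by (simp add: norm_L2_def)
  thus ?case by (auto simp: L2_zero transl_cont_def intro!: exI[of _ 1])
next
  case (insert i I)
  thus ?case by (auto intro!: L2_add transl_cont_add)
qed

text \<open>The property passes to linear combinations and to L2 limits, so indicators of bounded
  sets suffice: simple functions dominated by 2 |f| and cut off to balls of radius n converge to
  f.\<close>

lemma L2_transl_cont:
  fixes f :: "'a::euclidean_space \<Rightarrow> complex"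
  assumes f: "L2 f" shows "transl_cont f"
proof -
  obtain s where s: "\<And>i. simple_function lebesgue (s i)" "\<And>x. (\<lambda>i. s i x) \<longlonglongrightarrow> f x"
    "\<And>i x. dist (s i x) 0 \<le> 2 * dist (f x) 0"
    using borel_measurable_implies_sequence_metric[OF L2_measurable[OF f], of 0] by auto
  define g where "g n x = indicator (cball 0 (real n)) x * s n x" for n x
  have gsum: "g n = (\<lambda>x. \<Sum>z\<in>range (s n). z * indicator (cball 0 (real n) \<inter> s n -` {z}) x)" for n
  proof
    fix x
    have "finite (range (s n))" using s(1)[of n] by (simp add: simple_function_def)
    hence "(\<Sum>z\<in>range (s n). z * indicator (cball 0 (real n) \<inter> s n -` {z}) x)
      = (\<Sum>z\<in>range (s n). if z = s n x then s n x * indicator (cball 0 (real n)) x else 0)"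
      by (intro sum.cong) (auto simp: indicator_def)
    also have "\<dots> = s n x * indicator (cball 0 (real n)) x"
      using \<open>finite (range (s n))\<close> by (simp add: sum.delta)
    finally show "g n x = (\<Sum>z\<in>range (s n). z * indicator (cball 0 (real n) \<inter> s n -` {z}) x)"
      by (simp add: g_def)
  qed
  have "L2 (g n) \<and> transl_cont (g n)" for n
    unfolding gsum
  proof (rule transl_cont_sum)
    show "finite (range (s n))" using s(1)[of n] by (simp add: simple_function_def)
    fix z
    have "s n -` {z} \<inter> space lebesgue \<in> sets lebesgue" by (rule simple_functionD[OF s(1)])
    hence "cball 0 (real n) \<inter> s n -` {z} \<in> sets lebesgue" by auto
    moreover have "bounded (cball 0 (real n) \<inter> s n -` {z})" by (rule bounded_subset[OF bounded_cball]) auto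
    ultimately show "L2 (\<lambda>x. z * indicator (cball 0 (real n) \<inter> s n -` {z}) x) \<and> transl_cont (\<lambda>x. z * indicator (cball 0 (real n) \<inter> s n -` {z}) x)"
      by (intro conjI L2_scale transl_cont_scale L2_indicator transl_cont_indicator)
  qed
  hence g: "L2 (g n)" "transl_cont (g n)" for n by auto
  have "L2_lim g f"
  proof (rule L2_tendsto_dominated[where g = "\<lambda>x. 3 * f x"])
    show "AE x in lebesgue. (\<lambda>n. g n x) \<longlonglongrightarrow> f x"
    proof (rule AE_I2)
      fix x :: 'a
      obtain N :: nat where "norm x \<le> real N" using real_arch_simple by blast
      hence "\<forall>\<^sub>F n in sequentially. s n x = g n x"
        unfolding eventually_sequentially by (intro exI[of _ N]) (auto simp: g_def indicator_def)
      thus "(\<lambda>n. g n x) \<longlonglongrightarrow> f x" by (rule Lim_transform_eventually[OF s(2)])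
    qed
    show "cmod (g n x - f x) \<le> cmod (3 * f x)" for n x
    proof -
      have "cmod (g n x) \<le> 2 * cmod (f x)"
        using s(3)[of n x] by (auto simp: g_def indicator_def dist_norm)
      thus ?thesis using norm_triangle_ineq4[of "g n x" "f x"] by (simp add: norm_mult)
    qed
  qed (use g f in \<open>auto intro: L2_measurable L2_scale\<close>)
  thus ?thesis by (rule transl_cont_lim[OF g f])
qed

text \<open>Exchanging integrals needs joint measurability of g (z + x), which a Borel function
  provides; hence a Lebesgue measurable f is first replaced by a Borel function that agrees with it
  almost everywhere.\<close>

lemma L2_borel_version:
  fixes f :: "'a::euclidean_space \<Rightarrow> complex"
  assumes "L2 f"
  obtains g where "g \<in> borel_measurable borel" "AE x in lebesgue. f x = g x" "L2 g"
proof -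
  have "(\<lambda>x. Re (f x)) \<in> borel_measurable lebesgue" "(\<lambda>x. Im (f x)) \<in> borel_measurable lebesgue"
    using L2_measurable[OF assms] by measurable
  then obtain u v where u: "u \<in> borel_measurable lborel" "AE x in lborel. Re (f x) = u x"
    and v: "v \<in> borel_measurable lborel" "AE x in lborel. Im (f x) = v x"
    using completion_ex_borel_measurable_real by metis
  define g where "g x = Complex (u x) (v x)" for x
  have "g = (\<lambda>x. cr u x + \<i> * cr v x)"
    by (simp add: g_def fun_eq_iff complex_eq_iff)
  hence g: "g \<in> borel_measurable borel" using u(1) v(1) by simp
  have "AE x in lborel. f x = g x" using u(2) v(2) by eventually_elim (simp add: g_def complex_eq_iff)
  hence ae: "AE x in lebesgue. f x = g x" by (rule AE_completion)
  have gm: "g \<in> borel_measurable lebesgue" using g by (simp add: measurable_completion)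
  have "integrable lebesgue (\<lambda>x. (cmod (g x))\<^sup>2)"
    by (rule integrable_cong_AE_imp[OF L2_integrable[OF assms]]) (use ae gm in \<open>auto elim: eventually_mono\<close>)
  hence "L2 g" using gm by (simp add: L2_def)
  with g ae that show ?thesis by blast
qed

section \<open>Convolution with test functions\<close>

definition conv :: "('a::euclidean_space \<Rightarrow> real) \<Rightarrow> ('a \<Rightarrow> complex) \<Rightarrow> 'a \<Rightarrow> complex" where
  "conv \<eta> f x = integral\<^sup>L lebesgue (\<lambda>y. f y * complex_of_real (\<eta> (x - y)))"

lemma smooth_reflect:
  fixes h :: "'a::euclidean_space \<Rightarrow> real"
  assumes "smooth h" shows "smooth (\<lambda>y. h (x - y))"
    and "b \<in> Basis \<Longrightarrow> partial (\<lambda>y. h (x - y)) b = (\<lambda>y. - partial h b (x - y))"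
proof -
  have der: "((\<lambda>t. k * h (x - (y + t *\<^sub>R b))) has_real_derivative (- k) * partial h b (x - y)) (at 0)"
    if "smooth h" "b \<in> Basis" for k h y b
  proof -
    have "((\<lambda>t. h ((x - y) + t *\<^sub>R b)) has_real_derivative partial h b (x - y)) (at (- 0))"
      using smooth_partial_deriv0[OF that, of "x - y"] by simp
    hence "((\<lambda>t. h ((x - y) + (- t) *\<^sub>R b)) has_real_derivative - partial h b (x - y)) (at 0)"
      using DERIV_mirror[of "\<lambda>t. h ((x - y) + t *\<^sub>R b)"] by fastforce
    from DERIV_cmult[OF this, of k] show ?thesis by (simp add: algebra_simps)
  qed
  show "smooth (\<lambda>y. h (x - y))"
  proof (rule smoothI[of _ "{f. \<exists>k h. smooth h \<and> f = (\<lambda>y. k * h (x - y))}"])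
    show "(\<lambda>y. h (x - y)) \<in> {f. \<exists>k h. smooth h \<and> f = (\<lambda>y. k * h (x - y))}"
      using assms by (auto intro!: exI[of _ 1] exI[of _ h])
  next
    fix f :: "'a \<Rightarrow> real" assume "f \<in> {f. \<exists>k h. smooth h \<and> f = (\<lambda>y. k * h (x - y))}"
    then obtain k h where h: "smooth h" and f: "f = (\<lambda>y. k * h (x - y))" by auto
    show "continuous_on UNIV f" unfolding f
      by (intro continuous_on_mult continuous_on_const continuous_on_compose2[OF smooth_continuous[OF h]] continuous_intros) auto
    fix b :: 'a assume b: "b \<in> Basis"
    show "\<exists>g'\<in>{f. \<exists>k h. smooth h \<and> f = (\<lambda>y. k * h (x - y))}.
      \<forall>y. ((\<lambda>t. f (y + t *\<^sub>R b)) has_real_derivative g' y) (at 0)"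
    proof (rule bexI)
      show "\<forall>y. ((\<lambda>t. f (y + t *\<^sub>R b)) has_real_derivative (- k) * partial h b (x - y)) (at 0)"
        unfolding f using der[OF h b, of k] by blast
      show "(\<lambda>y. (- k) * partial h b (x - y)) \<in> {f. \<exists>k h. smooth h \<and> f = (\<lambda>y. k * h (x - y))}"
        using smooth_partial[OF h b] by blast
    qed
  qed
  show "partial (\<lambda>y. h (x - y)) b = (\<lambda>y. - partial h b (x - y))" if "b \<in> Basis"
    using der[OF assms that, of 1] by (intro partial_eq) simp
qed

lemma test_fun_reflect:
  fixes h :: "'a::euclidean_space \<Rightarrow> real"
  assumes "test_fun h" shows "test_fun (\<lambda>y. h (x - y))"
proof -
  obtain R where R: "R > 0" "\<And>x. norm x > R \<Longrightarrow> h x = 0" using test_fun_support[OF assms] by metis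
  show ?thesis
  proof (rule test_funI[OF smooth_reflect(1)[OF test_fun_smooth[OF assms]]])
    fix y :: 'a assume "norm y > R + norm x"
    thus "h (x - y) = 0" using R(2)[of "x - y"] norm_triangle_ineq2[of y x] by (simp add: norm_minus_commute)
  qed
qed

lemma conv_integrable: "L2 f \<Longrightarrow> test_fun \<eta> \<Longrightarrow> integrable lebesgue (\<lambda>y. f y * complex_of_real (\<eta> (x - y)))"
  by (rule L2_mult_integrable[OF _ test_fun_L2[OF test_fun_reflect]])

lemma conv_cong_AE:
  assumes "L2 f" "L2 g" "AE x in lebesgue. f x = g x" "test_fun \<eta>" shows "conv \<eta> f = conv \<eta> g"
proof
  fix x
  have "(\<lambda>y. complex_of_real (\<eta> (x - y))) \<in> borel_measurable lebesgue"
    using test_fun_L2[OF test_fun_reflect[OF assms(4)]] by (rule L2_measurable)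
  thus "conv \<eta> f x = conv \<eta> g x"
    unfolding conv_def by (intro integral_cong_AE) (use assms in \<open>auto simp: L2_def\<close>)
qed

text \<open>Dominated convergence for uniformly bounded kernels with common bounded support, against
  an L2 function. Continuity and differentiability of convolutions are both instances.\<close>

lemma integral_kernel_tendsto:
  fixes k :: "nat \<Rightarrow> 'a::euclidean_space \<Rightarrow> real"
  assumes f: "L2 f" and k: "\<And>n. k n \<in> borel_measurable lebesgue" "\<And>y. (\<lambda>n. k n y) \<longlonglongrightarrow> l y"
    and b: "\<And>n y. \<bar>k n y\<bar> \<le> B" "\<And>n y. norm y > R \<Longrightarrow> k n y = 0"
  shows "(\<lambda>n. \<integral>y. f y * complex_of_real (k n y) \<partial>lebesgue) \<longlonglongrightarrow> (LEBINT y. f y * cr l y)"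
proof (rule integral_dominated_convergence[where w = "\<lambda>y. cmod (f y * (complex_of_real B * indicator (cball 0 R) y))"])
  have "L2 (\<lambda>y. complex_of_real B * indicator (cball 0 R) y)"
    by (intro L2_scale L2_indicator) auto
  hence "integrable lebesgue (\<lambda>y. f y * (complex_of_real B * indicator (cball 0 R) y))"
    by (rule L2_mult_integrable[OF f])
  thus "integrable lebesgue (\<lambda>y. cmod (f y * (complex_of_real B * indicator (cball 0 R) y)))" by simp
  have [measurable]: "f \<in> borel_measurable lebesgue" by (rule L2_measurable[OF f])
  have "l \<in> borel_measurable lebesgue" by (rule borel_measurable_LIMSEQ_metric[OF k])
  thus "(\<lambda>y. f y * cr l y) \<in> borel_measurable lebesgue" by measurable
  show "(\<lambda>y. f y * complex_of_real (k n y)) \<in> borel_measurable lebesgue" for n using k(1)[of n] by measurable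
  show "AE y in lebesgue. (\<lambda>n. f y * complex_of_real (k n y)) \<longlonglongrightarrow> f y * cr l y"
    by (intro AE_I2 tendsto_mult tendsto_const tendsto_of_real k)
  show "AE y in lebesgue. norm (f y * complex_of_real (k n y)) \<le> cmod (f y * (complex_of_real B * indicator (cball 0 R) y))" for n
  proof (rule AE_I2)
    fix y
    show "norm (f y * complex_of_real (k n y)) \<le> cmod (f y * (complex_of_real B * indicator (cball 0 R) y))"
      using b(1)[of n y] b(2)[of y n] by (cases "norm y \<le> R") (auto simp: norm_mult intro!: mult_left_mono)
  qed
qed

lemma conv_continuous:
  assumes "L2 f" "test_fun \<eta>" shows "continuous_on UNIV (conv \<eta> f)"
proof -
  obtain R where R: "R > 0" "\<And>x. norm x > R \<Longrightarrow> \<eta> x = 0" using test_fun_support[OF assms(2)] by metis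
  obtain B where B: "\<And>x. \<bar>\<eta> x\<bar> \<le> B" using test_fun_bounded[OF assms(2)] by metis
  have "(conv \<eta> f \<circ> X) \<longlonglongrightarrow> conv \<eta> f x" if X: "X \<longlonglongrightarrow> x" for X x
  proof -
    obtain M where M: "\<And>n. norm (X n) \<le> M" using convergent_imp_Bseq[of X] X by (metis BseqD convergentI)
    have "(\<lambda>n. \<integral>y. f y * complex_of_real (\<eta> (X n - y)) \<partial>lebesgue) \<longlonglongrightarrow> (LEBINT y. f y * complex_of_real (\<eta> (x - y)))"
    proof (rule integral_kernel_tendsto[OF assms(1), where R = "R + M"])
      show "(\<lambda>y. \<eta> (X n - y)) \<in> borel_measurable lebesgue" for n
        using test_fun_integrable[OF test_fun_reflect[OF assms(2)]] by auto
      show "(\<lambda>n. \<eta> (X n - y)) \<longlonglongrightarrow> \<eta> (x - y)" for y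
        by (rule continuous_on_tendsto_compose[OF test_fun_continuous[OF assms(2)]]) (auto intro!: tendsto_intros X)
      show "\<eta> (X n - y) = 0" if "norm y > R + M" for n y
        by (rule R(2)) (use that M[of n] norm_triangle_ineq2[of y "X n"] in \<open>simp add: norm_minus_commute\<close>)
    qed (rule B)
    thus ?thesis by (simp add: conv_def o_def)
  qed
  thus ?thesis by (simp add: continuous_on_sequentially)
qed

lemma conv_deriv:
  assumes f: "L2 f" and eta: "test_fun \<eta>" and b: "b \<in> Basis"
  shows "((\<lambda>t. (conv \<eta> f (x + t *\<^sub>R b) - conv \<eta> f x) / complex_of_real t) \<longlongrightarrow> conv (partial \<eta> b) f x) (at 0)"
proof -
  note sm = test_fun_smooth[OF eta]
  obtain R where R: "R > 0" "\<And>x. norm x > R \<Longrightarrow> \<eta> x = 0" using test_fun_support[OF eta] by metis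
  obtain B where B: "B > 0" "\<And>x. \<bar>partial \<eta> b x\<bar> \<le> B" using test_fun_bounded[OF test_fun_partial[OF eta b]] by metis
  have nb: "norm b = 1" using b by simp
  have bound: "\<bar>(\<eta> (z + t *\<^sub>R b) - \<eta> z) / t\<bar> \<le> B" if "t \<noteq> 0" for z t
  proof -
    have "\<bar>\<eta> (z + t *\<^sub>R b) - \<eta> (z + 0 *\<^sub>R b)\<bar> \<le> B * \<bar>t - 0\<bar>"
      using field_differentiable_bound[of UNIV "\<lambda>t. \<eta> (z + t *\<^sub>R b)" "\<lambda>t. partial \<eta> b (z + t *\<^sub>R b)" B 0 t]
        smooth_partial_deriv[OF sm b] B by simp
    thus ?thesis using that by (simp add: field_simps)
  qed
  have "(\<lambda>n. (conv \<eta> f (x + X n *\<^sub>R b) - conv \<eta> f x) / cr X n) \<longlonglongrightarrow> conv (partial \<eta> b) f x"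
    if X: "X \<longlonglongrightarrow> 0" "\<And>n. X n \<noteq> 0" for X
  proof -
    obtain M where M: "\<And>n. \<bar>X n\<bar> \<le> M" using convergent_imp_Bseq[of X] X by (metis BseqD convergentI real_norm_def)
    have "(\<lambda>n. \<integral>y. f y * complex_of_real ((\<eta> ((x - y) + X n *\<^sub>R b) - \<eta> (x - y)) / X n) \<partial>lebesgue)
       \<longlonglongrightarrow> (LEBINT y. f y * complex_of_real (partial \<eta> b (x - y)))"
    proof (rule integral_kernel_tendsto[OF f, where R = "R + norm x + M"])
      fix n
      have 1: "(\<lambda>y. \<eta> (z - y)) \<in> borel_measurable lebesgue" for z
        using test_fun_integrable[OF test_fun_reflect[OF eta]] by auto
      have 2: "(\<lambda>y. \<eta> ((x - y) + X n *\<^sub>R b)) = (\<lambda>y. \<eta> ((x + X n *\<^sub>R b) - y))" by (simp add: algebra_simps)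
      show "(\<lambda>y. (\<eta> ((x - y) + X n *\<^sub>R b) - \<eta> (x - y)) / X n) \<in> borel_measurable lebesgue"
        using 1[of x] 1[of "x + X n *\<^sub>R b"] unfolding 2[symmetric] by measurable
      fix y
      show "\<bar>(\<eta> ((x - y) + X n *\<^sub>R b) - \<eta> (x - y)) / X n\<bar> \<le> B" by (rule bound[OF X(2)])
      show "(\<eta> ((x - y) + X n *\<^sub>R b) - \<eta> (x - y)) / X n = 0" if "norm y > R + norm x + M"
      proof -
        have M0: "0 \<le> M" using M[of n] by linarith
        have "norm y \<le> norm (x - y) + norm x" by (metis diff_add_cancel norm_minus_commute norm_triangle_sub add.commute)
        hence "norm (x - y) > R + M" using that by simp
        moreover have "norm (x - y) \<le> norm ((x - y) + X n *\<^sub>R b) + norm (X n *\<^sub>R b)"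
          using norm_triangle_ineq4[of "(x - y) + X n *\<^sub>R b" "X n *\<^sub>R b"] by simp
        ultimately have "\<eta> ((x - y) + X n *\<^sub>R b) = 0" "\<eta> (x - y) = 0" using M[of n] nb M0 by (auto intro!: R(2))
        thus ?thesis by simp
      qed
    next
      fix y
      have "((\<lambda>h. (\<eta> ((x - y) + h *\<^sub>R b) - \<eta> (x - y)) / h) \<longlongrightarrow> partial \<eta> b (x - y)) (at 0)"
        using smooth_partial_deriv0[OF sm b, of "x - y"] by (simp add: DERIV_def)
      thus "(\<lambda>n. (\<eta> ((x - y) + X n *\<^sub>R b) - \<eta> (x - y)) / X n) \<longlonglongrightarrow> partial \<eta> b (x - y)"
        by (rule filterlim_compose) (use X in \<open>auto simp: filterlim_at\<close>)
    qed
    moreover have "(LEBINT y. f y * complex_of_real ((\<eta> ((x - y) + X n *\<^sub>R b) - \<eta> (x - y)) / X n))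
       = (conv \<eta> f (x + X n *\<^sub>R b) - conv \<eta> f x) / cr X n" for n
    proof -
      have "(conv \<eta> f (x + X n *\<^sub>R b) - conv \<eta> f x) =
        (LEBINT y. f y * complex_of_real (\<eta> (x + X n *\<^sub>R b - y)) - f y * complex_of_real (\<eta> (x - y)))"
        unfolding conv_def by (rule Bochner_Integration.integral_diff[symmetric]) (intro conv_integrable f eta)+
      also have "\<dots> / cr X n =
        (LEBINT y. (f y * complex_of_real (\<eta> (x + X n *\<^sub>R b - y)) - f y * complex_of_real (\<eta> (x - y))) / cr X n)"
        by simp
      also have "\<dots> = (LEBINT y. f y * complex_of_real ((\<eta> ((x - y) + X n *\<^sub>R b) - \<eta> (x - y)) / X n))"
        by (simp add: algebra_simps diff_divide_distrib add_diff_eq)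
      finally show ?thesis by (rule sym)
    qed
    ultimately show ?thesis by (simp only: conv_def[of "partial \<eta> b"])
  qed
  thus ?thesis unfolding tendsto_at_iff_sequentially by (auto simp: o_def)
qed

lemma conv_Re_Im_deriv:
  assumes f: "L2 f" and eta: "test_fun \<eta>" and b: "b \<in> Basis"
  shows "((\<lambda>t. Re (conv \<eta> f (x + t *\<^sub>R b))) has_real_derivative Re (conv (partial \<eta> b) f x)) (at 0)"
    and "((\<lambda>t. Im (conv \<eta> f (x + t *\<^sub>R b))) has_real_derivative Im (conv (partial \<eta> b) f x)) (at 0)"
  using tendsto_Re[OF conv_deriv[OF f eta b, of x]] tendsto_Im[OF conv_deriv[OF f eta b, of x]]
  by (simp_all add: DERIV_def)

text \<open>A derivative of the convolution falls on the kernel, so the convolutions of f with all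
  test functions form a family closed under partial derivatives.\<close>

lemma smooth_conv:
  fixes f :: "'a::euclidean_space \<Rightarrow> complex"
  assumes f: "L2 f" and eta: "test_fun \<eta>"
  shows "smooth (\<lambda>x. Re (conv \<eta> f x))" "smooth (\<lambda>x. Im (conv \<eta> f x))"
proof -
  show "smooth (\<lambda>x. Re (conv \<eta> f x))"
  proof (rule smoothI[of _ "{g. \<exists>h. test_fun h \<and> g = (\<lambda>x. Re (conv h f x))}"])
    fix g :: "'a \<Rightarrow> real" and b :: 'a assume "g \<in> {g. \<exists>h. test_fun h \<and> g = (\<lambda>x. Re (conv h f x))}" "b \<in> Basis"
    then obtain h where h: "test_fun h" "g = (\<lambda>x. Re (conv h f x))" and b: "b \<in> Basis" by blast
    show "\<exists>g'\<in>{g. \<exists>h. test_fun h \<and> g = (\<lambda>x. Re (conv h f x))}. \<forall>x. ((\<lambda>t. g (x + t *\<^sub>R b)) has_real_derivative g' x) (at 0)"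
      unfolding h(2)
      by (intro bexI[of _ "\<lambda>x. Re (conv (partial h b) f x)"] allI conv_Re_Im_deriv(1)[OF f h(1) b] CollectI exI[of _ "partial h b"] conjI test_fun_partial h b refl)
  qed (use eta conv_continuous[OF f] in \<open>auto intro!: continuous_on_Re\<close>)
  show "smooth (\<lambda>x. Im (conv \<eta> f x))"
  proof (rule smoothI[of _ "{g. \<exists>h. test_fun h \<and> g = (\<lambda>x. Im (conv h f x))}"])
    fix g :: "'a \<Rightarrow> real" and b :: 'a assume "g \<in> {g. \<exists>h. test_fun h \<and> g = (\<lambda>x. Im (conv h f x))}" "b \<in> Basis"
    then obtain h where h: "test_fun h" "g = (\<lambda>x. Im (conv h f x))" and b: "b \<in> Basis" by blast
    show "\<exists>g'\<in>{g. \<exists>h. test_fun h \<and> g = (\<lambda>x. Im (conv h f x))}. \<forall>x. ((\<lambda>t. g (x + t *\<^sub>R b)) has_real_derivative g' x) (at 0)"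
      unfolding h(2)
      by (intro bexI[of _ "\<lambda>x. Im (conv (partial h b) f x)"] allI conv_Re_Im_deriv(2)[OF f h(1) b] CollectI exI[of _ "partial h b"] conjI test_fun_partial h b refl)
  qed (use eta conv_continuous[OF f] in \<open>auto intro!: continuous_on_Im\<close>)
qed

lemma partial_conv:
  assumes "L2 f" "test_fun \<eta>" "b \<in> Basis"
  shows "partial (\<lambda>x. Re (conv \<eta> f x)) b = (\<lambda>x. Re (conv (partial \<eta> b) f x))"
    and "partial (\<lambda>x. Im (conv \<eta> f x)) b = (\<lambda>x. Im (conv (partial \<eta> b) f x))"
  by (intro partial_eq conv_Re_Im_deriv assms)+

section \<open>Weak derivatives and the Sobolev space\<close>

lemma moll_symmetric: "moll d (- x) = moll d x"
  by (simp add: moll_def bump_def mult.commute)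

lemma cnj_mult_self: "cnj z * z = complex_of_real ((cmod z)\<^sup>2)"
  by (metis complex_norm_square mult.commute of_real_power)

text \<open>Jensen's inequality for the probability density moll d, in the form of Cauchy-Schwarz
  between sqrt (moll d), of norm 1, and sqrt (moll d) times the increment of g.\<close>

lemma conv_moll_pointwise:
  fixes g :: "'a::euclidean_space \<Rightarrow> complex"
  assumes g: "L2 g" and d: "d > 0"
  shows "integrable lebesgue (\<lambda>z. moll d z * (cmod (g (z + x) - g x))\<^sup>2)"
    and "(cmod (conv (moll d) g x - g x))\<^sup>2 \<le> (LEBINT z. moll d z * (cmod (g (z + x) - g x))\<^sup>2)"
proof -
  let ?m = "moll d :: 'a \<Rightarrow> real"
  define p where "p z = complex_of_real (sqrt (?m z))" for z
  define D where "D z = g (x + z) - g x" for z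
  have pc: "continuous_on UNIV (\<lambda>z. sqrt (?m z))"
    by (intro continuous_intros test_fun_continuous test_fun_moll)
  have "integrable lebesgue (\<lambda>z. sqrt (?m z))"
    by (rule cc_integrable(2)[OF pc, of d]) (simp add: moll_support)
  hence pm: "p \<in> borel_measurable lebesgue" unfolding p_def by measurable
  have pL: "L2 p"
  proof (rule L2_I_bound[OF pm])
    show "integrable lebesgue ?m" by (rule test_fun_integrable[OF test_fun_moll])
  qed (simp add: p_def moll_nonneg)
  obtain B where B: "\<And>z. \<bar>?m z\<bar> \<le> B" using test_fun_bounded[OF test_fun_moll[of d]] by metis
  have pb: "cmod (p z) \<le> sqrt B" for z using B[of z] by (simp add: p_def moll_nonneg)
  have "L2 (\<lambda>z. p z * g (x + z))"
    by (rule L2_mult_bounded[OF L2_translate(1)[OF g] pm pb])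
  moreover have "L2 (\<lambda>z. g x * p z)" by (rule L2_scale[OF pL])
  ultimately have pD: "L2 (\<lambda>z. p z * D z)"
    using L2_diff[of "\<lambda>z. p z * g (x + z)" "\<lambda>z. g x * p z"] by (simp add: D_def algebra_simps)
  have sq: "(cmod (p z * D z))\<^sup>2 = ?m z * (cmod (g (z + x) - g x))\<^sup>2" for z
    by (simp add: p_def D_def norm_mult power_mult_distrib moll_nonneg add.commute)
  show "integrable lebesgue (\<lambda>z. ?m z * (cmod (g (z + x) - g x))\<^sup>2)"
    using L2_integrable[OF pD] by (simp only: sq)
  have n1: "norm_L2 p = 1"
  proof -
    have "(LEBINT z. (cmod (p z))\<^sup>2) = integral\<^sup>L lebesgue ?m" by (simp add: p_def moll_nonneg)
    thus ?thesis using integral_moll[OF d, where 'a = 'a] by (simp add: norm_L2_def)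
  qed
  have n2: "(norm_L2 (\<lambda>z. p z * D z))\<^sup>2 = (LEBINT z. ?m z * (cmod (g (z + x) - g x))\<^sup>2)"
    unfolding norm_L2_sq sq ..
  have pp: "cnj (p z) * (p z * w) = cr ?m z * w" for z w
    using moll_nonneg[of d z] by (simp add: p_def flip: mult.assoc of_real_mult)
  have i1: "integrable lebesgue (\<lambda>z. cr ?m z * g (x + z))"
    using L2_mult_integrable[OF test_fun_L2[OF test_fun_moll] L2_translate(1)[OF g]] .
  have i2: "integrable lebesgue (\<lambda>z. cr ?m z * g x)"
    using test_fun_integrable[OF test_fun_moll[of d, where 'a = 'a]] by simp
  have "inner_L2 p (\<lambda>z. p z * D z) = (LEBINT z. cr ?m z * g (x + z) - cr ?m z * g x)"
    unfolding inner_L2_def pp by (simp add: D_def right_diff_distrib)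
  also have "\<dots> = (LEBINT z. cr ?m z * g (x + z)) - (LEBINT z. cr ?m z * g x)"
    by (rule Bochner_Integration.integral_diff[OF i1 i2])
  also have "(LEBINT z. cr ?m z * g x) = g x"
    using integral_moll[OF d, where 'a = 'a] by simp
  also have "(LEBINT z. cr ?m z * g (x + z)) = conv ?m g x"
  proof -
    have "conv ?m g x = (LEBINT y. g y * complex_of_real (?m (y - x)))"
      unfolding conv_def using moll_symmetric[of d "_ - x"] by (metis minus_diff_eq)
    also have "\<dots> = (LEBINT z. g (x + z) * complex_of_real (?m (x + z - x)))"
    proof (rule integral_translate_lebesgue[symmetric])
      have "(\<lambda>y. g y * complex_of_real (?m (x - y))) \<in> borel_measurable lebesgue"
        using conv_integrable[OF g test_fun_moll[of d], of x] by auto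
      thus "(\<lambda>y. g y * complex_of_real (?m (y - x))) \<in> borel_measurable lebesgue"
        using moll_symmetric[of d "_ - x"] by (metis (no_types, lifting) ext minus_diff_eq)
    qed
    finally show ?thesis by (simp add: mult.commute)
  qed
  finally have "cmod (conv ?m g x - g x) \<le> norm_L2 (\<lambda>z. p z * D z)"
    using cauchy_schwarz_L2[OF pL pD] n1 by simp
  hence "(cmod (conv ?m g x - g x))\<^sup>2 \<le> (norm_L2 (\<lambda>z. p z * D z))\<^sup>2" by (intro power_mono) auto
  thus "(cmod (conv ?m g x - g x))\<^sup>2 \<le> (LEBINT z. ?m z * (cmod (g (z + x) - g x))\<^sup>2)"
    by (simp only: n2)
qed

lemma conv_measurable: "L2 f \<Longrightarrow> test_fun \<eta> \<Longrightarrow> conv \<eta> f \<in> borel_measurable borel"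
  by (rule borel_measurable_continuous_onI[OF conv_continuous])

text \<open>Integrate the pointwise bound over x and exchange the integrals: the inner integral
  becomes the squared distance of g to its translate by z, small because only z with |z| \<le> r < d
  contribute. Square integrability of the convolution is part of the result, as it follows from the
  same estimate.\<close>

lemma conv_moll_approx:
  fixes f :: "'a::euclidean_space \<Rightarrow> complex"
  assumes f: "L2 f" and e: "e > 0"
  obtains d where "d > 0" "\<And>r. 0 < r \<Longrightarrow> r < d \<Longrightarrow> L2 (conv (moll r) f) \<and> norm_L2 (\<lambda>x. conv (moll r) f x - f x) \<le> e"
proof -
  obtain g where g: "g \<in> borel_measurable borel" "AE x in lebesgue. f x = g x" "L2 g"
    using L2_borel_version[OF f] by blast
  obtain d where d: "d > 0" "\<And>y. norm y < d \<Longrightarrow> norm_L2 (\<lambda>x. g (y + x) - g x) < e"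
    using L2_transl_cont[OF g(3)] e unfolding transl_cont_def by blast
  have main: "L2 (conv (moll r) f) \<and> norm_L2 (\<lambda>x. conv (moll r) f x - f x) \<le> e" if r: "0 < r" "r < d" for r
  proof -
    let ?m = "moll r :: 'a \<Rightarrow> real"
    note [measurable] = g(1)
    have mm[measurable]: "?m \<in> borel_measurable borel"
      by (rule borel_measurable_continuous_onI[OF test_fun_continuous[OF test_fun_moll]])
    have cm[measurable]: "conv ?m g \<in> borel_measurable borel" by (rule conv_measurable[OF g(3) test_fun_moll])
    have "(\<integral>\<^sup>+x. ennreal ((cmod (conv ?m g x - g x))\<^sup>2) \<partial>lebesgue)
      \<le> (\<integral>\<^sup>+x. (\<integral>\<^sup>+z. ennreal (?m z * (cmod (g (z + x) - g x))\<^sup>2) \<partial>lborel) \<partial>lebesgue)"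
    proof (rule nn_integral_mono)
      fix x
      have "ennreal ((cmod (conv ?m g x - g x))\<^sup>2) \<le> ennreal (LEBINT z. ?m z * (cmod (g (z + x) - g x))\<^sup>2)"
        by (rule ennreal_leI[OF conv_moll_pointwise(2)[OF g(3) r(1)]])
      also have "\<dots> = (\<integral>\<^sup>+z. ennreal (?m z * (cmod (g (z + x) - g x))\<^sup>2) \<partial>lebesgue)"
        by (rule nn_integral_eq_integral[symmetric, OF conv_moll_pointwise(1)[OF g(3) r(1)]]) (simp add: moll_nonneg)
      finally show "ennreal ((cmod (conv ?m g x - g x))\<^sup>2) \<le> (\<integral>\<^sup>+z. ennreal (?m z * (cmod (g (z + x) - g x))\<^sup>2) \<partial>lborel)"
        by (simp only: nn_integral_completion)
    qed
    also have "\<dots> = (\<integral>\<^sup>+x. (\<integral>\<^sup>+z. ennreal (?m z * (cmod (g (z + x) - g x))\<^sup>2) \<partial>lborel) \<partial>lborel)"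
      by (simp only: nn_integral_completion)
    also have "\<dots> = (\<integral>\<^sup>+z. (\<integral>\<^sup>+x. ennreal (?m z * (cmod (g (z + x) - g x))\<^sup>2) \<partial>lborel) \<partial>lborel)"
      by (rule lborel_pair.Fubini') measurable
    also have "\<dots> \<le> (\<integral>\<^sup>+z. ennreal (?m z) * ennreal (e\<^sup>2) \<partial>lborel)"
    proof (rule nn_integral_mono)
      fix z :: 'a
      have "(\<integral>\<^sup>+x. ennreal (?m z * (cmod (g (z + x) - g x))\<^sup>2) \<partial>lborel) = ennreal (?m z) * (\<integral>\<^sup>+x. ennreal ((cmod (g (z + x) - g x))\<^sup>2) \<partial>lborel)"
        by (subst nn_integral_cmult[symmetric]) (auto simp: ennreal_mult moll_nonneg)
      also have "(\<integral>\<^sup>+x. ennreal ((cmod (g (z + x) - g x))\<^sup>2) \<partial>lborel) = (\<integral>\<^sup>+x. ennreal ((cmod (g (z + x) - g x))\<^sup>2) \<partial>lebesgue)"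
        by (simp only: nn_integral_completion)
      also have "\<dots> = ennreal ((norm_L2 (\<lambda>x. g (z + x) - g x))\<^sup>2)"
        by (rule nn_integral_L2[OF L2_diff[OF L2_translate(1)[OF g(3)] g(3)]])
      also have "ennreal (?m z) * \<dots> \<le> ennreal (?m z) * ennreal (e\<^sup>2)"
      proof (cases "norm z < d")
        case True
        thus ?thesis using d(2)[OF True] by (intro mult_left_mono ennreal_leI power_mono) auto
      next
        case False
        thus ?thesis using moll_support[of r z] r by simp
      qed
      finally show "(\<integral>\<^sup>+x. ennreal (?m z * (cmod (g (z + x) - g x))\<^sup>2) \<partial>lborel) \<le> ennreal (?m z) * ennreal (e\<^sup>2)" .
    qed
    also have "\<dots> = (\<integral>\<^sup>+z. ennreal (?m z) \<partial>lborel) * ennreal (e\<^sup>2)"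
      by (rule nn_integral_multc) measurable
    also have "(\<integral>\<^sup>+z. ennreal (?m z) \<partial>lborel) = (\<integral>\<^sup>+z. ennreal (?m z) \<partial>lebesgue)"
      by (simp only: nn_integral_completion)
    also have "\<dots> = ennreal (integral\<^sup>L lebesgue ?m)"
      by (rule nn_integral_eq_integral[OF test_fun_integrable[OF test_fun_moll]]) (simp add: moll_nonneg)
    also have "\<dots> = 1" using integral_moll[OF r(1), where 'a = 'a] by simp
    finally have le: "(\<integral>\<^sup>+x. ennreal ((cmod (conv ?m g x - g x))\<^sup>2) \<partial>lebesgue) \<le> ennreal (e\<^sup>2)" by simp
    have "(\<lambda>x. conv ?m g x - g x) \<in> borel_measurable lebesgue"
      by (rule measurable_completion) measurable
    from L2_nn_integralI[OF this le] e
    have 1: "L2 (\<lambda>x. conv ?m g x - g x)" "norm_L2 (\<lambda>x. conv ?m g x - g x) \<le> e" by auto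
    have eq: "conv ?m f = conv ?m g" by (rule conv_cong_AE[OF f g(3,2) test_fun_moll])
    have L: "L2 (conv ?m f)" using L2_add[OF 1(1) g(3)] by (simp add: eq)
    have "norm_L2 (\<lambda>x. conv ?m f x - f x) = norm_L2 (\<lambda>x. conv ?m g x - g x)"
      by (rule norm_L2_cong_AE) (use L f 1 g(2) in \<open>auto intro: L2_diff simp: eq elim: eventually_mono\<close>)
    with L 1 show ?thesis by simp
  qed
  show ?thesis by (rule that[OF d(1) main])
qed

text \<open>The values of the mollifications of f are integrals of f against test functions, so they
  all vanish, and they approximate f.\<close>

lemma fundamental_lemma:
  assumes f: "L2 f" and z: "\<And>\<eta>. test_fun \<eta> \<Longrightarrow> integral\<^sup>L lebesgue (\<lambda>x. f x * cr \<eta> x) = 0"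
  shows "AE x in lebesgue. f x = 0"
proof -
  have c0: "conv (moll r) f x = 0" for r x
    unfolding conv_def by (rule z[OF test_fun_reflect[OF test_fun_moll]])
  have "norm_L2 f \<le> e" if "e > 0" for e
  proof -
    obtain d where "d > 0" "\<And>r. 0 < r \<Longrightarrow> r < d \<Longrightarrow> L2 (conv (moll r) f) \<and> norm_L2 (\<lambda>x. conv (moll r) f x - f x) \<le> e"
      using conv_moll_approx[OF f \<open>e > 0\<close>] by blast
    hence "norm_L2 (\<lambda>x. conv (moll (d/2)) f x - f x) \<le> e" by simp
    thus ?thesis by (simp add: c0 norm_L2_def)
  qed
  hence "norm_L2 f = 0" using norm_L2_nonneg[of f] by (meson dense_ge order.antisym)
  thus ?thesis using norm_L2_eq_0_iff[OF f] by simp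
qed

text \<open>In terms of scalar products, linearity and closedness of the weak derivative are those
  of the L2 product.\<close>

lemma weak_deriv_inner:
  "weak_deriv f b g \<longleftrightarrow> (\<forall>\<eta>. test_fun \<eta> \<longrightarrow> inner_L2 (cr (partial \<eta> b)) f = - inner_L2 (cr \<eta>) g)"
  by (simp add: weak_deriv_def inner_L2_def mult.commute)

lemma weak_deriv_unique:
  assumes "L2 g" "L2 g'" "weak_deriv f b g" "weak_deriv f b g'"
  shows "AE x in lebesgue. g x = g' x"
proof -
  have "AE x in lebesgue. g x - g' x = 0"
  proof (rule fundamental_lemma[OF L2_diff[OF assms(1,2)]])
    fix \<eta> :: "'a \<Rightarrow> real" assume t: "test_fun \<eta>"
    have "integral\<^sup>L lebesgue (\<lambda>x. (g x - g' x) * cr \<eta> x) = inner_L2 (cr \<eta>) (\<lambda>x. g x - g' x)"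
      by (simp add: inner_L2_def mult.commute)
    also have "\<dots> = inner_L2 (cr \<eta>) g - inner_L2 (cr \<eta>) g'"
      using L2.f_sub[OF test_fun_L2[OF t] assms(1,2)] by simp
    also have "\<dots> = 0" using assms(3,4) t by (simp add: weak_deriv_inner) 
    finally show "integral\<^sup>L lebesgue (\<lambda>x. (g x - g' x) * cr \<eta> x) = 0" .
  qed
  thus ?thesis by simp
qed

lemma weak_deriv_add:
  assumes "L2 f" "L2 f'" "L2 g" "L2 g'" "weak_deriv f b g" "weak_deriv f' b g'" "b \<in> Basis"
  shows "weak_deriv (\<lambda>x. f x + f' x) b (\<lambda>x. g x + g' x)"
  using assms by (auto simp: weak_deriv_inner L2.f_add test_fun_L2 test_fun_partial)

lemma weak_deriv_scale:
  assumes "L2 f" "L2 g" "weak_deriv f b g" "b \<in> Basis"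
  shows "weak_deriv (\<lambda>x. c * f x) b (\<lambda>x. c * g x)"
  using assms by (auto simp: weak_deriv_inner L2.f_scl test_fun_L2 test_fun_partial)

lemma weak_deriv_diff:
  assumes "L2 f" "L2 f'" "L2 g" "L2 g'" "weak_deriv f b g" "weak_deriv f' b g'" "b \<in> Basis"
  shows "weak_deriv (\<lambda>x. f x - f' x) b (\<lambda>x. g x - g' x)"
  using weak_deriv_add[OF assms(1) L2_scale[OF assms(2), of "-1"] assms(3) L2_scale[OF assms(4), of "-1"] assms(5) weak_deriv_scale[OF assms(2,4,6,7)] assms(7)]
  by simp

lemma weak_deriv_lim:
  assumes f: "\<And>n. L2 (f n)" "L2 F" "L2_lim f F"
    and g: "\<And>n. L2 (g n)" "L2 G" "L2_lim g G"
    and w: "\<And>n. weak_deriv (f n) b (g n)" and b: "b \<in> Basis"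
  shows "weak_deriv F b G"
  unfolding weak_deriv_inner
proof (intro allI impI)
  fix \<eta> :: "'a \<Rightarrow> real" assume t: "test_fun \<eta>"
  have c: "(\<lambda>n::nat. norm_L2 (\<lambda>x. h x - h x)) \<longlonglongrightarrow> 0" for h :: "'a \<Rightarrow> complex" by (simp add: norm_L2_def)
  have "(\<lambda>n. inner_L2 (cr (partial \<eta> b)) (f n)) \<longlonglongrightarrow> inner_L2 (cr (partial \<eta> b)) F"
    by (intro inner_L2_tendsto f test_fun_L2 test_fun_partial t b c)
  moreover have "(\<lambda>n. - inner_L2 (cr \<eta>) (g n)) \<longlonglongrightarrow> - inner_L2 (cr \<eta>) G"
    by (intro tendsto_minus inner_L2_tendsto g test_fun_L2 t c)
  moreover have "inner_L2 (cr (partial \<eta> b)) (f n) = - inner_L2 (cr \<eta>) (g n)" for n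
    using w t by (simp add: weak_deriv_inner)
  ultimately show "inner_L2 (cr (partial \<eta> b)) F = - inner_L2 (cr \<eta>) G"
    using LIMSEQ_unique by auto
qed

lemma W12_L2: "W12 f \<Longrightarrow> L2 f" by (simp add: W12_def)

lemma wgrad: assumes "W12 f" "b \<in> Basis" shows wgrad_L2: "L2 (wgrad f b)" and wgrad_weak: "weak_deriv f b (wgrad f b)"
proof -
  have "\<exists>g. L2 g \<and> weak_deriv f b g" using assms by (auto simp: W12_def)
  from someI_ex[OF this] show "L2 (wgrad f b)" "weak_deriv f b (wgrad f b)" by (auto simp: wgrad_def)
qed

lemma W12I: "L2 f \<Longrightarrow> (\<And>b. b \<in> Basis \<Longrightarrow> L2 (g b)) \<Longrightarrow> (\<And>b. b \<in> Basis \<Longrightarrow> weak_deriv f b (g b)) \<Longrightarrow> W12 f"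
  unfolding W12_def by blast

text \<open>\<open>wgrad\<close> is a choice, so it is unique, additive and homogeneous only almost
  everywhere. This is why the form identities below pass through
  \<open>inner_L2_cong_AE\<close>.\<close>

lemma wgrad_AE:
  assumes "W12 f" "b \<in> Basis" "L2 g" "weak_deriv f b g" shows "AE x in lebesgue. wgrad f b x = g x"
  by (rule weak_deriv_unique[OF wgrad_L2[OF assms(1,2)] assms(3) wgrad_weak[OF assms(1,2)] assms(4)])

lemma W12_add: "W12 f \<Longrightarrow> W12 g \<Longrightarrow> W12 (\<lambda>x. f x + g x)"
  by (rule W12I[where g = "\<lambda>b x. wgrad f b x + wgrad g b x"])
    (auto intro: L2_add weak_deriv_add W12_L2 wgrad_L2 wgrad_weak)

lemma W12_scale: "W12 f \<Longrightarrow> W12 (\<lambda>x. c * f x)"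
  by (rule W12I[where g = "\<lambda>b x. c * wgrad f b x"])
    (auto intro: L2_scale weak_deriv_scale W12_L2 wgrad_L2 wgrad_weak)

lemma W12_diff: "W12 f \<Longrightarrow> W12 g \<Longrightarrow> W12 (\<lambda>x. f x - g x)"
  using W12_add[of f "\<lambda>x. (-1) * g x"] W12_scale[of g "-1"] by simp

lemma wgrad_add: "W12 f \<Longrightarrow> W12 g \<Longrightarrow> b \<in> Basis \<Longrightarrow> AE x in lebesgue. wgrad (\<lambda>x. f x + g x) b x = wgrad f b x + wgrad g b x"
  by (rule wgrad_AE) (auto intro: W12_add L2_add weak_deriv_add W12_L2 wgrad_L2 wgrad_weak)

lemma wgrad_scale: "W12 f \<Longrightarrow> b \<in> Basis \<Longrightarrow> AE x in lebesgue. wgrad (\<lambda>x. c * f x) b x = c * wgrad f b x"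
  by (rule wgrad_AE) (auto intro: W12_scale L2_scale weak_deriv_scale W12_L2 wgrad_L2 wgrad_weak)

lemma wgrad_diff: "W12 f \<Longrightarrow> W12 g \<Longrightarrow> b \<in> Basis \<Longrightarrow> AE x in lebesgue. wgrad (\<lambda>x. f x - g x) b x = wgrad f b x - wgrad g b x"
  by (rule wgrad_AE) (auto intro: W12_diff L2_diff weak_deriv_diff W12_L2 wgrad_L2 wgrad_weak)

lemma wgrad_herm:
  assumes "b \<in> Basis"
  shows "herm_form W12 (\<lambda>f g x. f x + g x) (\<lambda>c f x. c * f x) (\<lambda>f g. inner_L2 (wgrad f b) (wgrad g b))"
proof
  fix u v w :: "'a \<Rightarrow> complex" and c :: complex
  assume u: "W12 u"
  show "W12 (\<lambda>x. c * u x)" by (rule W12_scale[OF u])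
  assume v: "W12 v"
  show "W12 (\<lambda>x. u x + v x)" by (rule W12_add[OF u v])
  note L = wgrad_L2[OF u assms] wgrad_L2[OF v assms]
  show "inner_L2 (wgrad v b) (wgrad u b) = cnj (inner_L2 (wgrad u b) (wgrad v b))"
    by (rule L2.f_cnj[OF L])
  have "inner_L2 (wgrad u b) (wgrad (\<lambda>x. c * v x) b) = inner_L2 (wgrad u b) (\<lambda>x. c * wgrad v b x)"
    by (intro inner_L2_cong_AE wgrad_scale wgrad_L2 W12_scale L2_scale assms u v AE_I2 refl)
  thus "inner_L2 (wgrad u b) (wgrad (\<lambda>x. c * v x) b) = c * inner_L2 (wgrad u b) (wgrad v b)"
    using L2.f_scl[OF L] by simp
  assume w: "W12 w"
  have "inner_L2 (wgrad u b) (wgrad (\<lambda>x. v x + w x) b) = inner_L2 (wgrad u b) (\<lambda>x. wgrad v b x + wgrad w b x)"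
    by (intro inner_L2_cong_AE wgrad_add wgrad_L2 W12_add L2_add assms u v w AE_I2 refl)
  thus "inner_L2 (wgrad u b) (wgrad (\<lambda>x. v x + w x) b) = inner_L2 (wgrad u b) (wgrad v b) + inner_L2 (wgrad u b) (wgrad w b)"
    using L2.f_add[OF L wgrad_L2[OF w assms]] by simp
qed

section \<open>Algebra of Hermitian forms\<close>

lemma herm_form_add:
  assumes "herm_form P add scl f" "herm_form P add scl g"
  shows "herm_form P add scl (\<lambda>u v. f u v + g u v)"
proof -
  interpret f: herm_form P add scl f by fact
  interpret g: herm_form P add scl g by fact
  show ?thesis
  proof
    fix u v w c
    show "P u \<Longrightarrow> P v \<Longrightarrow> P (add u v)" "P u \<Longrightarrow> P (scl c u)" by (simp_all add: f.lin)
    show "P u \<Longrightarrow> P v \<Longrightarrow> P w \<Longrightarrow> f u (add v w) + g u (add v w) = f u v + g u v + (f u w + g u w)"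
      by (simp add: f.lin g.lin)
    show "P u \<Longrightarrow> P v \<Longrightarrow> f u (scl c v) + g u (scl c v) = c * (f u v + g u v)"
      by (simp add: f.lin g.lin distrib_left)
    show "P u \<Longrightarrow> P v \<Longrightarrow> f v u + g v u = cnj (f u v + g u v)"
      by (simp add: f.f_cnj[of u v] g.f_cnj[of u v])
  qed
qed

lemma herm_form_scale:
  assumes "herm_form P add scl f"
  shows "herm_form P add scl (\<lambda>u v. complex_of_real r * f u v)"
proof -
  interpret f: herm_form P add scl f by fact
  show ?thesis
  proof
    fix u v w c
    show "P u \<Longrightarrow> P v \<Longrightarrow> P (add u v)" "P u \<Longrightarrow> P (scl c u)" by (simp_all add: f.lin)
    show "P u \<Longrightarrow> P v \<Longrightarrow> P w \<Longrightarrow> complex_of_real r * f u (add v w) = complex_of_real r * f u v + complex_of_real r * f u w"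
      by (simp add: f.lin distrib_left)
    show "P u \<Longrightarrow> P v \<Longrightarrow> complex_of_real r * f u (scl c v) = c * (complex_of_real r * f u v)"
      by (simp add: f.lin)
    show "P u \<Longrightarrow> P v \<Longrightarrow> complex_of_real r * f v u = cnj (complex_of_real r * f u v)"
      by (simp add: f.f_cnj[of u v])
  qed
qed

lemma herm_form_sum:
  assumes "finite I" "I \<noteq> {}" "\<And>i. i \<in> I \<Longrightarrow> herm_form P add scl (f i)"
  shows "herm_form P add scl (\<lambda>u v. \<Sum>i\<in>I. f i u v)"
  using assms
proof (induction I rule: finite_ne_induct)
  case (insert i I)
  hence "herm_form P add scl (\<lambda>u v. f i u v + (\<Sum>i\<in>I. f i u v))" by (intro herm_form_add) auto
  thus ?case using insert by simp
qed auto

lemma herm_form_subset: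
  assumes "herm_form P add scl f" "\<And>u. Q u \<Longrightarrow> P u" "\<And>u v. Q u \<Longrightarrow> Q v \<Longrightarrow> Q (add u v)" "\<And>u c. Q u \<Longrightarrow> Q (scl c u)"
  shows "herm_form Q add scl f"
proof -
  interpret f: herm_form P add scl f by fact
  show ?thesis
  proof
    fix u v w c
    show "Q u \<Longrightarrow> Q v \<Longrightarrow> Q (add u v)" "Q u \<Longrightarrow> Q (scl c u)" by (fact assms)+
    show "Q u \<Longrightarrow> Q v \<Longrightarrow> Q w \<Longrightarrow> f u (add v w) = f u v + f u w" "Q u \<Longrightarrow> Q v \<Longrightarrow> f u (scl c v) = c * f u v"
      by (simp_all add: f.lin assms(2))
    show "Q u \<Longrightarrow> Q v \<Longrightarrow> f v u = cnj (f u v)" by (rule f.f_cnj) (auto intro: assms(2))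
  qed
qed

section \<open>The Sobolev scalar product and completeness\<close>

definition grad_form :: "('a::euclidean_space \<Rightarrow> complex) \<Rightarrow> ('a \<Rightarrow> complex) \<Rightarrow> complex" where
  "grad_form f g = (\<Sum>b\<in>Basis. inner_L2 (wgrad f b) (wgrad g b))"

definition inner_W :: "('a::euclidean_space \<Rightarrow> complex) \<Rightarrow> ('a \<Rightarrow> complex) \<Rightarrow> complex" where
  "inner_W f g = inner_L2 f g + grad_form f g"

lemma herm_inner_L2_W12: "herm_form W12 (\<lambda>f g x. f x + g x) (\<lambda>c f x. c * f x) inner_L2"
  by (rule herm_form_subset[OF L2.herm_form_axioms]) (auto intro: W12_L2 W12_add W12_scale)

lemma herm_grad_form: "herm_form W12 (\<lambda>f g x. f x + g x) (\<lambda>c f x. c * f x) grad_form"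
  unfolding grad_form_def[abs_def] by (rule herm_form_sum) (auto intro: wgrad_herm)

interpretation W: psd_form W12 "\<lambda>f g x. f x + g x" "\<lambda>c f x. c * f x" inner_W
proof -
  interpret h: herm_form W12 "\<lambda>f g x. f x + g x" "\<lambda>c f x. c * f x" "inner_W :: ('a::euclidean_space \<Rightarrow> complex) \<Rightarrow> _"
    unfolding inner_W_def[abs_def] by (intro herm_form_add herm_inner_L2_W12 herm_grad_form)
  show "psd_form W12 (\<lambda>f g x. f x + g x) (\<lambda>c f x. c * f x) (inner_W :: ('a::euclidean_space \<Rightarrow> complex) \<Rightarrow> _)"
    by unfold_locales (auto simp: inner_W_def grad_form_def inner_L2_self intro!: add_nonneg_nonneg sum_nonneg)
qed

abbreviation "Wr u \<equiv> W.nrm (cr u)"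

abbreviation "W_lim x f \<equiv> (\<lambda>n. W.nrm (\<lambda>t. x n t - f t)) \<longlonglongrightarrow> 0"

lemma W_nrm_sq: "(W.nrm f)\<^sup>2 = (norm_L2 f)\<^sup>2 + (\<Sum>b\<in>Basis. (norm_L2 (wgrad f b))\<^sup>2)"
proof -
  have "Re (inner_W f f) = (norm_L2 f)\<^sup>2 + (\<Sum>b\<in>Basis. (norm_L2 (wgrad f b))\<^sup>2)"
    by (simp add: inner_W_def grad_form_def inner_L2_self)
  thus ?thesis by (simp add: W.nrm_def sum_nonneg)
qed

lemma W_nrm_nonneg [simp]: "0 \<le> W.nrm f"
  using W_nrm_sq[of f] by (simp add: W.nrm_def inner_W_def grad_form_def inner_L2_self sum_nonneg)

lemma norm_L2_le_W: "norm_L2 f \<le> W.nrm f"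
  by (rule power2_le_imp_le) (auto simp: W_nrm_sq sum_nonneg)

lemma norm_wgrad_le_W: "b \<in> Basis \<Longrightarrow> norm_L2 (wgrad f b) \<le> W.nrm f"
proof (rule power2_le_imp_le)
  assume "b \<in> Basis"
  hence "(norm_L2 (wgrad f b))\<^sup>2 \<le> (\<Sum>b\<in>Basis. (norm_L2 (wgrad f b))\<^sup>2)"
    by (intro member_le_sum) auto
  thus "(norm_L2 (wgrad f b))\<^sup>2 \<le> (W.nrm f)\<^sup>2" by (simp add: W_nrm_sq add_increasing)
qed simp

text \<open>Frees the norm from the chosen gradient: it may be computed with any weak derivatives at
  hand, such as classical partial derivatives.\<close>

lemma W_nrm_sq_weak:
  assumes "L2 f" "\<And>b. b \<in> Basis \<Longrightarrow> L2 (g b)" "\<And>b. b \<in> Basis \<Longrightarrow> weak_deriv f b (g b)"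
  shows "(W.nrm f)\<^sup>2 = (norm_L2 f)\<^sup>2 + (\<Sum>b\<in>Basis. (norm_L2 (g b))\<^sup>2)"
proof -
  have W: "W12 f" by (rule W12I[OF assms])
  have "norm_L2 (wgrad f b) = norm_L2 (g b)" if "b \<in> Basis" for b
    by (rule norm_L2_cong_AE[OF wgrad_L2[OF W that] assms(2)[OF that] wgrad_AE[OF W that assms(2)[OF that] assms(3)[OF that]]])
  thus ?thesis by (simp add: W_nrm_sq)
qed

lemma W12_dist2_eq: assumes "W12 f" "W12 g" shows "W12_dist2 f g = (W.nrm (\<lambda>x. f x - g x))\<^sup>2"
proof -
  have "(W.nrm (\<lambda>x. f x - g x))\<^sup>2 = (norm_L2 (\<lambda>x. f x - g x))\<^sup>2 + (\<Sum>b\<in>Basis. (norm_L2 (\<lambda>x. wgrad f b x - wgrad g b x))\<^sup>2)"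
    by (rule W_nrm_sq_weak) (use assms in \<open>auto intro: L2_diff weak_deriv_diff W12_L2 wgrad_L2 wgrad_weak\<close>)
  thus ?thesis by (simp add: W12_dist2_def)
qed

lemma W_tendstoI:
  assumes f: "\<And>n. L2 (f n)" "\<And>n b. b \<in> Basis \<Longrightarrow> L2 (g n b)" "\<And>n b. b \<in> Basis \<Longrightarrow> weak_deriv (f n) b (g n b)"
    and F: "L2 F" "\<And>b. b \<in> Basis \<Longrightarrow> L2 (G b)" "\<And>b. b \<in> Basis \<Longrightarrow> weak_deriv F b (G b)"
    and l: "L2_lim f F" "\<And>b. b \<in> Basis \<Longrightarrow> (\<lambda>n. norm_L2 (\<lambda>x. g n b x - G b x)) \<longlonglongrightarrow> 0"
  shows "W_lim f F"
proof -
  have "(W.nrm (\<lambda>x. f n x - F x))\<^sup>2 = (norm_L2 (\<lambda>x. f n x - F x))\<^sup>2 + (\<Sum>b\<in>Basis. (norm_L2 (\<lambda>x. g n b x - G b x))\<^sup>2)" for n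
    by (rule W_nrm_sq_weak) (use f F in \<open>auto intro: L2_diff weak_deriv_diff\<close>)
  moreover have "(\<lambda>n. (norm_L2 (\<lambda>x. f n x - F x))\<^sup>2 + (\<Sum>b\<in>Basis. (norm_L2 (\<lambda>x. g n b x - G b x))\<^sup>2)) \<longlonglongrightarrow> 0\<^sup>2 + (\<Sum>b\<in>(Basis::'a set). 0\<^sup>2)"
    by (intro tendsto_intros l)
  ultimately have "(\<lambda>n. (W.nrm (\<lambda>x. f n x - F x))\<^sup>2) \<longlonglongrightarrow> 0" by simp
  hence "(\<lambda>n. sqrt ((W.nrm (\<lambda>x. f n x - F x))\<^sup>2)) \<longlonglongrightarrow> sqrt 0" by (intro tendsto_real_sqrt)
  thus ?thesis by simp
qed

text \<open>Function and weak derivatives converge separately in L2; that the limits still belong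
  together is \<open>weak_deriv_lim\<close>.\<close>

lemma W12_complete:
  fixes x :: "nat \<Rightarrow> 'a::euclidean_space \<Rightarrow> complex"
  assumes x: "\<And>n. W12 (x n)"
    and C: "\<And>e. e > 0 \<Longrightarrow> \<exists>N. \<forall>m\<ge>N. \<forall>n\<ge>N. W.nrm (\<lambda>t. x m t - x n t) < e"
  shows "\<exists>u. W12 u \<and> W_lim x u"
proof -
  have "\<exists>f. L2 f \<and> L2_lim x f"
  proof (rule L2_complete)
    show "\<exists>N. \<forall>m\<ge>N. \<forall>n\<ge>N. norm_L2 (\<lambda>t. x m t - x n t) < e" if "e > 0" for e
      using C[OF that] norm_L2_le_W order_le_less_trans by blast
  qed (use x W12_L2 in auto)
  then obtain F where F: "L2 F" "L2_lim x F" by blast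
  have "\<exists>g. L2 g \<and> (\<lambda>n. norm_L2 (\<lambda>t. wgrad (x n) b t - g t)) \<longlonglongrightarrow> 0" if b: "b \<in> Basis" for b
  proof (rule L2_complete)
    show "L2 (wgrad (x n) b)" for n by (rule wgrad_L2[OF x b])
    have eq: "norm_L2 (\<lambda>t. wgrad (x m) b t - wgrad (x n) b t) = norm_L2 (wgrad (\<lambda>t. x m t - x n t) b)" for m n
      by (rule norm_L2_cong_AE) (use wgrad_diff[OF x x b, of m n] x b in \<open>auto intro!: L2_diff wgrad_L2 W12_diff elim: eventually_mono\<close>)
    show "\<exists>N. \<forall>m\<ge>N. \<forall>n\<ge>N. norm_L2 (\<lambda>t. wgrad (x m) b t - wgrad (x n) b t) < e" if "e > 0" for e
      unfolding eq using C[OF that] norm_wgrad_le_W[OF b] order_le_less_trans by blast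
  qed
  then obtain G where G: "\<And>b. b \<in> Basis \<Longrightarrow> L2 (G b)"
    "\<And>b. b \<in> Basis \<Longrightarrow> (\<lambda>n. norm_L2 (\<lambda>t. wgrad (x n) b t - G b t)) \<longlonglongrightarrow> 0" by metis
  have w: "weak_deriv F b (G b)" if b: "b \<in> Basis" for b
    by (rule weak_deriv_lim[OF W12_L2[OF x] F wgrad_L2[OF x b] G(1)[OF b] G(2)[OF b] wgrad_weak[OF x b] b])
  have "W12 F" by (rule W12I[OF F(1) G(1) w])
  moreover have "W_lim x F"
    by (rule W_tendstoI[where g = "\<lambda>n. wgrad (x n)", OF _ _ _ F(1) G(1) w F(2) G(2)])
      (auto intro: W12_L2 wgrad_L2 wgrad_weak x)
  ultimately show ?thesis by blast
qed

section \<open>Density of test functions\<close>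

lemma weak_deriv_test:
  assumes "test_fun u" "b \<in> Basis"
  shows "weak_deriv (cr u) b (cr (partial u b))"
  unfolding weak_deriv_def
proof (intro allI impI)
  fix \<eta> :: "'a \<Rightarrow> real" assume t: "test_fun \<eta>"
  have "(LEBINT x. u x * partial \<eta> b x) = - (LEBINT x. partial u b x * \<eta> x)"
    by (rule integral_by_parts_test[OF test_fun_smooth[OF assms(1)] t assms(2)])
  thus "(LEBINT x. cr u x * cr (partial \<eta> b) x) =
      - (LEBINT x. cr (partial u b) x * cr \<eta> x)"
    by (simp flip: of_real_mult of_real_minus)
qed

lemma W12_test: "test_fun u \<Longrightarrow> W12 (cr u)"
  by (rule W12I[OF test_fun_L2 test_fun_L2[OF test_fun_partial] weak_deriv_test])

lemma wgrad_test: "test_fun u \<Longrightarrow> b \<in> Basis \<Longrightarrow> AE x in lebesgue. wgrad (cr u) b x = cr (partial u b) x"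
  by (intro wgrad_AE W12_test test_fun_L2 test_fun_partial weak_deriv_test)

lemma ctestI: "test_fun u \<Longrightarrow> test_fun v \<Longrightarrow> ctest_fun (\<lambda>x. cr u x + \<i> * cr v x)"
  unfolding ctest_fun_def by blast

lemma W12_ctest: "ctest_fun f \<Longrightarrow> W12 f"
  unfolding ctest_fun_def by (auto intro!: W12_add W12_scale W12_test)

lemma ctest_of_real: "test_fun u \<Longrightarrow> ctest_fun (cr u)"
  using ctestI[OF _ test_fun_zero, of u] by simp

lemma ctest_diff: assumes "ctest_fun f" "ctest_fun g" shows "ctest_fun (\<lambda>x. f x - g x)"
proof -
  obtain u v where f: "test_fun u" "test_fun v" "f = (\<lambda>x. cr u x + \<i> * cr v x)"
    using assms(1) unfolding ctest_fun_def by blast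
  obtain u' v' where g: "test_fun u'" "test_fun v'" "g = (\<lambda>x. complex_of_real (u' x) + \<i> * complex_of_real (v' x))"
    using assms(2) unfolding ctest_fun_def by blast
  have "ctest_fun (\<lambda>x. complex_of_real (u x - u' x) + \<i> * complex_of_real (v x - v' x))"
    by (intro ctestI test_fun_diff f g)
  thus ?thesis by (simp add: f g algebra_simps)
qed

text \<open>The indicator of the ball of radius n, mollified at the fixed scale 1. The transition
  takes place in a shell of fixed width, and the derivatives are bounded, uniformly in n, by the
  maximum of the derivative of the mollifier times the volume of the unit ball.\<close>

lemma cutoff_exists:
  obtains \<theta> :: "nat \<Rightarrow> 'a::euclidean_space \<Rightarrow> real" and C :: real where
    "\<And>n. test_fun (\<theta> n)" "\<And>n x. \<bar>\<theta> n x\<bar> \<le> 1" "\<And>n x. norm x < real n - 1 \<Longrightarrow> \<theta> n x = 1"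
    "\<And>n x b. b \<in> Basis \<Longrightarrow> \<bar>partial (\<theta> n) b x\<bar> \<le> C"
    "\<And>n x b. norm x < real n - 1 \<Longrightarrow> partial (\<theta> n) b x = 0"
proof -
  let ?m = "moll 1 :: 'a \<Rightarrow> real"
  define I where "I n = (\<lambda>y. indicator (cball (0::'a) (real n)) y :: complex)" for n
  have IL: "L2 (I n)" for n unfolding I_def by (rule L2_indicator) auto
  define \<theta> where "\<theta> n x = Re (conv ?m (I n) x)" for n x
  have sm: "smooth (\<theta> n)" for n unfolding \<theta>_def[abs_def] by (rule smooth_conv(1)[OF IL test_fun_moll])
  have int1: "(LEBINT y. ?m (x - y)) = 1" for x
  proof -
    have "(LEBINT y. ?m (x - y)) = (LEBINT y. ?m (- x + y))"
    proof (rule Bochner_Integration.integral_cong[OF refl])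
      fix y show "?m (x - y) = ?m (- x + y)" using moll_symmetric[of 1 "x - y"] by simp
    qed
    also have "\<dots> = integral\<^sup>L lebesgue ?m"
      by (rule integral_translate_lebesgue) (use test_fun_integrable[OF test_fun_moll] in auto)
    finally show ?thesis using integral_moll[of 1, where 'a = 'a] by simp
  qed
  have test: "test_fun (\<theta> n)" for n
  proof (rule test_funI[OF sm])
    fix x :: 'a assume x: "norm x > real n + 1"
    have z: "I n y * complex_of_real (?m (x - y)) = 0" for y
    proof (cases "norm y \<le> real n")
      case True
      hence "norm (x - y) > 1" using x norm_triangle_ineq2[of x y] by simp
      thus ?thesis by (simp add: moll_support)
    qed (simp add: I_def)
    show "\<theta> n x = 0" unfolding \<theta>_def conv_def z by simp
  qed
  have b1: "\<bar>\<theta> n x\<bar> \<le> 1" for n x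
  proof -
    have "\<bar>\<theta> n x\<bar> \<le> cmod (conv ?m (I n) x)" by (simp add: \<theta>_def abs_Re_le_cmod)
    also have "\<dots> \<le> (LEBINT y. ?m (x - y))"
      unfolding conv_def
      by (rule Bochner_Integration.integral_norm_bound_integral[OF conv_integrable[OF IL test_fun_moll]])
        (use test_fun_integrable[OF test_fun_reflect[OF test_fun_moll]] in \<open>auto simp: I_def indicator_def norm_mult moll_nonneg\<close>)
    finally show ?thesis by (simp add: int1)
  qed
  have one: "\<theta> n x = 1" if x: "norm x < real n - 1" for n x
  proof -
    have z: "I n y * complex_of_real (?m (x - y)) = complex_of_real (?m (x - y))" for y
    proof (cases "norm y \<le> real n")
      case False
      hence "norm (x - y) > 1" using x norm_triangle_ineq2[of y x] by (simp add: norm_minus_commute)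
      thus ?thesis by (simp add: moll_support)
    qed (simp add: I_def)
    show "\<theta> n x = 1" unfolding \<theta>_def conv_def z by (simp add: int1)
  qed
  have d0: "partial (\<theta> n) b x = 0" if x: "norm x < real n - 1" for n b x
  proof -
    have "open {x::'a. norm x < real n - 1}" by (simp add: open_Collect_less continuous_intros)
    hence "\<forall>\<^sub>F t in nhds 0. x + t *\<^sub>R b \<in> {x. norm x < real n - 1}"
      using x by (intro topological_tendstoD[of "\<lambda>t. x + t *\<^sub>R b" x]) (auto intro!: tendsto_eq_intros filterlim_ident)
    hence ev: "\<forall>\<^sub>F t in nhds 0. \<theta> n (x + t *\<^sub>R b) = 1"
      by eventually_elim (use one in auto)
    have "((\<lambda>t. \<theta> n (x + t *\<^sub>R b)) has_real_derivative 0) (at 0)"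
      by (rule iffD2[OF DERIV_cong_ev[OF refl ev refl] DERIV_const])
    thus ?thesis by (simp add: partial_def DERIV_imp_deriv)
  qed
  have "\<exists>C. \<forall>n x. \<bar>partial (\<theta> n) b x\<bar> \<le> C" if b: "b \<in> Basis" for b
  proof -
    obtain B where B: "B > 0" "\<And>x. \<bar>partial ?m b x\<bar> \<le> B" using test_fun_bounded[OF test_fun_partial[OF test_fun_moll b]] by metis
    define V where "V = integral\<^sup>L lebesgue (\<lambda>y. B * indicator (cball (0::'a) 1) y)"
    have ci: "integrable lebesgue (\<lambda>y. B * indicator (cball x 1) y)" for x :: 'a
      using lmeasurable_cball[of x 1] unfolding fmeasurable_def by (intro integrable_mult_right integrable_real_indicator) blast+
    have V: "(LEBINT y. B * indicator (cball x 1) y) = V" for x :: 'a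
    proof -
      have "(LEBINT y. B * indicator (cball x 1) y) = (LEBINT y. B * indicator (cball x 1) (x + y))"
        by (rule integral_translate_lebesgue[OF borel_measurable_integrable[OF ci], symmetric])
      also have "(\<lambda>y. B * indicator (cball x 1) (x + y)) = (\<lambda>y. B * indicator (cball 0 1) y)"
        by (auto simp: fun_eq_iff indicator_def dist_norm)
      finally show ?thesis by (simp add: V_def)
    qed
    have "\<bar>partial (\<theta> n) b x\<bar> \<le> V" for n x
    proof -
      have "\<bar>partial (\<theta> n) b x\<bar> \<le> cmod (conv (partial ?m b) (I n) x)"
        unfolding \<theta>_def[abs_def] partial_conv(1)[OF IL test_fun_moll b] by (simp add: abs_Re_le_cmod)
      also have "\<dots> \<le> (LEBINT y. B * indicator (cball x 1) y)"
        unfolding conv_def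
      proof (rule Bochner_Integration.integral_norm_bound_integral[OF conv_integrable[OF IL test_fun_partial[OF test_fun_moll b]] ci])
        fix y
        show "norm (I n y * complex_of_real (partial ?m b (x - y))) \<le> B * indicator (cball x 1) y"
        proof (cases "norm (x - y) \<le> 1")
          case True
          hence "norm (I n y * complex_of_real (partial ?m b (x - y))) \<le> 1 * B"
            unfolding norm_mult using B by (intro mult_mono) (auto simp: I_def indicator_def)
          thus ?thesis using True by (simp add: dist_norm)
        next
          case False
          hence "partial ?m b (x - y) = 0" by (intro partial_support[of 1]) (auto simp: moll_support)
          thus ?thesis using B by simp
        qed
      qed
      finally show ?thesis unfolding V .
    qed
    thus ?thesis by blast
  qed
  then obtain C where C: "\<And>n x b. b \<in> Basis \<Longrightarrow> \<bar>partial (\<theta> n) b x\<bar> \<le> C b" by metis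
  have "\<bar>partial (\<theta> n) b x\<bar> \<le> (\<Sum>b\<in>Basis. C b)" if "b \<in> Basis" for n b and x :: 'a
  proof -
    have "0 \<le> C b'" if "b' \<in> Basis" for b' using C[OF that, of n x] by (meson abs_ge_zero order_trans)
    hence "C b \<le> (\<Sum>b\<in>Basis. C b)" using that by (intro member_le_sum) auto
    thus ?thesis using C[OF that, of n x] by simp
  qed
  thus ?thesis by (intro that[of \<theta> "\<Sum>b\<in>Basis. C b"] test b1 one d0)
qed

text \<open>Leibniz rule: the weak derivative of f is tested with \<theta> \<eta>.\<close>

lemma weak_deriv_mult:
  assumes "L2 f" "L2 g" "weak_deriv f b g" "test_fun \<theta>" "b \<in> Basis"
  shows "weak_deriv (\<lambda>x. cr \<theta> x * f x) b (\<lambda>x. cr \<theta> x * g x + cr (partial \<theta> b) x * f x)"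
  unfolding weak_deriv_def
proof (intro allI impI)
  fix \<eta> :: "'a \<Rightarrow> real" assume t: "test_fun \<eta>"
  note sc = test_fun_smooth[OF assms(4)] test_fun_smooth[OF t]
  have t1: "test_fun (\<lambda>x. \<theta> x * \<eta> x)" by (rule test_fun_mult[OF sc(1) t])
  have t2: "test_fun (\<lambda>x. \<theta> x * partial \<eta> b x)" by (rule test_fun_mult[OF sc(1) test_fun_partial[OF t assms(5)]])
  have t3: "test_fun (\<lambda>x. partial \<theta> b x * \<eta> x)" by (rule test_fun_mult[OF smooth_partial[OF sc(1) assms(5)] t])
  note i = L2_mult_integrable[OF assms(1) test_fun_L2[OF t2]] L2_mult_integrable[OF assms(1) test_fun_L2[OF t3]]
    L2_mult_integrable[OF assms(2) test_fun_L2[OF t1]]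
  have "(LEBINT x. f x * complex_of_real (\<theta> x * partial \<eta> b x)) + (LEBINT x. f x * complex_of_real (partial \<theta> b x * \<eta> x))
     = (LEBINT x. f x * complex_of_real (\<theta> x * partial \<eta> b x) + f x * complex_of_real (partial \<theta> b x * \<eta> x))"
    by (rule Bochner_Integration.integral_add[symmetric]) (use i in auto)
  also have "\<dots> = (LEBINT x. f x * complex_of_real (partial (\<lambda>x. \<theta> x * \<eta> x) b x))"
    unfolding partial_mult[OF sc assms(5)] by (simp add: algebra_simps)
  also have "\<dots> = - (LEBINT x. g x * complex_of_real (\<theta> x * \<eta> x))"
    using assms(3) t1 by (simp add: weak_deriv_def)
  finally have eq: "(LEBINT x. f x * complex_of_real (\<theta> x * partial \<eta> b x)) =
     - ((LEBINT x. g x * complex_of_real (\<theta> x * \<eta> x)) + (LEBINT x. f x * complex_of_real (partial \<theta> b x * \<eta> x)))"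
    by (simp add: eq_neg_iff_add_eq_0 algebra_simps)
  have "(LEBINT x. (cr \<theta> x * g x + cr (partial \<theta> b) x * f x) * cr \<eta> x)
    = (LEBINT x. g x * complex_of_real (\<theta> x * \<eta> x) + f x * complex_of_real (partial \<theta> b x * \<eta> x))"
    by (simp add: algebra_simps)
  also have "\<dots> = (LEBINT x. g x * complex_of_real (\<theta> x * \<eta> x)) + (LEBINT x. f x * complex_of_real (partial \<theta> b x * \<eta> x))"
    by (rule Bochner_Integration.integral_add) (use i in auto)
  finally show "(LEBINT x. cr \<theta> x * f x * cr (partial \<eta> b) x) =
      - (LEBINT x. (cr \<theta> x * g x + cr (partial \<theta> b) x * f x) * cr \<eta> x)"
    using eq by (simp add: mult_ac)
qed

lemma L2_mult_test: assumes "L2 f" "test_fun \<theta>" shows "L2 (\<lambda>x. cr \<theta> x * f x)"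
proof -
  obtain B where "\<And>x. \<bar>\<theta> x\<bar> \<le> B" using test_fun_bounded[OF assms(2)] by metis
  thus ?thesis by (intro L2_mult_bounded[OF assms(1) L2_measurable[OF test_fun_L2[OF assms(2)]], of B]) simp
qed

lemma W12_cutoff:
  fixes f :: "'a::euclidean_space \<Rightarrow> complex"
  assumes f: "W12 f"
  obtains F where "\<And>n::nat. W12 (F n)" "\<And>n. \<exists>R. \<forall>x. norm x > R \<longrightarrow> F n x = 0" "W_lim F f"
proof -
  obtain \<theta> :: "nat \<Rightarrow> 'a \<Rightarrow> real" and C :: real where \<theta>:
    "\<And>n. test_fun (\<theta> n)" "\<And>n x. \<bar>\<theta> n x\<bar> \<le> 1" "\<And>n x. norm x < real n - 1 \<Longrightarrow> \<theta> n x = 1"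
    "\<And>n x b. b \<in> Basis \<Longrightarrow> \<bar>partial (\<theta> n) b x\<bar> \<le> C"
    "\<And>n x b. norm x < real n - 1 \<Longrightarrow> partial (\<theta> n) b x = 0"
    using cutoff_exists by blast
  note fL = W12_L2[OF f]
  define F where "F n x = complex_of_real (\<theta> n x) * f x" for n x
  define G where "G n b x = complex_of_real (\<theta> n x) * wgrad f b x + complex_of_real (partial (\<theta> n) b x) * f x" for n b x
  have FL: "L2 (F n)" for n unfolding F_def by (rule L2_mult_test[OF fL \<theta>(1)])
  have GL: "L2 (G n b)" if "b \<in> Basis" for n b
    unfolding G_def by (intro L2_add L2_mult_test fL \<theta>(1) test_fun_partial wgrad_L2 f that)
  have w: "weak_deriv (F n) b (G n b)" if "b \<in> Basis" for n b
    unfolding F_def G_def by (rule weak_deriv_mult[OF fL wgrad_L2[OF f that] wgrad_weak[OF f that] \<theta>(1) that])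
  have ev: "\<forall>\<^sub>F n in sequentially. norm x < real n - 1" for x :: 'a
  proof -
    obtain N :: nat where "norm x + 1 < real N" using reals_Archimedean2 by blast
    thus ?thesis unfolding eventually_sequentially by (intro exI[of _ N]) auto
  qed
  have lF: "L2_lim F f"
  proof (rule L2_tendsto_dominated[where g = "\<lambda>x. 2 * f x"])
    show "AE x in lebesgue. (\<lambda>n. F n x) \<longlonglongrightarrow> f x"
    proof (rule AE_I2)
      fix x show "(\<lambda>n. F n x) \<longlonglongrightarrow> f x" by (rule tendsto_eventually[OF eventually_mono[OF ev[of x]]]) (simp add: F_def \<theta>(3))
    qed
    show "cmod (F n x - f x) \<le> cmod (2 * f x)" for n x
    proof -
      have "cmod (F n x) \<le> 1 * cmod (f x)" unfolding F_def norm_mult by (intro mult_right_mono) (auto simp: \<theta>)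
      thus ?thesis using norm_triangle_ineq4[of "F n x" "f x"] by (simp add: norm_mult)
    qed
  qed (use FL fL in \<open>auto intro: L2_measurable L2_scale\<close>)
  have lG: "(\<lambda>n. norm_L2 (\<lambda>x. G n b x - wgrad f b x)) \<longlonglongrightarrow> 0" if b: "b \<in> Basis" for b
  proof (rule L2_tendsto_dominated[where g = "\<lambda>x. complex_of_real (2 * cmod (wgrad f b x) + C * cmod (f x))"])
    have C0: "C \<ge> 0" using \<theta>(4)[OF b, of 0 0] by (meson abs_ge_zero order_trans)
    have Ln: "L2 (\<lambda>x. complex_of_real (cmod (h x)))" if "L2 h" for h :: "'a \<Rightarrow> complex" using that by (auto simp: L2_def)
    have "L2 (\<lambda>x. 2 * complex_of_real (cmod (wgrad f b x)) + complex_of_real C * complex_of_real (cmod (f x)))"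
      by (intro L2_add L2_scale Ln fL wgrad_L2 f b)
    thus "L2 (\<lambda>x. complex_of_real (2 * cmod (wgrad f b x) + C * cmod (f x)))" by simp
    show "AE x in lebesgue. (\<lambda>n. G n b x) \<longlonglongrightarrow> wgrad f b x"
    proof (rule AE_I2)
      fix x show "(\<lambda>n. G n b x) \<longlonglongrightarrow> wgrad f b x" by (rule tendsto_eventually[OF eventually_mono[OF ev[of x]]]) (simp add: G_def \<theta>(3,5))
    qed
    show "cmod (G n b x - wgrad f b x) \<le> cmod (complex_of_real (2 * cmod (wgrad f b x) + C * cmod (f x)))" for n x
    proof -
      have 1: "cmod (complex_of_real (\<theta> n x) * wgrad f b x) \<le> 1 * cmod (wgrad f b x)"
        unfolding norm_mult by (intro mult_right_mono) (auto simp: \<theta>)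
      have 2: "cmod (complex_of_real (partial (\<theta> n) b x) * f x) \<le> C * cmod (f x)"
        unfolding norm_mult by (intro mult_right_mono) (auto simp: \<theta>(4)[OF b])
      have "cmod (G n b x - wgrad f b x) \<le> cmod (wgrad f b x) + C * cmod (f x) + cmod (wgrad f b x)"
        unfolding G_def using 1 2 norm_triangle_ineq[of "complex_of_real (\<theta> n x) * wgrad f b x" "complex_of_real (partial (\<theta> n) b x) * f x"]
          norm_triangle_ineq4[of "complex_of_real (\<theta> n x) * wgrad f b x + complex_of_real (partial (\<theta> n) b x) * f x" "wgrad f b x"] by linarith
      also have "\<dots> = \<bar>2 * cmod (wgrad f b x) + C * cmod (f x)\<bar>" using C0 by simp
      finally show ?thesis by (simp only: norm_of_real)
    qed
  qed (use GL wgrad_L2[OF f] b in \<open>auto intro: L2_measurable\<close>)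
  have "W_lim F f"
    by (rule W_tendstoI[OF FL GL w fL wgrad_L2[OF f] wgrad_weak[OF f] lF lG])
  moreover have "\<exists>R. \<forall>x. norm x > R \<longrightarrow> F n x = 0" for n
    using test_fun_support[OF \<theta>(1)[of n]] by (metis F_def mult_zero_left of_real_0)
  moreover have "W12 (F n)" for n by (rule W12I[OF FL GL w])
  ultimately show ?thesis using that by blast
qed

lemma ctest_conv:
  fixes F :: "'a::euclidean_space \<Rightarrow> complex"
  assumes F: "L2 F" and R: "\<And>x. norm x > R \<Longrightarrow> F x = 0" and r: "r > 0"
  shows "ctest_fun (conv (moll r) F)"
proof -
  have z: "conv (moll r) F x = 0" if "norm x > R + r" for x
  proof -
    have "F y * complex_of_real (moll r (x - y)) = 0" for y
    proof (cases "norm y > R")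
      case False
      hence "norm (x - y) > r" using that norm_triangle_ineq2[of x y] by simp
      thus ?thesis by (simp add: moll_support)
    qed (simp add: R)
    thus ?thesis by (simp only: conv_def integral_zero)
  qed
  have "test_fun (\<lambda>x. Re (conv (moll r) F x))" "test_fun (\<lambda>x. Im (conv (moll r) F x))"
    by (rule test_funI[OF smooth_conv(1)[OF F test_fun_moll], of "R + r"], simp add: z)
      (rule test_funI[OF smooth_conv(2)[OF F test_fun_moll], of "R + r"], simp add: z)
  from ctestI[OF this] show ?thesis by (simp add: complex_eq[symmetric])
qed

text \<open>The derivative falls on the reflected kernel, which as a function of y is an admissible
  test function for the weak derivative of F. So mollification commutes with it, and one
  approximation result serves functions and gradients.\<close>

lemma conv_weak_deriv:
  fixes F :: "'a::euclidean_space \<Rightarrow> complex"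
  assumes F: "L2 F" and G: "L2 G" and w: "weak_deriv F b G" and b: "b \<in> Basis" and R: "\<And>x. norm x > R \<Longrightarrow> F x = 0" and r: "r > 0"
  shows "weak_deriv (conv (moll r) F) b (conv (moll r) G)"
proof -
  have eq: "conv (partial (moll r) b) F x = conv (moll r) G x" for x
  proof -
    have "(LEBINT y. F y * complex_of_real (partial (\<lambda>y. moll r (x - y)) b y)) = - (LEBINT y. G y * complex_of_real (moll r (x - y)))"
      using w test_fun_reflect[OF test_fun_moll, of r x] unfolding weak_deriv_def by blast
    thus ?thesis by (simp add: conv_def smooth_reflect(2)[OF test_fun_smooth[OF test_fun_moll] b])
  qed
  have z: "conv (moll r) F x = 0" if "norm x > R + r" for x
  proof -
    have "F y * complex_of_real (moll r (x - y)) = 0" for y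
    proof (cases "norm y > R")
      case False
      hence "norm (x - y) > r" using that norm_triangle_ineq2[of x y] by simp
      thus ?thesis by (simp add: moll_support)
    qed (simp add: R)
    thus ?thesis by (simp only: conv_def integral_zero)
  qed
  have tR: "test_fun (\<lambda>x. Re (conv (moll r) F x))"
    by (rule test_funI[OF smooth_conv(1)[OF F test_fun_moll], of "R + r"]) (simp add: z)
  have tI: "test_fun (\<lambda>x. Im (conv (moll r) F x))"
    by (rule test_funI[OF smooth_conv(2)[OF F test_fun_moll], of "R + r"]) (simp add: z)
  have "weak_deriv (\<lambda>x. complex_of_real (Re (conv (moll r) F x)) + \<i> * complex_of_real (Im (conv (moll r) F x))) b
     (\<lambda>x. complex_of_real (partial (\<lambda>x. Re (conv (moll r) F x)) b x) + \<i> * complex_of_real (partial (\<lambda>x. Im (conv (moll r) F x)) b x))"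
    by (intro weak_deriv_add weak_deriv_scale weak_deriv_test L2_scale test_fun_L2 test_fun_partial tR tI b)
  thus ?thesis by (simp add: partial_conv[OF F test_fun_moll b] eq complex_eq[symmetric])
qed

text \<open>Cutting off comes before mollifying, since the mollification has bounded support only if
  the function has.\<close>

theorem ctest_dense:
  fixes f :: "'a::euclidean_space \<Rightarrow> complex"
  assumes f: "W12 f" and e: "e > 0"
  shows "\<exists>\<phi>. ctest_fun \<phi> \<and> W.nrm (\<lambda>x. \<phi> x - f x) < e"
proof -
  obtain F where F: "\<And>n::nat. W12 (F n)" "\<And>n. \<exists>R. \<forall>x. norm x > R \<longrightarrow> F n x = 0" "W_lim F f"
    using W12_cutoff[OF f] by blast
  have "e / 2 > 0" using e by simp
  then obtain n where n: "W.nrm (\<lambda>x. F n x - f x) < e / 2"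
    using eventually_happens'[OF sequentially_bot order_tendstoD(2)[OF F(3)]] by blast
  obtain R where R: "\<And>x. norm x > R \<Longrightarrow> F n x = 0" using F(2) by blast
  note FL = W12_L2[OF F(1)[of n]] and GL = wgrad_L2[OF F(1)[of n]] and w = wgrad_weak[OF F(1)[of n]]
  define c where "c m = conv (moll (1 / real (Suc m))) (F n)" for m
  define d where "d m b = conv (moll (1 / real (Suc m))) (wgrad (F n) b)" for m b
  have conv_lim: "(\<lambda>m. norm_L2 (\<lambda>x. conv (moll (1 / real (Suc m))) h x - h x)) \<longlonglongrightarrow> 0 \<and> (\<exists>M. \<forall>m\<ge>M. L2 (conv (moll (1 / real (Suc m))) h))"
    if h: "L2 h" for h :: "'a \<Rightarrow> complex"
  proof
    have ev: "\<exists>M. \<forall>m\<ge>M. L2 (conv (moll (1 / real (Suc m))) h) \<and> norm_L2 (\<lambda>x. conv (moll (1 / real (Suc m))) h x - h x) \<le> s" if s: "s > 0" for s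
    proof -
      obtain \<delta> where \<delta>: "\<delta> > 0" "\<And>r. 0 < r \<Longrightarrow> r < \<delta> \<Longrightarrow> L2 (conv (moll r) h) \<and> norm_L2 (\<lambda>x. conv (moll r) h x - h x) \<le> s"
        using conv_moll_approx[OF h s] by blast
      obtain M where M: "inverse (real (Suc M)) < \<delta>" using reals_Archimedean[OF \<delta>(1)] by blast
      have "1 / real (Suc m) < \<delta>" if "m \<ge> M" for m
      proof -
        have "inverse (real (Suc m)) \<le> inverse (real (Suc M))" using that by (intro le_imp_inverse_le) auto
        thus ?thesis using M by (simp add: inverse_eq_divide)
      qed
      thus ?thesis using \<delta>(2) by (intro exI[of _ M]) auto
    qed
    show "(\<lambda>m. norm_L2 (\<lambda>x. conv (moll (1 / real (Suc m))) h x - h x)) \<longlonglongrightarrow> 0"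
    proof (rule LIMSEQ_I)
      fix s :: real assume "s > 0"
      then obtain M where "\<forall>m\<ge>M. norm_L2 (\<lambda>x. conv (moll (1 / real (Suc m))) h x - h x) \<le> s / 2" using ev[of "s / 2"] by auto
      thus "\<exists>M. \<forall>m\<ge>M. norm (norm_L2 (\<lambda>x. conv (moll (1 / real (Suc m))) h x - h x) - 0) < s"
        using \<open>s > 0\<close> by (intro exI[of _ M]) (auto intro: order_le_less_trans)
    qed
    show "\<exists>M. \<forall>m\<ge>M. L2 (conv (moll (1 / real (Suc m))) h)" using ev[of 1] by auto
  qed
  have "\<exists>M. \<forall>m\<ge>M. L2 (d m b)" if "b \<in> Basis" for b
    unfolding d_def using conv_lim[OF GL[OF that]] by blast
  then obtain M where M: "\<And>b m. b \<in> Basis \<Longrightarrow> m \<ge> M b \<Longrightarrow> L2 (d m b)" by metis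
  \<comment> \<open>The mollified gradients are known to lie in L2 only from some index on, which
    depends on the direction; the sequence is shifted beyond all these indices.\<close>
  define K where "K = (\<Sum>b\<in>Basis. M b)"
  have K: "M b \<le> K" if "b \<in> Basis" for b unfolding K_def using that by (intro member_le_sum) auto
  have ct: "ctest_fun (c m)" for m unfolding c_def by (rule ctest_conv[OF FL R]) auto
  have "(\<lambda>m. W.nrm (\<lambda>x. c (m + K) x - F n x)) \<longlonglongrightarrow> 0"
  proof (rule W_tendstoI[where g = "\<lambda>m b. d (m + K) b" and G = "wgrad (F n)"])
    show "L2 (c (m + K))" for m using W12_L2[OF W12_ctest[OF ct]] .
    show "L2 (d (m + K) b)" if "b \<in> Basis" for m b using M[OF that] K[OF that] by (simp add: trans_le_add2)
    show "weak_deriv (c (m + K)) b (d (m + K) b)" if "b \<in> Basis" for m b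
      unfolding c_def d_def by (rule conv_weak_deriv[OF FL GL[OF that] w[OF that] that R]) auto
    have "(\<lambda>m. norm_L2 (\<lambda>x. c m x - F n x)) \<longlonglongrightarrow> 0" unfolding c_def using conv_lim[OF FL] by blast
    thus "(\<lambda>m. norm_L2 (\<lambda>x. c (m + K) x - F n x)) \<longlonglongrightarrow> 0" by (rule LIMSEQ_ignore_initial_segment)
    show "(\<lambda>m. norm_L2 (\<lambda>x. d (m + K) b x - wgrad (F n) b x)) \<longlonglongrightarrow> 0" if "b \<in> Basis" for b
    proof -
      have "(\<lambda>m. norm_L2 (\<lambda>x. d m b x - wgrad (F n) b x)) \<longlonglongrightarrow> 0" unfolding d_def using conv_lim[OF GL[OF that]] by blast
      thus ?thesis by (rule LIMSEQ_ignore_initial_segment)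
    qed
  qed (use FL GL w in auto)
  from eventually_happens'[OF sequentially_bot order_tendstoD(2)[OF this \<open>e / 2 > 0\<close>]]
  obtain m where m: "W.nrm (\<lambda>x. c (m + K) x - F n x) < e / 2" by blast
  have "W.nrm (\<lambda>x. (c (m + K) x - F n x) + (F n x - f x)) \<le> W.nrm (\<lambda>x. c (m + K) x - F n x) + W.nrm (\<lambda>x. F n x - f x)"
    by (rule W.nrm_add) (auto intro: W12_diff W12_ctest ct F f)
  hence "W.nrm (\<lambda>x. c (m + K) x - f x) < e" using m n by simp
  thus ?thesis using ct by blast
qed

corollary ctest_dense_seq:
  assumes "W12 f" obtains \<phi> where "\<And>n::nat. ctest_fun (\<phi> n)" "(\<lambda>n. W.nrm (\<lambda>x. \<phi> n x - f x)) \<longlonglongrightarrow> 0"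
proof -
  have "\<exists>\<phi>. ctest_fun \<phi> \<and> W.nrm (\<lambda>x. \<phi> x - f x) < inverse (real (Suc n))" for n
    by (rule ctest_dense[OF assms]) simp
  then obtain \<phi> where \<phi>: "\<And>n. ctest_fun (\<phi> n)" "\<And>n. W.nrm (\<lambda>x. \<phi> n x - f x) < inverse (real (Suc n))" by metis
  have "(\<lambda>n. W.nrm (\<lambda>x. \<phi> n x - f x)) \<longlonglongrightarrow> 0"
    by (rule Lim_null_comparison[OF _ LIMSEQ_inverse_real_of_nat]) (use \<phi>(2) in \<open>simp add: less_imp_le del: of_nat_Suc\<close>)
  with \<phi>(1) that show ?thesis by blast
qed

section \<open>The ground state of the two point interactions\<close>

lemma bb_integrable:
  fixes f :: "'a::euclidean_space \<Rightarrow> real"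
  assumes "f \<in> borel_measurable borel" "\<And>x. \<bar>f x\<bar> \<le> B" "\<And>x. norm x > R \<Longrightarrow> f x = 0"
  shows "integrable lborel f"
proof (rule Bochner_Integration.integrable_bound)
  show "integrable lborel (\<lambda>x::'a. indicator (cball 0 R) x * B)"
    by (intro integrable_mult_left integrable_real_indicator) (auto simp: emeasure_bounded_finite[OF bounded_cball, unfolded infinity_ennreal_def])
  show "AE x in lborel. norm (f x) \<le> norm (indicator (cball 0 R) x * B)"
  proof (rule AE_I2)
    fix x show "norm (f x) \<le> norm (indicator (cball 0 R) x * B)"
      using assms(2)[of x] assms(3)[of x] by (cases "norm x \<le> R") auto
  qed
qed (use assms in simp)

lemma test_fun_measurable [measurable_dest]: "test_fun f \<Longrightarrow> f \<in> borel_measurable borel"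
  by (rule borel_measurable_continuous_onI[OF test_fun_continuous])

lemma integral_lebesgue_lborel:
  fixes f :: "'a::euclidean_space \<Rightarrow> 'b::{banach, second_countable_topology}"
  shows "f \<in> borel_measurable borel \<Longrightarrow> integral\<^sup>L lebesgue f = integral\<^sup>L lborel f"
  by (rule integral_completion) simp

lemma integral_cauchy_schwarz_set:
  fixes f :: "'a::euclidean_space \<Rightarrow> real"
  assumes S: "S \<in> sets borel" "emeasure lborel S < \<infinity>"
    and i: "integrable lborel (\<lambda>x. indicator S x * f x)" "integrable lborel (\<lambda>x. indicator S x * (f x)\<^sup>2)"
  shows "(LBINT x. indicator S x * f x)\<^sup>2 \<le> measure lborel S * (LBINT x. indicator S x * (f x)\<^sup>2)"
proof -
  define M A B where "M = measure lborel S" and "A = (LBINT x. indicator S x * f x)" and "B = (LBINT x. indicator S x * (f x)\<^sup>2)"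
  have iS: "integrable lborel (\<lambda>x. indicator S x :: real)" using S by (intro integrable_real_indicator) auto
  have IS: "(LBINT x. indicator S x) = M" by (simp add: M_def)
  have q: "0 \<le> M * t\<^sup>2 - 2 * t * A + B" for t
  proof -
    have "0 \<le> (LBINT x. indicator S x * (t - f x)\<^sup>2)" by (intro integral_nonneg_AE) auto
    also have "\<dots> = (LBINT x. indicator S x * t\<^sup>2 - (2 * t) * (indicator S x * f x) + indicator S x * (f x)\<^sup>2)"
      by (intro Bochner_Integration.integral_cong) (auto simp: power2_diff algebra_simps)
    also have "\<dots> = (LBINT x. indicator S x * t\<^sup>2 - (2 * t) * (indicator S x * f x)) + B"
      unfolding B_def by (intro Bochner_Integration.integral_add Bochner_Integration.integrable_diff integrable_mult_left integrable_mult_right iS i)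
    also have "(LBINT x. indicator S x * t\<^sup>2 - (2 * t) * (indicator S x * f x)) = (LBINT x. indicator S x * t\<^sup>2) - (LBINT x. (2 * t) * (indicator S x * f x))"
      by (intro Bochner_Integration.integral_diff integrable_mult_left integrable_mult_right iS i)
    also have "(LBINT x. indicator S x * t\<^sup>2) = M * t\<^sup>2" by (simp add: M_def)
    also have "(LBINT x. (2 * t) * (indicator S x * f x)) = 2 * t * A" unfolding A_def by (rule integral_mult_right_zero)
    finally show ?thesis .
  qed
  have "M \<ge> 0" "B \<ge> 0" by (auto simp: M_def B_def intro!: integral_nonneg_AE)
  have "A\<^sup>2 \<le> M * B"
  proof (cases "M = 0")
    case True
    have "A = 0"
    proof (rule ccontr)
      assume "A \<noteq> 0"
      thus False using q[of "(B + 1) / A"] True \<open>B \<ge> 0\<close> by simp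
    qed
    thus ?thesis using True by simp
  next
    case False
    hence "M > 0" using \<open>M \<ge> 0\<close> by simp
    have "0 \<le> B - A\<^sup>2 / M" using q[of "A / M"] \<open>M > 0\<close> by (simp add: power2_eq_square field_simps)
    thus ?thesis using \<open>M > 0\<close> by (simp add: field_simps)
  qed
  thus ?thesis by (simp add: A_def B_def M_def)
qed

lemma interval_integrable:
  fixes f :: "real \<Rightarrow> real"
  assumes "continuous_on UNIV f" shows "integrable lborel (\<lambda>x. indicator {p..q} x * f x)"
  using borel_integrable_compact[of "{p..q}" f] continuous_on_subset[OF assms] by auto

text \<open>Fundamental theorem of calculus and Cauchy-Schwarz. Both the trace inequality and the
  Poincare inequality on squares rest on it.\<close>

lemma difference_sq_le:
  fixes g g' :: "real \<Rightarrow> real"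
  assumes d: "\<And>x. (g has_real_derivative g' x) (at x)" and c: "continuous_on UNIV g'"
    and xy: "x \<in> {p..p+h}" "y \<in> {p..p+h}" and h: "h > 0"
  shows "(g x - g y)\<^sup>2 \<le> h * (LBINT t. indicator {p..p+h} t * (g' t)\<^sup>2)"
proof -
  have main: "(g v - g u)\<^sup>2 \<le> h * (LBINT t. indicator {p..p+h} t * (g' t)\<^sup>2)" if uv: "p \<le> u" "u \<le> v" "v \<le> p + h" for u v
  proof -
    have "(LBINT t. indicator {u..v} t * g' t) = g v - g u"
      using integral_FTC_Icc_real[of u v g g'] uv d c by (simp add: mult.commute continuous_on_eq_continuous_at)
    hence "(g v - g u)\<^sup>2 = (LBINT t. indicator {u..v} t * g' t)\<^sup>2" by simp
    also have "\<dots> \<le> measure lborel {u..v} * (LBINT t. indicator {u..v} t * (g' t)\<^sup>2)"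
      by (rule integral_cauchy_schwarz_set) (auto intro!: interval_integrable continuous_intros c simp: emeasure_lborel_Icc_eq)
    also have "\<dots> \<le> h * (LBINT t. indicator {p..p+h} t * (g' t)\<^sup>2)"
    proof (rule mult_mono)
      show "(LBINT t. indicator {u..v} t * (g' t)\<^sup>2) \<le> (LBINT t. indicator {p..p+h} t * (g' t)\<^sup>2)"
      proof (rule integral_mono[OF interval_integrable interval_integrable])
        show "indicator {u..v} t * (g' t)\<^sup>2 \<le> indicator {p..p+h} t * (g' t)\<^sup>2" for t
          using uv by (auto simp: indicator_def)
      qed (intro continuous_intros c)+
    qed (use uv h in \<open>auto intro!: integral_nonneg_AE\<close>)
    finally show ?thesis .
  qed
  show ?thesis
  proof (cases "x \<le> y")
    case True
    thus ?thesis using main[of x y] xy by (simp add: power2_commute)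
  next
    case False
    thus ?thesis using main[of y x] xy by simp
  qed
qed

text \<open>The inequality g(p)^2 \<le> 2 g(t)^2 + 2 (g(p) - g(t))^2, averaged over t in an interval
  of length h. The free h matters: small h gives the derivative a small coefficient at the cost of a
  large one for g.\<close>

lemma trace_1d:
  fixes g g' :: "real \<Rightarrow> real"
  assumes d: "\<And>x. (g has_real_derivative g' x) (at x)" and c: "continuous_on UNIV g'" and h: "h > 0"
  shows "(g p)\<^sup>2 \<le> (2 / h) * (LBINT t. indicator {p..p+h} t * (g t)\<^sup>2) + 2 * h * (LBINT t. indicator {p..p+h} t * (g' t)\<^sup>2)"
proof -
  define A where "A = (LBINT t. indicator {p..p+h} t * (g' t)\<^sup>2)"
  have gc: "continuous_on UNIV g" using d by (auto intro!: continuous_at_imp_continuous_on DERIV_isCont)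
  have pt: "indicator {p..p+h} t * (g p)\<^sup>2 \<le> indicator {p..p+h} t * (2 * (g t)\<^sup>2 + 2 * (h * A))" for t
  proof (cases "t \<in> {p..p+h}")
    case True
    have "(g p - g t)\<^sup>2 \<le> h * A" unfolding A_def by (rule difference_sq_le[OF d c _ True h]) (use h in auto)
    moreover have "(g p)\<^sup>2 \<le> 2 * (g t)\<^sup>2 + 2 * (g p - g t)\<^sup>2"
    proof -
      have "0 \<le> (2 * g t - g p)\<^sup>2" by simp
      thus ?thesis by (simp add: power2_eq_square algebra_simps)
    qed
    ultimately show ?thesis using True by simp
  qed simp
  have "(LBINT t. indicator {p..p+h} t * (g p)\<^sup>2) \<le> (LBINT t. indicator {p..p+h} t * (2 * (g t)\<^sup>2 + 2 * (h * A)))"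
    by (rule integral_mono[OF interval_integrable interval_integrable pt]) (intro continuous_intros gc)+
  also have "(LBINT t. indicator {p..p+h} t * (2 * (g t)\<^sup>2 + 2 * (h * A)))
     = (LBINT t. 2 * (indicator {p..p+h} t * (g t)\<^sup>2) + indicator {p..p+h} t * (2 * (h * A)))"
    by (intro Bochner_Integration.integral_cong) (auto simp: algebra_simps)
  also have "\<dots> = (LBINT t. 2 * (indicator {p..p+h} t * (g t)\<^sup>2)) + (LBINT t. indicator {p..p+h} t * (2 * (h * A)))"
    by (intro Bochner_Integration.integral_add integrable_mult_right interval_integrable continuous_intros gc)
  also have "(LBINT t. indicator {p..p+h} t * (2 * (h * A))) = h * (2 * (h * A))"
    using h by simp
  also have "(LBINT t. indicator {p..p+h} t * (g p)\<^sup>2) = h * (g p)\<^sup>2" using h by simp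
  finally have "h * (g p)\<^sup>2 \<le> 2 * (LBINT t. indicator {p..p+h} t * (g t)\<^sup>2) + h * (2 * (h * A))" by simp
  hence "(g p)\<^sup>2 \<le> (2 * (LBINT t. indicator {p..p+h} t * (g t)\<^sup>2) + h * (2 * (h * A))) / h"
    using h by (simp add: field_simps)
  thus ?thesis using h by (simp add: A_def add_divide_distrib)
qed

text \<open>The common shape of \<open>w\<close>, its derivative and the ground state, so that
  integration by parts with its jump terms is carried out only once.\<close>

definition cut3 :: "real \<Rightarrow> (real \<Rightarrow> real) \<Rightarrow> (real \<Rightarrow> real) \<Rightarrow> (real \<Rightarrow> real) \<Rightarrow> real \<Rightarrow> real" where
  "cut3 a p1 p2 p3 x = (if x < - a then p1 x else if x \<le> a then p2 x else p3 x)"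

lemma cut3_measurable:
  assumes "continuous_on UNIV p1" "continuous_on UNIV p2" "continuous_on UNIV p3"
  shows "cut3 a p1 p2 p3 \<in> borel_measurable borel"
  unfolding cut3_def[abs_def]
  using assms[THEN borel_measurable_continuous_onI] by measurable

lemma cut3_integrable:
  assumes p: "continuous_on UNIV p1" "continuous_on UNIV p2" "continuous_on UNIV p3" and g: "test_fun g"
  shows "integrable lborel (\<lambda>x. cut3 a p1 p2 p3 x * g x)"
proof -
  obtain R where R: "\<And>x. norm x > R \<Longrightarrow> g x = 0" using test_fun_support[OF g] by metis
  have i: "integrable lborel (\<lambda>x. indicator S x * (p x * g x))" if "continuous_on UNIV p" "S \<in> sets borel" for p S
    using integrable_mult_indicator[of S lborel "\<lambda>x. p x * g x"] cc_integrable(1)[of "\<lambda>x. p x * g x" R] R that test_fun_continuous[OF g]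
    by (auto intro: continuous_on_mult)
  have "integrable lborel (\<lambda>x. indicator {..<-a} x * (p1 x * g x) + (indicator ({-a..} \<inter> {..a}) x * (p2 x * g x) + indicator ({-a..} \<inter> {a<..}) x * (p3 x * g x)))"
    by (intro Bochner_Integration.integrable_add i p) auto
  moreover have "(\<lambda>x. indicator {..<-a} x * (p1 x * g x) + (indicator ({-a..} \<inter> {..a}) x * (p2 x * g x) + indicator ({-a..} \<inter> {a<..}) x * (p3 x * g x))) = (\<lambda>x. cut3 a p1 p2 p3 x * g x)"
    by (auto simp: fun_eq_iff cut3_def indicator_def)
  ultimately show ?thesis by simp
qed

text \<open>The fundamental theorem on three intervals, the outer ones reaching beyond the support
  of g. The boundary terms at -a and a do not cancel when the pieces disagree: a jump of the
  function becomes a point value of g.\<close>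

lemma cut3_by_parts:
  assumes a: "a > 0"
    and d: "\<And>x. (p1 has_real_derivative p1' x) (at x)" "\<And>x. (p2 has_real_derivative p2' x) (at x)" "\<And>x. (p3 has_real_derivative p3' x) (at x)"
    and c: "continuous_on UNIV p1'" "continuous_on UNIV p2'" "continuous_on UNIV p3'" and g: "test_fun g"
  shows "(LBINT x. cut3 a p1 p2 p3 x * partial g 1 x) =
     (p1 (-a) - p2 (-a)) * g (-a) + (p2 a - p3 a) * g a - (LBINT x. cut3 a p1' p2' p3' x * g x)"
proof -
  have pc: "continuous_on UNIV p1" "continuous_on UNIV p2" "continuous_on UNIV p3"
    using d by (auto intro!: continuous_at_imp_continuous_on DERIV_isCont)
  obtain R where R: "R > 0" "\<And>x. norm x > R \<Longrightarrow> g x = 0" using test_fun_support[OF g] by metis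
  define M where "M = R + a + 1"
  have M: "M > a" "g M = 0" "g (- M) = 0" using R a by (auto simp: M_def)
  have gd: "(g has_real_derivative partial g 1 x) (at x)" for x by (rule smooth_real_deriv[OF test_fun_smooth[OF g]])
  have gt: "test_fun (partial g 1)" by (rule test_fun_partial[OF g]) simp
  define F where "F x = cut3 a p1 p2 p3 x * partial g 1 x + cut3 a p1' p2' p3' x * g x" for x
  have piece: "((\<lambda>x. p x * partial g 1 x + p' x * g x) has_integral (p v * g v - p u * g u)) {u..v}"
    if "u \<le> v" "\<And>x. (p has_real_derivative p' x) (at x)" for p p' u v
  proof (rule fundamental_theorem_of_calculus[OF that(1)])
    fix x
    have "((\<lambda>x. p x * g x) has_real_derivative p x * partial g 1 x + p' x * g x) (at x)"
      using DERIV_mult[OF that(2) gd, of x] by (simp add: algebra_simps)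
    thus "((\<lambda>x. p x * g x) has_vector_derivative p x * partial g 1 x + p' x * g x) (at x within {u..v})"
      by (simp add: has_real_derivative_iff_has_vector_derivative has_vector_derivative_at_within)
  qed
  \<comment> \<open>At -a and a the middle branch is in force, so on the outer intervals the
    integrand differs from the smooth one in an end point.\<close>
  have 1: "(F has_integral (p1 (-a) * g (-a) - p1 (-M) * g (-M))) {-M..-a}"
    by (rule has_integral_spike_finite[OF _ _ piece[OF _ d(1)], of "{-a}"]) (use M a in \<open>auto simp: F_def cut3_def\<close>)
  have 2: "(F has_integral (p2 a * g a - p2 (-a) * g (-a))) {-a..a}"
    by (rule has_integral_spike_finite[OF _ _ piece[OF _ d(2)], of "{}"]) (use M a in \<open>auto simp: F_def cut3_def\<close>)
  have 3: "(F has_integral (p3 M * g M - p3 a * g a)) {a..M}"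
    by (rule has_integral_spike_finite[OF _ _ piece[OF _ d(3)], of "{a}"]) (use M a in \<open>auto simp: F_def cut3_def\<close>)
  have "(F has_integral (p1 (-a) * g (-a) - p1 (-M) * g (-M)) + (p2 a * g a - p2 (-a) * g (-a)) + (p3 M * g M - p3 a * g a)) {-M..M}"
    by (rule has_integral_combine[OF _ _ has_integral_combine[OF _ _ 1 2] 3]) (use M a in auto)
  hence "(F has_integral (p1 (-a) - p2 (-a)) * g (-a) + (p2 a - p3 a) * g a) {-M..M}"
    by (simp add: M algebra_simps)
  hence hF: "(F has_integral (p1 (-a) - p2 (-a)) * g (-a) + (p2 a - p3 a) * g a) UNIV"
  proof (rule has_integral_on_superset)
    fix x assume "x \<notin> {-M..M}"
    hence "norm x > R" using a by (auto simp: M_def)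
    thus "F x = 0" using R(2) partial_support[of R g x 1] by (simp add: F_def)
  qed auto
  note i = cut3_integrable[OF pc gt, of a] cut3_integrable[OF c g, of a]
  have "integrable lborel F" unfolding F_def[abs_def] using i by (rule Bochner_Integration.integrable_add)
  hence "(F has_integral (integral\<^sup>L lborel F)) UNIV" by (rule has_integral_integral_lborel)
  with hF have "integral\<^sup>L lborel F = (p1 (-a) - p2 (-a)) * g (-a) + (p2 a - p3 a) * g a"
    using has_integral_unique by blast
  moreover have "integral\<^sup>L lborel F = (LBINT x. cut3 a p1 p2 p3 x * partial g 1 x) + (LBINT x. cut3 a p1' p2' p3' x * g x)"
    unfolding F_def[abs_def] using i by (rule Bochner_Integration.integral_add)
  ultimately show ?thesis by simp
qed

section \<open>Completion of the square on the line\<close>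

lemma ex_kappa:
  assumes "a > 0" "\<alpha> > 0"
  obtains \<kappa> :: real where "\<kappa> > 0" "\<kappa> * (1 + tanh (\<kappa> * a)) = \<alpha>"
proof -
  have "\<exists>x. 0 \<le> x \<and> x \<le> \<alpha> \<and> x * (1 + tanh (x * a)) = \<alpha>"
  proof (rule IVT')
    have "0 \<le> tanh (\<alpha> * a)" using assms by simp
    thus "\<alpha> \<le> \<alpha> * (1 + tanh (\<alpha> * a))" using assms by simp
    show "continuous_on {0..\<alpha>} (\<lambda>x. x * (1 + tanh (x * a)))"
      by (intro continuous_intros) (auto simp: cosh_real_nonzero)
  qed (use assms in auto)
  then obtain x where x: "0 \<le> x" "x * (1 + tanh (x * a)) = \<alpha>" by blast
  hence "x > 0" using assms by (cases "x = 0") auto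
  with x that show ?thesis by blast
qed

locale point_int =
  fixes a \<alpha> \<kappa> :: real
  assumes a: "a > 0" and \<alpha>: "\<alpha> > 0" and \<kappa>: "\<kappa> > 0" and kap: "\<kappa> * (1 + tanh (\<kappa> * a)) = \<alpha>"
begin

definition w :: "real \<Rightarrow> real" where
  "w = cut3 a (\<lambda>_. \<kappa>) (\<lambda>x. \<kappa> * tanh (\<kappa> * x)) (\<lambda>_. - \<kappa>)"

text \<open>\<open>w\<close> is the logarithmic derivative of the ground state, which \<open>ann\<close> therefore annihilates.\<close>

abbreviation ann :: "(real \<Rightarrow> real) \<Rightarrow> real \<Rightarrow> real" where
  "ann u x \<equiv> partial u 1 x - w x * u x"

abbreviation ann2 :: "(plane \<Rightarrow> real) \<Rightarrow> plane \<Rightarrow> real" where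
  "ann2 u z \<equiv> partial u (0, 1) z - w (snd z) * u z"

text \<open>The derivative of \<open>w\<close> away from the two points; the jumps at the points
  enter through \<open>w_by_parts\<close>.\<close>

definition w' :: "real \<Rightarrow> real" where
  "w' = cut3 a (\<lambda>_. 0) (\<lambda>x. \<kappa>\<^sup>2 * (1 - (tanh (\<kappa> * x))\<^sup>2)) (\<lambda>_. 0)"

lemma tanh_cont: "continuous_on UNIV (\<lambda>x::real. tanh (\<kappa> * x))"
  by (intro continuous_intros) (auto simp: cosh_real_nonzero)

lemma w_measurable [measurable]: "w \<in> borel_measurable borel"
  unfolding w_def by (intro cut3_measurable continuous_intros tanh_cont)

lemma w_bound: "\<bar>w x\<bar> \<le> \<kappa>"
proof -
  have "\<bar>tanh (\<kappa> * x)\<bar> \<le> 1" using tanh_real_bounds[of "\<kappa> * x"] by (auto simp: abs_le_iff less_imp_le)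
  hence "\<bar>\<kappa> * tanh (\<kappa> * x)\<bar> \<le> \<kappa> * 1" unfolding abs_mult using \<kappa> by (intro mult_mono) auto
  thus ?thesis using \<kappa> by (auto simp: w_def cut3_def)
qed

text \<open>Riccati equation: u'' = \<kappa>^2 u for the ground state, written in its logarithmic
  derivative. That the right-hand side is the same constant on all three pieces makes the square
  complete.\<close>

lemma w_riccati: "w' x + (w x)\<^sup>2 = \<kappa>\<^sup>2"
  by (simp add: w_def w'_def cut3_def algebra_simps power_mult_distrib)

text \<open>At both points \<open>w\<close> drops by \<kappa> (1 + tanh (\<kappa> a)) = \<alpha>.
  Here the equation for \<kappa> is used and the point interactions come out.\<close>

lemma w_by_parts:
  assumes g: "test_fun g"
  shows "(LBINT x. w x * partial g 1 x) = \<alpha> * g (-a) + \<alpha> * g a - (LBINT x. w' x * g x)"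
proof -
  have "(LBINT x. w x * partial g 1 x) = (\<kappa> - \<kappa> * tanh (\<kappa> * (-a))) * g (-a) + (\<kappa> * tanh (\<kappa> * a) - (- \<kappa>)) * g a - (LBINT x. w' x * g x)"
    unfolding w_def w'_def
  proof (rule cut3_by_parts[OF a _ _ _ _ _ _ g])
    show "((\<lambda>x. \<kappa> * tanh (\<kappa> * x)) has_real_derivative \<kappa>\<^sup>2 * (1 - (tanh (\<kappa> * x))\<^sup>2)) (at x)" for x
      by (auto intro!: derivative_eq_intros simp: cosh_real_nonzero power2_eq_square algebra_simps)
  qed (auto intro!: continuous_intros tanh_cont)
  also have "\<kappa> - \<kappa> * tanh (\<kappa> * (-a)) = \<alpha>" using kap by (simp add: algebra_simps)
  also have "\<kappa> * tanh (\<kappa> * a) - (- \<kappa>) = \<alpha>" using kap by (simp add: algebra_simps)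
  finally show ?thesis .
qed

lemma w_mult_integrable: "test_fun g \<Longrightarrow> integrable lborel (\<lambda>x. w x * g x)"
  and w'_mult_integrable: "test_fun g \<Longrightarrow> integrable lborel (\<lambda>x. w' x * g x)"
  unfolding w_def w'_def by (intro cut3_integrable continuous_intros tanh_cont; assumption)+

text \<open>Expanding the product gives u' v' + w^2 u v - w (u v)'. Replace w^2 by \<kappa>^2 - w'
  and integrate w (u v)' + w' u v with \<open>w_by_parts\<close>: what remains is the two point
  interactions.\<close>

lemma ground_state_1d:
  assumes u: "test_fun u" and v: "test_fun v"
  shows "(LBINT x. ann u x * ann v x) =
    (LBINT x. partial u 1 x * partial v 1 x) + \<kappa>\<^sup>2 * (LBINT x. u x * v x) - \<alpha> * (u a * v a) - \<alpha> * (u (-a) * v (-a))"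
proof -
  note su = test_fun_smooth[OF u] and sv = test_fun_smooth[OF v]
  define g where "g x = u x * v x" for x
  have g: "test_fun g" unfolding g_def[abs_def] by (rule test_fun_mult[OF su v])
  have gp: "test_fun (partial g 1)" by (rule test_fun_partial[OF g]) simp
  have pg: "partial g 1 = (\<lambda>x. partial u 1 x * v x + partial v 1 x * u x)"
    unfolding g_def[abs_def] by (rule partial_mult[OF su sv]) simp
  have up: "test_fun (partial u 1)" and vp: "test_fun (partial v 1)" by (rule test_fun_partial; (fact | simp))+
  have i1: "integrable lborel (\<lambda>x. partial u 1 x * partial v 1 x)"
    using test_fun_integrable[OF test_fun_mult[OF test_fun_smooth[OF up] vp]] test_fun_measurable[OF test_fun_mult[OF test_fun_smooth[OF up] vp]]
    by (simp add: integrable_completion)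
  have ig: "integrable lborel g" using test_fun_integrable[OF g] test_fun_measurable[OF g] by (simp add: integrable_completion)
  have "(LBINT x. ann u x * ann v x) =
    (LBINT x. (partial u 1 x * partial v 1 x + \<kappa>\<^sup>2 * g x) - (w x * partial g 1 x + w' x * g x))"
  proof (rule Bochner_Integration.integral_cong[OF refl])
    fix x
    have "ann u x * ann v x = partial u 1 x * partial v 1 x + (w x)\<^sup>2 * g x - w x * partial g 1 x"
      unfolding pg g_def by (simp add: algebra_simps power2_eq_square)
    also have "(w x)\<^sup>2 = \<kappa>\<^sup>2 - w' x" using w_riccati[of x] by simp
    finally show "ann u x * ann v x = (partial u 1 x * partial v 1 x + \<kappa>\<^sup>2 * g x) - (w x * partial g 1 x + w' x * g x)"
      by (simp add: algebra_simps)
  qed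
  also have "\<dots> = (LBINT x. partial u 1 x * partial v 1 x + \<kappa>\<^sup>2 * g x) - (LBINT x. w x * partial g 1 x + w' x * g x)"
    by (intro Bochner_Integration.integral_diff Bochner_Integration.integrable_add integrable_mult_right i1 ig w_mult_integrable w'_mult_integrable g gp)
  also have "(LBINT x. partial u 1 x * partial v 1 x + \<kappa>\<^sup>2 * g x) = (LBINT x. partial u 1 x * partial v 1 x) + \<kappa>\<^sup>2 * (LBINT x. g x)"
    using i1 ig by simp
  also have "(LBINT x. w x * partial g 1 x + w' x * g x) = (LBINT x. w x * partial g 1 x) + (LBINT x. w' x * g x)"
    by (intro Bochner_Integration.integral_add w_mult_integrable w'_mult_integrable g gp)
  also have "\<dots> = \<alpha> * g (-a) + \<alpha> * g a" by (simp add: w_by_parts[OF g])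
  finally show ?thesis by (simp add: g_def)
qed

text \<open>The unnormalised ground state. The factor cosh (\<kappa> a) makes it continuous at -a
  and a, so its weak derivative is w u0 without jump terms.\<close>

definition u0 :: "real \<Rightarrow> real" where
  "u0 = cut3 a (\<lambda>x. cosh (\<kappa> * a) * exp (\<kappa> * (x + a))) (\<lambda>x. cosh (\<kappa> * x)) (\<lambda>x. cosh (\<kappa> * a) * exp (- \<kappa> * (x - a)))"

lemma u0_measurable [measurable]: "u0 \<in> borel_measurable borel"
  unfolding u0_def by (intro cut3_measurable continuous_intros)

lemma u0_pos: "u0 x > 0" by (simp add: u0_def cut3_def)

lemma u0_weak:
  assumes g: "test_fun g"
  shows "(LBINT x. u0 x * partial g 1 x) = - (LBINT x. (w x * u0 x) * g x)"
proof -
  have "w x * u0 x = cut3 a (\<lambda>x. \<kappa> * (cosh (\<kappa> * a) * exp (\<kappa> * (x + a)))) (\<lambda>x. \<kappa> * sinh (\<kappa> * x)) (\<lambda>x. - \<kappa> * (cosh (\<kappa> * a) * exp (- \<kappa> * (x - a)))) x" for x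
    by (simp add: w_def u0_def cut3_def tanh_def)
  hence "(LBINT x. (w x * u0 x) * g x) = (LBINT x. cut3 a (\<lambda>x. \<kappa> * (cosh (\<kappa> * a) * exp (\<kappa> * (x + a)))) (\<lambda>x. \<kappa> * sinh (\<kappa> * x)) (\<lambda>x. - \<kappa> * (cosh (\<kappa> * a) * exp (- \<kappa> * (x - a)))) x * g x)"
    by simp
  moreover have "(LBINT x. u0 x * partial g 1 x) =
     (cosh (\<kappa> * a) * exp (\<kappa> * (-a + a)) - cosh (\<kappa> * (-a))) * g (-a) + (cosh (\<kappa> * a) - cosh (\<kappa> * a) * exp (- \<kappa> * (a - a))) * g a
     - (LBINT x. cut3 a (\<lambda>x. \<kappa> * (cosh (\<kappa> * a) * exp (\<kappa> * (x + a)))) (\<lambda>x. \<kappa> * sinh (\<kappa> * x)) (\<lambda>x. - \<kappa> * (cosh (\<kappa> * a) * exp (- \<kappa> * (x - a)))) x * g x)"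
    unfolding u0_def
    by (rule cut3_by_parts[OF a _ _ _ _ _ _ g]) (auto intro!: derivative_eq_intros continuous_intros)
  ultimately show ?thesis by simp
qed

lemma exp_half_line: "integrable lborel (\<lambda>x. indicator {0..} x * exp (- (2 * \<kappa>) * x))"
proof -
  have "((\<lambda>x. exp (- (2 * \<kappa>) * x)) has_integral exp (- (2 * \<kappa>) * 0) / (2 * \<kappa>)) {0..}"
    by (rule has_integral_exp_minus_to_infinity) (use \<kappa> in simp)
  hence "set_integrable lebesgue {0..} (\<lambda>x. exp (- (2 * \<kappa>) * x))"
    by (intro nonnegative_absolutely_integrable_1) (auto simp: integrable_on_def)
  hence "integrable lebesgue (\<lambda>x. indicator {0..} x * exp (- (2 * \<kappa>) * x))" by (simp add: set_integrable_def)
  moreover have "(\<lambda>x. indicator {0..} x * exp (- (2 * \<kappa>) * x)) \<in> borel_measurable lborel" by measurable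
  ultimately show ?thesis by (simp add: integrable_completion)
qed

lemma u0_sq_integrable: "integrable lborel (\<lambda>x. (u0 x)\<^sup>2)"
proof (rule Bochner_Integration.integrable_bound)
  let ?C = "(cosh (\<kappa> * a))\<^sup>2"
  let ?e = "\<lambda>x. indicator {0..} x * exp (- (2 * \<kappa>) * x)"
  have 1: "integrable lborel (\<lambda>x. ?e (- a + 1 * x))"
    by (rule lborel_integrable_real_affine[OF exp_half_line]) simp
  have 2: "integrable lborel (\<lambda>x. ?e (- a + (-1) * x))"
    by (rule lborel_integrable_real_affine[OF exp_half_line]) simp
  have 3: "integrable lborel (\<lambda>x. indicator {-a..a} x :: real)" by (intro integrable_real_indicator) (auto simp: emeasure_lborel_Icc_eq)
  show "integrable lborel (\<lambda>x. ?C * ?e (- a + 1 * x) + (?C * ?e (- a + (-1) * x) + ?C * indicator {-a..a} x))"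
    using 1 2 3 by (intro Bochner_Integration.integrable_add integrable_mult_right)
  show "AE x in lborel. norm ((u0 x)\<^sup>2) \<le> norm (?C * ?e (- a + 1 * x) + (?C * ?e (- a + (-1) * x) + ?C * indicator {-a..a} x))"
  proof (rule AE_I2)
    fix x
    have nn: "0 \<le> ?C * ?e (- a + 1 * x)" "0 \<le> ?C * ?e (- a + (-1) * x)" "0 \<le> ?C * indicator {-a..a} x" by auto
    consider "x < -a" | "-a \<le> x" "x \<le> a" | "x > a" by linarith
    hence "(u0 x)\<^sup>2 \<le> ?C * ?e (- a + 1 * x) + (?C * ?e (- a + (-1) * x) + ?C * indicator {-a..a} x)"
    proof cases
      case 1
      have "(u0 x)\<^sup>2 = ?C * ?e (- a + (-1) * x)" using 1 a
        by (simp add: u0_def cut3_def power_mult_distrib exp_double[symmetric] algebra_simps)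
      thus ?thesis using nn by linarith
    next
      case 2
      have "cosh (\<kappa> * x) \<le> cosh (\<kappa> * a)"
      proof -
        have "cosh \<bar>\<kappa> * x\<bar> \<le> cosh \<bar>\<kappa> * a\<bar>"
          by (subst cosh_real_nonneg_le_iff) (use 2 \<kappa> a in \<open>auto simp: abs_mult intro!: mult_left_mono\<close>)
        thus ?thesis by simp
      qed
      hence "(u0 x)\<^sup>2 \<le> ?C * indicator {-a..a} x" using 2
        by (auto simp: u0_def cut3_def intro!: power_mono)
      thus ?thesis using nn by linarith
    next
      case 3
      have "(u0 x)\<^sup>2 = ?C * ?e (- a + 1 * x)" using 3 a
        by (simp add: u0_def cut3_def power_mult_distrib exp_double[symmetric] algebra_simps)
      thus ?thesis using nn by linarith
    qed
    thus "norm ((u0 x)\<^sup>2) \<le> norm (?C * ?e (- a + 1 * x) + (?C * ?e (- a + (-1) * x) + ?C * indicator {-a..a} x))"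
      by simp
  qed
qed measurable

end

section \<open>Bounded Hermitian forms on the Sobolev space\<close>

text \<open>The class of forms along which identities and inequalities pass from test functions to
  W12: it is closed under real linear combinations, and its members are continuous in the Sobolev
  norm.\<close>

definition bform :: "(('a::euclidean_space \<Rightarrow> complex) \<Rightarrow> ('a \<Rightarrow> complex) \<Rightarrow> complex) \<Rightarrow> bool" where
  "bform f \<longleftrightarrow> herm_form W12 (\<lambda>f g x. f x + g x) (\<lambda>c f x. c * f x) f \<and>
     (\<exists>C. \<forall>u v. W12 u \<longrightarrow> W12 v \<longrightarrow> cmod (f u v) \<le> C * (W.nrm u * W.nrm v))"

lemma bform_herm: "bform f \<Longrightarrow> herm_form W12 (\<lambda>f g x. f x + g x) (\<lambda>c f x. c * f x) f"
  by (simp add: bform_def)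

lemma bform_bound:
  assumes "bform f" shows "\<exists>C\<ge>0. \<forall>u v. W12 u \<longrightarrow> W12 v \<longrightarrow> cmod (f u v) \<le> C * (W.nrm u * W.nrm v)"
proof -
  obtain C where C: "\<And>u v. W12 u \<Longrightarrow> W12 v \<Longrightarrow> cmod (f u v) \<le> C * (W.nrm u * W.nrm v)"
    using assms unfolding bform_def by blast
  have "cmod (f u v) \<le> \<bar>C\<bar> * (W.nrm u * W.nrm v)" if "W12 u" "W12 v" for u v
  proof -
    have "cmod (f u v) \<le> C * (W.nrm u * W.nrm v)" by (rule C[OF that])
    also have "\<dots> \<le> \<bar>C\<bar> * (W.nrm u * W.nrm v)" by (intro mult_right_mono) auto
    finally show "cmod (f u v) \<le> \<bar>C\<bar> * (W.nrm u * W.nrm v)" .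
  qed
  thus ?thesis by (intro exI[of _ "\<bar>C\<bar>"]) auto
qed

lemma bform_add: assumes "bform f" "bform g" shows "bform (\<lambda>u v. f u v + g u v)"
proof -
  obtain C where "C \<ge> 0" and C: "\<And>u v. W12 u \<Longrightarrow> W12 v \<Longrightarrow> cmod (f u v) \<le> C * (W.nrm u * W.nrm v)" using bform_bound[OF assms(1)] by blast
  obtain D where "D \<ge> 0" and D: "\<And>u v. W12 u \<Longrightarrow> W12 v \<Longrightarrow> cmod (g u v) \<le> D * (W.nrm u * W.nrm v)" using bform_bound[OF assms(2)] by blast
  have "cmod (f u v + g u v) \<le> (C + D) * (W.nrm u * W.nrm v)" if "W12 u" "W12 v" for u v
    using norm_triangle_ineq[of "f u v" "g u v"] C[OF that] D[OF that] by (simp add: distrib_right)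
  thus ?thesis unfolding bform_def using herm_form_add[OF bform_herm[OF assms(1)] bform_herm[OF assms(2)]] by blast
qed

lemma bform_scale: assumes "bform f" shows "bform (\<lambda>u v. complex_of_real r * f u v)"
proof -
  obtain C where "C \<ge> 0" and C: "\<And>u v. W12 u \<Longrightarrow> W12 v \<Longrightarrow> cmod (f u v) \<le> C * (W.nrm u * W.nrm v)" using bform_bound[OF assms(1)] by blast
  have "cmod (complex_of_real r * f u v) \<le> (\<bar>r\<bar> * C) * (W.nrm u * W.nrm v)" if "W12 u" "W12 v" for u v
    using C[OF that] by (simp add: norm_mult mult.assoc mult_left_mono)
  thus ?thesis unfolding bform_def using herm_form_scale[OF bform_herm[OF assms(1)]] by blast
qed

lemma bform_diff: assumes "bform f" "bform g" shows "bform (\<lambda>u v. f u v - g u v)"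
  using bform_add[OF assms(1) bform_scale[OF assms(2), of "-1"]] by simp

lemma bform_zero: "bform (\<lambda>u v. 0)"
  unfolding bform_def by (auto intro!: exI[of _ 0] herm_form.intro W12_add W12_scale)

lemma bform_sum: "finite I \<Longrightarrow> (\<And>i. i \<in> I \<Longrightarrow> bform (f i)) \<Longrightarrow> bform (\<lambda>u v. \<Sum>i\<in>I. f i u v)"
proof (induction I rule: finite_induct)
  case (insert i I)
  hence "bform (\<lambda>u v. f i u v + (\<Sum>i\<in>I. f i u v))" by (intro bform_add) auto
  thus ?case using insert by simp
qed (simp add: bform_zero)

lemma bform_inner_W: "bform inner_W"
  unfolding bform_def using W.cauchy_schwarz by (auto intro!: exI[of _ 1] W.herm_form_axioms)

section \<open>Forms built from linear maps into L2\<close>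

definition wform :: "('b::euclidean_space \<Rightarrow> real) \<Rightarrow> (('a::euclidean_space \<Rightarrow> complex) \<Rightarrow> 'b \<Rightarrow> complex) \<Rightarrow> ('a \<Rightarrow> complex) \<Rightarrow> ('a \<Rightarrow> complex) \<Rightarrow> complex" where
  "wform V T u v = integral\<^sup>L lebesgue (\<lambda>x. cr V x * cnj (T u x) * T v x)"

text \<open>Linearity is required only almost everywhere, because the maps in question (weak
  gradient, trace, annihilation operator) involve a choice of representative.\<close>

definition lin_op :: "(('a::euclidean_space \<Rightarrow> complex) \<Rightarrow> 'b::euclidean_space \<Rightarrow> complex) \<Rightarrow> bool" where
  "lin_op T \<longleftrightarrow> (\<forall>u. W12 u \<longrightarrow> L2 (T u)) \<and>
     (\<forall>u v. W12 u \<longrightarrow> W12 v \<longrightarrow> (AE x in lebesgue. T (\<lambda>x. u x + v x) x = T u x + T v x)) \<and>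
     (\<forall>u c. W12 u \<longrightarrow> (AE x in lebesgue. T (\<lambda>x. c * u x) x = c * T u x)) \<and>
     (\<exists>C. \<forall>u. W12 u \<longrightarrow> norm_L2 (T u) \<le> C * W.nrm u)"

lemma wform_inner: "wform V T u v = inner_L2 (T u) (\<lambda>x. cr V x * T v x)"
  by (simp add: wform_def inner_L2_def mult_ac)

lemma bform_wform:
  fixes T :: "('a::euclidean_space \<Rightarrow> complex) \<Rightarrow> 'b::euclidean_space \<Rightarrow> complex"
  assumes T: "lin_op T" and V: "V \<in> borel_measurable lebesgue" "\<And>x. \<bar>V x\<bar> \<le> B"
  shows "bform (wform V T)"
proof -
  have TL: "W12 u \<Longrightarrow> L2 (T u)" for u using T by (simp add: lin_op_def)
  have Tadd: "W12 u \<Longrightarrow> W12 v \<Longrightarrow> AE x in lebesgue. T (\<lambda>x. u x + v x) x = T u x + T v x" for u v using T unfolding lin_op_def by blast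
  have Tscl: "W12 u \<Longrightarrow> AE x in lebesgue. T (\<lambda>x. c * u x) x = c * T u x" for u c using T unfolding lin_op_def by blast
  obtain C where C: "\<And>u. W12 u \<Longrightarrow> norm_L2 (T u) \<le> C * W.nrm u" using T unfolding lin_op_def by blast
  have B: "B \<ge> 0" using V(2) by (meson abs_ge_zero order_trans)
  define M where "M h = (\<lambda>x. cr V x * h x)" for h :: "'b \<Rightarrow> complex"
  have VL: "L2 (M h)" if "L2 h" for h unfolding M_def
    by (rule L2_mult_bounded[OF that, of _ B]) (use V in auto)
  have Mn: "norm_L2 (M h) \<le> B * norm_L2 h" if h: "L2 h" for h
  proof (rule power2_le_imp_le)
    have "(norm_L2 (M h))\<^sup>2 \<le> (LEBINT x. B\<^sup>2 * (cmod (h x))\<^sup>2)"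
      unfolding norm_L2_sq
    proof (rule integral_mono[OF L2_integrable[OF VL[OF h]]])
      show "(cmod (M h x))\<^sup>2 \<le> B\<^sup>2 * (cmod (h x))\<^sup>2" for x
      proof -
        have "\<bar>V x\<bar>\<^sup>2 \<le> B\<^sup>2" by (rule power_mono[OF V(2)]) simp
        thus ?thesis by (simp add: M_def norm_mult power_mult_distrib mult_right_mono)
      qed
    qed (use L2_integrable[OF h] in simp)
    thus "(norm_L2 (M h))\<^sup>2 \<le> (B * norm_L2 h)\<^sup>2" by (simp add: power_mult_distrib norm_L2_sq)
  qed (use B in simp)
  have eq: "wform V T u v = inner_L2 (T u) (M (T v))" for u v by (simp add: wform_inner M_def)
  have "herm_form W12 (\<lambda>f g x. f x + g x) (\<lambda>c f x. c * f x) (wform V T)"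
  proof
    fix u v z :: "'a \<Rightarrow> complex" and c :: complex
    assume u: "W12 u"
    show "W12 (\<lambda>x. c * u x)" by (rule W12_scale[OF u])
    assume v: "W12 v"
    show "W12 (\<lambda>x. u x + v x)" by (rule W12_add[OF u v])
    show "wform V T v u = cnj (wform V T u v)"
    proof -
      have "wform V T v u = inner_L2 (M (T v)) (T u)" by (simp add: wform_def inner_L2_def M_def mult_ac)
      also have "\<dots> = cnj (inner_L2 (T u) (M (T v)))" by (rule L2.f_cnj[OF TL[OF u] VL[OF TL[OF v]]])
      finally show ?thesis by (simp add: eq)
    qed
    have "inner_L2 (T u) (M (T (\<lambda>x. c * v x))) = inner_L2 (T u) (\<lambda>x. c * M (T v) x)"
    proof (rule inner_L2_cong_AE[OF TL[OF u] TL[OF u] VL[OF TL[OF W12_scale[OF v]]] L2_scale[OF VL[OF TL[OF v]]]])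
      show "AE x in lebesgue. M (T (\<lambda>x. c * v x)) x = c * M (T v) x"
        using Tscl[OF v, of c] by eventually_elim (simp add: M_def)
    qed simp
    thus "wform V T u (\<lambda>x. c * v x) = c * wform V T u v"
      using L2.f_scl[OF TL[OF u] VL[OF TL[OF v]], of c] by (simp add: eq)
    assume z: "W12 z"
    have "inner_L2 (T u) (M (T (\<lambda>x. v x + z x))) = inner_L2 (T u) (\<lambda>x. M (T v) x + M (T z) x)"
    proof (rule inner_L2_cong_AE[OF TL[OF u] TL[OF u] VL[OF TL[OF W12_add[OF v z]]] L2_add[OF VL[OF TL[OF v]] VL[OF TL[OF z]]]])
      show "AE x in lebesgue. M (T (\<lambda>x. v x + z x)) x = M (T v) x + M (T z) x"
        using Tadd[OF v z] by eventually_elim (simp add: M_def algebra_simps)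
    qed simp
    thus "wform V T u (\<lambda>x. v x + z x) = wform V T u v + wform V T u z"
      using L2.f_add[OF TL[OF u] VL[OF TL[OF v]] VL[OF TL[OF z]]] by (simp add: eq)
  qed
  moreover have "cmod (wform V T u v) \<le> (B * C\<^sup>2) * (W.nrm u * W.nrm v)" if u: "W12 u" and v: "W12 v" for u v
  proof -
    have "cmod (wform V T u v) \<le> norm_L2 (T u) * norm_L2 (M (T v))"
      unfolding eq by (rule cauchy_schwarz_L2[OF TL[OF u] VL[OF TL[OF v]]])
    also have "\<dots> \<le> norm_L2 (T u) * (B * norm_L2 (T v))" by (intro mult_left_mono Mn TL v) auto
    also have "\<dots> = B * (norm_L2 (T u) * norm_L2 (T v))" by simp
    also have "\<dots> \<le> B * ((C * W.nrm u) * (C * W.nrm v))"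
      by (intro mult_left_mono mult_mono C u v B order_trans[OF norm_L2_nonneg C]) auto
    finally show ?thesis by (simp add: power2_eq_square mult_ac)
  qed
  ultimately show ?thesis unfolding bform_def by blast
qed

lemma lin_op_id: "lin_op (\<lambda>u. u)"
  unfolding lin_op_def by (auto intro!: W12_L2 exI[of _ 1] simp: norm_L2_le_W)

lemma lin_op_wgrad: "b \<in> Basis \<Longrightarrow> lin_op (\<lambda>u. wgrad u b)"
  unfolding lin_op_def by (auto intro!: wgrad_L2 wgrad_add wgrad_scale exI[of _ 1] simp: norm_wgrad_le_W)

lemma bform_inner_L2: "bform inner_L2"
  using bform_wform[OF lin_op_id, of "\<lambda>_. 1" 1] by (simp add: wform_inner[abs_def])

lemma bform_wgrad: "b \<in> Basis \<Longrightarrow> bform (\<lambda>u v. inner_L2 (wgrad u b) (wgrad v b))"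
  using bform_wform[OF lin_op_wgrad, of b "\<lambda>_. 1" 1] by (simp add: wform_inner[abs_def])

lemma bform_functional:
  assumes "\<And>u v. W12 u \<Longrightarrow> W12 v \<Longrightarrow> l (\<lambda>x. u x + v x) = l u + (l v :: complex)"
    "\<And>u c. W12 u \<Longrightarrow> l (\<lambda>x. c * u x) = c * l u" "\<And>u. W12 u \<Longrightarrow> cmod (l u) \<le> C * W.nrm u"
  shows "bform (\<lambda>u v. cnj (l u) * l v)"
  unfolding bform_def
proof
  show "herm_form W12 (\<lambda>f g x. f x + g x) (\<lambda>c f x. c * f x) (\<lambda>u v. cnj (l u) * l v)"
    by unfold_locales (auto simp: assms W12_add W12_scale algebra_simps)
  have "cmod (cnj (l u) * l v) \<le> C\<^sup>2 * (W.nrm u * W.nrm v)" if "W12 u" "W12 v" for u v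
  proof -
    have "cmod (cnj (l u) * l v) = cmod (l u) * cmod (l v)" by (simp add: norm_mult)
    also have "\<dots> \<le> (C * W.nrm u) * (C * W.nrm v)"
      by (intro mult_mono assms that order_trans[OF norm_ge_zero assms(3)]) auto
    finally show ?thesis by (simp add: power2_eq_square mult_ac)
  qed
  thus "\<exists>C. \<forall>u v. W12 u \<longrightarrow> W12 v \<longrightarrow> cmod (cnj (l u) * l v) \<le> C * (W.nrm u * W.nrm v)" by blast
qed

lemma W_nrm_tendsto:
  assumes "\<And>n. W12 (x n)" "W12 f" "W_lim x f"
  shows "(\<lambda>n. W.nrm (x n)) \<longlonglongrightarrow> W.nrm f"
proof -
  have 1: "W.nrm (x n) \<le> W.nrm (\<lambda>t. x n t - f t) + W.nrm f" for n
    using W.nrm_add[OF W12_diff[OF assms(1)[of n] assms(2)] assms(2)] by simp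
  have 2: "W.nrm f \<le> W.nrm (\<lambda>t. x n t - f t) + W.nrm (x n)" for n
    using W.nrm_add[OF W12_scale[OF W12_diff[OF assms(1)[of n] assms(2)], of "-1"] assms(1)[of n]]
      W.nrm_scl[OF W12_diff[OF assms(1)[of n] assms(2)], of "-1"] by simp
  have "\<bar>W.nrm (x n) - W.nrm f\<bar> \<le> W.nrm (\<lambda>t. x n t - f t)" for n using 1[of n] 2[of n] by simp
  hence "(\<lambda>n. W.nrm (x n) - W.nrm f) \<longlonglongrightarrow> 0"
    by (intro Lim_null_comparison[OF _ assms(3)]) auto
  thus ?thesis by (simp add: LIM_zero_iff)
qed

lemma bform_tendsto:
  assumes f: "bform f" and x: "\<And>n. W12 (x n)" "W12 u" "W_lim x u"
    and y: "\<And>n. W12 (y n)" "W12 v" "W_lim y v"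
  shows "(\<lambda>n. f (x n) (y n)) \<longlonglongrightarrow> f u v"
proof -
  interpret f: herm_form W12 "\<lambda>f g x. f x + g x" "\<lambda>c f x. c * f x" f by (rule bform_herm[OF f])
  obtain C where C: "C \<ge> 0" "\<And>u v. W12 u \<Longrightarrow> W12 v \<Longrightarrow> cmod (f u v) \<le> C * (W.nrm u * W.nrm v)" using bform_bound[OF f] by blast
  have eq: "f (x n) (y n) - f u v = f (\<lambda>t. x n t - u t) (y n) + f u (\<lambda>t. y n t - v t)" for n
    using f.f_sub[OF x(2) y(1) y(2), of n] f.f_sub_left[OF y(1) x(1) x(2), of n n] by simp
  have "(\<lambda>n. f (x n) (y n) - f u v) \<longlonglongrightarrow> 0"
  proof (rule Lim_null_comparison)
    show "\<forall>\<^sub>F n in sequentially. cmod (f (x n) (y n) - f u v) \<le> C * (W.nrm (\<lambda>t. x n t - u t) * W.nrm (y n)) + C * (W.nrm u * W.nrm (\<lambda>t. y n t - v t))"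
      unfolding eq by (intro always_eventually allI order_trans[OF norm_triangle_ineq] add_mono C W12_diff x y)
    have "(\<lambda>n. C * (W.nrm (\<lambda>t. x n t - u t) * W.nrm (y n)) + C * (W.nrm u * W.nrm (\<lambda>t. y n t - v t))) \<longlonglongrightarrow> C * (0 * W.nrm v) + C * (W.nrm u * 0)"
      by (intro tendsto_intros x y W_nrm_tendsto)
    thus "(\<lambda>n. C * (W.nrm (\<lambda>t. x n t - u t) * W.nrm (y n)) + C * (W.nrm u * W.nrm (\<lambda>t. y n t - v t))) \<longlonglongrightarrow> 0" by simp
  qed
  thus ?thesis by (simp add: LIM_zero_iff)
qed

section \<open>From real test functions to the Sobolev space\<close>

lemma ctest_cases:
  assumes "ctest_fun f" obtains u v where "test_fun u" "test_fun v" "f = (\<lambda>x. cr u x + \<i> * cr v x)"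
  using assms unfolding ctest_fun_def by blast

text \<open>Sesquilinearity extends the identity from real to complex test functions, and density
  with continuity extends it to W12.\<close>

lemma bform_eq_test:
  assumes f: "bform f" and g: "bform g" and eq: "\<And>u v. test_fun u \<Longrightarrow> test_fun v \<Longrightarrow> f (cr u) (cr v) = g (cr u) (cr v)"
    and u: "W12 u" and v: "W12 v"
  shows "f u v = g u v"
proof -
  interpret f: herm_form W12 "\<lambda>f g x. f x + g x" "\<lambda>c f x. c * f x" f by (rule bform_herm[OF f])
  interpret g: herm_form W12 "\<lambda>f g x. f x + g x" "\<lambda>c f x. c * f x" g by (rule bform_herm[OF g])
  have ct: "f p q = g p q" if "ctest_fun p" "ctest_fun q" for p q
  proof -
    obtain a b where p: "test_fun a" "test_fun b" "p = (\<lambda>x. cr a x + \<i> * cr b x)" using ctest_cases[OF \<open>ctest_fun p\<close>] .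
    obtain c d where q: "test_fun c" "test_fun d" "q = (\<lambda>x. cr c x + \<i> * cr d x)" using ctest_cases[OF \<open>ctest_fun q\<close>] .
    show ?thesis unfolding p(3) q(3)
      using p(1,2) q(1,2) by (simp add: f.f_add f.f_add_left f.f_scl f.f_scl_left g.f_add g.f_add_left g.f_scl g.f_scl_left W12_test W12_add W12_scale eq)
  qed
  obtain p where p: "\<And>n::nat. ctest_fun (p n)" "W_lim p u" using ctest_dense_seq[OF u] by blast
  obtain q where q: "\<And>n::nat. ctest_fun (q n)" "W_lim q v" using ctest_dense_seq[OF v] by blast
  have "(\<lambda>n. f (p n) (q n)) \<longlonglongrightarrow> f u v" by (rule bform_tendsto[OF f W12_ctest[OF p(1)] u p(2) W12_ctest[OF q(1)] v q(2)])
  moreover have "(\<lambda>n. f (p n) (q n)) \<longlonglongrightarrow> g u v"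
    using bform_tendsto[OF g W12_ctest[OF p(1)] u p(2) W12_ctest[OF q(1)] v q(2)] ct p q by simp
  ultimately show ?thesis by (rule LIMSEQ_unique)
qed

text \<open>The cross term f u (\<i> v) = \<i> f u v is imaginary when f is real on real functions,
  so real and imaginary parts decouple.\<close>

lemma herm_ctest_split:
  assumes f: "herm_form W12 (\<lambda>f g x. f x + g x) (\<lambda>c f x. c * f x) f"
    and re: "\<And>u v. test_fun u \<Longrightarrow> test_fun v \<Longrightarrow> Im (f (cr u) (cr v)) = 0" and u: "test_fun u" and v: "test_fun v"
  shows "Re (f (\<lambda>x. cr u x + \<i> * cr v x) (\<lambda>x. cr u x + \<i> * cr v x)) = Re (f (cr u) (cr u)) + Re (f (cr v) (cr v))"
proof -
  interpret f: herm_form W12 "\<lambda>f g x. f x + g x" "\<lambda>c f x. c * f x" f by (rule f)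
  show ?thesis
    using f.quad_add[OF W12_test[OF u] W12_scale[OF W12_test[OF v]], of \<i>] f.quad_scl[OF W12_test[OF v], of \<i>]
      f.f_scl[OF W12_test[OF u] W12_test[OF v], of \<i>] re[OF u v] by simp
qed

text \<open>Applied to the difference of two sides of an inequality between quadratic forms.
  Garding's inequality and coercivity are transferred to W12 in this way.\<close>

lemma bform_nonneg_test:
  assumes f: "bform f" and re: "\<And>u v. test_fun u \<Longrightarrow> test_fun v \<Longrightarrow> Im (f (cr u) (cr v)) = 0"
    and pos: "\<And>u. test_fun u \<Longrightarrow> 0 \<le> Re (f (cr u) (cr u))" and u: "W12 u"
  shows "0 \<le> Re (f u u)"
proof -
  obtain p where p: "\<And>n::nat. ctest_fun (p n)" "W_lim p u" using ctest_dense_seq[OF u] by blast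
  have "(\<lambda>n. f (p n) (p n)) \<longlonglongrightarrow> f u u" by (rule bform_tendsto[OF f W12_ctest[OF p(1)] u p(2) W12_ctest[OF p(1)] u p(2)])
  hence "(\<lambda>n. Re (f (p n) (p n))) \<longlonglongrightarrow> Re (f u u)" by (rule tendsto_Re)
  moreover have "0 \<le> Re (f (p n) (p n))" for n
  proof -
    obtain a b where ab: "test_fun a" "test_fun b" "p n = (\<lambda>x. cr a x + \<i> * cr b x)" using ctest_cases[OF p(1)] .
    show ?thesis using herm_ctest_split[OF bform_herm[OF f] re ab(1,2)] pos[OF ab(1)] pos[OF ab(2)] unfolding ab(3) by linarith
  qed
  ultimately show ?thesis by (intro LIMSEQ_le_const) auto
qed

lemma inner_L2_test:
  assumes "test_fun u" "test_fun v" shows "inner_L2 (cr u) (cr v) = complex_of_real (LBINT x. u x * v x)"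
proof -
  have "inner_L2 (cr u) (cr v) = complex_of_real (LEBINT x. u x * v x)"
    unfolding inner_L2_def by (simp flip: of_real_mult)
  thus ?thesis using integral_lebesgue_lborel[OF test_fun_measurable[OF test_fun_mult[OF test_fun_smooth[OF assms(1)] assms(2)]]] by simp
qed

lemma inner_wgrad_test:
  assumes u: "test_fun u" and v: "test_fun v" and b: "b \<in> Basis"
  shows "inner_L2 (wgrad (cr u) b) (wgrad (cr v) b) = complex_of_real (LBINT x. partial u b x * partial v b x)"
proof -
  have "inner_L2 (wgrad (cr u) b) (wgrad (cr v) b) = inner_L2 (cr (partial u b)) (cr (partial v b))"
    by (intro inner_L2_cong_AE wgrad_L2 W12_test test_fun_L2 test_fun_partial wgrad_test u v b)
  thus ?thesis using inner_L2_test[OF test_fun_partial[OF u b] test_fun_partial[OF v b]] by simp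
qed

lemma norm_L2_test: assumes "test_fun u" shows "(rnorm u)\<^sup>2 = (LBINT x. (u x)\<^sup>2)"
  using inner_L2_test[OF assms assms] unfolding inner_L2_self by (simp only: of_real_eq_iff power2_eq_square)

lemma test_fun_integrable_lborel: assumes "test_fun f" shows "integrable lborel f"
proof -
  obtain R where R: "R > 0" "\<And>x. norm x > R \<Longrightarrow> f x = 0" using test_fun_support[OF assms] by metis
  show ?thesis by (rule cc_integrable(1)[OF test_fun_continuous[OF assms] R(2)])
qed

lemma test_mult_integrable: "test_fun u \<Longrightarrow> test_fun v \<Longrightarrow> integrable lborel (\<lambda>x. u x * v x)"
  by (rule test_fun_integrable_lborel[OF test_fun_mult[OF test_fun_smooth]])

lemma W_nrm_test: assumes "test_fun u" shows "(Wr u)\<^sup>2 = (LBINT x. (u x)\<^sup>2) + (\<Sum>b\<in>Basis. \<integral>x. (partial u b x)\<^sup>2 \<partial>lborel)"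
proof -
  have "(Wr u)\<^sup>2 = (rnorm u)\<^sup>2 + (\<Sum>b\<in>Basis. (rnorm (partial u b))\<^sup>2)"
    by (rule W_nrm_sq_weak) (auto intro: test_fun_L2 test_fun_partial weak_deriv_test assms)
  thus ?thesis by (simp add: norm_L2_test assms test_fun_partial)
qed

lemma W_nrm_ctest:
  assumes "test_fun u" "test_fun v"
  shows "(W.nrm (\<lambda>x. cr u x + \<i> * cr v x))\<^sup>2 = (Wr u)\<^sup>2 + (Wr v)\<^sup>2"
proof -
  have re: "Im (inner_W (cr p) (cr q)) = 0" if "test_fun p" "test_fun q" for p q :: "'a \<Rightarrow> real"
    using that by (simp add: inner_W_def grad_form_def inner_L2_test inner_wgrad_test)
  show ?thesis
    unfolding W.nrm_sq[OF W12_test[OF assms(1)]] W.nrm_sq[OF W12_test[OF assms(2)]]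
      W.nrm_sq[OF W12_add[OF W12_test[OF assms(1)] W12_scale[OF W12_test[OF assms(2)]]]]
    by (rule herm_ctest_split[OF W.herm_form_axioms re assms])
qed

section \<open>The threshold\<close>

lemma interval_le_integral:
  fixes g :: "real \<Rightarrow> real"
  assumes "continuous_on UNIV g" "integrable lborel g" "\<And>x. g x \<ge> 0"
  shows "(LBINT t. indicator {p..q} t * g t) \<le> integral\<^sup>L lborel g"
  by (rule integral_mono[OF interval_integrable[OF assms(1)] assms(2)]) (use assms(3) in \<open>auto simp: indicator_def\<close>)

lemma point_bound_test:
  fixes u :: "real \<Rightarrow> real"
  assumes u: "test_fun u" shows "(u c)\<^sup>2 \<le> 2 * (Wr u)\<^sup>2"
proof -
  have up: "test_fun (partial u 1)" by (rule test_fun_partial[OF u]) simp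
  have sq: "integrable lborel (\<lambda>x. (v x)\<^sup>2)" "continuous_on UNIV (\<lambda>x. (v x)\<^sup>2)" if "test_fun v" for v :: "real \<Rightarrow> real"
    using test_mult_integrable[OF that that] continuous_on_mult[OF test_fun_continuous[OF that] test_fun_continuous[OF that]]
    unfolding power2_eq_square by auto
  have "(u c)\<^sup>2 \<le> (2 / 1) * (LBINT t. indicator {c..c+1} t * (u t)\<^sup>2) + 2 * 1 * (LBINT t. indicator {c..c+1} t * (partial u 1 t)\<^sup>2)"
    by (rule trace_1d[OF smooth_real_deriv[OF test_fun_smooth[OF u]] test_fun_continuous[OF up]]) simp
  also have "\<dots> \<le> 2 * (LBINT t. (u t)\<^sup>2) + 2 * (LBINT t. (partial u 1 t)\<^sup>2)"
    using interval_le_integral[OF sq(2)[OF u] sq(1)[OF u], of c "c+1"] interval_le_integral[OF sq(2)[OF up] sq(1)[OF up], of c "c+1"] by simp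
  also have "\<dots> = 2 * (Wr u)\<^sup>2" by (simp add: W_nrm_test[OF u])
  finally show ?thesis .
qed

lemma point_bound_ctest:
  fixes f :: "real \<Rightarrow> complex"
  assumes "ctest_fun f" shows "cmod (f c) \<le> sqrt 2 * W.nrm f"
proof (rule power2_le_imp_le)
  obtain u v where uv: "test_fun u" "test_fun v" "f = (\<lambda>x. cr u x + \<i> * cr v x)" using ctest_cases[OF assms] .
  have "(cmod (f c))\<^sup>2 = (u c)\<^sup>2 + (v c)\<^sup>2" by (simp add: uv(3) cmod_power2)
  also have "\<dots> \<le> 2 * (W.nrm f)\<^sup>2"
    using point_bound_test[OF uv(1), of c] point_bound_test[OF uv(2), of c] W_nrm_ctest[OF uv(1,2)] unfolding uv(3) by linarith
  finally show "(cmod (f c))\<^sup>2 \<le> (sqrt 2 * W.nrm f)\<^sup>2" by (simp add: power_mult_distrib)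
qed simp

section \<open>Continuous representatives\<close>

lemma ctest_continuous: "ctest_fun f \<Longrightarrow> continuous_on UNIV f"
  unfolding ctest_fun_def by (auto intro!: continuous_intros test_fun_continuous)

lemma continuous_AE_eq:
  fixes f g :: "real \<Rightarrow> complex"
  assumes "continuous_on UNIV f" "continuous_on UNIV g" "AE x in lebesgue. f x = g x" shows "f = g"
proof -
  have "negligible {x. f x \<noteq> g x}"
    using assms(3) by (simp add: negligible_iff_null_sets eventually_ae_filter)
      (metis (no_types, lifting) completion.complete2 mem_Collect_eq subsetI)
  moreover have "open {x. f x \<noteq> g x}" using assms by (intro open_Collect_neq)
  ultimately have "{x. f x \<noteq> g x} = {}" using open_not_negligible by blast
  thus ?thesis by auto
qed

lemma W_seq_cauchy:
  assumes x: "\<And>n. W12 (x n)" and f: "W12 f" and l: "W_lim x f" and e: "e > 0"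
  shows "\<exists>N. \<forall>m\<ge>N. \<forall>n\<ge>N. W.nrm (\<lambda>t. x m t - x n t) < e"
proof -
  have "e / 2 > 0" using e by simp
  from order_tendstoD(2)[OF l this] obtain N where N: "\<And>n. n \<ge> N \<Longrightarrow> W.nrm (\<lambda>t. x n t - f t) < e / 2"
    unfolding eventually_sequentially by blast
  have "W.nrm (\<lambda>t. x m t - x n t) < e" if "m \<ge> N" "n \<ge> N" for m n
  proof -
    have "W.nrm (\<lambda>t. (x m t - f t) + (-1) * (x n t - f t)) \<le> W.nrm (\<lambda>t. x m t - f t) + W.nrm (\<lambda>t. (-1) * (x n t - f t))"
      by (rule W.nrm_add[OF W12_diff[OF x f] W12_scale[OF W12_diff[OF x f]]])
    also have "W.nrm (\<lambda>t. (-1) * (x n t - f t)) = W.nrm (\<lambda>t. x n t - f t)"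
      using W.nrm_scl[OF W12_diff[OF x f], of "-1" n] by simp
    finally show ?thesis using N[OF that(1)] N[OF that(2)] by simp
  qed
  thus ?thesis by blast
qed

text \<open>\<open>point_bound_ctest\<close> makes an approximating sequence uniformly Cauchy, so
  its limit is a continuous representative of f. Continuous functions that agree almost everywhere
  are equal, hence the chosen \<open>cont_rep f\<close> is this limit.\<close>

lemma cont_rep_props:
  fixes f :: "real \<Rightarrow> complex"
  assumes f: "W12 f" and x: "\<And>n. ctest_fun (x n)" and l: "W_lim x f"
  shows "(\<lambda>n. x n c) \<longlonglongrightarrow> cont_rep f c"
proof -
  note xW = W12_ctest[OF x]
  have "uniformly_Cauchy_on UNIV x"
  proof (rule uniformly_Cauchy_onI)
    fix e :: real assume "e > 0"
    hence "e / 2 > 0" by simp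
    from W_seq_cauchy[OF xW f l this] obtain N where N: "\<And>m n. m \<ge> N \<Longrightarrow> n \<ge> N \<Longrightarrow> W.nrm (\<lambda>t. x m t - x n t) < e / 2" by blast
    have "dist (x m t) (x n t) < e" if "m \<ge> N" "n \<ge> N" for m n t
    proof -
      have "cmod (x m t - x n t) \<le> sqrt 2 * W.nrm (\<lambda>t. x m t - x n t)"
        by (rule point_bound_ctest[OF ctest_diff[OF x x]])
      also have "\<dots> \<le> 2 * W.nrm (\<lambda>t. x m t - x n t)"
        by (intro mult_right_mono) (auto intro: real_le_lsqrt)
      also have "\<dots> < e" using N[OF that] by simp
      finally show ?thesis by (simp add: dist_norm)
    qed
    thus "\<exists>M. \<forall>t\<in>UNIV. \<forall>m\<ge>M. \<forall>n\<ge>M. dist (x m t) (x n t) < e" by blast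
  qed
  then obtain h where h: "uniform_limit UNIV x h sequentially"
    using Cauchy_uniformly_convergent[of UNIV x] unfolding uniformly_convergent_on_def by blast
  have hc: "continuous_on UNIV h"
    by (rule uniform_limit_theorem[OF _ h]) (auto intro!: always_eventually ctest_continuous x)
  have hp: "(\<lambda>n. x n t) \<longlonglongrightarrow> h t" for t by (rule tendsto_uniform_limitI[OF h]) simp
  have hm: "h \<in> borel_measurable lebesgue"
    using borel_measurable_continuous_onI[OF hc] by (simp add: measurable_completion)
  note fL = W12_L2[OF f]
  have le: "L2 (\<lambda>t. h t - f t) \<and> norm_L2 (\<lambda>t. h t - f t) \<le> e" if "e > 0" for e
  proof -
    from order_tendstoD(2)[OF l that] obtain N where N: "\<And>n. n \<ge> N \<Longrightarrow> W.nrm (\<lambda>t. x n t - f t) < e"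
      unfolding eventually_sequentially by blast
    show ?thesis
    proof (rule L2_fatou[where x = "\<lambda>n t. x n t - f t" and N = N])
      show "(\<lambda>t. h t - f t) \<in> borel_measurable lebesgue" using hm L2_measurable[OF fL] by auto
      show "AE t in lebesgue. (\<lambda>n. x n t - f t) \<longlonglongrightarrow> h t - f t" by (intro AE_I2 tendsto_intros hp)
      show "norm_L2 (\<lambda>t. x n t - f t) \<le> e" if "n \<ge> N" for n
        using norm_L2_le_W[of "\<lambda>t. x n t - f t"] N[OF that] by simp
    qed (intro L2_diff fL W12_L2[OF xW])
  qed
  have "norm_L2 (\<lambda>t. h t - f t) = 0"
    using le norm_L2_nonneg[of "\<lambda>t. h t - f t"] by (meson dense_ge order.antisym)
  hence ae: "AE t in lebesgue. h t = f t" using norm_L2_eq_0_iff[of "\<lambda>t. h t - f t"] le[of 1] by simp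
  have ex: "\<exists>h. continuous_on UNIV h \<and> (AE t in lebesgue. h t = f t)" using hc ae by blast
  from someI_ex[OF this] have cr: "continuous_on UNIV (cont_rep f)" "AE t in lebesgue. cont_rep f t = f t"
    unfolding cont_rep_def by auto
  have "AE t in lebesgue. h t = cont_rep f t" using ae cr(2) by eventually_elim simp
  hence "h = cont_rep f" by (rule continuous_AE_eq[OF hc cr(1)])
  thus ?thesis using hp by simp
qed

lemma cont_rep_ctest: assumes "ctest_fun f" shows "cont_rep f = (f :: real \<Rightarrow> complex)"
proof
  fix c
  have "W.nrm (\<lambda>t. f t - f t) = 0" using W.nrm_scl[OF W12_ctest[OF assms], of 0] by simp
  hence "(\<lambda>n::nat. f c) \<longlonglongrightarrow> cont_rep f c"
    by (intro cont_rep_props[OF W12_ctest[OF assms] assms]) simp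
  thus "cont_rep f c = f c" by (simp add: LIMSEQ_const_iff)
qed

lemma ctest_add: "ctest_fun f \<Longrightarrow> ctest_fun g \<Longrightarrow> ctest_fun (\<lambda>x. f x + g x)"
proof -
  assume f: "ctest_fun f" and g: "ctest_fun g"
  have "ctest_fun (\<lambda>x. (\<lambda>x. 0) x - g x)"
    by (rule ctest_diff[OF _ g]) (use ctest_of_real[OF test_fun_zero] in simp)
  from ctest_diff[OF f this] show ?thesis by simp
qed

lemma ctest_scale: assumes "ctest_fun f" shows "ctest_fun (\<lambda>x. c * f x)"
proof -
  obtain u v where uv: "test_fun u" "test_fun v" "f = (\<lambda>x. cr u x + \<i> * cr v x)" using ctest_cases[OF assms] .
  have "ctest_fun (\<lambda>x. cr (\<lambda>x. Re c * u x - Im c * v x) x + \<i> * cr (\<lambda>x. Re c * v x + Im c * u x) x)"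
    by (intro ctestI test_fun_diff test_fun_add test_fun_cmult uv)
  also have "(\<lambda>x. cr (\<lambda>x. Re c * u x - Im c * v x) x + \<i> * cr (\<lambda>x. Re c * v x + Im c * u x) x) = (\<lambda>x. c * f x)"
    by (auto simp: uv(3) fun_eq_iff complex_eq_iff)
  finally show ?thesis .
qed

lemma W_tendsto_add:
  assumes "\<And>n. W12 (x n)" "W12 f" "W_lim x f"
    "\<And>n. W12 (y n)" "W12 g" "W_lim y g"
  shows "(\<lambda>n. W.nrm (\<lambda>t. (x n t + y n t) - (f t + g t))) \<longlonglongrightarrow> 0"
proof (rule Lim_null_comparison)
  have "norm (W.nrm (\<lambda>t. (x n t + y n t) - (f t + g t))) \<le> W.nrm (\<lambda>t. x n t - f t) + W.nrm (\<lambda>t. y n t - g t)" for n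
    using W.nrm_add[OF W12_diff[OF assms(1)[of n] assms(2)] W12_diff[OF assms(4)[of n] assms(5)]] by (simp add: algebra_simps)
  thus "\<forall>\<^sub>F n in sequentially. norm (W.nrm (\<lambda>t. (x n t + y n t) - (f t + g t))) \<le> W.nrm (\<lambda>t. x n t - f t) + W.nrm (\<lambda>t. y n t - g t)"
    by simp
  show "(\<lambda>n. W.nrm (\<lambda>t. x n t - f t) + W.nrm (\<lambda>t. y n t - g t)) \<longlonglongrightarrow> 0"
    using tendsto_add[OF assms(3,6)] by simp
qed

lemma W_tendsto_scale:
  assumes "\<And>n. W12 (x n)" "W12 f" "W_lim x f"
  shows "(\<lambda>n. W.nrm (\<lambda>t. c * x n t - c * f t)) \<longlonglongrightarrow> 0"
proof -
  have "W.nrm (\<lambda>t. c * x n t - c * f t) = cmod c * W.nrm (\<lambda>t. x n t - f t)" for n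
    using W.nrm_scl[OF W12_diff[OF assms(1)[of n] assms(2)], of c] by (simp add: right_diff_distrib)
  thus ?thesis using tendsto_mult_right_zero[OF assms(3)] by simp
qed

lemma cont_rep_add: assumes "W12 f" "W12 g" shows "cont_rep (\<lambda>x. f x + g x) c = cont_rep f c + cont_rep g c"
proof -
  obtain p where p: "\<And>n::nat. ctest_fun (p n)" "W_lim p f" using ctest_dense_seq[OF assms(1)] by blast
  obtain q where q: "\<And>n::nat. ctest_fun (q n)" "W_lim q g" using ctest_dense_seq[OF assms(2)] by blast
  have "(\<lambda>n. p n c + q n c) \<longlonglongrightarrow> cont_rep (\<lambda>x. f x + g x) c"
    by (rule cont_rep_props[OF W12_add[OF assms] ctest_add[OF p(1) q(1)]])
      (rule W_tendsto_add[OF W12_ctest[OF p(1)] assms(1) p(2) W12_ctest[OF q(1)] assms(2) q(2)])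
  moreover have "(\<lambda>n. p n c + q n c) \<longlonglongrightarrow> cont_rep f c + cont_rep g c"
    by (intro tendsto_add cont_rep_props[OF assms(1) p] cont_rep_props[OF assms(2) q])
  ultimately show ?thesis by (rule LIMSEQ_unique)
qed

lemma cont_rep_scale: assumes "W12 f" shows "cont_rep (\<lambda>x. k * f x) c = k * cont_rep f c"
proof -
  obtain p where p: "\<And>n::nat. ctest_fun (p n)" "W_lim p f" using ctest_dense_seq[OF assms(1)] by blast
  have "(\<lambda>n. k * p n c) \<longlonglongrightarrow> cont_rep (\<lambda>x. k * f x) c"
    by (rule cont_rep_props[OF W12_scale[OF assms] ctest_scale[OF p(1)]])
      (rule W_tendsto_scale[OF W12_ctest[OF p(1)] assms(1) p(2)])
  moreover have "(\<lambda>n. k * p n c) \<longlonglongrightarrow> k * cont_rep f c"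
    by (intro tendsto_mult tendsto_const cont_rep_props[OF assms(1) p])
  ultimately show ?thesis by (rule LIMSEQ_unique)
qed

lemma cont_rep_bound: assumes "W12 f" shows "cmod (cont_rep f c) \<le> sqrt 2 * W.nrm f"
proof -
  obtain p where p: "\<And>n::nat. ctest_fun (p n)" "W_lim p f" using ctest_dense_seq[OF assms(1)] by blast
  have "(\<lambda>n. cmod (p n c)) \<longlonglongrightarrow> cmod (cont_rep f c)" by (intro tendsto_norm cont_rep_props[OF assms p])
  moreover have "(\<lambda>n. sqrt 2 * W.nrm (p n)) \<longlonglongrightarrow> sqrt 2 * W.nrm f"
    by (intro tendsto_mult tendsto_const W_nrm_tendsto[OF W12_ctest[OF p(1)] assms p(2)])
  ultimately show ?thesis by (rule LIMSEQ_le) (use point_bound_ctest[OF p(1)] in auto)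
qed

lemma bform_point: "bform (\<lambda>f g. cnj (cont_rep f c) * cont_rep g c)"
  by (rule bform_functional[OF cont_rep_add cont_rep_scale cont_rep_bound])

section \<open>Identification of the lowest eigenvalue\<close>

context point_int
begin

text \<open>\<open>ann\<close> extended to W12, with the weak in place of the classical
  derivative.\<close>

definition T1 :: "(real \<Rightarrow> complex) \<Rightarrow> real \<Rightarrow> complex" where
  "T1 f x = wgrad f 1 x - cr w x * f x"

lemma w_leb: "cr w \<in> borel_measurable lebesgue"
  by (rule measurable_completion) measurable

lemma w_L2: "L2 f \<Longrightarrow> L2 (\<lambda>x. cr w x * f x)"
  by (rule L2_mult_bounded[OF _ w_leb, of _ \<kappa>]) (auto simp: w_bound)

lemma w_norm: assumes "L2 f" shows "norm_L2 (\<lambda>x. cr w x * f x) \<le> \<kappa> * norm_L2 f"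
proof (rule power2_le_imp_le)
  have "(norm_L2 (\<lambda>x. cr w x * f x))\<^sup>2 \<le> (LEBINT x. \<kappa>\<^sup>2 * (cmod (f x))\<^sup>2)"
    unfolding norm_L2_sq
  proof (rule integral_mono[OF L2_integrable[OF w_L2[OF assms]]])
    show "(cmod (cr w x * f x))\<^sup>2 \<le> \<kappa>\<^sup>2 * (cmod (f x))\<^sup>2" for x
    proof -
      have "\<bar>w x\<bar>\<^sup>2 \<le> \<kappa>\<^sup>2" by (rule power_mono[OF w_bound]) simp
      thus ?thesis by (simp add: norm_mult power_mult_distrib mult_right_mono)
    qed
  qed (use L2_integrable[OF assms] in simp)
  thus "(norm_L2 (\<lambda>x. cr w x * f x))\<^sup>2 \<le> (\<kappa> * norm_L2 f)\<^sup>2" by (simp add: power_mult_distrib norm_L2_sq)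
qed (use \<kappa> in simp)

lemma lin_op_T1: "lin_op T1"
  unfolding lin_op_def
proof (intro conjI allI impI)
  have b: "(1::real) \<in> Basis" by simp
  show "L2 (T1 u)" if "W12 u" for u
    unfolding T1_def[abs_def] by (intro L2_diff wgrad_L2 that w_L2 W12_L2 b)
  show "AE x in lebesgue. T1 (\<lambda>x. u x + v x) x = T1 u x + T1 v x" if "W12 u" "W12 v" for u v
    using wgrad_add[OF that b] by eventually_elim (simp add: T1_def algebra_simps)
  show "AE x in lebesgue. T1 (\<lambda>x. c * u x) x = c * T1 u x" if "W12 u" for u c
    using wgrad_scale[OF that b, of c] by eventually_elim (simp add: T1_def algebra_simps)
  have "norm_L2 (T1 u) \<le> (1 + \<kappa>) * W.nrm u" if u: "W12 u" for u
  proof -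
    have "norm_L2 (T1 u) \<le> norm_L2 (wgrad u 1) + norm_L2 (\<lambda>x. cr w x * u x)"
      unfolding T1_def[abs_def] by (intro norm_L2_triangle_diff wgrad_L2 u w_L2 W12_L2 b)
    also have "\<dots> \<le> W.nrm u + \<kappa> * W.nrm u"
      using norm_wgrad_le_W[OF b, of u] w_norm[OF W12_L2[OF u]] mult_left_mono[OF norm_L2_le_W[of u], of \<kappa>] \<kappa> by linarith
    finally show ?thesis by (simp add: algebra_simps)
  qed
  thus "\<exists>C. \<forall>u. W12 u \<longrightarrow> norm_L2 (T1 u) \<le> C * W.nrm u" by blast
qed

lemma bform_T1: "bform (\<lambda>u v. inner_L2 (T1 u) (T1 v))"
  using bform_wform[OF lin_op_T1, of "\<lambda>_. 1" 1] by (simp add: wform_inner[abs_def])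

lemma T1_test:
  assumes u: "test_fun u"
  shows "AE x in lebesgue. T1 (cr u) x = cr (ann u) x" "L2 (cr (ann u))"
proof -
  have b: "(1::real) \<in> Basis" by simp
  show "AE x in lebesgue. T1 (cr u) x = cr (ann u) x"
    using wgrad_test[OF u b] by eventually_elim (simp add: T1_def)
  show "L2 (cr (ann u))"
    using L2_diff[OF test_fun_L2[OF test_fun_partial[OF u b]] w_L2[OF test_fun_L2[OF u]]] by simp
qed

lemma T1_L2: "W12 u \<Longrightarrow> L2 (T1 u)" using lin_op_T1 unfolding lin_op_def by blast

lemma inner_T1_test:
  assumes u: "test_fun u" and v: "test_fun v"
  shows "inner_L2 (T1 (cr u)) (T1 (cr v)) = complex_of_real (LBINT x. ann u x * ann v x)"
proof -
  have "inner_L2 (T1 (cr u)) (T1 (cr v)) = inner_L2 (cr (ann u)) (cr (ann v))"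
    by (rule inner_L2_cong_AE[OF T1_L2[OF W12_test[OF u]] T1_test(2)[OF u] T1_L2[OF W12_test[OF v]] T1_test(2)[OF v] T1_test(1)[OF u] T1_test(1)[OF v]])
  also have "\<dots> = complex_of_real (LEBINT x. ann u x * ann v x)"
    unfolding inner_L2_def by (simp only: complex_cnj_complex_of_real of_real_mult[symmetric] integral_complex_of_real)
  also have "(LEBINT x. ann u x * ann v x) = (LBINT x. ann u x * ann v x)"
  proof (rule integral_lebesgue_lborel)
    note [measurable] = test_fun_measurable[OF u] test_fun_measurable[OF v] test_fun_measurable[OF test_fun_partial[OF u]] test_fun_measurable[OF test_fun_partial[OF v]]
    show "(\<lambda>x. ann u x * ann v x) \<in> borel_measurable borel" by measurable
  qed
  finally show ?thesis .
qed

text \<open>Both sides are bounded forms, and on test functions they agree by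
  \<open>ground_state_1d\<close>.\<close>

lemma form_1D_identity:
  assumes "W12 u" "W12 v"
  shows "form_1D \<alpha> a u v + complex_of_real (\<kappa>\<^sup>2) * inner_L2 u v = inner_L2 (T1 u) (T1 v)"
proof (rule bform_eq_test[OF _ bform_T1 _ assms])
  have b: "(1::real) \<in> Basis" by simp
  have eq: "form_1D \<alpha> a u v = inner_L2 (wgrad u 1) (wgrad v 1) - complex_of_real \<alpha> * (cnj (cont_rep u a) * cont_rep v a) - complex_of_real \<alpha> * (cnj (cont_rep u (-a)) * cont_rep v (-a))" for u v
    by (simp add: form_1D_def inner_L2_def mult.assoc)
  show "bform (\<lambda>u v. form_1D \<alpha> a u v + complex_of_real (\<kappa>\<^sup>2) * inner_L2 u v)"
    unfolding eq by (intro bform_add bform_diff bform_scale bform_wgrad bform_point bform_inner_L2 b)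
  fix u v :: "real \<Rightarrow> real" assume u: "test_fun u" and v: "test_fun v"
  show "form_1D \<alpha> a (cr u) (cr v) + complex_of_real (\<kappa>\<^sup>2) * inner_L2 (cr u) (cr v) = inner_L2 (T1 (cr u)) (T1 (cr v))"
    unfolding eq inner_wgrad_test[OF u v b] inner_L2_test[OF u v] inner_T1_test[OF u v] ground_state_1d[OF u v]
      cont_rep_ctest[OF ctest_of_real[OF u]] cont_rep_ctest[OF ctest_of_real[OF v]] by simp
qed

lemma u0_L2: "L2 (cr u0)"
proof -
  have "cr u0 \<in> borel_measurable lebesgue" by (rule measurable_completion) measurable
  moreover have "integrable lebesgue (\<lambda>x. (u0 x)\<^sup>2)"
    using u0_sq_integrable by (subst integrable_completion) auto
  ultimately show ?thesis by (simp add: L2_def)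
qed

lemma u0_W12: "W12 (cr u0)" and T1_u0: "AE x in lebesgue. T1 (cr u0) x = 0"
proof -
  have L: "L2 (\<lambda>x. cr w x * cr u0 x)" by (rule w_L2[OF u0_L2])
  have wd: "weak_deriv (cr u0) 1 (\<lambda>x. cr w x * cr u0 x)"
    unfolding weak_deriv_def
  proof (intro allI impI)
    fix g :: "real \<Rightarrow> real" assume g: "test_fun g"
    have b: "(1::real) \<in> Basis" by simp
    note [measurable] = test_fun_measurable[OF g] test_fun_measurable[OF test_fun_partial[OF g b]]
    have "(LEBINT x. u0 x * partial g 1 x) = (LBINT x. u0 x * partial g 1 x)"
      by (rule integral_lebesgue_lborel) measurable
    moreover have "(LEBINT x. (w x * u0 x) * g x) = (LBINT x. (w x * u0 x) * g x)"
      by (rule integral_lebesgue_lborel) measurable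
    ultimately have "(LEBINT x. u0 x * partial g 1 x) = - (LEBINT x. (w x * u0 x) * g x)"
      using u0_weak[OF g] by simp
    thus "(LEBINT x. cr u0 x * cr (partial g 1) x) = - (LEBINT x. cr w x * cr u0 x * cr g x)"
      by (simp flip: of_real_mult of_real_minus)
  qed
  show W: "W12 (cr u0)" by (rule W12I[where g = "\<lambda>_ x. cr w x * cr u0 x"]) (use u0_L2 L wd in auto)
  show "AE x in lebesgue. T1 (cr u0) x = 0"
    using wgrad_AE[OF W _ L wd] by (simp add: T1_def)
qed

lemma u0_norm: "rnorm u0 > 0"
proof (rule ccontr)
  assume "\<not> ?thesis"
  hence "rnorm u0 = 0" using norm_L2_nonneg[of "cr u0"] by linarith
  hence "AE x in (lebesgue :: real measure). False" using norm_L2_eq_0_iff[OF u0_L2] u0_pos by (simp add: less_imp_neq[THEN not_sym])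
  hence "emeasure lebesgue (UNIV :: real set) = 0" by (simp add: ae_filter_eq_bot_iff flip: trivial_limit_def)
  thus False by simp
qed

text \<open>The infimum is a minimum: T1 annihilates u0, which is thus an eigenfunction for
  -\<kappa>^2, and an eigenfunction \<psi> for t satisfies (t + \<kappa>^2) |\<psi>|^2 = |T1
  \<psi>|^2 in norms.\<close>

theorem xi0_eq: "xi0 \<alpha> a = - \<kappa>\<^sup>2"
  unfolding xi0_def
proof (rule cInf_eq_minimum)
  have "form_1D \<alpha> a v (cr u0) = inner_L2 v (\<lambda>x. - complex_of_real (\<kappa>\<^sup>2) * cr u0 x)" if v: "W12 v" for v
  proof -
    have "inner_L2 (T1 v) (T1 (cr u0)) = inner_L2 (T1 v) (\<lambda>x. 0)"
      by (rule inner_L2_cong_AE[OF T1_L2[OF v] T1_L2[OF v] T1_L2[OF u0_W12] L2_zero _ T1_u0]) simp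
    also have "\<dots> = 0" by (simp add: inner_L2_def)
    finally have 1: "form_1D \<alpha> a v (cr u0) = - (complex_of_real (\<kappa>\<^sup>2) * inner_L2 v (cr u0))"
      using form_1D_identity[OF v u0_W12] by (simp only: eq_neg_iff_add_eq_0)
    have 2: "inner_L2 v (\<lambda>x. - complex_of_real (\<kappa>\<^sup>2) * cr u0 x) = - (complex_of_real (\<kappa>\<^sup>2) * inner_L2 v (cr u0))"
      using L2.f_scl[OF W12_L2[OF v] u0_L2, of "- complex_of_real (\<kappa>\<^sup>2)"] by (simp only: mult_minus_left)
    show ?thesis unfolding 1 2 ..
  qed
  hence "Delta_1D \<alpha> a (cr u0) (\<lambda>x. - complex_of_real (\<kappa>\<^sup>2) * cr u0 x)"
    unfolding Delta_1D_def assoc_op_def using u0_W12 L2_scale[OF u0_L2] by blast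
  hence "eigenfun (Delta_1D \<alpha> a) (complex_of_real (- \<kappa>\<^sup>2)) (cr u0)"
    unfolding eigenfun_def by (intro exI[of _ "\<lambda>x. - complex_of_real (\<kappa>\<^sup>2) * cr u0 x"]) simp
  hence "is_eigenvalue (Delta_1D \<alpha> a) (complex_of_real (- \<kappa>\<^sup>2))"
    unfolding is_eigenvalue_def using u0_norm by (intro exI[of _ "cr u0"]) simp
  thus "- \<kappa>\<^sup>2 \<in> {t. is_eigenvalue (Delta_1D \<alpha> a) (complex_of_real t)}" by (simp only: mem_Collect_eq)
next
  fix t assume "t \<in> {t. is_eigenvalue (Delta_1D \<alpha> a) (complex_of_real t)}"
  then obtain \<psi> g where G: "Delta_1D \<alpha> a \<psi> g" and ae: "AE x in lebesgue. g x = complex_of_real t * \<psi> x" and n: "norm_L2 \<psi> \<noteq> 0"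
    unfolding mem_Collect_eq is_eigenvalue_def eigenfun_def by blast
  have W: "W12 \<psi>" and gL: "L2 g" and f: "form_1D \<alpha> a \<psi> \<psi> = inner_L2 \<psi> g"
    using G unfolding Delta_1D_def assoc_op_def by blast+
  note pL = W12_L2[OF W]
  have "inner_L2 \<psi> g = inner_L2 \<psi> (\<lambda>x. complex_of_real t * \<psi> x)"
    by (rule inner_L2_cong_AE[OF pL pL gL L2_scale[OF pL] _ ae]) simp
  also have "\<dots> = complex_of_real t * complex_of_real ((norm_L2 \<psi>)\<^sup>2)"
    using L2.f_scl[OF pL pL] by (simp add: inner_L2_self)
  finally have "complex_of_real t * complex_of_real ((norm_L2 \<psi>)\<^sup>2) + complex_of_real (\<kappa>\<^sup>2) * complex_of_real ((norm_L2 \<psi>)\<^sup>2) = complex_of_real ((norm_L2 (T1 \<psi>))\<^sup>2)"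
    using form_1D_identity[OF W W] f unfolding inner_L2_self by metis
  hence "t * (norm_L2 \<psi>)\<^sup>2 + \<kappa>\<^sup>2 * (norm_L2 \<psi>)\<^sup>2 = (norm_L2 (T1 \<psi>))\<^sup>2"
    by (simp only: of_real_mult[symmetric] of_real_add[symmetric] of_real_eq_iff)
  hence "(t + \<kappa>\<^sup>2) * (norm_L2 \<psi>)\<^sup>2 \<ge> 0" by (simp add: distrib_right)
  moreover have "(norm_L2 \<psi>)\<^sup>2 > 0" using n by simp
  ultimately show "- \<kappa>\<^sup>2 \<le> t" by (simp add: zero_le_mult_iff)
qed

text \<open>u0 has neither bounded support nor continuous derivatives. The form \<delta>^2 |v|^2 -
  |T1 v|^2 is positive at u0, hence at a complex test function close to it; there it is the sum of
  its values at the real and the imaginary part, one of which must be positive.\<close>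

lemma approx_ground_state:
  assumes d: "\<delta> > 0"
  obtains v where "test_fun v" "rnorm v > 0" "rnorm (ann v) \<le> \<delta> * rnorm v"
proof -
  obtain p where p: "\<And>n::nat. ctest_fun (p n)" "(\<lambda>n. W.nrm (\<lambda>x. p n x - cr u0 x)) \<longlonglongrightarrow> 0" using ctest_dense_seq[OF u0_W12] by blast
  note P = W12_ctest[OF p(1)] u0_W12 p(2)
  have bf: "bform (\<lambda>u v. complex_of_real (\<delta>\<^sup>2) * inner_L2 u v - inner_L2 (T1 u) (T1 v))"
    by (intro bform_diff bform_scale bform_inner_L2 bform_T1)
  let ?f = "\<lambda>u v. complex_of_real (\<delta>\<^sup>2) * inner_L2 u v - inner_L2 (T1 u) (T1 v)"
  have "(\<lambda>n. ?f (p n) (p n)) \<longlonglongrightarrow> ?f (cr u0) (cr u0)" by (rule bform_tendsto[OF bf P P])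
  hence "(\<lambda>n. Re (?f (p n) (p n))) \<longlonglongrightarrow> Re (?f (cr u0) (cr u0))" by (rule tendsto_Re)
  moreover have "Re (?f (cr u0) (cr u0)) > 0"
  proof -
    have "norm_L2 (T1 (cr u0)) = 0" using norm_L2_eq_0_iff[OF T1_L2[OF u0_W12]] T1_u0 by blast
    thus ?thesis using u0_norm d by (simp add: inner_L2_self del: of_real_power)
  qed
  ultimately have "\<forall>\<^sub>F n in sequentially. Re (?f (p n) (p n)) > 0" by (rule order_tendstoD(1))
  then obtain n where n: "Re (?f (p n) (p n)) > 0" using eventually_happens'[OF sequentially_bot] by blast
  obtain u v where uv: "test_fun u" "test_fun v" "p n = (\<lambda>x. cr u x + \<i> * cr v x)" using ctest_cases[OF p(1)] .
  have "Im (?f (cr u) (cr v)) = 0" if "test_fun u" "test_fun v" for u v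
    by (simp add: inner_L2_test[OF that] inner_T1_test[OF that])
  from herm_ctest_split[OF bform_herm[OF bf] this uv(1,2)]
  have "Re (?f (p n) (p n)) = Re (?f (cr u) (cr u)) + Re (?f (cr v) (cr v))" unfolding uv(3) .
  hence "Re (?f (cr u) (cr u)) > 0 \<or> Re (?f (cr v) (cr v)) > 0" using n by linarith
  then obtain z where z: "test_fun z" "Re (?f (cr z) (cr z)) > 0" using uv by blast
  have eq: "Re (?f (cr z) (cr z)) = \<delta>\<^sup>2 * (rnorm z)\<^sup>2 - (norm_L2 (T1 (cr z)))\<^sup>2"
    by (simp add: inner_L2_self del: of_real_power)
  have T: "norm_L2 (T1 (cr z)) = rnorm (ann z)"
    by (rule norm_L2_cong_AE[OF T1_L2[OF W12_test[OF z(1)]] T1_test(2)[OF z(1)] T1_test(1)[OF z(1)]])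
  have lt: "(norm_L2 (T1 (cr z)))\<^sup>2 < \<delta>\<^sup>2 * (rnorm z)\<^sup>2" using z(2) unfolding eq by simp
  have "rnorm z \<noteq> 0"
  proof
    assume "rnorm z = 0"
    thus False using lt by simp
  qed
  hence pos: "rnorm z > 0" by (simp add: order_less_le)
  have "norm_L2 (T1 (cr z)) \<le> \<delta> * rnorm z"
    by (rule power2_le_imp_le) (use lt d in \<open>auto simp: power_mult_distrib\<close>)
  with that[OF z(1) pos] show ?thesis by (simp only: T)
qed

end

section \<open>Slices and traces\<close>

lemma Basis_RR: "(Basis :: plane set) = {(1, 0), (0, 1)}"
  by (auto simp: Basis_prod_def)

lemma e1_Basis [simp]: "(1::real, 0::real) \<in> Basis" and e2_Basis [simp]: "(0::real, 1::real) \<in> Basis"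
  by (simp_all add: Basis_RR)

lemma sum_Basis_RR: "(\<Sum>b\<in>(Basis :: plane set). f b) = f (1, 0) + f (0, 1)"
  by (simp add: Basis_RR)

lemma slice_deriv:
  fixes h :: "plane \<Rightarrow> real"
  assumes "smooth h"
  shows "((\<lambda>y. h (x, y)) has_real_derivative partial h (0, 1) (x, y)) (at y)"
    and "((\<lambda>x. h (x, y)) has_real_derivative partial h (1, 0) (x, y)) (at x)"
proof -
  have "((\<lambda>t. h (x, y + t *\<^sub>R 1)) has_real_derivative partial h (0, 1) (x, y)) (at 0)"
    using smooth_partial_deriv0[OF assms e2_Basis, of "(x, y)"] by simp
  thus "((\<lambda>y. h (x, y)) has_real_derivative partial h (0, 1) (x, y)) (at y)" by (simp only: deriv_real_iff[where f = "\<lambda>y. h (x, y)"])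
  have "((\<lambda>t. h (x + t *\<^sub>R 1, y)) has_real_derivative partial h (1, 0) (x, y)) (at 0)"
    using smooth_partial_deriv0[OF assms e1_Basis, of "(x, y)"] by simp
  thus "((\<lambda>x. h (x, y)) has_real_derivative partial h (1, 0) (x, y)) (at x)" by (simp only: deriv_real_iff[where f = "\<lambda>x. h (x, y)"])
qed

lemma smooth_slice:
  fixes h :: "plane \<Rightarrow> real"
  assumes "smooth h" shows "smooth (\<lambda>y. h (x, y))" and "smooth (\<lambda>x. h (x, y))"
proof -
  show "smooth (\<lambda>y. h (x, y))"
  proof (rule smooth_realI[of _ "{g. \<exists>h :: plane \<Rightarrow> real. smooth h \<and> g = (\<lambda>y. h (x, y))}"])
    show "(\<lambda>y. h (x, y)) \<in> {g. \<exists>h :: plane \<Rightarrow> real. smooth h \<and> g = (\<lambda>y. h (x, y))}" using assms by auto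
    fix g :: "real \<Rightarrow> real" assume "g \<in> {g. \<exists>h :: plane \<Rightarrow> real. smooth h \<and> g = (\<lambda>y. h (x, y))}"
    then obtain k :: "plane \<Rightarrow> real" where k: "smooth k" "g = (\<lambda>y. k (x, y))" by auto
    show "\<exists>g'\<in>{g. \<exists>h :: plane \<Rightarrow> real. smooth h \<and> g = (\<lambda>y. h (x, y))}. \<forall>y. (g has_real_derivative g' y) (at y)"
    proof (rule bexI)
      show "\<forall>y. (g has_real_derivative partial k (0, 1) (x, y)) (at y)" unfolding k(2) using slice_deriv(1)[OF k(1)] by blast
      show "(\<lambda>y. partial k (0, 1) (x, y)) \<in> {g. \<exists>h :: plane \<Rightarrow> real. smooth h \<and> g = (\<lambda>y. h (x, y))}"
        using smooth_partial[OF k(1) e2_Basis] by auto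
    qed
  qed
  show "smooth (\<lambda>x. h (x, y))"
  proof (rule smooth_realI[of _ "{g. \<exists>h :: plane \<Rightarrow> real. smooth h \<and> g = (\<lambda>x. h (x, y))}"])
    show "(\<lambda>x. h (x, y)) \<in> {g. \<exists>h :: plane \<Rightarrow> real. smooth h \<and> g = (\<lambda>x. h (x, y))}" using assms by auto
    fix g :: "real \<Rightarrow> real" assume "g \<in> {g. \<exists>h :: plane \<Rightarrow> real. smooth h \<and> g = (\<lambda>x. h (x, y))}"
    then obtain k :: "plane \<Rightarrow> real" where k: "smooth k" "g = (\<lambda>x. k (x, y))" by auto
    show "\<exists>g'\<in>{g. \<exists>h :: plane \<Rightarrow> real. smooth h \<and> g = (\<lambda>x. h (x, y))}. \<forall>x. (g has_real_derivative g' x) (at x)"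
    proof (rule bexI)
      show "\<forall>x. (g has_real_derivative partial k (1, 0) (x, y)) (at x)" unfolding k(2) using slice_deriv(2)[OF k(1)] by blast
      show "(\<lambda>x. partial k (1, 0) (x, y)) \<in> {g. \<exists>h :: plane \<Rightarrow> real. smooth h \<and> g = (\<lambda>x. h (x, y))}"
        using smooth_partial[OF k(1) e1_Basis] by auto
    qed
  qed
qed

lemma partial_slice:
  fixes h :: "plane \<Rightarrow> real"
  assumes "smooth h"
  shows "partial (\<lambda>y. h (x, y)) 1 = (\<lambda>y. partial h (0, 1) (x, y))" and "partial (\<lambda>x. h (x, y)) 1 = (\<lambda>x. partial h (1, 0) (x, y))"
  by (rule ext, rule DERIV_unique[OF smooth_real_deriv[OF smooth_slice(1)[OF assms]] slice_deriv(1)[OF assms]])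
    (rule ext, rule DERIV_unique[OF smooth_real_deriv[OF smooth_slice(2)[OF assms]] slice_deriv(2)[OF assms]])

lemma test_fun_slice:
  fixes h :: "plane \<Rightarrow> real"
  assumes "test_fun h" shows "test_fun (\<lambda>y. h (x, y))" and "test_fun (\<lambda>x. h (x, y))"
proof -
  obtain R where R: "\<And>z. norm z > R \<Longrightarrow> h z = 0" using test_fun_support[OF assms] by metis
  show "test_fun (\<lambda>y. h (x, y))"
    by (rule test_funI[OF smooth_slice(1)[OF test_fun_smooth[OF assms]], of R]) (rule R, erule order_less_le_trans, rule norm_snd_le)
  show "test_fun (\<lambda>x. h (x, y))"
    by (rule test_funI[OF smooth_slice(2)[OF test_fun_smooth[OF assms]], of R]) (rule R, erule order_less_le_trans, rule norm_fst_le)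
qed

section \<open>Tensor products and Fubini\<close>

abbreviation tensor :: "(real \<Rightarrow> real) \<Rightarrow> (real \<Rightarrow> real) \<Rightarrow> plane \<Rightarrow> real" where
  "tensor f v z \<equiv> f (fst z) * v (snd z)"

lemma smooth_tensor:
  fixes f v :: "real \<Rightarrow> real"
  assumes "smooth f" "smooth v"
  shows "smooth (tensor f v)"
    and "partial (tensor f v) (1, 0) = tensor (partial f 1) v"
    and "partial (tensor f v) (0, 1) = tensor f (partial v 1)"
proof -
  have "smooth (\<lambda>z::plane. f (0 + z \<bullet> (1, 0)) * v (0 + z \<bullet> (0, 1)))"
    by (intro smooth_mult smooth_affine assms)
  thus s: "smooth (tensor f v)" by (simp add: inner_prod_def)
  have 1: "((\<lambda>x. f x * v y) has_real_derivative partial f 1 x * v y) (at x)" for x y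
    using DERIV_cmult_right[OF smooth_real_deriv[OF assms(1)]] .
  have 2: "((\<lambda>y. f x * v y) has_real_derivative f x * partial v 1 y) (at y)" for x y
    using DERIV_cmult[OF smooth_real_deriv[OF assms(2)]] .
  show "partial (tensor f v) (1, 0) = tensor (partial f 1) v"
  proof
    fix z :: "plane"
    show "partial (tensor f v) (1, 0) z = partial f 1 (fst z) * v (snd z)"
      using DERIV_unique[OF slice_deriv(2)[OF s, of "snd z" "fst z", simplified] 1] by simp
  qed
  show "partial (tensor f v) (0, 1) = tensor f (partial v 1)"
  proof
    fix z :: "plane"
    show "partial (tensor f v) (0, 1) z = f (fst z) * partial v 1 (snd z)"
      using DERIV_unique[OF slice_deriv(1)[OF s, of "fst z" "snd z", simplified] 2] by simp
  qed
qed

lemma test_fun_tensor: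
  fixes f v :: "real \<Rightarrow> real"
  assumes "test_fun f" "test_fun v"
  shows "test_fun (tensor f v)"
proof -
  obtain R where R: "\<And>z. norm z > R \<Longrightarrow> f z = 0" using test_fun_support[OF assms(1)] by metis
  obtain S where S: "\<And>z. norm z > S \<Longrightarrow> v z = 0" using test_fun_support[OF assms(2)] by metis
  show ?thesis
  proof (rule test_funI[OF smooth_tensor(1)[OF test_fun_smooth[OF assms(1)] test_fun_smooth[OF assms(2)]], of "\<bar>R\<bar> + \<bar>S\<bar>"])
    fix z :: "plane" assume z: "norm z > \<bar>R\<bar> + \<bar>S\<bar>"
    have "norm z \<le> norm (fst z) + norm (snd z)" using norm_Pair_le[of "fst z" "snd z"] by simp
    hence "norm (fst z) > R \<or> norm (snd z) > S" using z by linarith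
    thus "f (fst z) * v (snd z) = 0" using R S by auto
  qed
qed

lemma fubini_lborel:
  fixes F :: "plane \<Rightarrow> real"
  assumes "integrable lborel F"
  shows "integral\<^sup>L lborel F = (LBINT x. (LBINT y. F (x, y)))"
    and "integrable lborel (\<lambda>x. \<integral>y. F (x, y) \<partial>lborel)"
    and "integral\<^sup>L lborel F = (LBINT y. (LBINT x. F (x, y)))"
    and "integrable lborel (\<lambda>y. \<integral>x. F (x, y) \<partial>lborel)"
proof -
  have i: "integrable (lborel \<Otimes>\<^sub>M lborel) F" using assms by (simp add: lborel_prod)
  show "integral\<^sup>L lborel F = (LBINT x. (LBINT y. F (x, y)))"
    using lborel_pair.integral_fst'[OF i] by (simp add: lborel_prod)
  show "integrable lborel (\<lambda>x. \<integral>y. F (x, y) \<partial>lborel)" by (rule lborel_pair.integrable_fst'[OF i])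
  have i2: "integrable (lborel \<Otimes>\<^sub>M lborel) (case_prod (\<lambda>x y. F (x, y)))" using i by simp
  show "integral\<^sup>L lborel F = (LBINT y. (LBINT x. F (x, y)))"
    using lborel_pair.integral_snd[OF i2] by (simp add: lborel_prod)
  show "integrable lborel (\<lambda>y. \<integral>x. F (x, y) \<partial>lborel)" by (rule lborel_pair.integrable_snd[OF i2])
qed

lemma test_sq_integrable: "test_fun u \<Longrightarrow> integrable lborel (\<lambda>x. (u x)\<^sup>2)"
  using test_mult_integrable[of u u] by (simp add: power2_eq_square)

text \<open>\<open>trace_1d\<close> in every fibre, integrated over x.\<close>

lemma trace_2d:
  fixes u :: "plane \<Rightarrow> real"
  assumes u: "test_fun u" and h: "h > 0"
  shows "(LBINT x. (u (x, c))\<^sup>2) \<le> (2 / h) * (LBINT z. (u z)\<^sup>2) + 2 * h * (LBINT z. (partial u (0, 1) z)\<^sup>2)"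
proof -
  note su = test_fun_smooth[OF u]
  have up: "test_fun (partial u (0, 1))" by (rule test_fun_partial[OF u e2_Basis])
  have sl: "test_fun (\<lambda>y. u (x, y))" "test_fun (\<lambda>y. partial u (0, 1) (x, y))" for x
    using test_fun_slice(1)[OF u, of x] test_fun_slice(1)[OF up, of x] .
  have pt: "(u (x, c))\<^sup>2 \<le> (2 / h) * (LBINT y. (u (x, y))\<^sup>2) + 2 * h * (LBINT y. (partial u (0, 1) (x, y))\<^sup>2)" for x
  proof -
    have "(u (x, c))\<^sup>2 \<le> (2 / h) * (LBINT t. indicator {c..c+h} t * (u (x, t))\<^sup>2) + 2 * h * (LBINT t. indicator {c..c+h} t * (partial u (0, 1) (x, t))\<^sup>2)"
      by (rule trace_1d[OF slice_deriv(1)[OF su] test_fun_continuous[OF sl(2)] h])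
    also have "\<dots> \<le> (2 / h) * (LBINT y. (u (x, y))\<^sup>2) + 2 * h * (LBINT y. (partial u (0, 1) (x, y))\<^sup>2)"
      by (intro add_mono mult_left_mono interval_le_integral test_sq_integrable sl continuous_on_power test_fun_continuous) (use h in auto)
    finally show ?thesis .
  qed
  have "(LBINT x. (u (x, c))\<^sup>2) \<le> (LBINT x. (2 / h) * (LBINT y. (u (x, y))\<^sup>2) + 2 * h * (LBINT y. (partial u (0, 1) (x, y))\<^sup>2))"
    by (rule integral_mono[OF test_sq_integrable[OF test_fun_slice(2)[OF u, of c]] _ pt])
      (intro Bochner_Integration.integrable_add integrable_mult_right fubini_lborel(2)[OF test_sq_integrable[OF u]] fubini_lborel(2)[OF test_sq_integrable[OF up]])
  also have "\<dots> = (2 / h) * (LBINT x. (LBINT y. (u (x, y))\<^sup>2)) + 2 * h * (LBINT x. (LBINT y. (partial u (0, 1) (x, y))\<^sup>2))"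
    using fubini_lborel(2)[OF test_sq_integrable[OF u]] fubini_lborel(2)[OF test_sq_integrable[OF up]] by simp
  also have "\<dots> = (2 / h) * (LBINT z. (u z)\<^sup>2) + 2 * h * (LBINT z. (partial u (0, 1) z)\<^sup>2)"
    unfolding fubini_lborel(1)[OF test_sq_integrable[OF u]] fubini_lborel(1)[OF test_sq_integrable[OF up]] ..
  finally show ?thesis .
qed

lemma slice_norm_test:
  fixes u :: "plane \<Rightarrow> real"
  assumes u: "test_fun u" shows "(rnorm (\<lambda>x. u (x, c)))\<^sup>2 \<le> 2 * (Wr u)\<^sup>2"
proof -
  have "(rnorm (\<lambda>x. u (x, c)))\<^sup>2 \<le> 2 * (LBINT z. (u z)\<^sup>2) + 2 * (LBINT z. (partial u (0, 1) z)\<^sup>2)"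
    using trace_2d[OF u, of 1 c] unfolding norm_L2_test[OF test_fun_slice(2)[OF u, of c]] by simp
  moreover have "0 \<le> (LBINT z. (partial u (1, 0) z)\<^sup>2)" by (intro integral_nonneg_AE) simp
  ultimately show ?thesis unfolding W_nrm_test[OF u] sum_Basis_RR distrib_left by linarith
qed

lemma slice_ctest: fixes f :: "plane \<Rightarrow> complex" assumes "ctest_fun f" shows "ctest_fun (\<lambda>x. f (x, c))"
proof -
  obtain u v where uv: "test_fun u" "test_fun v" "f = (\<lambda>x. cr u x + \<i> * cr v x)" using ctest_cases[OF assms] .
  show ?thesis using ctestI[OF test_fun_slice(2)[OF uv(1), of c] test_fun_slice(2)[OF uv(2), of c]] unfolding uv(3) .
qed

lemma norm_L2_ctest:
  assumes "test_fun u" "test_fun v"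
  shows "(norm_L2 (\<lambda>x::'a::euclidean_space. cr u x + \<i> * cr v x))\<^sup>2 = (rnorm u)\<^sup>2 + (rnorm v)\<^sup>2"
proof -
  have re: "Im (inner_L2 (cr p) (cr q)) = 0" if "test_fun p" "test_fun q" for p q :: "'a \<Rightarrow> real"
    using that by (simp add: inner_L2_test)
  have n: "(norm_L2 g)\<^sup>2 = Re (inner_L2 g g)" for g :: "'a \<Rightarrow> complex"
    by (simp add: inner_L2_self del: of_real_power)
  show ?thesis unfolding n by (rule herm_ctest_split[OF herm_inner_L2_W12 re assms])
qed

lemma slice_norm_ctest:
  fixes f :: "plane \<Rightarrow> complex"
  assumes "ctest_fun f" shows "norm_L2 (\<lambda>x. f (x, c)) \<le> sqrt 2 * W.nrm f"
proof (rule power2_le_imp_le)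
  obtain u v where uv: "test_fun u" "test_fun v" "f = (\<lambda>x. cr u x + \<i> * cr v x)" using ctest_cases[OF assms] .
  have "(norm_L2 (\<lambda>x. f (x, c)))\<^sup>2 = (rnorm (\<lambda>x. u (x, c)))\<^sup>2 + (rnorm (\<lambda>x. v (x, c)))\<^sup>2"
    using norm_L2_ctest[OF test_fun_slice(2)[OF uv(1), of c] test_fun_slice(2)[OF uv(2), of c]] unfolding uv(3) .
  also have "\<dots> \<le> 2 * (W.nrm f)\<^sup>2"
    using slice_norm_test[OF uv(1), of c] slice_norm_test[OF uv(2), of c] W_nrm_ctest[OF uv(1,2)] unfolding uv(3) by linarith
  finally show "(norm_L2 (\<lambda>x. f (x, c)))\<^sup>2 \<le> (sqrt 2 * W.nrm f)\<^sup>2" by (simp add: power_mult_distrib)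
qed simp

section \<open>Traces on horizontal lines\<close>

lemma W12_dist2_tendsto_iff:
  assumes x: "\<And>n. W12 (x n)" and f: "W12 f"
  shows "(\<lambda>n. W12_dist2 (x n) f) \<longlonglongrightarrow> 0 \<longleftrightarrow> W_lim x f"
proof
  assume "(\<lambda>n. W12_dist2 (x n) f) \<longlonglongrightarrow> 0"
  hence "(\<lambda>n. sqrt ((W.nrm (\<lambda>t. x n t - f t))\<^sup>2)) \<longlonglongrightarrow> sqrt 0"
    unfolding W12_dist2_eq[OF x f] by (rule tendsto_real_sqrt)
  thus "W_lim x f" by simp
next
  assume "W_lim x f"
  from tendsto_power[OF this, of 2] show "(\<lambda>n. W12_dist2 (x n) f) \<longlonglongrightarrow> 0" unfolding W12_dist2_eq[OF x f] by simp
qed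

lemma slice_L2: "ctest_fun f \<Longrightarrow> L2 (\<lambda>x::real. f (x, c :: real))"
  by (rule W12_L2[OF W12_ctest[OF slice_ctest]])

lemma is_trace_exists:
  assumes f: "W12 f" shows "\<exists>h. is_trace f c h"
proof -
  obtain p where p: "\<And>n::nat. ctest_fun (p n)" "W_lim p f" using ctest_dense_seq[OF f] by blast
  have "\<exists>h. L2 h \<and> (\<lambda>n. norm_L2 (\<lambda>t. p n (t, c) - h t)) \<longlonglongrightarrow> 0"
  proof (rule L2_complete[OF slice_L2[OF p(1)]])
    fix e :: real assume "e > 0"
    hence "e / 2 > 0" by simp
    from W_seq_cauchy[OF W12_ctest[OF p(1)] f p(2) this] obtain N where N: "\<And>m n. m \<ge> N \<Longrightarrow> n \<ge> N \<Longrightarrow> W.nrm (\<lambda>t. p m t - p n t) < e / 2" by blast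
    have "norm_L2 (\<lambda>t. p m (t, c) - p n (t, c)) < e" if "m \<ge> N" "n \<ge> N" for m n
    proof -
      have "norm_L2 (\<lambda>t. p m (t, c) - p n (t, c)) \<le> sqrt 2 * W.nrm (\<lambda>t. p m t - p n t)"
        by (rule slice_norm_ctest[OF ctest_diff[OF p(1) p(1)]])
      also have "\<dots> \<le> 2 * W.nrm (\<lambda>t. p m t - p n t)"
        by (intro mult_right_mono) (auto intro: real_le_lsqrt)
      finally show ?thesis using N[OF that] by simp
    qed
    thus "\<exists>N. \<forall>m\<ge>N. \<forall>n\<ge>N. norm_L2 (\<lambda>t. p m (t, c) - p n (t, c)) < e" by blast
  qed
  then obtain h where h: "L2 h" "(\<lambda>n. norm_L2 (\<lambda>t. p n (t, c) - h t)) \<longlonglongrightarrow> 0" by blast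
  hence "is_trace f c h"
    unfolding is_trace_def using p(1) iffD2[OF W12_dist2_tendsto_iff[OF W12_ctest[OF p(1)] f] p(2)]
    by (intro conjI exI[of _ p]) auto
  thus ?thesis by blast
qed

lemma trace_line_is_trace: "W12 f \<Longrightarrow> is_trace f c (trace_line f c)"
  unfolding trace_line_def by (rule someI_ex[OF is_trace_exists])

lemma trace_line_L2: "W12 f \<Longrightarrow> L2 (trace_line f c)"
  using trace_line_is_trace[of f c] by (simp add: is_trace_def)

text \<open>The definition of a trace supplies one approximating sequence. Since slices are
  controlled by the Sobolev norm, every other one has the same slice limit; this makes the chosen
  trace computable and linear almost everywhere.\<close>

lemma trace_line_tendsto:
  assumes f: "W12 f" and p: "\<And>n. ctest_fun (p n)" "W_lim p f"
  shows "(\<lambda>n. norm_L2 (\<lambda>t. p n (t, c) - trace_line f c t)) \<longlonglongrightarrow> 0"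
proof -
  let ?h = "trace_line f c"
  obtain q where q: "\<And>n. ctest_fun (q n)" "(\<lambda>n. W12_dist2 (q n) f) \<longlonglongrightarrow> 0" "(\<lambda>n. norm_L2 (\<lambda>t. q n (t, c) - ?h t)) \<longlonglongrightarrow> 0"
    using trace_line_is_trace[OF f, of c] unfolding is_trace_def by blast
  have qW: "W_lim q f" by (rule iffD1[OF W12_dist2_tendsto_iff[of q, OF W12_ctest[OF q(1)] f] q(2)])
  note L = slice_L2[OF p(1)] slice_L2[OF q(1)] trace_line_L2[OF f]
  have le: "norm_L2 (\<lambda>t. p n (t, c) - ?h t) \<le> sqrt 2 * (W.nrm (\<lambda>x. p n x - f x) + W.nrm (\<lambda>x. q n x - f x)) + norm_L2 (\<lambda>t. q n (t, c) - ?h t)" for n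
  proof -
    have "norm_L2 (\<lambda>t. p n (t, c) - ?h t) \<le> norm_L2 (\<lambda>t. p n (t, c) - q n (t, c)) + norm_L2 (\<lambda>t. q n (t, c) - ?h t)"
      by (rule norm_L2_triangle3[OF L])
    also have "norm_L2 (\<lambda>t. p n (t, c) - q n (t, c)) \<le> sqrt 2 * W.nrm (\<lambda>x. p n x - q n x)"
      by (rule slice_norm_ctest[OF ctest_diff[OF p(1) q(1)]])
    also have "W.nrm (\<lambda>x. p n x - q n x) \<le> W.nrm (\<lambda>x. p n x - f x) + W.nrm (\<lambda>x. q n x - f x)"
    proof -
      have "W.nrm (\<lambda>t. (p n t - f t) + (-1) * (q n t - f t)) \<le> W.nrm (\<lambda>t. p n t - f t) + W.nrm (\<lambda>t. (-1) * (q n t - f t))"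
        by (rule W.nrm_add[OF W12_diff[OF W12_ctest[OF p(1)] f] W12_scale[OF W12_diff[OF W12_ctest[OF q(1)] f]]])
      also have "W.nrm (\<lambda>t. (-1) * (q n t - f t)) = W.nrm (\<lambda>t. q n t - f t)"
        using W.nrm_scl[OF W12_diff[OF W12_ctest[OF q(1)] f], of "-1" n] by simp
      finally show ?thesis by simp
    qed
    finally show ?thesis by simp
  qed
  show ?thesis
  proof (rule Lim_null_comparison)
    show "\<forall>\<^sub>F n in sequentially. norm (norm_L2 (\<lambda>t. p n (t, c) - ?h t)) \<le> sqrt 2 * (W.nrm (\<lambda>x. p n x - f x) + W.nrm (\<lambda>x. q n x - f x)) + norm_L2 (\<lambda>t. q n (t, c) - ?h t)"
      using le by simp
    have "(\<lambda>n. sqrt 2 * (W.nrm (\<lambda>x. p n x - f x) + W.nrm (\<lambda>x. q n x - f x)) + norm_L2 (\<lambda>t. q n (t, c) - ?h t)) \<longlonglongrightarrow> sqrt 2 * (0 + 0) + 0"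
      by (intro tendsto_intros p qW q)
    thus "(\<lambda>n. sqrt 2 * (W.nrm (\<lambda>x. p n x - f x) + W.nrm (\<lambda>x. q n x - f x)) + norm_L2 (\<lambda>t. q n (t, c) - ?h t)) \<longlonglongrightarrow> 0" by simp
  qed
qed

lemma trace_line_ctest: assumes "ctest_fun f" shows "AE x in lebesgue. trace_line f c x = f (x, c)"
proof -
  have z: "W.nrm (\<lambda>t. f t - f t) = 0" using W.nrm_scl[OF W12_ctest[OF assms], of 0] by simp
  have 1: "(\<lambda>n::nat. norm_L2 (\<lambda>t. f (t, c) - trace_line f c t)) \<longlonglongrightarrow> 0"
    by (rule trace_line_tendsto[OF W12_ctest[OF assms] assms]) (simp only: z tendsto_const)
  have 2: "(\<lambda>n::nat. norm_L2 (\<lambda>t. f (t, c) - f (t, c))) \<longlonglongrightarrow> 0" by (simp add: norm_L2_def)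
  show ?thesis
    by (rule L2_lim_unique[OF slice_L2[OF assms] trace_line_L2[OF W12_ctest[OF assms]] 1 slice_L2[OF assms] 2])
qed

lemma lin_op_trace: "lin_op (\<lambda>f. trace_line f c)"
  unfolding lin_op_def
proof (intro conjI allI impI)
  show "L2 (trace_line u c)" if "W12 u" for u by (rule trace_line_L2[OF that])
  show "AE x in lebesgue. trace_line (\<lambda>x. u x + v x) c x = trace_line u c x + trace_line v c x" if u: "W12 u" and v: "W12 v" for u v
  proof -
    obtain p where p: "\<And>n::nat. ctest_fun (p n)" "W_lim p u" using ctest_dense_seq[OF u] by blast
    obtain q where q: "\<And>n::nat. ctest_fun (q n)" "W_lim q v" using ctest_dense_seq[OF v] by blast
    have 1: "(\<lambda>n. norm_L2 (\<lambda>t. (p n (t, c) + q n (t, c)) - trace_line (\<lambda>x. u x + v x) c t)) \<longlonglongrightarrow> 0"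
      by (rule trace_line_tendsto[OF W12_add[OF u v] ctest_add[OF p(1) q(1)]])
        (rule W_tendsto_add[OF W12_ctest[OF p(1)] u p(2) W12_ctest[OF q(1)] v q(2)])
    have 2: "(\<lambda>n. norm_L2 (\<lambda>t. (p n (t, c) + q n (t, c)) - (trace_line u c t + trace_line v c t))) \<longlonglongrightarrow> 0"
    proof (rule Lim_null_comparison)
      have "norm_L2 (\<lambda>t. (p n (t, c) - trace_line u c t) + (q n (t, c) - trace_line v c t)) \<le> norm_L2 (\<lambda>t. p n (t, c) - trace_line u c t) + norm_L2 (\<lambda>t. q n (t, c) - trace_line v c t)" for n
        by (intro norm_L2_triangle L2_diff slice_L2 trace_line_L2 p q u v)
      thus "\<forall>\<^sub>F n in sequentially. norm (norm_L2 (\<lambda>t. (p n (t, c) + q n (t, c)) - (trace_line u c t + trace_line v c t))) \<le> norm_L2 (\<lambda>t. p n (t, c) - trace_line u c t) + norm_L2 (\<lambda>t. q n (t, c) - trace_line v c t)"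
        by (simp add: algebra_simps)
      show "(\<lambda>n. norm_L2 (\<lambda>t. p n (t, c) - trace_line u c t) + norm_L2 (\<lambda>t. q n (t, c) - trace_line v c t)) \<longlonglongrightarrow> 0"
        using tendsto_add[OF trace_line_tendsto[OF u p] trace_line_tendsto[OF v q]] by simp
    qed
    show ?thesis
      by (rule L2_lim_unique[OF L2_add[OF slice_L2[OF p(1)] slice_L2[OF q(1)]] trace_line_L2[OF W12_add[OF u v]] 1 L2_add[OF trace_line_L2[OF u] trace_line_L2[OF v]] 2])
  qed
  show "AE x in lebesgue. trace_line (\<lambda>x. k * u x) c x = k * trace_line u c x" if u: "W12 u" for u k
  proof -
    obtain p where p: "\<And>n::nat. ctest_fun (p n)" "W_lim p u" using ctest_dense_seq[OF u] by blast
    have 1: "(\<lambda>n. norm_L2 (\<lambda>t. k * p n (t, c) - trace_line (\<lambda>x. k * u x) c t)) \<longlonglongrightarrow> 0"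
      by (rule trace_line_tendsto[OF W12_scale[OF u] ctest_scale[OF p(1)]])
        (rule W_tendsto_scale[OF W12_ctest[OF p(1)] u p(2)])
    have "norm_L2 (\<lambda>t. k * p n (t, c) - k * trace_line u c t) = cmod k * norm_L2 (\<lambda>t. p n (t, c) - trace_line u c t)" for n
      using norm_L2_scale[of k "\<lambda>t. p n (t, c) - trace_line u c t"] by (simp add: right_diff_distrib)
    hence 2: "(\<lambda>n. norm_L2 (\<lambda>t. k * p n (t, c) - k * trace_line u c t)) \<longlonglongrightarrow> 0"
      using tendsto_mult_right_zero[OF trace_line_tendsto[OF u p], of "cmod k" c] by simp
    show ?thesis
      by (rule L2_lim_unique[OF L2_scale[OF slice_L2[OF p(1)]] trace_line_L2[OF W12_scale[OF u]] 1 L2_scale[OF trace_line_L2[OF u]] 2])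
  qed
  have "norm_L2 (trace_line u c) \<le> sqrt 2 * W.nrm u" if u: "W12 u" for u
  proof -
    obtain p where p: "\<And>n::nat. ctest_fun (p n)" "W_lim p u" using ctest_dense_seq[OF u] by blast
    have "(\<lambda>n. norm_L2 (\<lambda>t. p n (t, c))) \<longlonglongrightarrow> norm_L2 (trace_line u c)"
      by (rule norm_L2_tendsto[OF slice_L2[OF p(1)] trace_line_L2[OF u] trace_line_tendsto[OF u p]])
    moreover have "(\<lambda>n. sqrt 2 * W.nrm (p n)) \<longlonglongrightarrow> sqrt 2 * W.nrm u"
      by (intro tendsto_mult tendsto_const W_nrm_tendsto[OF W12_ctest[OF p(1)] u p(2)])
    ultimately show ?thesis by (rule LIMSEQ_le) (use slice_norm_ctest[OF p(1)] in auto)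
  qed
  thus "\<exists>C. \<forall>u. W12 u \<longrightarrow> norm_L2 (trace_line u c) \<le> C * W.nrm u" by blast
qed

section \<open>Tensor products and averages over squares\<close>

lemma tensor_integral:
  fixes F G :: "real \<Rightarrow> real"
  assumes F: "integrable lborel F" and G: "integrable lborel G"
  shows "integrable lborel (tensor F G)"
    and "(\<integral>z. F (fst z) * G (snd z) \<partial>(lborel :: plane measure)) = integral\<^sup>L lborel F * integral\<^sup>L lborel G"
proof -
  have [measurable]: "F \<in> borel_measurable borel" "G \<in> borel_measurable borel" using F G by auto
  have "integrable (lborel \<Otimes>\<^sub>M lborel) (tensor F G)"
  proof (rule lborel_pair.Fubini_integrable)
    have "(\<lambda>x. \<integral>y. norm (F (fst (x, y)) * G (snd (x, y))) \<partial>lborel) = (\<lambda>x. \<bar>F x\<bar> * (LBINT y. \<bar>G y\<bar>))"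
      by (simp add: abs_mult)
    thus "integrable lborel (\<lambda>x. \<integral>y. norm (F (fst (x, y)) * G (snd (x, y))) \<partial>lborel)"
      using F by (simp add: integrable_mult_left)
    show "AE x in lborel. integrable lborel (\<lambda>y. F (fst (x, y)) * G (snd (x, y)))" using G by simp
  qed measurable
  thus i: "integrable lborel (tensor F G)" by (simp add: lborel_prod)
  show "(\<integral>z. F (fst z) * G (snd z) \<partial>(lborel :: plane measure)) = integral\<^sup>L lborel F * integral\<^sup>L lborel G"
    unfolding fubini_lborel(1)[OF i] by simp
qed

lemma norm_L2_borel:
  assumes "g \<in> borel_measurable borel" shows "(rnorm g)\<^sup>2 = (LBINT x. (g x)\<^sup>2)"
proof -
  have "(rnorm g)\<^sup>2 = (LEBINT x. (g x)\<^sup>2)" by (simp add: norm_L2_sq)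
  also have "\<dots> = (LBINT x. (g x)\<^sup>2)" by (rule integral_lebesgue_lborel) (use assms in measurable)
  finally show ?thesis .
qed

lemma L2_borel:
  assumes "g \<in> borel_measurable borel" "integrable lborel (\<lambda>x. (g x)\<^sup>2)" shows "L2 (cr g)"
proof -
  have "(\<lambda>x. (g x)\<^sup>2) \<in> borel_measurable lborel" using assms by auto
  hence "integrable lebesgue (\<lambda>x. (g x)\<^sup>2)" using assms(2) by (simp add: integrable_completion)
  moreover have "cr g \<in> borel_measurable lebesgue" by (rule measurable_completion) (use assms(1) in measurable)
  ultimately show ?thesis by (simp add: L2_def)
qed

lemma norm_tensor:
  fixes F G :: "real \<Rightarrow> real"
  assumes F: "F \<in> borel_measurable borel" "integrable lborel (\<lambda>x. (F x)\<^sup>2)" and G: "G \<in> borel_measurable borel" "integrable lborel (\<lambda>x. (G x)\<^sup>2)"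
  shows "L2 (cr (tensor F G))"
    and "rnorm (tensor F G) = rnorm F * rnorm G"
proof -
  have m: "(tensor F G) \<in> borel_measurable borel"
    using F(1) G(1) by (auto simp: borel_prod[symmetric])
  have sq: "(\<lambda>z::plane. (F (fst z) * G (snd z))\<^sup>2) = (\<lambda>z. (F (fst z))\<^sup>2 * (G (snd z))\<^sup>2)" by (simp add: power_mult_distrib)
  show "L2 (cr (tensor F G))"
    by (rule L2_borel[OF m]) (unfold sq, rule tensor_integral(1)[OF F(2) G(2)])
  have "(rnorm (tensor F G))\<^sup>2 = (rnorm F * rnorm G)\<^sup>2"
    unfolding norm_L2_borel[OF m] sq tensor_integral(2)[OF F(2) G(2)] power_mult_distrib norm_L2_borel[OF F(1)] norm_L2_borel[OF G(1)] ..
  thus "rnorm (tensor F G) = rnorm F * rnorm G"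
    by (rule power2_eq_imp_eq) auto
qed

section \<open>Completion of the square in the fibres\<close>

context point_int
begin

lemma w_snd_measurable [measurable]: "(\<lambda>z::plane. w (snd z)) \<in> borel_measurable borel"
  by (simp add: borel_prod[symmetric])

text \<open>\<open>w\<close> jumps across the lines, so \<open>ann2 u\<close> need not be
  continuous. Being Borel and bounded with bounded support takes the place of continuity when
  integrability is needed.\<close>

lemma T2_bb:
  fixes u :: "plane \<Rightarrow> real"
  assumes u: "test_fun u"
  defines "P \<equiv> \<lambda>z. partial u (0, 1) z - w (snd z) * u z"
  shows "P \<in> borel_measurable borel" "\<exists>B. \<forall>z. \<bar>P z\<bar> \<le> B" "\<exists>R. \<forall>z. norm z > R \<longrightarrow> P z = 0"
proof -
  have up: "test_fun (partial u (0, 1))" by (rule test_fun_partial[OF u e2_Basis])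
  note [measurable] = test_fun_measurable[OF u] test_fun_measurable[OF up]
  show "P \<in> borel_measurable borel" unfolding P_def by measurable
  obtain A where A: "\<And>z. \<bar>u z\<bar> \<le> A" using test_fun_bounded[OF u] by metis
  obtain B where B: "\<And>z. \<bar>partial u (0, 1) z\<bar> \<le> B" using test_fun_bounded[OF up] by metis
  have "\<bar>P z\<bar> \<le> B + \<kappa> * A" for z
  proof -
    have "\<bar>w (snd z) * u z\<bar> \<le> \<kappa> * A" unfolding abs_mult using w_bound A \<kappa> by (intro mult_mono) auto
    thus ?thesis unfolding P_def using B[of z] by linarith
  qed
  thus "\<exists>B. \<forall>z. \<bar>P z\<bar> \<le> B" by blast
  obtain R where R: "\<And>z. norm z > R \<Longrightarrow> u z = 0" using test_fun_support[OF u] by metis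
  show "\<exists>R. \<forall>z. norm z > R \<longrightarrow> P z = 0"
    using R partial_support[of R u] unfolding P_def by (intro exI[of _ R]) auto
qed

lemma T2_prod_integrable:
  fixes u v :: "plane \<Rightarrow> real"
  assumes u: "test_fun u" and v: "test_fun v"
  shows "integrable lborel (\<lambda>z. ann2 u z * ann2 v z)"
proof -
  obtain A where A: "\<And>z. \<bar>partial u (0, 1) z - w (snd z) * u z\<bar> \<le> A" using T2_bb(2)[OF u] by blast
  obtain B where B: "\<And>z. \<bar>partial v (0, 1) z - w (snd z) * v z\<bar> \<le> B" using T2_bb(2)[OF v] by blast
  obtain R where R: "\<And>z. norm z > R \<Longrightarrow> partial u (0, 1) z - w (snd z) * u z = 0" using T2_bb(3)[OF u] by blast
  show ?thesis
  proof (rule bb_integrable[where B = "A * B" and R = R])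
    show "(\<lambda>z. ann2 u z * ann2 v z) \<in> borel_measurable borel"
      by (intro borel_measurable_times T2_bb(1)[OF u] T2_bb(1)[OF v])
    show "\<bar>ann2 u z * ann2 v z\<bar> \<le> A * B" for z
      unfolding abs_mult by (intro mult_mono A B order_trans[OF abs_ge_zero A]) auto
  qed (simp add: R)
qed

text \<open>The one-dimensional identity in each fibre, integrated over x; the point values become
  integrals over the two lines.\<close>

lemma ground_state_2d:
  fixes u v :: "plane \<Rightarrow> real"
  assumes u: "test_fun u" and v: "test_fun v"
  shows "(LBINT z. ann2 u z * ann2 v z) =
    (LBINT z. partial u (0, 1) z * partial v (0, 1) z) + \<kappa>\<^sup>2 * (LBINT z. u z * v z)
     - \<alpha> * (LBINT x. u (x, a) * v (x, a)) - \<alpha> * (LBINT x. u (x, -a) * v (x, -a))"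
proof -
  note su = test_fun_smooth[OF u] and sv = test_fun_smooth[OF v]
  have up: "test_fun (partial u (0, 1))" and vp: "test_fun (partial v (0, 1))"
    by (rule test_fun_partial[OF u e2_Basis], rule test_fun_partial[OF v e2_Basis])
  note i1 = test_mult_integrable[OF up vp] and i2 = test_mult_integrable[OF u v]
  have i3: "integrable lborel (\<lambda>x. u (x, c) * v (x, c))" for c
    using test_mult_integrable[OF test_fun_slice(2)[OF u, of c] test_fun_slice(2)[OF v, of c]] .
  have "(LBINT z. ann2 u z * ann2 v z)
    = (LBINT x. (LBINT y. (partial u (0, 1) (x, y) - w y * u (x, y)) * (partial v (0, 1) (x, y) - w y * v (x, y))))"
    using fubini_lborel(1)[OF T2_prod_integrable[OF u v]] by simp
  also have "\<dots> = (LBINT x. (LBINT y. partial u (0, 1) (x, y) * partial v (0, 1) (x, y)) + \<kappa>\<^sup>2 * (LBINT y. u (x, y) * v (x, y))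
      - \<alpha> * (u (x, a) * v (x, a)) - \<alpha> * (u (x, -a) * v (x, -a)))"
  proof (rule Bochner_Integration.integral_cong[OF refl])
    fix x
    show "(LBINT y. (partial u (0, 1) (x, y) - w y * u (x, y)) * (partial v (0, 1) (x, y) - w y * v (x, y))) =
      (LBINT y. partial u (0, 1) (x, y) * partial v (0, 1) (x, y)) + \<kappa>\<^sup>2 * (LBINT y. u (x, y) * v (x, y))
      - \<alpha> * (u (x, a) * v (x, a)) - \<alpha> * (u (x, -a) * v (x, -a))"
      using ground_state_1d[OF test_fun_slice(1)[OF u, of x] test_fun_slice(1)[OF v, of x]]
      unfolding partial_slice(1)[OF su, of x] partial_slice(1)[OF sv, of x] .
  qed
  also have "\<dots> = (LBINT x. (LBINT y. partial u (0, 1) (x, y) * partial v (0, 1) (x, y))) + \<kappa>\<^sup>2 * (LBINT x. (LBINT y. u (x, y) * v (x, y)))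
      - \<alpha> * (LBINT x. u (x, a) * v (x, a)) - \<alpha> * (LBINT x. u (x, -a) * v (x, -a))"
    using fubini_lborel(2)[OF i1] fubini_lborel(2)[OF i2] i3[of a] i3[of "-a"] by simp
  finally show ?thesis unfolding fubini_lborel(1)[OF i1] fubini_lborel(1)[OF i2] .
qed

end

section \<open>A Poincare inequality for traces on squares\<close>

lemma indicator_Ico_Icc:
  fixes g :: "real \<Rightarrow> real"
  assumes "g \<in> borel_measurable borel"
  shows "(LBINT t. indicator {p..<q} t * g t) = (LBINT t. indicator {p..q} t * g t)"
proof (rule integral_cong_AE)
  show "AE t in lborel. indicator {p..<q} t * g t = indicator {p..q} t * g t"
    using AE_lborel_singleton[of q] by eventually_elim (auto simp: indicator_def)
qed (use assms in measurable)

text \<open>u (x, c) is compared with u z along an L-shaped path, vertical at x and then horizontal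
  at the height of z; averaging over z in the square brings in the mean value. The gradient gets a
  factor proportional to h, which is small on small squares, while the price h^-3 falls on a single
  functional. The first interval is half-open so that neighbouring squares tile a strip.\<close>

lemma square_ineq:
  fixes u :: "plane \<Rightarrow> real" and p c h :: real
  assumes u: "test_fun u" and h: "h > 0"
  defines "q \<equiv> \<lambda>z::plane. indicator {p..<p+h} (fst z) * indicator {c..c+h} (snd z) :: real"
  shows "(LBINT x. indicator {p..<p+h} x * (u (x, c))\<^sup>2) \<le>
    4 * h * (LBINT z. q z * ((partial u (1, 0) z)\<^sup>2 + (partial u (0, 1) z)\<^sup>2)) + 2 / h ^ 3 * (LBINT z. q z * u z)\<^sup>2"
proof -
  note su = test_fun_smooth[OF u]
  let ?I = "{p..<p+h}" and ?J = "{c..c+h}"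
  let ?D1 = "partial u (1, 0)" and ?D2 = "partial u (0, 1)"
  have t1: "test_fun ?D1" and t2: "test_fun ?D2" by (rule test_fun_partial[OF u e1_Basis], rule test_fun_partial[OF u e2_Basis])
  let ?L = "lborel :: plane measure"
  define S where "S = ?I \<times> ?J"
  have Sb: "S \<in> sets borel" unfolding S_def by (simp add: borel_prod[symmetric])
  have qS: "q z = indicator S z" for z by (cases z) (auto simp: q_def S_def indicator_def)
  have mS: "emeasure lborel S = ennreal (h * h)"
    unfolding S_def lborel_prod[symmetric] using h by (simp add: lborel.emeasure_pair_measure_Times ennreal_mult)
  hence S2: "measure lborel S = h * h" "emeasure lborel S < \<infinity>" using h by (auto simp: measure_def)
  have qm: "q \<in> borel_measurable borel" unfolding qS[abs_def] using Sb by measurable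
  have iq: "integrable lborel (\<lambda>z. q z * F z)" if cF: "continuous_on UNIV F" for F :: "plane \<Rightarrow> real"
  proof -
    obtain B where B: "\<And>z. z \<in> {p..p+h} \<times> ?J \<Longrightarrow> \<bar>F z\<bar> \<le> B"
      using compact_imp_bounded[OF compact_continuous_image[OF continuous_on_subset[OF cF subset_UNIV] compact_Times[OF compact_Icc compact_Icc]], of p "p+h" c "c+h"]
      unfolding bounded_iff by (metis image_eqI real_norm_def)
    obtain R where R: "\<And>z. z \<in> {p..p+h} \<times> ?J \<Longrightarrow> norm z \<le> R"
      using compact_imp_bounded[OF compact_Times[OF compact_Icc compact_Icc], of p "p+h" c "c+h"] unfolding bounded_iff by metis
    show ?thesis
    proof (rule bb_integrable[where B = "\<bar>B\<bar>" and R = R])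
      show "(\<lambda>z. q z * F z) \<in> borel_measurable borel"
        by (intro borel_measurable_times qm borel_measurable_continuous_onI[OF cF])
      show "\<bar>q z * F z\<bar> \<le> \<bar>B\<bar>" for z
        using B[of z] by (auto simp: qS S_def indicator_def)
      show "q z * F z = 0" if "norm z > R" for z
        using R[of z] that by (auto simp: qS S_def indicator_def)
    qed
  qed
  have cu: "continuous_on UNIV u" and c1: "continuous_on UNIV ?D1" and c2: "continuous_on UNIV ?D2"
    using u t1 t2 by (auto intro: test_fun_continuous)
  define m where "m = (LBINT z. q z * u z)"
  define G1 where "G1 = (LBINT z. q z * (?D1 z)\<^sup>2)"
  define G2 where "G2 = (LBINT z. q z * (?D2 z)\<^sup>2)"
  have i1: "integrable lborel (\<lambda>z. q z * (?D1 z)\<^sup>2)" and i2: "integrable lborel (\<lambda>z. q z * (?D2 z)\<^sup>2)"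
    by (intro iq continuous_on_power c1, intro iq continuous_on_power c2)
  define A where "A x = (LBINT y. indicator ?J y * (?D2 (x, y))\<^sup>2)" for x
  define B where "B y = (LBINT x. indicator ?I x * (?D1 (x, y))\<^sup>2)" for y
  have G1: "G1 = (LBINT y. indicator ?J y * B y)" "integrable lborel (\<lambda>y. indicator ?J y * B y)"
  proof -
    have "(LBINT x. q (x, y) * (?D1 (x, y))\<^sup>2) = indicator ?J y * B y" for y
      unfolding B_def integral_mult_right_zero[symmetric] by (intro Bochner_Integration.integral_cong) (auto simp: q_def)
    thus "G1 = (LBINT y. indicator ?J y * B y)" "integrable lborel (\<lambda>y. indicator ?J y * B y)"
      using fubini_lborel(3,4)[OF i1] unfolding G1_def by simp_all
  qed
  have G2: "G2 = (LBINT x. indicator ?I x * A x)" "integrable lborel (\<lambda>x. indicator ?I x * A x)"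
  proof -
    have "(LBINT y. q (x, y) * (?D2 (x, y))\<^sup>2) = indicator ?I x * A x" for x
      unfolding A_def integral_mult_right_zero[symmetric] by (intro Bochner_Integration.integral_cong) (auto simp: q_def)
    thus "G2 = (LBINT x. indicator ?I x * A x)" "integrable lborel (\<lambda>x. indicator ?I x * A x)"
      using fubini_lborel(1,2)[OF i2] unfolding G2_def by simp_all
  qed
  have iI: "integrable lborel (\<lambda>x. indicator ?I x :: real)" "(LBINT x. indicator ?I x) = h"
    using h by (auto intro!: integrable_real_indicator)
  have iJ: "integrable lborel (\<lambda>x. indicator ?J x :: real)" "(LBINT x. indicator ?J x) = h"
    using h by (auto intro!: integrable_real_indicator simp: emeasure_lborel_Icc_eq)
  have slice2: "continuous_on UNIV (\<lambda>y. ?D2 (x, y))" for x using test_fun_continuous[OF test_fun_slice(1)[OF t2, of x]] .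
  have slice1: "continuous_on UNIV (\<lambda>x. ?D1 (x, y))" for y using test_fun_continuous[OF test_fun_slice(2)[OF t1, of y]] .
  have pt: "(u (x, c) - u z)\<^sup>2 \<le> 2 * h * A x + 2 * h * B (snd z)" if x: "x \<in> ?I" and z: "fst z \<in> ?I" "snd z \<in> ?J" for x z
  proof -
    have a: "(u (x, c) - u (x, snd z))\<^sup>2 \<le> h * A x" unfolding A_def
      by (rule difference_sq_le[OF slice_deriv(1)[OF su, of x] slice2 _ z(2) h]) (use h in auto)
    have "(u (x, snd z) - u (fst z, snd z))\<^sup>2 \<le> h * (LBINT t. indicator {p..p+h} t * (?D1 (t, snd z))\<^sup>2)"
      by (rule difference_sq_le[OF slice_deriv(2)[OF su, of "snd z"] slice1 _ _ h]) (use x z in auto)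
    also have "(LBINT t. indicator {p..p+h} t * (?D1 (t, snd z))\<^sup>2) = B (snd z)"
      unfolding B_def by (rule indicator_Ico_Icc[symmetric, OF borel_measurable_continuous_onI[OF continuous_on_power[OF slice1]]])
    finally have b: "(u (x, snd z) - u z)\<^sup>2 \<le> h * B (snd z)" by simp
    have "(u (x, c) - u z)\<^sup>2 \<le> 2 * (u (x, c) - u (x, snd z))\<^sup>2 + 2 * (u (x, snd z) - u z)\<^sup>2"
    proof -
      have "(s + t)\<^sup>2 \<le> 2 * s\<^sup>2 + 2 * t\<^sup>2" for s t :: real
      proof -
        have "0 \<le> (s - t)\<^sup>2" by simp
        thus ?thesis by (simp add: power2_sum power2_diff)
      qed
      from this[of "u (x, c) - u (x, snd z)" "u (x, snd z) - u z"] show ?thesis by simp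
    qed
    thus ?thesis using a b by linarith
  qed
  \<comment> \<open>The integral of u (x, c) - u over the square is h^2 u (x, c) - m; Cauchy-Schwarz
    costs the area h^2, and the bound \<open>pt\<close> is integrated term by term.\<close>
  have key: "(h\<^sup>2 * u (x, c) - m)\<^sup>2 \<le> 2 * h ^ 5 * A x + 2 * h ^ 4 * G1" if x: "x \<in> ?I" for x
  proof -
    let ?f = "\<lambda>z::plane. indicator ?I (fst z) * (indicator ?J (snd z) * (2 * h * A x))" and ?g = "\<lambda>z::plane. indicator ?I (fst z) * (2 * h * (indicator ?J (snd z) * B (snd z)))"
    note tg = tensor_integral[OF iI(1) integrable_mult_left[OF iJ(1), of "2 * h * A x"]] tensor_integral[OF iI(1) integrable_mult_right[OF G1(2), of "2 * h"]]
    have ci: "continuous_on UNIV (\<lambda>z. u (x, c) - u z)" by (intro continuous_intros cu)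
    have q1: "integrable lborel q" using iq[of "\<lambda>_. 1"] by simp
    have q2: "integral\<^sup>L lborel q = h\<^sup>2" unfolding qS[abs_def] using S2 by (simp add: power2_eq_square)
    have "(LBINT z. q z * (u (x, c) - u z)) = (LBINT z. q z * u (x, c) - q z * u z)" by (simp add: algebra_simps)
    also have "\<dots> = h\<^sup>2 * u (x, c) - m"
      using q1 iq[OF cu] by (simp add: q2 m_def)
    finally have "(h\<^sup>2 * u (x, c) - m)\<^sup>2 = (LBINT z. q z * (u (x, c) - u z))\<^sup>2" by simp
    also have "\<dots> \<le> measure lborel S * (LBINT z. q z * (u (x, c) - u z)\<^sup>2)"
      using integral_cauchy_schwarz_set[OF Sb S2(2), of "\<lambda>z. u (x, c) - u z"] iq[OF ci] iq[OF continuous_on_power[OF ci, of 2]] by (simp only: qS)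
    also have "\<dots> \<le> h * h * (\<integral>z. ?f z + ?g z \<partial>?L)"
      unfolding S2(1)
    proof (intro mult_left_mono integral_mono[OF iq[OF continuous_on_power[OF ci]]])
      show "integrable ?L (\<lambda>z. ?f z + ?g z)"
        by (rule Bochner_Integration.integrable_add[OF tg(1,3)])
      show "q z * (u (x, c) - u z)\<^sup>2 \<le> ?f z + ?g z" for z
        using pt[OF x, of z] by (cases "fst z \<in> ?I \<and> snd z \<in> ?J") (auto simp: q_def)
    qed (use h in auto)
    also have "(\<integral>z. ?f z + ?g z \<partial>?L)
       = (\<integral>z. ?f z \<partial>?L) + (\<integral>z. ?g z \<partial>?L)"
      by (rule Bochner_Integration.integral_add[OF tg(1,3)])
    also have "(\<integral>z. ?f z \<partial>?L) = h * (h * (2 * h * A x))"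
      using tg(2) iI(2) iJ(2) by simp
    also have "(\<integral>z. ?g z \<partial>?L) = h * (2 * h * G1)"
      using tg(4) iI(2) G1(1) by simp
    finally show ?thesis by (simp add: power2_eq_square eval_nat_numeral algebra_simps)
  qed
  have pt2: "indicator ?I x * (h ^ 4 * (u (x, c))\<^sup>2) \<le> 4 * h ^ 5 * (indicator ?I x * A x) + indicator ?I x * (4 * h ^ 4 * G1 + 2 * m\<^sup>2)" for x
  proof (cases "x \<in> ?I")
    case True
    \<comment> \<open>With X = h^2 u (x, c) this is X^2 \<le> 2 (X - m)^2 + 2 m^2.\<close>
    have "0 \<le> (h\<^sup>2 * u (x, c) - 2 * m)\<^sup>2" by simp
    hence "h ^ 4 * (u (x, c))\<^sup>2 \<le> 2 * (h\<^sup>2 * u (x, c) - m)\<^sup>2 + 2 * m\<^sup>2"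
      by (simp add: power2_eq_square eval_nat_numeral algebra_simps)
    thus ?thesis using key[OF True] True by simp
  qed simp
  have cs: "continuous_on UNIV (\<lambda>x. u (x, c))" using test_fun_continuous[OF test_fun_slice(2)[OF u, of c]] .
  have iu: "integrable lborel (\<lambda>x. indicator ?I x * (u (x, c))\<^sup>2)"
  proof -
    have "integrable lborel (\<lambda>x. indicator ?I x *\<^sub>R (u (x, c))\<^sup>2)"
      by (rule integrable_mult_indicator[OF _ test_sq_integrable[OF test_fun_slice(2)[OF u, of c]]]) simp
    thus ?thesis by simp
  qed
  have "h ^ 4 * (LBINT x. indicator ?I x * (u (x, c))\<^sup>2) = (LBINT x. indicator ?I x * (h ^ 4 * (u (x, c))\<^sup>2))"
    by (subst integral_mult_right_zero[symmetric]) (simp add: mult_ac)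
  also have "\<dots> \<le> (LBINT x. 4 * h ^ 5 * (indicator ?I x * A x) + indicator ?I x * (4 * h ^ 4 * G1 + 2 * m\<^sup>2))"
  proof (rule integral_mono[OF _ _ pt2])
    show "integrable lborel (\<lambda>x. indicator ?I x * (h ^ 4 * (u (x, c))\<^sup>2))" using integrable_mult_right[OF iu, of "h ^ 4"] by (simp add: mult_ac)
    show "integrable lborel (\<lambda>x. 4 * h ^ 5 * (indicator ?I x * A x) + indicator ?I x * (4 * h ^ 4 * G1 + 2 * m\<^sup>2))"
      by (intro Bochner_Integration.integrable_add integrable_mult_right integrable_mult_left G2(2) iI(1))
  qed
  also have "\<dots> = (LBINT x. 4 * h ^ 5 * (indicator ?I x * A x)) + (LBINT x. indicator ?I x * (4 * h ^ 4 * G1 + 2 * m\<^sup>2))"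
    by (intro Bochner_Integration.integral_add integrable_mult_right integrable_mult_left G2(2) iI(1))
  also have "(LBINT x. 4 * h ^ 5 * (indicator ?I x * A x)) = 4 * h ^ 5 * G2" unfolding G2(1) by (rule integral_mult_right_zero)
  also have "(LBINT x. indicator ?I x * (4 * h ^ 4 * G1 + 2 * m\<^sup>2)) = h * (4 * h ^ 4 * G1 + 2 * m\<^sup>2)"
    unfolding integral_mult_left_zero iI(2) ..
  finally have fin: "h ^ 4 * (LBINT x. indicator ?I x * (u (x, c))\<^sup>2) \<le> 4 * h ^ 5 * G2 + h * (4 * h ^ 4 * G1 + 2 * m\<^sup>2)" .
  have "4 * h ^ 5 * G2 + h * (4 * h ^ 4 * G1 + 2 * m\<^sup>2) = h ^ 4 * (4 * h * (G1 + G2) + 2 / h ^ 3 * m\<^sup>2)"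
    using h by (simp add: field_simps eval_nat_numeral)
  with fin have "h ^ 4 * (LBINT x. indicator ?I x * (u (x, c))\<^sup>2) \<le> h ^ 4 * (4 * h * (G1 + G2) + 2 / h ^ 3 * m\<^sup>2)" by simp
  hence "(LBINT x. indicator ?I x * (u (x, c))\<^sup>2) \<le> 4 * h * (G1 + G2) + 2 / h ^ 3 * m\<^sup>2"
    using h by (simp add: mult_le_cancel_left)
  moreover have "G1 + G2 = (LBINT z. q z * ((?D1 z)\<^sup>2 + (?D2 z)\<^sup>2))"
    unfolding G1_def G2_def distrib_left by (rule Bochner_Integration.integral_add[symmetric, OF i1 i2])
  ultimately show ?thesis by (simp add: m_def)
qed

section \<open>Coercivity below the threshold\<close>

lemma square_integrable:
  fixes u :: "plane \<Rightarrow> real"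
  assumes "test_fun u"
  shows "integrable lborel (\<lambda>z. (indicator {p..<q} (fst z) * indicator {c..d} (snd z)) * u z)"
proof -
  have "{p..<q} \<times> {c..d} \<in> sets borel" by (simp add: borel_prod[symmetric])
  hence "integrable lborel (\<lambda>z. indicator ({p..<q} \<times> {c..d}) z *\<^sub>R u z)"
    by (intro integrable_mult_indicator test_fun_integrable_lborel[OF assms]) simp
  moreover have "(\<lambda>z. indicator ({p..<q} \<times> {c..d}) z *\<^sub>R u z) = (\<lambda>z. (indicator {p..<q} (fst z) * indicator {c..d} (snd z)) * u z)"
    by (auto simp: fun_eq_iff indicator_def)
  ultimately show ?thesis by simp
qed

definition sqr :: "real \<Rightarrow> real \<Rightarrow> real \<Rightarrow> plane \<Rightarrow> real" where
  "sqr p c h z = indicator {p..<p+h} (fst z) * indicator {c..c+h} (snd z)"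

text \<open>The squares over the half-open intervals are disjoint, so the gradient integrals add up
  to one over the strip. Hence its coefficient 4 h does not grow with the number N of
  squares.\<close>

lemma strip_ineq:
  fixes u :: "plane \<Rightarrow> real"
  assumes u: "test_fun u" and h: "h > 0"
  shows "(LBINT x. indicator {p..<p + real N * h} x * (u (x, c))\<^sup>2) \<le>
    4 * h * (LBINT z. (indicator {p..<p + real N * h} (fst z) * indicator {c..c+h} (snd z)) * ((partial u (1, 0) z)\<^sup>2 + (partial u (0, 1) z)\<^sup>2))
     + 2 / h ^ 3 * (\<Sum>j<N. (LBINT z. sqr (p + real j * h) c h z * u z)\<^sup>2)"
proof (induction N)
  case 0
  thus ?case by simp
next
  case (Suc N)
  let ?P = "p + real N * h"
  let ?g = "\<lambda>z. (partial u (1, 0) z)\<^sup>2 + (partial u (0, 1) z)\<^sup>2"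
  have ind: "indicator {p..<p + real (Suc N) * h} x = indicator {p..<?P} x + (indicator {?P..<?P + h} x :: real)" for x
  proof -
    define Q where "Q = ?P"
    have "p \<le> Q" using h by (simp add: Q_def)
    moreover have "p + real (Suc N) * h = Q + h" by (simp add: Q_def algebra_simps)
    ultimately show ?thesis unfolding Q_def[symmetric] using h by (auto simp: indicator_def)
  qed
  have iu: "integrable lborel (\<lambda>x. indicator {s..<t} x * (u (x, c))\<^sup>2)" for s t
    using integrable_mult_indicator[OF _ test_sq_integrable[OF test_fun_slice(2)[OF u, of c]], of "{s..<t}"] by simp
  have g: "test_fun ?g"
    unfolding power2_eq_square
    by (intro test_fun_add test_fun_mult smooth_partial test_fun_partial test_fun_smooth u e1_Basis e2_Basis)
  have 1: "(LBINT x. indicator {p..<p + real (Suc N) * h} x * (u (x, c))\<^sup>2)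
     = (LBINT x. indicator {p..<?P} x * (u (x, c))\<^sup>2) + (LBINT x. indicator {?P..<?P + h} x * (u (x, c))\<^sup>2)"
    unfolding ind distrib_right by (rule Bochner_Integration.integral_add[OF iu iu])
  have 2: "(LBINT z. (indicator {p..<p + real (Suc N) * h} (fst z) * indicator {c..c+h} (snd z)) * ?g z)
     = (LBINT z. (indicator {p..<?P} (fst z) * indicator {c..c+h} (snd z)) * ?g z) + (LBINT z. (indicator {?P..<?P + h} (fst z) * indicator {c..c+h} (snd z)) * ?g z)"
    unfolding ind distrib_right[of "indicator {p..<?P} _"] distrib_right[of "indicator {p..<?P} _ * _"]
    by (rule Bochner_Integration.integral_add[OF square_integrable[OF g] square_integrable[OF g]])
  note sq = square_ineq[OF u h, of ?P c]
  have 3: "(\<Sum>j<Suc N. (LBINT z. sqr (p + real j * h) c h z * u z)\<^sup>2) =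
    (\<Sum>j<N. (LBINT z. sqr (p + real j * h) c h z * u z)\<^sup>2) + (LBINT z. indicator {?P..<?P + h} (fst z) * indicator {c..c+h} (snd z) * u z)\<^sup>2"
    by (simp add: sqr_def)
  have step: "x1 \<le> 4 * h * y1 + k * z1 \<Longrightarrow> x2 \<le> 4 * h * y2 + k * z2 \<Longrightarrow> x1 + x2 \<le> 4 * h * (y1 + y2) + k * (z1 + z2)" for x1 x2 y1 y2 z1 z2 k
    unfolding distrib_left by linarith
  show ?case unfolding 1 2 3 by (rule step[OF Suc.IH sq])
qed

lemma strip_ineq_total:
  fixes u :: "plane \<Rightarrow> real"
  assumes u: "test_fun u" and h: "h > 0"
  shows "(LBINT x. indicator {p..<p + real N * h} x * (u (x, c))\<^sup>2) \<le>
    4 * h * (Wr u)\<^sup>2 + 2 / h ^ 3 * (\<Sum>j<N. (LBINT z. sqr (p + real j * h) c h z * u z)\<^sup>2)"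
proof -
  let ?g = "\<lambda>z. (partial u (1, 0) z)\<^sup>2 + (partial u (0, 1) z)\<^sup>2"
  have g: "test_fun ?g"
    unfolding power2_eq_square
    by (intro test_fun_add test_fun_mult smooth_partial test_fun_partial test_fun_smooth u e1_Basis e2_Basis)
  have "(LBINT z. (indicator {p..<p + real N * h} (fst z) * indicator {c..c+h} (snd z)) * ?g z) \<le> integral\<^sup>L lborel ?g"
    by (rule integral_mono[OF square_integrable[OF g] test_fun_integrable_lborel[OF g]]) (auto simp: indicator_def)
  also have "integral\<^sup>L lborel ?g = (LBINT z. (partial u (1, 0) z)\<^sup>2) + (LBINT z. (partial u (0, 1) z)\<^sup>2)"
    by (intro Bochner_Integration.integral_add test_sq_integrable test_fun_partial u e1_Basis e2_Basis)
  also have "\<dots> \<le> (Wr u)\<^sup>2"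
    unfolding W_nrm_test[OF u] sum_Basis_RR by simp
  finally have "4 * h * (LBINT z. (indicator {p..<p + real N * h} (fst z) * indicator {c..c+h} (snd z)) * ?g z) \<le> 4 * h * (Wr u)\<^sup>2"
    using h by (intro mult_left_mono) auto
  thus ?thesis using strip_ineq[OF u h, of p N c] by linarith
qed

lemma real_cs_L2:
  assumes "L2 (cr p)" "L2 (cr q)" shows "\<bar>LEBINT x. p x * q x\<bar> \<le> rnorm p * rnorm q"
proof -
  have "inner_L2 (cr p) (cr q) = complex_of_real (LEBINT x. p x * q x)"
    unfolding inner_L2_def by (simp only: complex_cnj_complex_of_real of_real_mult[symmetric] integral_complex_of_real)
  thus ?thesis using cauchy_schwarz_L2[OF assms] by simp
qed

lemma inner_indicator_test:
  assumes "g \<in> borel_measurable borel" "test_fun u"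
  shows "inner_L2 (cr g) (cr u) = complex_of_real (LBINT x. g x * u x)"
proof -
  have "inner_L2 (cr g) (cr u) = complex_of_real (LEBINT x. g x * u x)"
    unfolding inner_L2_def by (simp only: complex_cnj_complex_of_real of_real_mult[symmetric] integral_complex_of_real)
  moreover have "(LEBINT x. g x * u x) = (LBINT x. g x * u x)"
    by (rule integral_lebesgue_lborel) (use assms test_fun_measurable in measurable)
  ultimately show ?thesis by simp
qed

lemma sqr_measurable: "sqr p c h \<in> borel_measurable borel"
  unfolding sqr_def[abs_def] by (simp add: borel_prod[symmetric])

lemma sqr_L2: "L2 (cr (sqr p c h))"
proof -
  have "cr (sqr p c h) = (\<lambda>z. indicator ({p..<p+h} \<times> {c..c+h}) z)"
    by (auto simp: fun_eq_iff sqr_def indicator_def)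
  moreover have "L2 (\<lambda>z. indicator ({p..<p+h} \<times> {c..c+h}) z :: complex)"
  proof (rule L2_indicator)
    have "{p..<p+h} \<times> {c..c+h} \<in> sets borel" by (simp add: borel_prod[symmetric])
    thus "{p..<p+h} \<times> {c..c+h} \<in> sets lebesgue" by simp
    show "bounded ({p..<p+h} \<times> {c..c+h})" by (intro bounded_Times) auto
  qed
  ultimately show ?thesis by simp
qed

lemma bform_inner_functional: assumes "L2 e" shows "bform (\<lambda>u v. cnj (inner_L2 e u) * inner_L2 e v)"
proof (rule bform_functional[where C = "norm_L2 e"])
  show "cmod (inner_L2 e u) \<le> norm_L2 e * W.nrm u" if "W12 u" for u
    using cauchy_schwarz_L2[OF assms W12_L2[OF that]] mult_left_mono[OF norm_L2_le_W[of u] norm_L2_nonneg[of e]] by linarith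
qed (simp_all add: L2.f_add L2.f_scl assms W12_L2)

lemma wform_trace_test:
  fixes V :: "real \<Rightarrow> real"
  assumes V: "V \<in> borel_measurable lebesgue" and u: "test_fun u" and v: "test_fun v"
  shows "wform V (\<lambda>f. trace_line f c) (cr u) (cr v) = complex_of_real (LEBINT x. V x * (u (x, c) * v (x, c)))"
proof -
  note L = trace_line_L2[OF W12_test[OF u], of c] trace_line_L2[OF W12_test[OF v], of c]
  have m: "(\<lambda>x. cnj (trace_line (cr u) c x)) \<in> borel_measurable lebesgue" by (rule L2_measurable[OF L2_cnj[OF L(1)]])
  have "wform V (\<lambda>f. trace_line f c) (cr u) (cr v) = (LEBINT x. complex_of_real (V x * (u (x, c) * v (x, c))))"
    unfolding wform_def
  proof (rule integral_cong_AE)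
    show "(\<lambda>x. cr V x * cnj (trace_line (cr u) c x) * trace_line (cr v) c x) \<in> borel_measurable lebesgue"
      using V m L2_measurable[OF L(2)] by measurable
    have "(\<lambda>x. u (x, c)) \<in> borel_measurable lebesgue" "(\<lambda>x. v (x, c)) \<in> borel_measurable lebesgue"
      using test_fun_integrable[OF test_fun_slice(2)[OF u, of c]] test_fun_integrable[OF test_fun_slice(2)[OF v, of c]] by auto
    thus "(\<lambda>x. complex_of_real (V x * (u (x, c) * v (x, c)))) \<in> borel_measurable lebesgue" using V by measurable
    show "AE x in lebesgue. cr V x * cnj (trace_line (cr u) c x) * trace_line (cr v) c x = complex_of_real (V x * (u (x, c) * v (x, c)))"
      using trace_line_ctest[OF ctest_of_real[OF u], of c] trace_line_ctest[OF ctest_of_real[OF v], of c] by eventually_elim simp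
  qed
  thus ?thesis by (simp only: integral_complex_of_real)
qed

lemma bounded_mult_integrable:
  fixes V :: "real \<Rightarrow> real"
  assumes "V \<in> borel_measurable lebesgue" "\<And>x. \<bar>V x\<bar> \<le> B" "integrable lebesgue g"
  shows "integrable lebesgue (\<lambda>x. V x * g x)"
proof (rule Bochner_Integration.integrable_bound)
  show "integrable lebesgue (\<lambda>x. B * g x)" using assms(3) by simp
  show "AE x in lebesgue. norm (V x * g x) \<le> norm (B * g x)"
  proof (rule AE_I2)
    fix x
    have "\<bar>V x\<bar> * \<bar>g x\<bar> \<le> \<bar>B\<bar> * \<bar>g x\<bar>" using assms(2)[of x] by (intro mult_right_mono) auto
    thus "norm (V x * g x) \<le> norm (B * g x)" by (simp add: abs_mult)
  qed
qed (use assms in auto)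

text \<open>The potentials are bounded everywhere, not just almost everywhere, as the pointwise
  weight bounds of the forms require. Clipping them reduces the general case to this one.\<close>

locale leaky = point_int +
  fixes Vp Vm :: "real \<Rightarrow> real" and M :: real
  assumes Vp: "Vp \<in> borel_measurable lebesgue" "\<And>x. \<bar>Vp x\<bar> \<le> M"
    and Vm: "Vm \<in> borel_measurable lebesgue" "\<And>x. \<bar>Vm x\<bar> \<le> M"
    and Vp0: "\<And>e. e > 0 \<Longrightarrow> \<exists>L. AE x in lebesgue. \<bar>x\<bar> > L \<longrightarrow> \<bar>Vp x\<bar> \<le> e"
    and Vm0: "\<And>e. e > 0 \<Longrightarrow> \<exists>L. AE x in lebesgue. \<bar>x\<bar> > L \<longrightarrow> \<bar>Vm x\<bar> \<le> e"
begin

section \<open>The form with potentials and its lower bounds\<close>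

abbreviation "s \<equiv> form_H \<alpha> Vp Vm a"

lemma M0: "M \<ge> 0" using Vp(2)[of 0] by linarith

lemma s_eq: "s u v = grad_form u v + wform (\<lambda>x. Vp x - \<alpha>) (\<lambda>f. trace_line f a) u v + wform (\<lambda>x. Vm x - \<alpha>) (\<lambda>f. trace_line f (-a)) u v"
  by (simp add: form_H_def grad_form_def inner_L2_def wform_def)

lemma bform_grad: "bform grad_form"
  unfolding grad_form_def[abs_def] by (intro bform_sum bform_wgrad) auto

lemma bform_s: "bform s"
proof -
  have "bform (\<lambda>u v. grad_form u v + wform (\<lambda>x. Vp x - \<alpha>) (\<lambda>f. trace_line f a) u v + wform (\<lambda>x. Vm x - \<alpha>) (\<lambda>f. trace_line f (-a)) u v)"
  proof (intro bform_add bform_grad bform_wform[OF lin_op_trace])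
    show "(\<lambda>x. Vp x - \<alpha>) \<in> borel_measurable lebesgue" "(\<lambda>x. Vm x - \<alpha>) \<in> borel_measurable lebesgue" using Vp Vm by auto
    show "\<bar>Vp x - \<alpha>\<bar> \<le> M + \<alpha>" "\<bar>Vm x - \<alpha>\<bar> \<le> M + \<alpha>" for x using Vp(2)[of x] Vm(2)[of x] \<alpha> by linarith+
  qed
  thus ?thesis unfolding s_eq[abs_def] .
qed

lemma slice_prod_integrable:
  assumes u: "test_fun u" and v: "test_fun v"
  shows "integrable lebesgue (\<lambda>x. u (x, c :: real) * v (x :: real, c))"
  using test_fun_integrable[OF test_fun_mult[OF test_fun_smooth[OF test_fun_slice(2)[OF u, of c]] test_fun_slice(2)[OF v, of c]]] .

lemma slice_prod_lborel:
  assumes u: "test_fun u" and v: "test_fun v"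
  shows "(LEBINT x. u (x, c :: real) * v (x :: real, c)) = (LBINT x. u (x, c) * v (x, c))"
  using integral_lebesgue_lborel[OF test_fun_measurable[OF test_fun_mult[OF test_fun_smooth[OF test_fun_slice(2)[OF u, of c]] test_fun_slice(2)[OF v, of c]]]] .

text \<open>On test functions the chosen traces and gradients are the classical ones almost
  everywhere, so the form is an explicit real number; the realness is what
  \<open>bform_nonneg_test\<close> asks for.\<close>

lemma s_test:
  fixes u v :: "plane \<Rightarrow> real"
  assumes u: "test_fun u" and v: "test_fun v"
  shows "s (cr u) (cr v) = complex_of_real ((LBINT z. partial u (1, 0) z * partial v (1, 0) z) + (LBINT z. partial u (0, 1) z * partial v (0, 1) z)
     - \<alpha> * (LBINT x. u (x, a) * v (x, a)) - \<alpha> * (LBINT x. u (x, -a) * v (x, -a))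
     + (LEBINT x. Vp x * (u (x, a) * v (x, a))) + (LEBINT x. Vm x * (u (x, -a) * v (x, -a))))"
proof -
  have split: "(LEBINT x. (V x - \<alpha>) * (u (x, c) * v (x, c))) = (LEBINT x. V x * (u (x, c) * v (x, c))) - \<alpha> * (LBINT x. u (x, c) * v (x, c))"
    if "V \<in> borel_measurable lebesgue" "\<And>x. \<bar>V x\<bar> \<le> M" for V c
  proof -
    have "(LEBINT x. (V x - \<alpha>) * (u (x, c) * v (x, c))) = (LEBINT x. V x * (u (x, c) * v (x, c)) - \<alpha> * (u (x, c) * v (x, c)))"
      by (simp only: left_diff_distrib)
    also have "\<dots> = (LEBINT x. V x * (u (x, c) * v (x, c))) - (LEBINT x. \<alpha> * (u (x, c) * v (x, c)))"
      by (intro Bochner_Integration.integral_diff bounded_mult_integrable[OF that slice_prod_integrable[OF u v, of c]] integrable_mult_right slice_prod_integrable[OF u v, of c])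
    finally show ?thesis unfolding integral_mult_right_zero slice_prod_lborel[OF u v, of c] .
  qed
  have m: "(\<lambda>x. Vp x - \<alpha>) \<in> borel_measurable lebesgue" "(\<lambda>x. Vm x - \<alpha>) \<in> borel_measurable lebesgue" using Vp Vm by auto
  show ?thesis
    unfolding s_eq wform_trace_test[OF m(1) u v] wform_trace_test[OF m(2) u v] split[OF Vp] split[OF Vm] grad_form_def sum_Basis_RR
      inner_wgrad_test[OF u v e1_Basis] inner_wgrad_test[OF u v e2_Basis] by simp
qed

lemma V_bound:
  fixes u :: "plane \<Rightarrow> real"
  assumes "V \<in> borel_measurable lebesgue" "\<And>x. \<bar>V x\<bar> \<le> B" "test_fun u"
  shows "\<bar>LEBINT x. V x * (u (x, c) * u (x, c :: real))\<bar> \<le> B * (LBINT x. (u (x, c))\<^sup>2)"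
proof -
  have "\<bar>LEBINT x. V x * (u (x, c) * u (x, c))\<bar> \<le> (LEBINT x. B * (u (x, c) * u (x, c)))"
  proof (rule integral_abs_bound_integral[OF bounded_mult_integrable[OF assms(1,2) slice_prod_integrable[OF assms(3,3), of c]]])
    show "integrable lebesgue (\<lambda>x. B * (u (x, c) * u (x, c)))" by (intro integrable_mult_right slice_prod_integrable[OF assms(3,3), of c])
    show "\<bar>V x * (u (x, c) * u (x, c))\<bar> \<le> B * (u (x, c) * u (x, c))" for x
      unfolding abs_mult abs_mult_self_eq by (intro mult_right_mono assms(2)) simp
  qed
  thus ?thesis unfolding integral_mult_right_zero slice_prod_lborel[OF assms(3,3), of c] by (simp add: power2_eq_square)
qed

text \<open>The difference of the two squares is the squared norm of the full gradient. Through
  small h the traces are form-small with respect to it.\<close>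

lemma trace_h:
  fixes u :: "plane \<Rightarrow> real"
  assumes u: "test_fun u" and h: "h > 0"
  shows "(LBINT x. (u (x, c))\<^sup>2) \<le> 2 * h * ((Wr u)\<^sup>2 - (rnorm u)\<^sup>2) + (2 / h) * (rnorm u)\<^sup>2"
proof -
  have "0 \<le> (LBINT z. (partial u (1, 0) z)\<^sup>2)" by (intro integral_nonneg_AE) simp
  hence "2 * h * (LBINT z. (partial u (0, 1) z)\<^sup>2) \<le> 2 * h * ((Wr u)\<^sup>2 - (rnorm u)\<^sup>2)"
    unfolding W_nrm_test[OF u] sum_Basis_RR norm_L2_test[OF u] using h by (intro mult_left_mono) auto
  thus ?thesis using trace_2d[OF u h, of c] unfolding norm_L2_test[OF u] by linarith
qed

lemma s_test_quad:
  assumes u: "test_fun u"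
  shows "Re (s (cr u) (cr u)) = ((Wr u)\<^sup>2 - (rnorm u)\<^sup>2)
     - \<alpha> * (LBINT x. (u (x, a))\<^sup>2) - \<alpha> * (LBINT x. (u (x, -a))\<^sup>2)
     + (LEBINT x. Vp x * (u (x, a) * u (x, a))) + (LEBINT x. Vm x * (u (x, -a) * u (x, -a)))"
  unfolding s_test[OF u u] W_nrm_test[OF u] sum_Basis_RR norm_L2_test[OF u] Re_complex_of_real by (simp add: power2_eq_square)

text \<open>The Sobolev half on the left makes the form norm bound the Sobolev norm. Together with
  the L2 half it dominates the full squared L2 norm, which gives the constant 1 in
  \<open>garding\<close>.\<close>

lemma garding_test:
  obtains \<mu> :: real where "\<And>u. test_fun u \<Longrightarrow> (Wr u)\<^sup>2 / 2 + (rnorm u)\<^sup>2 / 2 \<le> Re (s (cr u) (cr u)) + \<mu> * (rnorm u)\<^sup>2"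
proof -
  define B where "B = \<alpha> + M"
  have B: "B > 0" using \<alpha> M0 by (simp add: B_def)
  \<comment> \<open>Then 2 B h = 1/4: the two lines together consume half of the gradient
    term.\<close>
  define h where "h = 1 / (8 * B)"
  have h: "h > 0" using B by (simp add: h_def)
  have "(Wr u)\<^sup>2 / 2 + (rnorm u)\<^sup>2 / 2 \<le> Re (s (cr u) (cr u)) + (1 + 4 * B / h) * (rnorm u)\<^sup>2" if u: "test_fun u" for u
  proof -
    define G U where "G = (Wr u)\<^sup>2 - (rnorm u)\<^sup>2" and "U = (rnorm u)\<^sup>2"
    define t1 t2 where "t1 = (LBINT x. (u (x, a))\<^sup>2)" and "t2 = (LBINT x. (u (x, -a))\<^sup>2)"
    have tt: "t1 \<le> 2 * h * G + (2 / h) * U" "t2 \<le> 2 * h * G + (2 / h) * U"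
      unfolding t1_def t2_def G_def U_def by (rule trace_h[OF u h])+
    have "Re (s (cr u) (cr u)) \<ge> G - B * t1 - B * t2"
      using s_test_quad[OF u] V_bound[OF Vp u, of a] V_bound[OF Vm u, of "-a"]
      unfolding G_def[symmetric] t1_def[symmetric] t2_def[symmetric] B_def distrib_right abs_le_iff by linarith
    moreover have "B * t1 \<le> B * (2 * h * G + (2 / h) * U)" "B * t2 \<le> B * (2 * h * G + (2 / h) * U)"
      using tt B by (auto intro!: mult_left_mono)
    moreover have "B * (2 * h * G + (2 / h) * U) = G / 4 + (2 * B / h) * U"
      using B by (simp add: h_def field_simps)
    ultimately have "Re (s (cr u) (cr u)) \<ge> G / 2 - 2 * ((2 * B / h) * U)" by linarith
    moreover have "2 * ((2 * B / h) * U) = (4 * B / h) * U" by simp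
    moreover have "(Wr u)\<^sup>2 = G + U" by (simp add: G_def U_def)
    ultimately show ?thesis unfolding U_def[symmetric] distrib_right by linarith
  qed
  with that show ?thesis by blast
qed

lemma garding_W12:
  obtains \<mu> :: real where "\<And>u. W12 u \<Longrightarrow> (W.nrm u)\<^sup>2 / 2 + (norm_L2 u)\<^sup>2 / 2 \<le> Re (s u u) + \<mu> * (norm_L2 u)\<^sup>2"
proof -
  obtain \<mu> :: real where mu: "\<And>u. test_fun u \<Longrightarrow> (Wr u)\<^sup>2 / 2 + (rnorm u)\<^sup>2 / 2 \<le> Re (s (cr u) (cr u)) + \<mu> * (rnorm u)\<^sup>2"
    using garding_test by blast
  define f where "f u v = s u v + complex_of_real (\<mu> - 1/2) * inner_L2 u v - complex_of_real (1/2) * inner_W u v" for u v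
  have bf: "bform f" unfolding f_def[abs_def] by (intro bform_add bform_diff bform_scale bform_s bform_inner_L2 bform_inner_W)
  have Re_f: "Re (f u u) = Re (s u u) + (\<mu> - 1/2) * (norm_L2 u)\<^sup>2 - (W.nrm u)\<^sup>2 / 2" if "W12 u" for u
    using W.nrm_sq[OF that] by (simp add: f_def inner_L2_self del: of_real_power)
  have "0 \<le> Re (f u u)" if "W12 u" for u
  proof (rule bform_nonneg_test[OF bf _ _ that])
    show "Im (f (cr u) (cr v)) = 0" if "test_fun u" "test_fun v" for u v
      using that by (simp add: f_def s_test inner_L2_test inner_W_def grad_form_def inner_wgrad_test)
    show "0 \<le> Re (f (cr u) (cr u))" if "test_fun u" for u
      using mu[OF that] Re_f[OF W12_test[OF that]] by (simp add: algebra_simps)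
  qed
  hence "(W.nrm u)\<^sup>2 / 2 + (norm_L2 u)\<^sup>2 / 2 \<le> Re (s u u) + \<mu> * (norm_L2 u)\<^sup>2" if "W12 u" for u
    using Re_f[OF that] that by (force simp: algebra_simps)
  with that show ?thesis by blast
qed

text \<open>Far out the potential is at most e, elsewhere at most M. The bounded part is enclosed in
  an interval whose length is a multiple of the mesh h, ready to be cut into squares.\<close>

lemma V_compact:
  assumes V: "V \<in> borel_measurable lebesgue" "\<And>x. \<bar>V x\<bar> \<le> M" "\<And>e. e > 0 \<Longrightarrow> \<exists>L. AE x in lebesgue. \<bar>x\<bar> > L \<longrightarrow> \<bar>V x\<bar> \<le> e"
    and e: "e > 0" and h: "h > 0"
  obtains p N where "\<And>u. test_fun u \<Longrightarrow> \<bar>LEBINT x. V x * (u (x, c) * u (x, c :: real))\<bar> \<le> e * (LBINT x. (u (x, c))\<^sup>2) + M * (LBINT x. indicator {p..<p + real N * h} x * (u (x, c))\<^sup>2)"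
proof -
  obtain L where L: "AE x in lebesgue. \<bar>x\<bar> > L \<longrightarrow> \<bar>V x\<bar> \<le> e" using V(3)[OF e] by blast
  \<comment> \<open>The spare 1 puts the right end point |L| inside the half-open interval.\<close>
  obtain N :: nat where N: "(2 * \<bar>L\<bar> + 1) / h < real N" using reals_Archimedean2 by blast
  define p where "p = - \<bar>L\<bar>"
  have Nh: "2 * \<bar>L\<bar> + 1 < real N * h" using N h by (simp add: field_simps)
  have "\<bar>LEBINT x. V x * (u (x, c) * u (x, c))\<bar> \<le> e * (LBINT x. (u (x, c))\<^sup>2) + M * (LBINT x. indicator {p..<p + real N * h} x * (u (x, c))\<^sup>2)" if u: "test_fun u" for u
  proof -
    let ?k = "\<lambda>x. indicator {p..<p + real N * h} x :: real"
    note i = slice_prod_integrable[OF u u, of c]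
    have ik: "integrable lebesgue (\<lambda>x. ?k x * (u (x, c) * u (x, c)))"
      using integrable_mult_indicator[OF _ i, of "{p..<p + real N * h}"] by simp
    have "\<bar>LEBINT x. V x * (u (x, c) * u (x, c))\<bar> \<le> (LEBINT x. \<bar>V x * (u (x, c) * u (x, c))\<bar>)" by (rule integral_abs_bound)
    also have "\<dots> \<le> (LEBINT x. e * (u (x, c) * u (x, c)) + M * (?k x * (u (x, c) * u (x, c))))"
    proof (rule integral_mono_AE)
      show "integrable lebesgue (\<lambda>x. \<bar>V x * (u (x, c) * u (x, c))\<bar>)" using bounded_mult_integrable[OF V(1,2) i] by simp
      show "integrable lebesgue (\<lambda>x. e * (u (x, c) * u (x, c)) + M * (?k x * (u (x, c) * u (x, c))))"
        by (intro Bochner_Integration.integrable_add integrable_mult_right i ik)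
      show "AE x in lebesgue. \<bar>V x * (u (x, c) * u (x, c))\<bar> \<le> e * (u (x, c) * u (x, c)) + M * (?k x * (u (x, c) * u (x, c)))"
        using L
      proof eventually_elim
        case (elim x)
        have "\<bar>V x\<bar> \<le> e + M * ?k x"
        proof (cases "\<bar>x\<bar> > L")
          case True
          thus ?thesis using elim M0 by (simp add: add_increasing2)
        next
          case False
          hence "x \<in> {p..<p + real N * h}" using Nh by (auto simp: p_def)
          thus ?thesis using V(2)[of x] e by simp
        qed
        hence "\<bar>V x\<bar> * (u (x, c) * u (x, c)) \<le> (e + M * ?k x) * (u (x, c) * u (x, c))" by (rule mult_right_mono) simp
        thus ?case by (simp add: abs_mult algebra_simps)
      qed
    qed
    also have "\<dots> = (LEBINT x. e * (u (x, c) * u (x, c))) + (LEBINT x. M * (?k x * (u (x, c) * u (x, c))))"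
      by (intro Bochner_Integration.integral_add integrable_mult_right i ik)
    also have "(LEBINT x. e * (u (x, c) * u (x, c))) = e * (LBINT x. (u (x, c))\<^sup>2)"
      unfolding integral_mult_right_zero slice_prod_lborel[OF u u, of c] by (simp add: power2_eq_square)
    also have "(LEBINT x. M * (?k x * (u (x, c) * u (x, c)))) = M * (LBINT x. ?k x * (u (x, c))\<^sup>2)"
    proof -
      have [measurable]: "(\<lambda>x. u (x, c)) \<in> borel_measurable borel" using test_fun_measurable[OF test_fun_slice(2)[OF u, of c]] .
      have "(LEBINT x. ?k x * (u (x, c) * u (x, c))) = (LBINT x. ?k x * (u (x, c) * u (x, c)))"
        by (rule integral_lebesgue_lborel) measurable
      thus ?thesis unfolding integral_mult_right_zero by (simp add: power2_eq_square)
    qed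
    finally show ?thesis .
  qed
  with that show ?thesis by blast
qed

text \<open>Two bounds for the form without potentials are combined. The square gives -\<kappa>^2 U
  but no gradient, the trace inequality gives G / 2 at the cost of K U. A convex combination with a
  small weight \<theta> on the second keeps some gradient and spends at most half of the gap g =
  -\<kappa>^2 - \<Lambda>. The potentials are then absorbed, up to the averages over
  squares.\<close>

lemma coercive_test:
  assumes lam: "\<Lambda> < - \<kappa>\<^sup>2"
  obtains c C p1 N1 p2 N2 h where "c > 0" "\<And>u. test_fun u \<Longrightarrow>
     c * (Wr u)\<^sup>2 - C * ((\<Sum>j<(N1::nat). (LBINT z. sqr (p1 + real j * h) a h z * u z)\<^sup>2) + (\<Sum>j<(N2::nat). (LBINT z. sqr (p2 + real j * h) (-a) h z * u z)\<^sup>2))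
      \<le> Re (s (cr u) (cr u)) - \<Lambda> * (rnorm u)\<^sup>2"
proof -
  define g where "g = - \<kappa>\<^sup>2 - \<Lambda>"
  have g: "g > 0" using lam by (simp add: g_def)
  \<comment> \<open>At width 1 / (8 \<alpha>) the trace inequality charges G / 4 + 16 \<alpha>^2 U
    per line; the additional 1 is slack.\<close>
  define K where "K = 32 * \<alpha>\<^sup>2 + 1"
  have K: "K > 0" unfolding K_def by (intro add_nonneg_pos) auto
  \<comment> \<open>The weight is a convex one, and \<theta> K stays below half the gap.\<close>
  define \<theta> where "\<theta> = min 1 (g / (2 * K))"
  have th: "\<theta> > 0" "\<theta> \<le> 1" "\<theta> * K \<le> g / 2"
  proof -
    show "\<theta> > 0" "\<theta> \<le> 1" using g K by (auto simp: \<theta>_def)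
    have "\<theta> \<le> g / (2 * K)" by (simp add: \<theta>_def)
    hence "\<theta> * K \<le> g / (2 * K) * K" using K by (intro mult_right_mono) auto
    thus "\<theta> * K \<le> g / 2" using K by simp
  qed
  define d where "d = min (\<theta> / 2) (g / 2)"
  have d: "d > 0" using th g by (simp add: d_def)
  \<comment> \<open>On each line the far part costs e times a trace of at most 2 W, that is d W / 8,
    and the gradient over the squares costs 4 M h W \<le> d W / 8 by the choice of h. The two lines
    use up d W / 2 of the available d W.\<close>
  define e where "e = d / 16"
  have e: "e > 0" using d by (simp add: e_def)
  define h where "h = d / (32 * (M + 1))"
  have h: "h > 0" using d M0 by (simp add: h_def)
  have Mh: "M * (4 * h) \<le> d / 8"
  proof -
    have "M * (4 * h) = (d / 8) * (M / (M + 1))" using M0 by (simp add: h_def field_simps)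
    also have "\<dots> \<le> (d / 8) * 1" using M0 d by (intro mult_left_mono) auto
    finally show ?thesis by simp
  qed
  obtain p1 N1 where 1: "\<And>u. test_fun u \<Longrightarrow> \<bar>LEBINT x. Vp x * (u (x, a) * u (x, a))\<bar> \<le> e * (LBINT x. (u (x, a))\<^sup>2) + M * (LBINT x. indicator {p1..<p1 + real N1 * h} x * (u (x, a))\<^sup>2)"
    using V_compact[OF Vp Vp0 e h, of a] by blast
  obtain p2 N2 where 2: "\<And>u. test_fun u \<Longrightarrow> \<bar>LEBINT x. Vm x * (u (x, -a) * u (x, -a))\<bar> \<le> e * (LBINT x. (u (x, -a))\<^sup>2) + M * (LBINT x. indicator {p2..<p2 + real N2 * h} x * (u (x, -a))\<^sup>2)"
    using V_compact[OF Vm Vm0 e h, of "-a"] by blast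
  define C where "C = M * (2 / h ^ 3)"
  have main: "(d / 2) * (Wr u)\<^sup>2 - C * ((\<Sum>j<N1. (LBINT z. sqr (p1 + real j * h) a h z * u z)\<^sup>2) + (\<Sum>j<N2. (LBINT z. sqr (p2 + real j * h) (-a) h z * u z)\<^sup>2))
      \<le> Re (s (cr u) (cr u)) - \<Lambda> * (rnorm u)\<^sup>2" if u: "test_fun u" for u
  proof -
    define W U G where "W = (Wr u)\<^sup>2" and "U = (rnorm u)\<^sup>2" and "G = (Wr u)\<^sup>2 - (rnorm u)\<^sup>2"
    define t1 t2 where "t1 = (LBINT x. (u (x, a))\<^sup>2)" and "t2 = (LBINT x. (u (x, -a))\<^sup>2)"
    define v1 v2 where "v1 = (LEBINT x. Vp x * (u (x, a) * u (x, a)))" and "v2 = (LEBINT x. Vm x * (u (x, -a) * u (x, -a)))"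
    define S1 S2 where "S1 = (\<Sum>j<N1. (LBINT z. sqr (p1 + real j * h) a h z * u z)\<^sup>2)" and "S2 = (\<Sum>j<N2. (LBINT z. sqr (p2 + real j * h) (-a) h z * u z)\<^sup>2)"
    have WGU: "W = G + U" by (simp add: W_def G_def U_def)
    have U0: "U \<ge> 0" by (simp add: U_def)
    have G0: "G \<ge> 0" unfolding G_def W_nrm_test[OF u] norm_L2_test[OF u] by (simp add: sum_nonneg integral_nonneg_AE)
    have sq: "Re (s (cr u) (cr u)) = G - \<alpha> * t1 - \<alpha> * t2 + v1 + v2"
      unfolding s_test_quad[OF u] G_def t1_def t2_def v1_def v2_def ..
    have tr1: "t1 \<le> 2 * W" "t2 \<le> 2 * W"
      using trace_h[OF u, of 1 a] trace_h[OF u, of 1 "-a"] unfolding t1_def t2_def W_def by simp_all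
    have gs: "- \<kappa>\<^sup>2 * U \<le> G - \<alpha> * t1 - \<alpha> * t2"
    proof -
      have "0 \<le> (LBINT z. ann2 u z * ann2 u z)"
        by (intro integral_nonneg_AE) simp
      hence "0 \<le> (LBINT z. (partial u (0, 1) z)\<^sup>2) + \<kappa>\<^sup>2 * U - \<alpha> * t1 - \<alpha> * t2"
        unfolding ground_state_2d[OF u u] U_def norm_L2_test[OF u] t1_def t2_def by (simp add: power2_eq_square)
      moreover have "0 \<le> (LBINT z. (partial u (1, 0) z)\<^sup>2)" by (intro integral_nonneg_AE) simp
      moreover have "G = (LBINT z. (partial u (1, 0) z)\<^sup>2) + (LBINT z. (partial u (0, 1) z)\<^sup>2)"
        unfolding G_def W_nrm_test[OF u] norm_L2_test[OF u] sum_Basis_RR by simp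
      ultimately show ?thesis unfolding mult_minus_left by linarith
    qed
    have ga: "G / 2 - K * U \<le> G - \<alpha> * t1 - \<alpha> * t2"
    proof -
      have h8: "1 / (8 * \<alpha>) > 0" using \<alpha> by simp
      define Z where "Z = \<alpha> * (2 * (1 / (8 * \<alpha>)) * G + 2 / (1 / (8 * \<alpha>)) * U)"
      have "\<alpha> * t1 \<le> Z" "\<alpha> * t2 \<le> Z"
        unfolding Z_def using trace_h[OF u h8, of a] trace_h[OF u h8, of "-a"] \<alpha> unfolding t1_def t2_def G_def U_def by (auto intro!: mult_left_mono)
      moreover have "Z = G / 4 + 16 * (\<alpha>\<^sup>2 * U)"
        unfolding Z_def using \<alpha> by (simp add: field_simps power2_eq_square)
      moreover have "K * U = 32 * (\<alpha>\<^sup>2 * U) + U" by (simp add: K_def algebra_simps)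
      ultimately show ?thesis using U0 by linarith
    qed
    have low: "d * W \<le> G - \<alpha> * t1 - \<alpha> * t2 - \<Lambda> * U"
    proof -
      have "\<theta> * (G / 2 - K * U) + (1 - \<theta>) * (- \<kappa>\<^sup>2 * U) \<le> \<theta> * (G - \<alpha> * t1 - \<alpha> * t2) + (1 - \<theta>) * (G - \<alpha> * t1 - \<alpha> * t2)"
        using th ga gs by (intro add_mono mult_left_mono) auto
      also have "\<dots> = G - \<alpha> * t1 - \<alpha> * t2" by (simp add: algebra_simps)
      finally have A: "\<theta> * (G / 2 - K * U) + (1 - \<theta>) * (- \<kappa>\<^sup>2 * U) \<le> G - \<alpha> * t1 - \<alpha> * t2" .
      have "\<theta> * (G / 2 - K * U) + (1 - \<theta>) * (- \<kappa>\<^sup>2 * U) = (\<theta> / 2) * G - (\<theta> * K) * U - \<kappa>\<^sup>2 * U + \<theta> * (\<kappa>\<^sup>2 * U)" by (simp add: algebra_simps)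
      moreover have "(\<theta> * K) * U \<le> (g / 2) * U" using th U0 by (intro mult_right_mono) auto
      moreover have "0 \<le> \<theta> * (\<kappa>\<^sup>2 * U)" using th U0 by simp
      moreover have "\<Lambda> * U = - \<kappa>\<^sup>2 * U - g * U" by (simp add: g_def algebra_simps)
      moreover have "d * G \<le> (\<theta> / 2) * G" "d * U \<le> (g / 2) * U" by (intro mult_right_mono G0 U0; simp add: d_def)+
      moreover have "d * W = d * G + d * U" unfolding WGU by (rule distrib_left)
      moreover have "g * U = (g / 2) * U + (g / 2) * U" by simp
      ultimately show ?thesis using A by linarith
    qed
    have st: "M * (LBINT x. indicator {p..<p + real N * h} x * (u (x, c))\<^sup>2) \<le> (d / 8) * W + C * (\<Sum>j<N. (LBINT z. sqr (p + real j * h) c h z * u z)\<^sup>2)" for p N c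
    proof -
      have "M * (LBINT x. indicator {p..<p + real N * h} x * (u (x, c))\<^sup>2) \<le> M * (4 * h * W + 2 / h ^ 3 * (\<Sum>j<N. (LBINT z. sqr (p + real j * h) c h z * u z)\<^sup>2))"
        unfolding W_def by (intro mult_left_mono strip_ineq_total[OF u h] M0)
      also have "\<dots> = M * (4 * h) * W + C * (\<Sum>j<N. (LBINT z. sqr (p + real j * h) c h z * u z)\<^sup>2)" by (simp add: C_def algebra_simps)
      also have "M * (4 * h) * W \<le> (d / 8) * W" using Mh by (intro mult_right_mono) (auto simp: W_def)
      finally show ?thesis by simp
    qed
    have et: "e * t1 \<le> (d / 8) * W" "e * t2 \<le> (d / 8) * W"
      using mult_left_mono[OF tr1(1), of e] mult_left_mono[OF tr1(2), of e] e by (simp_all add: e_def)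
    have "\<bar>v1\<bar> \<le> (d / 8) * W + ((d / 8) * W + C * S1)" using 1[OF u] st[where p = p1 and N = N1 and c = a] et unfolding v1_def t1_def S1_def by linarith
    moreover have "\<bar>v2\<bar> \<le> (d / 8) * W + ((d / 8) * W + C * S2)" using 2[OF u] st[where p = p2 and N = N2 and c = "-a"] et unfolding v2_def t2_def S2_def by linarith
    moreover have "(d / 2) * W = 4 * ((d / 8) * W)" by simp
    ultimately have "v1 + v2 \<ge> - ((d / 2) * W) - C * S1 - C * S2" unfolding abs_le_iff by linarith
    moreover have "d * W = (d / 2) * W + (d / 2) * W" by simp
    ultimately have "(d / 2) * W - C * S1 - C * S2 \<le> Re (s (cr u) (cr u)) - \<Lambda> * U" using low unfolding sq by linarith
    thus ?thesis unfolding W_def[symmetric] U_def[symmetric] S1_def[symmetric] S2_def[symmetric] distrib_left by linarith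
  qed
  show ?thesis by (rule that[of "d / 2", OF _ main]) (use d in auto)
qed

end

section \<open>Weyl sequences above the threshold\<close>

lemma norm_L2_mult_le_AE:
  fixes f h :: "'a::euclidean_space \<Rightarrow> complex"
  assumes f: "L2 f" and h: "h \<in> borel_measurable lebesgue" "AE x in lebesgue. cmod (h x * f x) \<le> B * cmod (f x)" and B: "B \<ge> 0"
  shows "L2 (\<lambda>x. h x * f x)" "norm_L2 (\<lambda>x. h x * f x) \<le> B * norm_L2 f"
proof -
  have ae: "AE x in lebesgue. (cmod (h x * f x))\<^sup>2 \<le> B\<^sup>2 * (cmod (f x))\<^sup>2"
    using h(2)
  proof eventually_elim
    case (elim x)
    have "(cmod (h x * f x))\<^sup>2 \<le> (B * cmod (f x))\<^sup>2" by (rule power_mono[OF elim]) simp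
    thus ?case by (simp add: power_mult_distrib)
  qed
  have m: "(\<lambda>x. h x * f x) \<in> borel_measurable lebesgue" using h(1) L2_measurable[OF f] by measurable
  have i: "integrable lebesgue (\<lambda>x. B\<^sup>2 * (cmod (f x))\<^sup>2)" using L2_integrable[OF f] by simp
  have "integrable lebesgue (\<lambda>x. (cmod (h x * f x))\<^sup>2)"
    by (rule Bochner_Integration.integrable_bound[OF i]) (use m ae in auto)
  thus L: "L2 (\<lambda>x. h x * f x)" using m by (simp add: L2_def)
  have "(norm_L2 (\<lambda>x. h x * f x))\<^sup>2 \<le> (LEBINT x. B\<^sup>2 * (cmod (f x))\<^sup>2)"
    unfolding norm_L2_sq by (rule integral_mono_AE[OF L2_integrable[OF L] i ae])
  hence "(norm_L2 (\<lambda>x. h x * f x))\<^sup>2 \<le> (B * norm_L2 f)\<^sup>2" by (simp add: power_mult_distrib norm_L2_sq)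
  thus "norm_L2 (\<lambda>x. h x * f x) \<le> B * norm_L2 f" by (rule power2_le_imp_le) (use B in simp)
qed

lemma norm_test_le_W: "test_fun u \<Longrightarrow> rnorm u \<le> Wr u"
  by (rule norm_L2_le_W)

lemma norm_partial_le_W:
  assumes "test_fun u" "b \<in> Basis" shows "rnorm (partial u b) \<le> Wr u"
proof -
  have "rnorm (partial u b) = norm_L2 (wgrad (cr u) b)"
    by (rule norm_L2_cong_AE[OF test_fun_L2[OF test_fun_partial[OF assms]] wgrad_L2[OF W12_test[OF assms(1)] assms(2)]])
      (use wgrad_test[OF assms] in \<open>auto elim: eventually_mono\<close>)
  thus ?thesis using norm_wgrad_le_W[OF assms(2), of "cr u"] by simp
qed

context leaky
begin

lemma T2_norm:
  fixes u :: "plane \<Rightarrow> real"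
  assumes u: "test_fun u"
  shows "L2 (cr (ann2 u))"
    and "rnorm (ann2 u) \<le> (1 + \<kappa>) * Wr u"
proof -
  have wm: "(\<lambda>z::plane. complex_of_real (w (snd z))) \<in> borel_measurable lebesgue"
    by (rule measurable_completion) measurable
  have b: "AE z in lebesgue. cmod (complex_of_real (w (snd z)) * cr u z) \<le> \<kappa> * cmod (cr u z)"
    by (intro AE_I2) (auto simp: norm_mult abs_mult w_bound intro!: mult_right_mono)
  note wu = norm_L2_mult_le_AE[OF test_fun_L2[OF u] wm b less_imp_le[OF \<kappa>]]
  note D = test_fun_L2[OF test_fun_partial[OF u e2_Basis]]
  have eq: "cr (ann2 u) = (\<lambda>z. cr (partial u (0, 1)) z - complex_of_real (w (snd z)) * cr u z)" by simp
  show "L2 (cr (ann2 u))" unfolding eq by (rule L2_diff[OF D wu(1)])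
  have "rnorm (ann2 u) \<le> rnorm (partial u (0, 1)) + norm_L2 (\<lambda>z. complex_of_real (w (snd z)) * cr u z)"
    unfolding eq by (rule norm_L2_triangle_diff[OF D wu(1)])
  also have "\<dots> \<le> Wr u + \<kappa> * Wr u"
    using norm_partial_le_W[OF u e2_Basis] wu(2) mult_left_mono[OF norm_test_le_W[OF u] less_imp_le[OF \<kappa>]] by linarith
  finally show "rnorm (ann2 u) \<le> (1 + \<kappa>) * Wr u" by (simp add: algebra_simps)
qed

lemma weyl_V:
  fixes u :: "plane \<Rightarrow> real"
  assumes u: "test_fun u" and f: "test_fun f" and V: "V \<in> borel_measurable lebesgue" "AE x in lebesgue. f x \<noteq> 0 \<longrightarrow> \<bar>V x\<bar> \<le> e" and e: "e \<ge> 0"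
  shows "\<bar>LEBINT x. V x * (u (x, c) * (f x * r))\<bar> \<le> (sqrt 2 * Wr u) * (\<bar>r\<bar> * (e * rnorm f))"
proof -
  have Vm: "(cr V) \<in> borel_measurable lebesgue" using V(1) by measurable
  have ae: "AE x in lebesgue. cmod (cr V x * cr f x) \<le> e * cmod (cr f x)"
    using V(2)
  proof eventually_elim
    case (elim x)
    thus ?case by (cases "f x = 0") (auto simp: norm_mult abs_mult intro!: mult_right_mono)
  qed
  note Vf = norm_L2_mult_le_AE[OF test_fun_L2[OF f] Vm ae e]
  have eq: "cr (\<lambda>x. r * (V x * f x)) = (\<lambda>x. complex_of_real r * (cr V x * cr f x))" by simp
  have L: "L2 (cr (\<lambda>x. r * (V x * f x)))" unfolding eq by (rule L2_scale[OF Vf(1)])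
  have n: "rnorm (\<lambda>x. r * (V x * f x)) \<le> \<bar>r\<bar> * (e * rnorm f)"
    unfolding eq norm_L2_scale norm_of_real by (rule mult_left_mono[OF Vf(2)]) simp
  have Lu: "L2 (cr (\<lambda>x. u (x, c)))" using test_fun_L2[OF test_fun_slice(2)[OF u, of c]] .
  have "(LEBINT x. V x * (u (x, c) * (f x * r))) = (LEBINT x. u (x, c) * (r * (V x * f x)))" by (simp add: mult_ac)
  hence "\<bar>LEBINT x. V x * (u (x, c) * (f x * r))\<bar> \<le> rnorm (\<lambda>x. u (x, c)) * rnorm (\<lambda>x. r * (V x * f x))"
    using real_cs_L2[OF Lu L] by simp
  also have "\<dots> \<le> (sqrt 2 * Wr u) * (\<bar>r\<bar> * (e * rnorm f))"
    using slice_norm_ctest[OF ctest_of_real[OF u], of c] n by (intro mult_mono) auto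
  finally show ?thesis .
qed

text \<open>On a product f(x1) v(x2) the fibre part is completed to a square by
  \<open>ground_state_2d\<close>, which leaves three defects: f'' + k^2 f in the first variable,
  \<open>ann v\<close> in the second, and the potentials on the support of f. The square is not
  integrated by parts, so \<open>ann v\<close> is needed only in L2, and its partner
  \<open>ann2 u\<close> is bounded by the Sobolev norm of u.\<close>

lemma weyl_test:
  fixes u :: "plane \<Rightarrow> real" and f v :: "real \<Rightarrow> real"
  assumes u: "test_fun u" and f: "test_fun f" and v: "test_fun v" and e: "e \<ge> 0"
    and V: "AE x in lebesgue. f x \<noteq> 0 \<longrightarrow> \<bar>Vp x\<bar> \<le> e" "AE x in lebesgue. f x \<noteq> 0 \<longrightarrow> \<bar>Vm x\<bar> \<le> e"
  defines "\<psi> \<equiv> \<lambda>z::plane. f (fst z) * v (snd z)"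
  shows "cmod (s (cr u) (cr \<psi>) - complex_of_real (k\<^sup>2 - \<kappa>\<^sup>2) * inner_L2 (cr u) (cr \<psi>)) \<le>
    (rnorm (\<lambda>x. partial (partial f 1) 1 x + k\<^sup>2 * f x) * rnorm v
     + (1 + \<kappa>) * (rnorm f * rnorm (ann v))
     + sqrt 2 * (\<bar>v a\<bar> + \<bar>v (-a)\<bar>) * (e * rnorm f)) * Wr u"
proof -
  have b1: "(1::real) \<in> Basis" by simp
  note sf = test_fun_smooth[OF f] and sv = test_fun_smooth[OF v] and su = test_fun_smooth[OF u]
  have f1: "test_fun (partial f 1)" and f2: "test_fun (partial (partial f 1) 1)" and v1: "test_fun (partial v 1)"
    by (intro test_fun_partial f v b1)+
  have psi: "test_fun \<psi>" unfolding \<psi>_def by (rule test_fun_tensor[OF f v])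
  have p1: "partial \<psi> (1, 0) = tensor (partial f 1) v" and p2: "partial \<psi> (0, 1) = tensor f (partial v 1)"
    unfolding \<psi>_def by (rule smooth_tensor(2)[OF sf sv], rule smooth_tensor(3)[OF sf sv])
  define g where "g x = partial (partial f 1) 1 x + k\<^sup>2 * f x" for x
  have g: "test_fun g" unfolding g_def[abs_def] by (intro test_fun_add test_fun_cmult f f2)
  have gt: "test_fun (tensor g v)" by (rule test_fun_tensor[OF g v])
  have ft: "test_fun (tensor (partial (partial f 1) 1) v)" by (rule test_fun_tensor[OF f2 v])
  have A: "(LBINT z. partial u (1, 0) z * partial \<psi> (1, 0) z) = - (LBINT z. u z * (partial (partial f 1) 1 (fst z) * v (snd z)))"
  proof -
    have s1: "smooth (tensor (partial f 1) v)" by (rule smooth_tensor(1)[OF test_fun_smooth[OF f1] sv])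
    have "(LEBINT z. (partial f 1 (fst z) * v (snd z)) * partial u (1, 0) z) = - (LEBINT z. (partial (partial f 1) 1 (fst z) * v (snd z)) * u z)"
      using integral_by_parts_test[OF s1 u e1_Basis] unfolding smooth_tensor(2)[OF test_fun_smooth[OF f1] sv] .
    moreover have "(LEBINT z. (partial f 1 (fst z) * v (snd z)) * partial u (1, 0) z) = (LBINT z. (partial f 1 (fst z) * v (snd z)) * partial u (1, 0) z)"
      by (rule integral_lebesgue_lborel[OF test_fun_measurable[OF test_fun_mult[OF s1 test_fun_partial[OF u e1_Basis]]]])
    moreover have "(LEBINT z. (partial (partial f 1) 1 (fst z) * v (snd z)) * u z) = (LBINT z. (partial (partial f 1) 1 (fst z) * v (snd z)) * u z)"
      by (rule integral_lebesgue_lborel[OF test_fun_measurable[OF test_fun_mult[OF test_fun_smooth[OF ft] u]]])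
    ultimately show ?thesis unfolding p1 by (simp add: mult.commute)
  qed
  have B: "(LBINT z. u z * (g (fst z) * v (snd z))) = (LBINT z. u z * (partial (partial f 1) 1 (fst z) * v (snd z))) + k\<^sup>2 * (LBINT z. u z * \<psi> z)"
  proof -
    have "(LBINT z. u z * (g (fst z) * v (snd z))) = (LBINT z. u z * (partial (partial f 1) 1 (fst z) * v (snd z)) + k\<^sup>2 * (u z * \<psi> z))"
      unfolding g_def \<psi>_def by (simp add: algebra_simps)
    also have "\<dots> = (LBINT z. u z * (partial (partial f 1) 1 (fst z) * v (snd z))) + (LBINT z. k\<^sup>2 * (u z * \<psi> z))"
      by (intro Bochner_Integration.integral_add integrable_mult_right test_mult_integrable u ft psi)
    finally show ?thesis by simp
  qed
  define T where "T = (LBINT z. ann2 u z * ann2 \<psi> z)"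
  define X where "X = (LBINT z. u z * (g (fst z) * v (snd z)))"
  define Y1 Y2 where "Y1 = (LEBINT x. Vp x * (u (x, a) * (f x * v a)))" and "Y2 = (LEBINT x. Vm x * (u (x, -a) * (f x * v (-a))))"
  have "s (cr u) (cr \<psi>) - complex_of_real (k\<^sup>2 - \<kappa>\<^sup>2) * inner_L2 (cr u) (cr \<psi>) = complex_of_real (- X + T + Y1 + Y2)"
  proof -
    have gs: "T = (LBINT z. partial u (0, 1) z * partial \<psi> (0, 1) z) + \<kappa>\<^sup>2 * (LBINT z. u z * \<psi> z)
     - \<alpha> * (LBINT x. u (x, a) * \<psi> (x, a)) - \<alpha> * (LBINT x. u (x, -a) * \<psi> (x, -a))"
      unfolding T_def by (rule ground_state_2d[OF u psi])
    have y: "Y1 = (LEBINT x. Vp x * (u (x, a) * \<psi> (x, a)))" "Y2 = (LEBINT x. Vm x * (u (x, -a) * \<psi> (x, -a)))"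
      by (simp_all add: Y1_def Y2_def \<psi>_def)
    show ?thesis
      unfolding s_test[OF u psi] inner_L2_test[OF u psi] of_real_mult[symmetric] of_real_diff[symmetric] of_real_eq_iff
        A y[symmetric] using gs B unfolding X_def[symmetric] left_diff_distrib by linarith
  qed
  hence le: "cmod (s (cr u) (cr \<psi>) - complex_of_real (k\<^sup>2 - \<kappa>\<^sup>2) * inner_L2 (cr u) (cr \<psi>)) \<le> \<bar>X\<bar> + \<bar>T\<bar> + \<bar>Y1\<bar> + \<bar>Y2\<bar>"
    by (simp only: norm_of_real)
  have sqf: "integrable lborel (\<lambda>x. (f x)\<^sup>2)" "integrable lborel (\<lambda>x. (v x)\<^sup>2)" "integrable lborel (\<lambda>x. (g x)\<^sup>2)" by (intro test_sq_integrable f v g)+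
  have bX: "\<bar>X\<bar> \<le> Wr u * (rnorm g * rnorm v)"
  proof -
    note nt = norm_tensor[OF test_fun_measurable[OF g] sqf(3) test_fun_measurable[OF v] sqf(2)]
    have "X = (LEBINT z. u z * (g (fst z) * v (snd z)))"
      unfolding X_def by (rule integral_lebesgue_lborel[symmetric, OF test_fun_measurable[OF test_fun_mult[OF su gt]]])
    hence "\<bar>X\<bar> \<le> rnorm u * (rnorm g * rnorm v)"
      using real_cs_L2[OF test_fun_L2[OF u] nt(1)] unfolding nt(2) by simp
    also have "\<dots> \<le> Wr u * (rnorm g * rnorm v)" by (intro mult_right_mono norm_test_le_W u) auto
    finally show ?thesis .
  qed
  have bT: "\<bar>T\<bar> \<le> ((1 + \<kappa>) * Wr u) * (rnorm f * rnorm (ann v))"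
  proof -
    let ?h = "\<lambda>x. partial v 1 x - w x * v x"
    have hm: "?h \<in> borel_measurable borel" using test_fun_measurable[OF v] test_fun_measurable[OF v1] by measurable
    have hL: "L2 (cr ?h)" by (rule T1_test(2)[OF v])
    have hi: "integrable lborel (\<lambda>x. (?h x)\<^sup>2)"
    proof -
      have "integrable lebesgue (\<lambda>x. (?h x)\<^sup>2)" using L2_integrable[OF hL] by (simp only: norm_of_real power2_abs)
      thus ?thesis using hm by (subst (asm) integrable_completion) auto
    qed
    have eq: "partial \<psi> (0, 1) z - w (snd z) * \<psi> z = f (fst z) * ?h (snd z)" for z
      unfolding p2 by (simp add: \<psi>_def algebra_simps)
    note nt = norm_tensor[OF test_fun_measurable[OF f] sqf(1) hm hi]
    have "T = (LEBINT z. ann2 u z * ann2 \<psi> z)"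
      unfolding T_def by (rule integral_lebesgue_lborel[symmetric]) (intro borel_measurable_times T2_bb(1)[OF u] T2_bb(1)[OF psi])
    hence "\<bar>T\<bar> \<le> rnorm (ann2 u) * (rnorm f * rnorm ?h)"
      using real_cs_L2[OF T2_norm(1)[OF u] nt(1)] unfolding nt(2) eq by simp
    also have "\<dots> \<le> ((1 + \<kappa>) * Wr u) * (rnorm f * rnorm ?h)" by (intro mult_right_mono T2_norm(2)[OF u]) auto
    finally show ?thesis .
  qed
  have bY1: "\<bar>Y1\<bar> \<le> (sqrt 2 * Wr u) * (\<bar>v a\<bar> * (e * rnorm f))"
    unfolding Y1_def by (rule weyl_V[OF u f Vp(1) V(1) e])
  have bY2: "\<bar>Y2\<bar> \<le> (sqrt 2 * Wr u) * (\<bar>v (-a)\<bar> * (e * rnorm f))"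
    unfolding Y2_def by (rule weyl_V[OF u f Vm(1) V(2) e])
  have "\<bar>X\<bar> + \<bar>T\<bar> + \<bar>Y1\<bar> + \<bar>Y2\<bar> \<le> Wr u * (rnorm g * rnorm v) + ((1 + \<kappa>) * Wr u) * (rnorm f * rnorm (ann v))
     + (sqrt 2 * Wr u) * (\<bar>v a\<bar> * (e * rnorm f)) + (sqrt 2 * Wr u) * (\<bar>v (-a)\<bar> * (e * rnorm f))"
    by (intro add_mono bX bT bY1 bY2)
  also have "\<dots> = (rnorm g * rnorm v + (1 + \<kappa>) * (rnorm f * rnorm (ann v))
     + sqrt 2 * (\<bar>v a\<bar> + \<bar>v (-a)\<bar>) * (e * rnorm f)) * Wr u"
    by (simp only: distrib_left distrib_right mult_ac add_ac)
  finally show ?thesis using le unfolding g_def by linarith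
qed

text \<open>The factor 2 comes from splitting a complex test function into real and imaginary part,
  each of Sobolev norm at most that of the whole.\<close>

lemma weyl_extend:
  assumes psi: "W12 \<psi>" and E: "\<And>u. test_fun u \<Longrightarrow> cmod (s (cr u) \<psi> - complex_of_real l * inner_L2 (cr u) \<psi>) \<le> E * Wr u" and E0: "E \<ge> 0" and phi: "W12 \<phi>"
  shows "cmod (s \<phi> \<psi> - complex_of_real l * inner_L2 \<phi> \<psi>) \<le> 2 * E * W.nrm \<phi>"
proof -
  define f where "f u v = s u v - complex_of_real l * inner_L2 u v" for u v
  have bf: "bform f" unfolding f_def[abs_def] by (intro bform_diff bform_scale bform_s bform_inner_L2)
  interpret f: herm_form W12 "\<lambda>f g x. f x + g x" "\<lambda>c f x. c * f x" f by (rule bform_herm[OF bf])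
  have ct: "cmod (f p \<psi>) \<le> 2 * E * W.nrm p" if p: "ctest_fun p" for p
  proof -
    obtain u v where uv: "test_fun u" "test_fun v" "p = (\<lambda>x. cr u x + \<i> * cr v x)" using ctest_cases[OF p] .
    have "f p \<psi> = f (cr u) \<psi> + cnj \<i> * f (cr v) \<psi>"
      unfolding uv(3) using f.f_add_left[OF psi W12_test[OF uv(1)] W12_scale[OF W12_test[OF uv(2)]], of \<i>] f.f_scl_left[OF psi W12_test[OF uv(2)], of \<i>] by simp
    hence "cmod (f p \<psi>) \<le> cmod (f (cr u) \<psi>) + cmod (f (cr v) \<psi>)"
      using norm_triangle_ineq[of "f (cr u) \<psi>" "cnj \<i> * f (cr v) \<psi>"] by (simp add: norm_mult)
    also have "\<dots> \<le> E * Wr u + E * Wr v" using E[OF uv(1)] E[OF uv(2)] unfolding f_def by linarith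
    also have "\<dots> \<le> E * W.nrm p + E * W.nrm p"
    proof (intro add_mono mult_left_mono E0)
      show "Wr u \<le> W.nrm p" "Wr v \<le> W.nrm p"
        by (rule power2_le_imp_le; simp add: uv(3) W_nrm_ctest[OF uv(1,2)])+
    qed
    finally show ?thesis by simp
  qed
  obtain p where p: "\<And>n::nat. ctest_fun (p n)" "W_lim p \<phi>" using ctest_dense_seq[OF phi] by blast
  have z: "W.nrm (\<lambda>t. \<psi> t - \<psi> t) = 0" using W.nrm_scl[OF psi, of 0] by simp
  have c: "(\<lambda>n::nat. W.nrm (\<lambda>t. \<psi> t - \<psi> t)) \<longlonglongrightarrow> 0" by (simp only: z tendsto_const)
  have "(\<lambda>n. cmod (f (p n) \<psi>)) \<longlonglongrightarrow> cmod (f \<phi> \<psi>)"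
    by (intro tendsto_norm bform_tendsto[OF bf W12_ctest[OF p(1)] phi p(2) psi psi c])
  moreover have "(\<lambda>n. 2 * E * W.nrm (p n)) \<longlonglongrightarrow> 2 * E * W.nrm \<phi>"
    by (intro tendsto_mult tendsto_const W_nrm_tendsto[OF W12_ctest[OF p(1)] phi p(2)])
  ultimately have "cmod (f \<phi> \<psi>) \<le> 2 * E * W.nrm \<phi>" by (rule LIMSEQ_le) (use ct[OF p(1)] in auto)
  thus ?thesis by (simp add: f_def)
qed

end

section \<open>Modulated bumps\<close>

lemma smooth_cos: "smooth (\<lambda>x::real. cos (k * x + p))"
  and partial_cos: "partial (\<lambda>x::real. cos (k * x + p)) 1 = (\<lambda>x. - (k * sin (k * x + p)))"
  and smooth_sin: "smooth (\<lambda>x::real. sin (k * x + p))"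
  and partial_sin: "partial (\<lambda>x::real. sin (k * x + p)) 1 = (\<lambda>x. k * cos (k * x + p))"
proof -
  let ?S = "{g. \<exists>A B. g = (\<lambda>x::real. A * cos (k * x + p) + B * sin (k * x + p))}"
  have step: "\<exists>g'\<in>?S. \<forall>x. (g has_real_derivative g' x) (at x)" if g: "g \<in> ?S" for g
  proof -
    obtain A B where g: "g = (\<lambda>x. A * cos (k * x + p) + B * sin (k * x + p))" using g by auto
    have "(g has_real_derivative (B * k) * cos (k * x + p) + (- A * k) * sin (k * x + p)) (at x)" for x
      unfolding g by (auto intro!: derivative_eq_intros)
    thus ?thesis by (intro bexI[of _ "\<lambda>x. (B * k) * cos (k * x + p) + (- A * k) * sin (k * x + p)"] allI CollectI exI[of _ "B * k"] exI[of _ "- A * k"]) auto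
  qed
  have sm: "smooth (\<lambda>x::real. A * cos (k * x + p) + B * sin (k * x + p))" for A B
    by (rule smooth_realI[of _ ?S, OF _ step]) auto
  show c: "smooth (\<lambda>x::real. cos (k * x + p))" using sm[of 1 0] by simp
  show s: "smooth (\<lambda>x::real. sin (k * x + p))" using sm[of 0 1] by simp
  show "partial (\<lambda>x::real. cos (k * x + p)) 1 = (\<lambda>x. - (k * sin (k * x + p)))"
    by (rule ext, rule DERIV_unique[OF smooth_real_deriv[OF c]]) (auto intro!: derivative_eq_intros)
  show "partial (\<lambda>x::real. sin (k * x + p)) 1 = (\<lambda>x. k * cos (k * x + p))"
    by (rule ext, rule DERIV_unique[OF smooth_real_deriv[OF s]]) (auto intro!: derivative_eq_intros)
qed

lemma rescaled_test:
  fixes g :: "real \<Rightarrow> real"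
  assumes g: "test_fun g" and s: "s > 0"
  shows "test_fun (\<lambda>x. g (c + x * s))" and "partial (\<lambda>x. g (c + x * s)) 1 = (\<lambda>x. s * partial g 1 (c + x * s))"
    and "rnorm (\<lambda>x. g (c + x * s)) = rnorm g / sqrt s"
proof -
  have sm: "smooth (\<lambda>x. g (c + x * s))" using smooth_affine[OF test_fun_smooth[OF g], of c s] by simp
  obtain R where R: "\<And>x. norm x > R \<Longrightarrow> g x = 0" using test_fun_support[OF g] by metis
  show t: "test_fun (\<lambda>x. g (c + x * s))"
  proof (rule test_funI[OF sm])
    fix x :: real assume "norm x > (\<bar>R\<bar> + \<bar>c\<bar>) / s"
    hence "\<bar>R\<bar> + \<bar>c\<bar> < \<bar>x * s\<bar>" using s by (simp add: field_simps abs_mult)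
    thus "g (c + x * s) = 0" by (intro R) simp
  qed
  have "((\<lambda>x. g (c + x * s)) has_real_derivative s * partial g 1 (c + x * s)) (at x)" for x
  proof -
    have "((\<lambda>x. c + x * s) has_real_derivative s) (at x)" by (auto intro!: derivative_eq_intros)
    from DERIV_chain2[OF smooth_real_deriv[OF test_fun_smooth[OF g]] this] show ?thesis by (simp add: mult.commute)
  qed
  thus "partial (\<lambda>x. g (c + x * s)) 1 = (\<lambda>x. s * partial g 1 (c + x * s))"
    by (intro ext DERIV_unique[OF smooth_real_deriv[OF sm]])
  have "(LBINT x. (g x)\<^sup>2) = s * (LBINT x. (g (c + s * x))\<^sup>2)"
    using lborel_integral_real_affine[of s "\<lambda>x. (g x)\<^sup>2" c] s by simp
  hence "(rnorm (\<lambda>x. g (c + x * s)))\<^sup>2 = (rnorm g / sqrt s)\<^sup>2"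
    unfolding norm_L2_test[OF t] power_divide norm_L2_test[OF g] using s by (simp add: mult.commute field_simps)
  thus "rnorm (\<lambda>x. g (c + x * s)) = rnorm g / sqrt s"
    by (rule power2_eq_imp_eq) (use s in auto)
qed

lemma norm_L2_mult_trig:
  fixes g h :: "real \<Rightarrow> real"
  assumes g: "test_fun g" and h: "smooth h" "\<And>x. \<bar>h x\<bar> \<le> 1"
  shows "rnorm (\<lambda>x. h x * g x) \<le> rnorm g"
proof -
  have hm: "cr h \<in> borel_measurable lebesgue"
    using borel_measurable_continuous_onI[OF smooth_continuous[OF h(1)]] by (auto intro: measurable_completion)
  have b: "AE x in lebesgue. cmod (cr h x * cr g x) \<le> 1 * cmod (cr g x)"
    using h(2) by (intro AE_I2) (auto simp: abs_mult norm_mult mult_left_le_one_le)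
  show ?thesis using norm_L2_mult_le_AE(2)[OF test_fun_L2[OF g] hm b] by simp
qed

text \<open>In f'' + k^2 f the terms with k^2 cancel, leaving cos G'' - 2 k sin G'. The phases 0 and
  -pi / 2 yield cosine and sine, whose squares add up to 1, so one of the two functions keeps at
  least half of the squared norm of G. This replaces the evaluation of an oscillatory
  integral.\<close>

lemma modulated_bump:
  fixes G :: "real \<Rightarrow> real" and k :: real
  assumes G: "test_fun G"
  defines "f \<equiv> \<lambda>p x. cos (k * x + p) * G x"
  shows "test_fun (f p)" and "rnorm (f p) \<le> rnorm G"
    and "rnorm (\<lambda>x. partial (partial (f p) 1) 1 x + k\<^sup>2 * f p x) \<le> rnorm (partial (partial G 1) 1) + 2 * \<bar>k\<bar> * rnorm (partial G 1)"
    and "(rnorm (f 0))\<^sup>2 + (rnorm (f (- pi / 2)))\<^sup>2 = (rnorm G)\<^sup>2"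
proof -
  have b: "(1::real) \<in> Basis" by simp
  note sG = test_fun_smooth[OF G]
  have G1: "test_fun (partial G 1)" and G2: "test_fun (partial (partial G 1) 1)" by (intro test_fun_partial G b)+
  note s1 = test_fun_smooth[OF G1]
  show t: "test_fun (f p)" for p unfolding f_def by (rule test_fun_mult[OF smooth_cos G])
  show "rnorm (f p) \<le> rnorm G" unfolding f_def by (rule norm_L2_mult_trig[OF G smooth_cos]) simp
  have "partial (f p) 1 = (\<lambda>x. - (k * sin (k * x + p)) * G x + partial G 1 x * cos (k * x + p))"
    unfolding f_def partial_mult[OF smooth_cos sG b] partial_cos ..
  also have "\<dots> = (\<lambda>x. (- k) * (sin (k * x + p) * G x) + cos (k * x + p) * partial G 1 x)" by (simp add: fun_eq_iff mult_ac)
  finally have d1: "partial (f p) 1 = (\<lambda>x. (- k) * (sin (k * x + p) * G x) + cos (k * x + p) * partial G 1 x)" .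
  have d2: "partial (partial (f p) 1) 1 x + k\<^sup>2 * f p x = cos (k * x + p) * partial (partial G 1) 1 x - (2 * k) * (sin (k * x + p) * partial G 1 x)" for x
    unfolding d1 partial_add[OF smooth_cmult[OF smooth_mult[OF smooth_sin sG]] smooth_mult[OF smooth_cos s1] b]
      partial_cmult[OF smooth_mult[OF smooth_sin sG] b] partial_mult[OF smooth_sin sG b] partial_mult[OF smooth_cos s1 b] partial_sin partial_cos
    by (simp add: f_def algebra_simps power2_eq_square)
  have tc: "test_fun (\<lambda>x. cos (k * x + p) * partial (partial G 1) 1 x)" by (rule test_fun_mult[OF smooth_cos G2])
  have ts: "test_fun (\<lambda>x. sin (k * x + p) * partial G 1 x)" by (rule test_fun_mult[OF smooth_sin G1])
  have "rnorm (\<lambda>x. partial (partial (f p) 1) 1 x + k\<^sup>2 * f p x) = norm_L2 (\<lambda>x. cr (\<lambda>x. cos (k * x + p) * partial (partial G 1) 1 x) x - complex_of_real (2 * k) * cr (\<lambda>x. sin (k * x + p) * partial G 1 x) x)"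
    unfolding d2 by (simp only: of_real_diff of_real_mult)
  also have "\<dots> \<le> rnorm (\<lambda>x. cos (k * x + p) * partial (partial G 1) 1 x) + norm_L2 (\<lambda>x. complex_of_real (2 * k) * cr (\<lambda>x. sin (k * x + p) * partial G 1 x) x)"
    by (rule norm_L2_triangle_diff[OF test_fun_L2[OF tc] L2_scale[OF test_fun_L2[OF ts]]])
  also have "\<dots> \<le> rnorm (partial (partial G 1) 1) + 2 * \<bar>k\<bar> * rnorm (partial G 1)"
    unfolding norm_L2_scale norm_of_real
    by (intro add_mono mult_mono norm_L2_mult_trig[OF G2 smooth_cos] norm_L2_mult_trig[OF G1 smooth_sin]) (auto simp: abs_mult)
  finally show "rnorm (\<lambda>x. partial (partial (f p) 1) 1 x + k\<^sup>2 * f p x) \<le> rnorm (partial (partial G 1) 1) + 2 * \<bar>k\<bar> * rnorm (partial G 1)" .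
  have "(LBINT x. (f 0 x)\<^sup>2) + (LBINT x. (f (- pi / 2) x)\<^sup>2) = (LBINT x. (f 0 x)\<^sup>2 + (f (- pi / 2) x)\<^sup>2)"
    by (rule Bochner_Integration.integral_add[symmetric]) (intro test_sq_integrable t)+
  also have "(\<lambda>x. (f 0 x)\<^sup>2 + (f (- pi / 2) x)\<^sup>2) = (\<lambda>x. (G x)\<^sup>2)"
  proof
    fix x
    have "cos (k * x + - pi / 2) = sin (k * x)" by (simp add: cos_diff)
    thus "(f 0 x)\<^sup>2 + (f (- pi / 2) x)\<^sup>2 = (G x)\<^sup>2"
      by (simp add: f_def power_mult_distrib distrib_right[symmetric])
  qed
  finally show "(rnorm (f 0))\<^sup>2 + (rnorm (f (- pi / 2)))\<^sup>2 = (rnorm G)\<^sup>2"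
    unfolding norm_L2_test[OF t] norm_L2_test[OF G] .
qed

lemma norm_moll_pos: "rnorm (moll 1 :: real \<Rightarrow> real) > 0"
proof -
  have "rnorm (moll 1 :: real \<Rightarrow> real) \<noteq> 0"
  proof
    assume "rnorm (moll 1 :: real \<Rightarrow> real) = 0"
    hence "AE x in lebesgue. (moll 1 :: real \<Rightarrow> real) x = 0"
      using norm_L2_eq_0_iff[OF test_fun_L2[OF test_fun_moll[where 'a = real]], of 1] by simp
    hence "integral\<^sup>L lebesgue (moll 1 :: real \<Rightarrow> real) = integral\<^sup>L lebesgue (\<lambda>x::real. 0)"
      by (intro integral_cong_AE) (use test_fun_integrable[OF test_fun_moll] in auto)
    thus False using integral_moll[of 1, where 'a = real] by simp
  qed
  thus ?thesis by (simp add: order_less_le)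
qed

context leaky
begin

text \<open>For each prospective resolvent constant K there is a function whose defect is too small
  for \<open>weyl_bound\<close>. The choices depend on each other in a fixed order: v from r, the
  tolerance e from v, the distance L from e, the width 1 / t of the bump from k and r, and last its
  position.\<close>

lemma weyl_sequence:
  assumes K: "K \<ge> 0"
  shows "\<exists>\<psi> \<epsilon>. \<epsilon> \<ge> 0 \<and> W12 \<psi> \<and> (\<forall>\<phi>. W12 \<phi> \<longrightarrow> cmod (s \<phi> \<psi> - complex_of_real (k\<^sup>2 - \<kappa>\<^sup>2) * inner_L2 \<phi> \<psi>) \<le> \<epsilon> * W.nrm \<phi>) \<and> K * \<epsilon> < norm_L2 \<psi>"
proof -
  \<comment> \<open>Three defects of r Y each, with Y = R Nv, doubled by \<open>weyl_extend\<close>,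
    give 6 r Y. Times K this is below Y / 2, which the norm exceeds for one of the two
    phases.\<close>
  define r where "r = 1 / (12 * (K + 1))"
  have r: "r > 0" using K by (simp add: r_def)
  \<comment> \<open>Cancels the factor 1 + \<kappa> in \<open>weyl_test\<close>.\<close>
  define \<delta> where "\<delta> = r / (1 + \<kappa>)"
  have dl: "\<delta> > 0" using r \<kappa> by (simp add: \<delta>_def)
  obtain v where v: "test_fun v" "rnorm v > 0" "rnorm (ann v) \<le> \<delta> * rnorm v"
    using approx_ground_state[OF dl] by blast
  define Nv where "Nv = rnorm v"
  define B where "B = \<bar>v a\<bar> + \<bar>v (-a)\<bar>"
  have B0: "B \<ge> 0" by (simp add: B_def)
  \<comment> \<open>Compensates the values of v on the two lines; B + 1 because both may be
    0.\<close>
  define e where "e = r * Nv / (2 * (B + 1))"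
  have e: "e > 0" using r v(2) B0 by (simp add: e_def Nv_def)
  obtain L1 where L1: "AE x in lebesgue. \<bar>x\<bar> > L1 \<longrightarrow> \<bar>Vp x\<bar> \<le> e" using Vp0[OF e] by blast
  obtain L2' where L2': "AE x in lebesgue. \<bar>x\<bar> > L2' \<longrightarrow> \<bar>Vm x\<bar> \<le> e" using Vm0[OF e] by blast
  define L where "L = max L1 L2'"
  let ?g = "moll 1 :: real \<Rightarrow> real"
  have b: "(1::real) \<in> Basis" by simp
  have g: "test_fun ?g" by (rule test_fun_moll)
  have g1: "test_fun (partial ?g 1)" and g2: "test_fun (partial (partial ?g 1) 1)" by (intro test_fun_partial g b)+
  define n0 n1 n2 where "n0 = rnorm ?g" and "n1 = rnorm (partial ?g 1)" and "n2 = rnorm (partial (partial ?g 1) 1)"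
  have n0: "n0 > 0" unfolding n0_def by (rule norm_moll_pos)
  have n12: "n1 \<ge> 0" "n2 \<ge> 0" by (simp_all add: n1_def n2_def)
  define Z where "Z = n2 + 2 * \<bar>k\<bar> * n1"
  have Z0: "Z \<ge> 0" using n12 by (simp add: Z_def)
  \<comment> \<open>Each derivative of the stretched bump gains a factor t. With t \<le> 1 the whole
    longitudinal defect is at most t Z relative to the common factor 1 / sqrt t.\<close>
  define t where "t = min 1 (r * n0 / (Z + 1))"
  have t: "t > 0" "t \<le> 1" "t * Z \<le> r * n0"
  proof -
    show "t > 0" "t \<le> 1" using r n0 Z0 by (auto simp: t_def)
    have "t * Z \<le> t * (Z + 1)" using \<open>t > 0\<close> by simp
    also have "\<dots> \<le> r * n0 / (Z + 1) * (Z + 1)" using Z0 by (intro mult_right_mono) (auto simp: t_def)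
    also have "\<dots> = r * n0" using Z0 by simp
    finally show "t * Z \<le> r * n0" .
  qed
  \<comment> \<open>The mollifier lives on [-1, 1], so c + x t \<ge> -1 on the support, that is x
    \<ge> L + 1.\<close>
  define c where "c = - ((L + 1 / t + 1) * t)"
  define G where "G x = ?g (c + x * t)" for x
  have G: "test_fun G" unfolding G_def[abs_def] by (rule rescaled_test(1)[OF g t(1)])
  have G1: "partial G 1 = (\<lambda>x. t * partial ?g 1 (c + x * t))" unfolding G_def[abs_def] by (rule rescaled_test(2)[OF g t(1)])
  have G2: "partial (partial G 1) 1 = (\<lambda>x. t * (t * partial (partial ?g 1) 1 (c + x * t)))"
    unfolding G1 partial_cmult[OF test_fun_smooth[OF rescaled_test(1)[OF g1 t(1)]] b] rescaled_test(2)[OF g1 t(1)] ..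
  define R where "R = n0 / sqrt t"
  have R: "R > 0" using n0 t by (simp add: R_def)
  have nG: "rnorm G = R" unfolding G_def[abs_def] R_def n0_def by (rule rescaled_test(3)[OF g t(1)])
  have nG1: "rnorm (partial G 1) = t * (n1 / sqrt t)"
    unfolding G1 n1_def of_real_mult norm_L2_scale rescaled_test(3)[OF g1 t(1)] using t by simp
  have nG2: "rnorm (partial (partial G 1) 1) = t * (t * (n2 / sqrt t))"
    unfolding G2 n2_def of_real_mult norm_L2_scale rescaled_test(3)[OF g2 t(1)] using t by simp
  have nZ: "rnorm (partial (partial G 1) 1) + 2 * \<bar>k\<bar> * rnorm (partial G 1) \<le> r * R"
  proof -
    have "t * (t * (n2 / sqrt t)) \<le> t * (1 * (n2 / sqrt t))" using t n12 by (intro mult_left_mono mult_right_mono) auto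
    hence "rnorm (partial (partial G 1) 1) + 2 * \<bar>k\<bar> * rnorm (partial G 1) \<le> t * (n2 / sqrt t) + 2 * \<bar>k\<bar> * (t * (n1 / sqrt t))"
      unfolding nG1 nG2 by simp
    also have "\<dots> = (t * Z) / sqrt t" by (simp add: Z_def algebra_simps add_divide_distrib)
    also have "\<dots> \<le> (r * n0) / sqrt t" using t by (intro divide_right_mono) auto
    also have "\<dots> = r * R" by (simp add: R_def)
    finally show ?thesis .
  qed
  define f where "f p x = cos (k * x + p) * G x" for p x
  note mb = modulated_bump[OF G, of k, folded f_def]
  have supp: "\<bar>x\<bar> > L" if "f p x \<noteq> 0" for p x
  proof -
    have "?g (c + x * t) \<noteq> 0" using that by (auto simp: f_def G_def)
    hence "\<bar>c + x * t\<bar> \<le> 1" using moll_support[of 1 "c + x * t"] by (metis not_less real_norm_def)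
    hence "- 1 \<le> c + x * t" by linarith
    hence "(L + 1) * t \<le> x * t" using t by (simp add: c_def algebra_simps)
    hence "L + 1 \<le> x" using t(1) by (simp add: mult_le_cancel_right)
    thus ?thesis by linarith
  qed
  have V: "AE x in lebesgue. f p x \<noteq> 0 \<longrightarrow> \<bar>Vp x\<bar> \<le> e" "AE x in lebesgue. f p x \<noteq> 0 \<longrightarrow> \<bar>Vm x\<bar> \<le> e" for p
    using L1 L2' by (eventually_elim, use supp[of p] in \<open>force simp: L_def\<close>)+
  define \<psi> where "\<psi> p = (\<lambda>z::plane. f p (fst z) * v (snd z))" for p
  have pW: "W12 (cr (\<psi> p))" for p unfolding \<psi>_def by (rule W12_test[OF test_fun_tensor[OF mb(1) v(1)]])
  define E where "E = 3 * (r * (R * Nv))"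
  have E0: "E \<ge> 0" using r R v(2) by (simp add: E_def Nv_def)
  have bound: "cmod (s (cr u) (cr (\<psi> p)) - complex_of_real (k\<^sup>2 - \<kappa>\<^sup>2) * inner_L2 (cr u) (cr (\<psi> p))) \<le> E * Wr u" if u: "test_fun u" for u p
  proof -
    have "rnorm (\<lambda>x. partial (partial (f p) 1) 1 x + k\<^sup>2 * f p x) * rnorm v
     + (1 + \<kappa>) * (rnorm (f p) * rnorm (ann v))
     + sqrt 2 * (\<bar>v a\<bar> + \<bar>v (-a)\<bar>) * (e * rnorm (f p)) \<le> r * (R * Nv) + r * (R * Nv) + r * (R * Nv)"
    proof (intro add_mono)
      show "rnorm (\<lambda>x. partial (partial (f p) 1) 1 x + k\<^sup>2 * f p x) * rnorm v \<le> r * (R * Nv)"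
        using mult_right_mono[OF order_trans[OF mb(3) nZ] norm_L2_nonneg[of "cr v"]] by (simp add: Nv_def mult.assoc)
      have nf: "rnorm (f p) \<le> R" using mb(2)[of p] nG by simp
      have "(1 + \<kappa>) * (rnorm (f p) * rnorm (ann v)) \<le> (1 + \<kappa>) * (R * (\<delta> * Nv))"
        using nf v(3) R \<kappa> unfolding Nv_def by (intro mult_left_mono mult_mono) auto
      also have "\<dots> = r * (R * Nv)" using \<kappa> by (simp add: \<delta>_def)
      finally show "(1 + \<kappa>) * (rnorm (f p) * rnorm (ann v)) \<le> r * (R * Nv)" .
      have "sqrt 2 * (\<bar>v a\<bar> + \<bar>v (-a)\<bar>) * (e * rnorm (f p)) \<le> (2 * (B + 1)) * (e * R)"
        using nf e B0 unfolding B_def[symmetric] by (intro mult_mono) (auto intro: real_le_lsqrt)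
      also have "\<dots> = r * (R * Nv)" using B0 by (simp add: e_def)
      finally show "sqrt 2 * (\<bar>v a\<bar> + \<bar>v (-a)\<bar>) * (e * rnorm (f p)) \<le> r * (R * Nv)" .
    qed
    also have "\<dots> = E" by (simp add: E_def)
    finally have "(rnorm (\<lambda>x. partial (partial (f p) 1) 1 x + k\<^sup>2 * f p x) * rnorm v
     + (1 + \<kappa>) * (rnorm (f p) * rnorm (ann v))
     + sqrt 2 * (\<bar>v a\<bar> + \<bar>v (-a)\<bar>) * (e * rnorm (f p))) * Wr u \<le> E * Wr u" by (rule mult_right_mono) simp
    thus ?thesis
      using weyl_test[OF u mb(1)[of p] v(1) less_imp_le[OF e] V[of p], where k = k] unfolding \<psi>_def by linarith
  qed
  have npsi: "rnorm (\<psi> p) = rnorm (f p) * Nv" for p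
    unfolding \<psi>_def Nv_def
    by (rule norm_tensor(2)) (intro test_fun_measurable mb(1) v(1) test_sq_integrable)+
  define Y where "Y = R * Nv"
  have Y: "Y > 0" using R v(2) by (simp add: Y_def Nv_def)
  have sum: "(rnorm (\<psi> 0))\<^sup>2 + (rnorm (\<psi> (- pi / 2)))\<^sup>2 = Y\<^sup>2"
    unfolding npsi power_mult_distrib distrib_right[symmetric] mb(4) nG Y_def ..
  have KE: "K * (2 * E) < Y / 2"
  proof -
    have "K * (2 * E) = (Y / 2) * (K / (K + 1))" using K by (simp add: E_def r_def Y_def field_simps)
    also have "\<dots> < (Y / 2) * 1" using K Y by (intro mult_strict_left_mono) auto
    finally show ?thesis by simp
  qed
  have "\<exists>p. Y / 2 < rnorm (\<psi> p)"
  proof (rule ccontr)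
    assume "\<not> ?thesis"
    hence "rnorm (\<psi> p) \<le> Y / 2" for p by (simp add: not_less)
    hence "(rnorm (\<psi> p))\<^sup>2 \<le> (Y / 2)\<^sup>2" for p by (intro power_mono) auto
    from this[of 0] this[of "- pi / 2"] have "Y\<^sup>2 \<le> 2 * (Y / 2)\<^sup>2" using sum by linarith
    thus False using Y by (simp add: power2_eq_square)
  qed
  then obtain p where p: "Y / 2 < rnorm (\<psi> p)" by blast
  have fin: "cmod (s \<phi> (cr (\<psi> p)) - complex_of_real (k\<^sup>2 - \<kappa>\<^sup>2) * inner_L2 \<phi> (cr (\<psi> p))) \<le> 2 * E * W.nrm \<phi>" if "W12 \<phi>" for \<phi>
    by (rule weyl_extend[OF pW bound E0 that])
  show ?thesis
    by (intro exI[of _ "cr (\<psi> p)"] exI[of _ "2 * E"] conjI allI impI fin pW) (use E0 KE p in auto)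
qed

text \<open>The averages over squares become scalar products with indicators, the squares of both
  lines being numbered consecutively. With them the inequality is nonnegativity of one bounded
  form.\<close>

lemma coercive_W12:
  assumes lam: "\<Lambda> < - \<kappa>\<^sup>2"
  obtains c C and N :: nat and e :: "nat \<Rightarrow> plane \<Rightarrow> complex" where "c > 0" "\<And>i. i < N \<Longrightarrow> L2 (e i)"
    "\<And>\<psi>. W12 \<psi> \<Longrightarrow> c * (W.nrm \<psi>)\<^sup>2 - C * (\<Sum>i<N. (cmod (inner_L2 (e i) \<psi>))\<^sup>2) \<le> Re (s \<psi> \<psi>) - \<Lambda> * (norm_L2 \<psi>)\<^sup>2"
proof -
  obtain c C p1 N1 p2 N2 h where c: "c > 0" and co: "\<And>u. test_fun u \<Longrightarrow>
     c * (Wr u)\<^sup>2 - C * ((\<Sum>j<(N1::nat). (LBINT z. sqr (p1 + real j * h) a h z * u z)\<^sup>2) + (\<Sum>j<(N2::nat). (LBINT z. sqr (p2 + real j * h) (-a) h z * u z)\<^sup>2))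
      \<le> Re (s (cr u) (cr u)) - \<Lambda> * (rnorm u)\<^sup>2"
    by (rule coercive_test[OF lam]) (rule that)
  define q where "q i = (if i < N1 then sqr (p1 + real i * h) a h else sqr (p2 + real (i - N1) * h) (-a) h)" for i
  have qL: "L2 (cr (q i))" for i using sqr_L2 by (simp add: q_def)
  have qm: "q i \<in> borel_measurable borel" for i using sqr_measurable by (simp add: q_def)
  have sum: "(\<Sum>i<N1 + N2. (LBINT z. q i z * u z)\<^sup>2) = (\<Sum>j<N1. (LBINT z. sqr (p1 + real j * h) a h z * u z)\<^sup>2) + (\<Sum>j<N2. (LBINT z. sqr (p2 + real j * h) (-a) h z * u z)\<^sup>2)" for u
  proof -
    have "(\<Sum>i<N1 + N2. (LBINT z. q i z * u z)\<^sup>2) = (\<Sum>i<N1. (LBINT z. q i z * u z)\<^sup>2) + (\<Sum>i<N2. (LBINT z. q (N1 + i) z * u z)\<^sup>2)"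
      by (induction N2) auto
    thus ?thesis by (simp add: q_def)
  qed
  define f where "f u v = s u v - complex_of_real \<Lambda> * inner_L2 u v - complex_of_real c * inner_W u v
     + complex_of_real C * (\<Sum>i<N1 + N2. cnj (inner_L2 (cr (q i)) u) * inner_L2 (cr (q i)) v)" for u v
  have bf: "bform f" unfolding f_def[abs_def]
    by (intro bform_add bform_diff bform_scale bform_s bform_inner_L2 bform_inner_W bform_sum bform_inner_functional qL) auto
  have Re_f: "Re (f u u) = Re (s u u) - \<Lambda> * (norm_L2 u)\<^sup>2 - c * (W.nrm u)\<^sup>2 + C * (\<Sum>i<N1 + N2. (cmod (inner_L2 (cr (q i)) u))\<^sup>2)" if "W12 u" for u
    using W.nrm_sq[OF that] by (simp add: f_def inner_L2_self cnj_mult_self del: of_real_power)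
  have "0 \<le> Re (f u u)" if "W12 u" for u
  proof (rule bform_nonneg_test[OF bf _ _ that])
    show "Im (f (cr u) (cr v)) = 0" if "test_fun u" "test_fun v" for u v
      using that by (simp add: f_def s_test inner_L2_test inner_W_def grad_form_def inner_wgrad_test inner_indicator_test[OF qm] flip: of_real_mult of_real_sum)
    show "0 \<le> Re (f (cr u) (cr u))" if u: "test_fun u" for u
    proof -
      have eq: "(\<Sum>i<N1 + N2. (cmod (inner_L2 (cr (q i)) (cr u)))\<^sup>2) = (\<Sum>i<N1 + N2. (LBINT z. q i z * u z)\<^sup>2)"
        by (simp add: inner_indicator_test[OF qm u])
      show ?thesis using co[OF u] Re_f[OF W12_test[OF u]] unfolding eq sum by linarith
    qed
  qed
  hence fin: "c * (W.nrm u)\<^sup>2 - C * (\<Sum>i<N1 + N2. (cmod (inner_L2 (cr (q i)) u))\<^sup>2) \<le> Re (s u u) - \<Lambda> * (norm_L2 u)\<^sup>2" if "W12 u" for u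
    using Re_f[OF that] that by (smt (verit))
  show ?thesis by (rule that[OF c qL fin])
qed

end

section \<open>Finiteness of the spectrum near a coercive point\<close>

context form_space
begin

text \<open>Coercivity at \<Lambda> persists with constant c / 2 at every l within c / 2, so
  wherever the lower bound fails there is an eigenvector. Eigenvectors for distinct l are
  orthogonal, and infinitely many of them contradict \<open>no_orthonormal_eigen\<close>.\<close>

lemma finite_spectrum_near:
  assumes e: "\<And>i. i < N \<Longrightarrow> E (e i)" and c: "c > 0"
    and co: "\<And>\<psi>. D \<psi> \<Longrightarrow> c * (q.nrm \<psi>)\<^sup>2 - C * (\<Sum>i<(N::nat). (cmod (b (e i) \<psi>))\<^sup>2) \<le> Re (s \<psi> \<psi>) - \<Lambda> * Re (b \<psi> \<psi>)"
  shows "finite {l. \<bar>l - \<Lambda>\<bar> < c / 2 \<and> \<not> (\<exists>d>0. lower (complex_of_real l) d)}" (is "finite ?S")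
proof (rule ccontr)
  assume "infinite ?S"
  then obtain l :: "nat \<Rightarrow> real" where l: "inj l" "range l \<subseteq> ?S" using infinite_countable_subset by blast
  have ls: "\<bar>l n - \<Lambda>\<bar> < c / 2" "\<not> (\<exists>d>0. lower (cr l n) d)" for n using l(2) by auto
  have "\<exists>\<psi> g. sol (of_real (l n)) \<psi> g \<and> b.nrm g = 0 \<and> b.nrm \<psi> = 1" for n
  proof -
    have co': "(c / 2) * (q.nrm \<psi>)\<^sup>2 - C * (\<Sum>i<N. (cmod (b (e i) \<psi>))\<^sup>2) \<le> Re (s \<psi> \<psi>) - l n * Re (b \<psi> \<psi>)" if p: "D \<psi>" for \<psi>
    proof -
      have "(b.nrm \<psi>)\<^sup>2 \<le> (q.nrm \<psi>)\<^sup>2" by (intro power_mono b_le_q p) (simp add: D_E p)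
      hence bq: "Re (b \<psi> \<psi>) \<le> (q.nrm \<psi>)\<^sup>2" by (simp add: b.nrm_sq D_E p)
      have "l n - \<Lambda> \<le> c / 2" using ls(1)[of n] by linarith
      hence "(l n - \<Lambda>) * Re (b \<psi> \<psi>) \<le> (c / 2) * (q.nrm \<psi>)\<^sup>2"
        using bq b.pos[OF D_E[OF p]] c by (intro mult_mono) auto
      thus ?thesis using co[OF p] by (simp add: algebra_simps)
    qed
    obtain \<psi> g where S: "sol (of_real (l n)) \<psi> g" "b.nrm g = 0" "b.nrm \<psi> \<noteq> 0"
      using eigen_or_lower[OF e _ co'] c ls(2)[of n] by (metis half_gt_zero)
    have D: "D \<psi>" "E g" "E \<psi>" using S(1) by (auto simp: sol_def D_E)
    let ?k = "complex_of_real (1 / b.nrm \<psi>)"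
    have "sol (of_real (l n)) (scl ?k \<psi>) (scl ?k g)" by (rule sol_scl[OF S(1)])
    moreover have "b.nrm (scl ?k g) = 0" "b.nrm (scl ?k \<psi>) = 1"
      using S(2,3) b.nrm_nonneg[OF D(3)] by (auto simp: b.nrm_scl D norm_divide)
    ultimately show ?thesis by blast
  qed
  then obtain x g where x: "\<And>n. sol (of_real (l n)) (x n) (g n)" "\<And>n. b.nrm (g n) = 0" "\<And>n. b.nrm (x n) = 1" by metis
  have xD: "D (x n)" "E (x n)" "E (g n)" for n using x(1)[of n] by (auto simp: sol_def D_E)
  have on: "b (x m) (x n) = (if m = n then 1 else 0)" for m n
  proof (cases "m = n")
    case True
    have "Re (b (x n) (x n)) = 1" using b.nrm_sq[OF xD(2), of n] x(3)[of n] by simp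
    thus ?thesis using True b.quad_real[OF xD(2), of n] by simp
  next
    case False
    have z: "b (x i) (g j) = 0" for i j using b.cauchy_schwarz[OF xD(2,3), of i j] x(2) by simp
    have 1: "s (x i) (x j) = of_real (l j) * b (x i) (x j)" for i j
      using x(1)[of j] xD(1)[of i] z[of i j] by (auto simp: sol_def)
    have "of_real (l n) * b (x m) (x n) = cnj (s (x n) (x m))"
      using 1[of m n] s.f_cnj[OF xD(1) xD(1), of n m] by simp
    also have "\<dots> = of_real (l m) * b (x m) (x n)"
      using 1[of n m] b.f_cnj[OF xD(2) xD(2), of n m] by simp
    finally have "l n = l m \<or> b (x m) (x n) = 0" by auto
    thus ?thesis using False l(1) by (auto dest: injD)
  qed
  show False by (rule no_orthonormal_eigen[OF e c co x(1,2) _ on]) (use ls(1) in \<open>auto intro: less_imp_le\<close>)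
qed

end

section \<open>The essential spectrum\<close>

locale L2_form = form_space "L2 :: ('a::euclidean_space \<Rightarrow> complex) \<Rightarrow> bool" D "\<lambda>f g x. f x + g x" "\<lambda>c f x. c * f x" inner_L2 s \<mu>
  for D s \<mu>
begin

abbreviation "G \<equiv> assoc_op D s"

lemma op_sol:
  assumes "G \<psi> g" shows "sol z \<psi> (\<lambda>x. g x - z * \<psi> x)"
proof -
  have L: "L2 g" "L2 \<psi>" "L2 (\<lambda>x. z * \<psi> x)" using assms by (auto simp: assoc_op_def intro: D_E L2_scale)
  have "inner_L2 \<phi> (\<lambda>x. g x - z * \<psi> x) = inner_L2 \<phi> g - z * inner_L2 \<phi> \<psi>" if "L2 \<phi>" for \<phi>
    using L2.f_sub[OF that L(1,3)] L2.f_scl[OF that L(2), of z] by simp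
  thus ?thesis using assms L by (simp add: sol_def assoc_op_def D_E L2_diff)
qed

lemma sol_op:
  assumes "sol z \<psi> h" shows "G \<psi> (\<lambda>x. h x + z * \<psi> x)"
proof -
  have L: "L2 h" "L2 \<psi>" "L2 (\<lambda>x. z * \<psi> x)" using assms by (auto simp: sol_def intro: D_E L2_scale)
  have "inner_L2 \<phi> (\<lambda>x. h x + z * \<psi> x) = inner_L2 \<phi> h + z * inner_L2 \<phi> \<psi>" if "L2 \<phi>" for \<phi>
    using L2.f_add[OF that L(1,3)] L2.f_scl[OF that L(2), of z] by simp
  thus ?thesis using assms L by (simp add: sol_def assoc_op_def D_E L2_add diff_eq_eq)
qed

lemma sol_cong:
  assumes S: "sol z \<psi> h" and h': "L2 h'" "AE x in lebesgue. h x = h' x"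
  shows "sol z \<psi> h'"
proof -
  have "L2 h" using S by (simp add: sol_def)
  hence "inner_L2 \<phi> h = inner_L2 \<phi> h'" if "D \<phi>" for \<phi>
    using h' D_E[OF that] by (intro inner_L2_cong_AE) auto
  thus ?thesis using S h'(1) by (simp add: sol_def)
qed

text \<open>Translates between the operator graph, with equality almost everywhere, and the weak
  equation. The constant C of the definition may have any sign, whence |C| + 1.\<close>

lemma resolvent_iff: "z \<in> resolvent_set G \<longleftrightarrow> onto z \<and> (\<exists>c>0. lower z c)"
proof
  assume z: "z \<in> resolvent_set G"
  have "onto z"
    unfolding onto_def
  proof (intro allI impI)
    fix f :: "'a \<Rightarrow> complex" assume f: "L2 f"
    then obtain \<psi> g where "G \<psi> g" "AE x in lebesgue. g x - z * \<psi> x = f x"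
      using z unfolding resolvent_set_def by blast
    thus "\<exists>\<psi>. sol z \<psi> f" using sol_cong[OF op_sol f] by blast
  qed
  moreover obtain C where C: "\<And>\<psi> g. G \<psi> g \<Longrightarrow> norm_L2 \<psi> \<le> C * norm_L2 (\<lambda>x. g x - z * \<psi> x)"
    using z unfolding resolvent_set_def by blast
  have "lower z (1 / (\<bar>C\<bar> + 1))"
    unfolding lower_def
  proof (intro allI impI)
    fix \<psi> g assume S: "sol z \<psi> g"
    have "norm_L2 \<psi> \<le> C * norm_L2 g" using C[OF sol_op[OF S]] by simp
    also have "\<dots> \<le> (\<bar>C\<bar> + 1) * norm_L2 g" by (intro mult_right_mono) auto
    finally show "1 / (\<bar>C\<bar> + 1) * b.nrm \<psi> \<le> b.nrm g" by (simp add: field_simps)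
  qed
  hence "\<exists>c>0. lower z c" by (intro exI[of _ "1 / (\<bar>C\<bar> + 1)"]) auto
  ultimately show "onto z \<and> (\<exists>c>0. lower z c)" ..
next
  assume "onto z \<and> (\<exists>c>0. lower z c)"
  then obtain c where o: "onto z" and c: "c > 0" "lower z c" by blast
  show "z \<in> resolvent_set G"
    unfolding resolvent_set_def
  proof (intro CollectI conjI allI impI)
    fix f :: "'a \<Rightarrow> complex" assume "L2 f"
    then obtain \<psi> where "sol z \<psi> f" using o unfolding onto_def by blast
    from sol_op[OF this] show "\<exists>\<psi> g. G \<psi> g \<and> (AE x in lebesgue. g x - z * \<psi> x = f x)"
      by (intro exI[of _ \<psi>] exI[of _ "\<lambda>x. f x + z * \<psi> x"]) simp
  next
    have "norm_L2 \<psi> \<le> 1 / c * norm_L2 (\<lambda>x. g x - z * \<psi> x)" if "G \<psi> g" for \<psi> g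
      using c(2)[unfolded lower_def, rule_format, OF op_sol[OF that]] c(1) by (simp add: field_simps)
    thus "\<exists>C. \<forall>\<psi> g. G \<psi> g \<longrightarrow> norm_L2 \<psi> \<le> C * norm_L2 (\<lambda>x. g x - z * \<psi> x)" by blast
  qed
qed

lemma spectrum_real: assumes "z \<in> spectrum_op G" obtains l where "z = complex_of_real l" "\<not> (\<exists>c>0. lower (complex_of_real l) c)"
proof -
  have z: "\<not> (onto z \<and> (\<exists>c>0. lower z c))" using assms by (simp add: spectrum_op_def resolvent_iff)
  have "Im z = 0"
  proof (rule ccontr)
    assume "Im z \<noteq> 0"
    hence "onto z \<and> (\<exists>c>0. lower z c)" using onto_nonreal lower_nonreal by (meson zero_less_abs_iff)
    with z show False ..
  qed
  hence "z = cr Re z" by (simp add: complex_eq_iff)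
  with z onto_real_if_lower show ?thesis by (metis that)
qed

text \<open>Contraposition of \<open>weyl_bound\<close>. \<open>N\<close> is any functional
  dominated by the form norm, so that defects may be measured in the Sobolev norm.\<close>

lemma spectrum_if_weyl:
  assumes C: "C \<ge> 0" "\<And>\<phi>. D \<phi> \<Longrightarrow> N \<phi> \<le> C * q.nrm \<phi>"
    and w: "\<And>K. K \<ge> 0 \<Longrightarrow> \<exists>\<psi> \<epsilon>. \<epsilon> \<ge> 0 \<and> D \<psi> \<and> (\<forall>\<phi>. D \<phi> \<longrightarrow> cmod (s \<phi> \<psi> - complex_of_real l * inner_L2 \<phi> \<psi>) \<le> \<epsilon> * N \<phi>) \<and> K * \<epsilon> < norm_L2 \<psi>"
  shows "complex_of_real l \<in> spectrum_op G"
proof (rule ccontr)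
  assume "\<not> ?thesis"
  then obtain c where o: "onto (of_real l)" "lower (of_real l) c" "c > 0" by (auto simp: spectrum_op_def resolvent_iff)
  show False
  proof (rule weyl_bound[OF o])
    fix K :: real
    assume K: "\<And>\<psi> \<epsilon>. \<epsilon> \<ge> 0 \<Longrightarrow> D \<psi> \<Longrightarrow>
      (\<And>\<phi>. D \<phi> \<Longrightarrow> cmod (s \<phi> \<psi> - of_real l * inner_L2 \<phi> \<psi>) \<le> \<epsilon> * q.nrm \<phi>) \<Longrightarrow> b.nrm \<psi> \<le> K * \<epsilon>"
  obtain \<psi> \<epsilon> where e: "\<epsilon> \<ge> 0" "D \<psi>" "\<And>\<phi>. D \<phi> \<Longrightarrow> cmod (s \<phi> \<psi> - complex_of_real l * inner_L2 \<phi> \<psi>) \<le> \<epsilon> * N \<phi>" "(\<bar>K\<bar> * C) * \<epsilon> < norm_L2 \<psi>"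
    using w[of "\<bar>K\<bar> * C"] C(1) by auto
  have "norm_L2 \<psi> \<le> K * (\<epsilon> * C)"
  proof (rule K[unfolded L2_nrm])
    show "cmod (s \<phi> \<psi> - complex_of_real l * inner_L2 \<phi> \<psi>) \<le> \<epsilon> * C * q.nrm \<phi>" if "D \<phi>" for \<phi>
      using e(3)[OF that] mult_left_mono[OF C(2)[OF that] e(1)] by (simp add: mult.assoc)
  qed (use e C in auto)
  also have "\<dots> \<le> \<bar>K\<bar> * (\<epsilon> * C)" using e C by (intro mult_right_mono) auto
  finally show False using e(4) by (simp add: mult_ac)
  qed
qed

text \<open>One coercivity inequality supplies all parts of discreteness: an eigenfunction by
  \<open>eigen_or_lower\<close>, finite multiplicity by \<open>no_orthonormal_eigen\<close> with a
  constant eigenvalue, isolation by \<open>finite_spectrum_near\<close>.\<close>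

lemma disc_if_coercive:
  assumes spec: "complex_of_real l \<in> spectrum_op G"
    and e: "\<And>i. i < N \<Longrightarrow> L2 (e i)" and c: "c > 0"
    and co: "\<And>\<psi>. D \<psi> \<Longrightarrow> c * (q.nrm \<psi>)\<^sup>2 - C * (\<Sum>i<(N::nat). (cmod (inner_L2 (e i) \<psi>))\<^sup>2) \<le> Re (s \<psi> \<psi>) - l * Re (inner_L2 \<psi> \<psi>)"
  shows "complex_of_real l \<in> disc_spectrum G"
  unfolding disc_spectrum_def
proof (intro CollectI conjI)
  show "complex_of_real l \<in> spectrum_op G" by (rule spec)
  have nl: "\<not> (\<exists>c>0. lower (complex_of_real l) c)"
    using spectrum_real[OF spec] by (metis of_real_eq_iff)
  then obtain \<psi> g where S: "sol (of_real l) \<psi> g" "norm_L2 g = 0" "norm_L2 \<psi> \<noteq> 0"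
    using eigen_or_lower[OF e c co] by (metis L2_nrm)
  have "L2 g" using S(1) by (simp add: sol_def)
  hence "AE x in lebesgue. g x = 0" using S(2) norm_L2_eq_0_iff by blast
  hence "eigenfun G (of_real l) \<psi>"
    unfolding eigenfun_def by (intro exI[of _ "\<lambda>x. g x + of_real l * \<psi> x"] conjI sol_op[OF S(1)]) auto
  thus "is_eigenvalue G (of_real l)" using S(3) by (auto simp: is_eigenvalue_def)
  show "finite_multiplicity G (of_real l)"
    unfolding finite_multiplicity_def
  proof (intro notI, elim exE conjE)
    fix f :: "nat \<Rightarrow> 'a \<Rightarrow> complex"
    assume f: "\<forall>n. eigenfun G (complex_of_real l) (f n)" and on: "\<forall>m n. inner_L2 (f m) (f n) = (if m = n then 1 else 0)"
    obtain g where g: "\<And>n. G (f n) (g n)" "\<And>n. AE x in lebesgue. g n x = complex_of_real l * f n x"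
      using f unfolding eigenfun_def by metis
    note S = op_sol[OF g(1), where z = "complex_of_real l"]
    have L: "L2 (\<lambda>x. g n x - complex_of_real l * f n x)" for n using S[of n] by (simp add: sol_def)
    have "b.nrm (\<lambda>x. g n x - complex_of_real l * f n x) = 0" for n
      unfolding L2_nrm norm_L2_eq_0_iff[OF L] using g(2)[of n] by eventually_elim simp
    from no_orthonormal_eigen[OF e c co S this _ on[rule_format]] c show False by simp
  qed
  have "finite {l'. \<bar>l' - l\<bar> < c / 2 \<and> \<not> (\<exists>d>0. lower (complex_of_real l') d)}" (is "finite ?F")
    by (rule finite_spectrum_near[OF e c co])
  from finite_set_avoid[OF this, of l] obtain d where d: "d > 0" "\<And>x. x \<in> ?F \<Longrightarrow> x \<noteq> l \<Longrightarrow> d \<le> dist l x" by blast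
  have "spectrum_op G \<inter> ball (complex_of_real l) (min d (c / 2)) = {complex_of_real l}" (is "?A = _")
  proof (intro equalityI subsetI)
    fix z assume z: "z \<in> ?A"
    then obtain l' where l': "z = complex_of_real l'" "\<not> (\<exists>c>0. lower (complex_of_real l') c)" by (auto elim: spectrum_real)
    have "\<bar>l' - l\<bar> < min d (c / 2)"
      using z unfolding l'(1) by (simp add: dist_norm abs_minus_commute flip: of_real_diff)
    hence "l' = l" using d(2)[of l'] l'(2) by (force simp: dist_real_def abs_minus_commute)
    thus "z \<in> {complex_of_real l}" by (simp add: l')
  qed (use spec d c in auto)
  thus "\<exists>\<epsilon>>0. spectrum_op G \<inter> ball (complex_of_real l) \<epsilon> = {complex_of_real l}" using d c
    by (intro exI[of _ "min d (c / 2)"]) auto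
qed

lemma ess_spectrum_eq:
  assumes A: "\<And>l. l \<ge> l0 \<Longrightarrow> complex_of_real l \<in> spectrum_op G"
    and B: "\<And>l. l < l0 \<Longrightarrow> complex_of_real l \<in> spectrum_op G \<Longrightarrow> complex_of_real l \<in> disc_spectrum G"
  shows "ess_spectrum G = complex_of_real ` {l0..}"
proof (intro equalityI subsetI)
  fix z assume z: "z \<in> ess_spectrum G"
  then obtain l where "z = complex_of_real l" by (auto simp: ess_spectrum_def elim: spectrum_real)
  thus "z \<in> complex_of_real ` {l0..}" using z B[of l] by (cases "l < l0") (auto simp: ess_spectrum_def)
next
  fix z assume "z \<in> complex_of_real ` {l0..}"
  then obtain l where l: "z = complex_of_real l" "l0 \<le> l" by auto
  have "z \<notin> disc_spectrum G"
  proof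
    assume "z \<in> disc_spectrum G"
    then obtain \<epsilon> where e: "\<epsilon> > 0" "spectrum_op G \<inter> ball z \<epsilon> = {z}" by (auto simp: disc_spectrum_def)
    have "complex_of_real (l + \<epsilon> / 2) \<in> spectrum_op G \<inter> ball z \<epsilon>"
      using A[of "l + \<epsilon> / 2"] l e(1) by (simp add: dist_norm norm_divide)
    hence "complex_of_real (l + \<epsilon> / 2) = complex_of_real l" unfolding e(2) unfolding l(1) by (rule singletonD)
    hence "l + \<epsilon> / 2 = l" by (simp only: of_real_eq_iff)
    thus False using e(1) by simp
  qed
  thus "z \<in> ess_spectrum G" using A l by (simp add: ess_spectrum_def)
qed

end

text \<open>The remaining work is to compare the form norm with the Sobolev norm, from below by
  Garding's inequality and from above by boundedness of the form. This gives closedness of the form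
  and transfers the Weyl bounds and the coercivity.\<close>

theorem (in leaky) ess_spectrum_bounded: "ess_spectrum (H_op \<alpha> Vp Vm a) = complex_of_real ` {- \<kappa>\<^sup>2..}"
proof -
  obtain \<mu> where mu: "\<And>u. W12 u \<Longrightarrow> (W.nrm u)\<^sup>2 / 2 + (norm_L2 u)\<^sup>2 / 2 \<le> Re (s u u) + \<mu> * (norm_L2 u)\<^sup>2"
    by (rule garding_W12) (rule that)
  obtain B where B: "B \<ge> 0" "\<And>u v. W12 u \<Longrightarrow> W12 v \<Longrightarrow> cmod (s u v) \<le> B * (W.nrm u * W.nrm v)" using bform_bound[OF bform_s] by blast
  \<comment> \<open>The upper comparison constant: the squared form norm is at most K times the
    squared Sobolev norm, which later turns coercivity with c into coercivity with c / K.\<close>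
  define K where "K = B + \<bar>\<mu>\<bar> + 1"
  have K: "K > 0" using B by (simp add: K_def)
  have up: "Re (s u u) + \<mu> * (norm_L2 u)\<^sup>2 \<le> K * (W.nrm u)\<^sup>2" if u: "W12 u" for u
  proof -
    have "Re (s u u) \<le> B * (W.nrm u)\<^sup>2" using B(2)[OF u u] complex_Re_le_cmod[of "s u u"] by (simp add: power2_eq_square)
    moreover have "\<mu> * (norm_L2 u)\<^sup>2 \<le> \<bar>\<mu>\<bar> * (W.nrm u)\<^sup>2" by (intro mult_mono power_mono norm_L2_le_W u) auto
    moreover have "0 \<le> (W.nrm u)\<^sup>2" by simp
    ultimately show ?thesis unfolding K_def distrib_right by linarith
  qed
  have lo: "(W.nrm u)\<^sup>2 \<le> 2 * (Re (s u u) + \<mu> * (norm_L2 u)\<^sup>2)" if "W12 u" for u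
    using mu[OF that] zero_le_power2[of "norm_L2 u"] unfolding distrib_left by linarith
  interpret F: L2_form W12 s \<mu>
  proof (intro L2_form.intro form_space.intro form_space_axioms.intro)
    show "psd_form L2 (\<lambda>f g (x::plane). f x + g x) (\<lambda>c f x. c * f x) inner_L2" by (rule L2.psd_form_axioms)
    show "herm_form W12 (\<lambda>f g x. f x + g x) (\<lambda>c f x. c * f x) s" by (rule bform_herm[OF bform_s])
    show "L2 u" if "W12 u" for u :: "plane \<Rightarrow> complex" using that by (simp add: W12_def)
    show "\<exists>u. W12 (u :: plane \<Rightarrow> complex)" using W12_test[OF test_fun_moll] by blast
    show "Re (inner_L2 u u) \<le> Re (s u u) + \<mu> * Re (inner_L2 u u)" if u: "W12 u" for u
    proof -
      have "(norm_L2 u)\<^sup>2 \<le> (W.nrm u)\<^sup>2" by (intro power_mono norm_L2_le_W u) simp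
      thus ?thesis using mu[OF u] unfolding inner_L2_self Re_complex_of_real by linarith
    qed
    fix x :: "nat \<Rightarrow> plane \<Rightarrow> complex"
    let ?d = "lsub (\<lambda>f g x. f x + g x) (\<lambda>c f x. c * f x) :: (plane \<Rightarrow> complex) \<Rightarrow> _"
    let ?Q = "\<lambda>v. Re (s v v) + \<mu> * Re (inner_L2 v v)"
    assume x: "\<And>n. W12 (x n)" and c: "\<And>e. e > 0 \<Longrightarrow> \<exists>N. \<forall>m\<ge>N. \<forall>n\<ge>N. ?Q (?d (x m) (x n)) < e"
    have "\<exists>N. \<forall>m\<ge>N. \<forall>n\<ge>N. W.nrm (\<lambda>t. x m t - x n t) < e" if e: "e > 0" for e
    proof -
      obtain N where N: "\<forall>m\<ge>N. \<forall>n\<ge>N. ?Q (?d (x m) (x n)) < e\<^sup>2 / 2"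
        using c[of "e\<^sup>2 / 2"] e by auto
      have "W.nrm (\<lambda>t. x m t - x n t) < e" if "m \<ge> N" "n \<ge> N" for m n
      proof (rule power2_less_imp_less)
        show "(W.nrm (\<lambda>t. x m t - x n t))\<^sup>2 < e\<^sup>2"
          using N[rule_format, OF that] lo[OF W12_diff[OF x x], of m n] by (simp add: inner_L2_self del: of_real_power)
      qed (use e in simp)
      thus ?thesis by blast
    qed
    from W12_complete[OF x this] obtain u where u: "W12 u" "W_lim x u" by blast
    have "(\<lambda>n. ?Q (?d (x n) u)) \<longlonglongrightarrow> 0"
    proof (rule Lim_null_comparison)
      have "norm (?Q (?d (x n) u)) \<le> K * (W.nrm (\<lambda>t. x n t - u t))\<^sup>2" for n
        using up[OF W12_diff[OF x u(1)], of n] lo[OF W12_diff[OF x u(1)], of n] zero_le_power2[of "W.nrm (\<lambda>t. x n t - u t)"]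
        unfolding L2_lsub inner_L2_self Re_complex_of_real real_norm_def distrib_left by linarith
      thus "\<forall>\<^sub>F n in sequentially. norm (?Q (?d (x n) u)) \<le> K * (W.nrm (\<lambda>t. x n t - u t))\<^sup>2" by simp
      show "(\<lambda>n. K * (W.nrm (\<lambda>t. x n t - u t))\<^sup>2) \<longlonglongrightarrow> 0"
        using tendsto_mult[OF tendsto_const[of K] tendsto_power[OF u(2), of 2]] by simp
    qed
    with u(1) show "\<exists>u. W12 u \<and> (\<lambda>n. ?Q (?d (x n) u)) \<longlonglongrightarrow> 0" by blast
  qed
  have qn: "(F.q.nrm u)\<^sup>2 = Re (s u u) + \<mu> * (norm_L2 u)\<^sup>2" if "W12 u" for u
    using F.q.nrm_sq[OF that] by (simp add: F.q_def inner_L2_self del: of_real_power)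
  have "complex_of_real l \<in> spectrum_op F.G" if l: "l \<ge> - \<kappa>\<^sup>2" for l
  proof (rule F.spectrum_if_weyl)
    show "W.nrm u \<le> 2 * F.q.nrm u" if u: "W12 u" for u
    proof (rule power2_le_imp_le)
      have "0 \<le> (F.q.nrm u)\<^sup>2" by simp
      thus "(W.nrm u)\<^sup>2 \<le> (2 * F.q.nrm u)\<^sup>2" using lo[OF u] qn[OF u] unfolding power_mult_distrib by simp
    qed (use u in simp)
    have "l = (sqrt (l + \<kappa>\<^sup>2))\<^sup>2 - \<kappa>\<^sup>2" using l by simp
    thus "\<exists>\<psi> \<epsilon>. \<epsilon> \<ge> 0 \<and> W12 \<psi> \<and> (\<forall>\<phi>. W12 \<phi> \<longrightarrow> cmod (s \<phi> \<psi> - complex_of_real l * inner_L2 \<phi> \<psi>) \<le> \<epsilon> * W.nrm \<phi>) \<and> K * \<epsilon> < norm_L2 \<psi>"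
      if "K \<ge> 0" for K using weyl_sequence[OF that, of "sqrt (l + \<kappa>\<^sup>2)"] by simp
  qed simp
  moreover have "complex_of_real l \<in> disc_spectrum F.G" if l: "l < - \<kappa>\<^sup>2" and spec: "complex_of_real l \<in> spectrum_op F.G" for l
  proof -
    obtain c C and N :: nat and e :: "nat \<Rightarrow> plane \<Rightarrow> complex" where c: "c > 0" and e: "\<And>i. i < N \<Longrightarrow> L2 (e i)"
      and co: "\<And>\<psi>. W12 \<psi> \<Longrightarrow> c * (W.nrm \<psi>)\<^sup>2 - C * (\<Sum>i<N. (cmod (inner_L2 (e i) \<psi>))\<^sup>2) \<le> Re (s \<psi> \<psi>) - l * (norm_L2 \<psi>)\<^sup>2"
      by (rule coercive_W12[OF l]) (rule that)
    show ?thesis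
    proof (rule F.disc_if_coercive[OF spec e])
      show "c / K > 0" using c K by simp
      fix \<psi> :: "plane \<Rightarrow> complex" assume p: "W12 \<psi>"
      have "(c / K) * (F.q.nrm \<psi>)\<^sup>2 \<le> (c / K) * (K * (W.nrm \<psi>)\<^sup>2)" unfolding qn[OF p] using up[OF p] c K by (intro mult_left_mono) auto
      also have "\<dots> = c * (W.nrm \<psi>)\<^sup>2" using K by simp
      finally show "(c / K) * (F.q.nrm \<psi>)\<^sup>2 - C * (\<Sum>i<N. (cmod (inner_L2 (e i) \<psi>))\<^sup>2) \<le> Re (s \<psi> \<psi>) - l * Re (inner_L2 \<psi> \<psi>)"
        using co[OF p] by (simp add: inner_L2_self del: of_real_power)
    qed
  qed
  ultimately show ?thesis unfolding H_op_def by (rule F.ess_spectrum_eq)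
qed

section \<open>Reduction to potentials bounded everywhere\<close>

lemma esssup_finite_imp_bound:
  assumes "V \<in> borel_measurable lebesgue" "esssup lebesgue (\<lambda>x::real. ereal \<bar>V x\<bar>) < \<infinity>"
  shows "\<exists>M\<ge>0. AE x in lebesgue. \<bar>V x\<bar> \<le> M"
proof -
  obtain M where M: "esssup lebesgue (\<lambda>x. ereal \<bar>V x\<bar>) \<le> ereal M"
    using assms(2) by (cases "esssup lebesgue (\<lambda>x. ereal \<bar>V x\<bar>)") auto
  have "AE x in lebesgue. \<bar>V x\<bar> \<le> \<bar>M\<bar>"
    using esssup_AE[of "\<lambda>x. ereal \<bar>V x\<bar>" lebesgue]
  proof eventually_elim
    case (elim x)
    hence "ereal \<bar>V x\<bar> \<le> ereal M" using M by (rule order_trans)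
    thus ?case by simp
  qed
  thus ?thesis by (intro exI[of _ "\<bar>M\<bar>"]) auto
qed

lemma esssup_tendsto_imp_decay:
  assumes V: "V \<in> borel_measurable lebesgue"
    and lim: "((\<lambda>L. esssup (restrict_space lebesgue (- {-L..L})) (\<lambda>x::real. ereal \<bar>V x\<bar>)) \<longlongrightarrow> 0) at_top" and e: "e > 0"
  shows "\<exists>L. AE x in lebesgue. \<bar>x\<bar> > L \<longrightarrow> \<bar>V x\<bar> \<le> e"
proof -
  have "\<forall>\<^sub>F L in at_top. esssup (restrict_space lebesgue (- {-L..L})) (\<lambda>x. ereal \<bar>V x\<bar>) < ereal e"
    using order_tendstoD(2)[OF lim, of "ereal e"] e by simp
  then obtain L where L: "esssup (restrict_space lebesgue (- {-L..L})) (\<lambda>x. ereal \<bar>V x\<bar>) < ereal e"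
    using eventually_happens'[OF trivial_limit_at_top_linorder] by blast
  have "AE x in restrict_space lebesgue (- {-L..L}). \<bar>V x\<bar> \<le> e"
    using esssup_AE[of "\<lambda>x. ereal \<bar>V x\<bar>" "restrict_space lebesgue (- {-L..L})"]
  proof eventually_elim
    case (elim x)
    hence "ereal \<bar>V x\<bar> \<le> ereal e" using L by (meson order_trans less_imp_le)
    thus ?case by simp
  qed
  hence "AE x in lebesgue. x \<in> - {-L..L} \<longrightarrow> \<bar>V x\<bar> \<le> e"
    by (subst (asm) AE_restrict_space_iff) auto
  hence "AE x in lebesgue. \<bar>x\<bar> > L \<longrightarrow> \<bar>V x\<bar> \<le> e" by eventually_elim auto
  thus ?thesis by blast
qed

text \<open>The potentials enter only through integrals, so potentials that agree almost everywhere
  define the same form and hence the same operator.\<close>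

lemma form_H_cong_AE:
  assumes V: "Vp \<in> borel_measurable lebesgue" "Vp' \<in> borel_measurable lebesgue" "AE x in lebesgue. Vp x = Vp' x"
    "Vm \<in> borel_measurable lebesgue" "Vm' \<in> borel_measurable lebesgue" "AE x in lebesgue. Vm x = Vm' x"
    and f: "W12 \<phi>" "W12 \<psi>"
  shows "form_H \<alpha> Vp Vm a \<phi> \<psi> = form_H \<alpha> Vp' Vm' a \<phi> \<psi>"
proof -
  have "(LEBINT x. complex_of_real (V x - \<alpha>) * cnj (trace_line \<phi> c x) * trace_line \<psi> c x)
      = (LEBINT x. complex_of_real (V' x - \<alpha>) * cnj (trace_line \<phi> c x) * trace_line \<psi> c x)"
    if "V \<in> borel_measurable lebesgue" "V' \<in> borel_measurable lebesgue" "AE x in lebesgue. V x = V' x" for V V' c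
  proof (rule integral_cong_AE)
    have [measurable]: "(\<lambda>x. cnj (trace_line \<phi> c x)) \<in> borel_measurable lebesgue" "trace_line \<psi> c \<in> borel_measurable lebesgue"
      using L2_measurable[OF L2_cnj[OF trace_line_L2[OF f(1)]]] L2_measurable[OF trace_line_L2[OF f(2)]] .
    note [measurable] = that(1,2)
    show "(\<lambda>x. complex_of_real (V x - \<alpha>) * cnj (trace_line \<phi> c x) * trace_line \<psi> c x) \<in> borel_measurable lebesgue"
      "(\<lambda>x. complex_of_real (V' x - \<alpha>) * cnj (trace_line \<phi> c x) * trace_line \<psi> c x) \<in> borel_measurable lebesgue" by measurable
  qed (use that(3) in \<open>eventually_elim, simp\<close>)
  from this[OF V(1-3)] this[OF V(4-6)] show ?thesis by (simp only: form_H_def)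
qed

text \<open>Clipping at an essential bound changes V on a null set only, makes the bound valid
  everywhere, and preserves decay at infinity because it never increases the modulus.\<close>

definition clip :: "real \<Rightarrow> (real \<Rightarrow> real) \<Rightarrow> real \<Rightarrow> real" where "clip M V x = max (- M) (min M (V x))"

lemma clip:
  assumes "M \<ge> 0" "V \<in> borel_measurable lebesgue"
  shows "clip M V \<in> borel_measurable lebesgue" "\<bar>clip M V x\<bar> \<le> M" "\<bar>clip M V x\<bar> \<le> \<bar>V x\<bar>" "\<bar>V x\<bar> \<le> M \<Longrightarrow> clip M V x = V x"
  using assms by (auto simp: clip_def[abs_def])

lemma clip_decay:
  assumes "M \<ge> 0" "V \<in> borel_measurable lebesgue"
    and "((\<lambda>L. esssup (restrict_space lebesgue (- {-L..L})) (\<lambda>x::real. ereal \<bar>V x\<bar>)) \<longlongrightarrow> 0) at_top" and "e > 0"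
  shows "\<exists>L. AE x in lebesgue. \<bar>x\<bar> > L \<longrightarrow> \<bar>clip M V x\<bar> \<le> e"
proof -
  obtain L where "AE x in lebesgue. \<bar>x\<bar> > L \<longrightarrow> \<bar>V x\<bar> \<le> e" using esssup_tendsto_imp_decay[OF assms(2-4)] by blast
  hence "AE x in lebesgue. \<bar>x\<bar> > L \<longrightarrow> \<bar>clip M V x\<bar> \<le> e" by eventually_elim (meson clip(3)[OF assms(1,2)] order_trans)
  thus ?thesis by blast
qed

theorem theorem3p1:
  fixes a \<alpha> :: real and Vp Vm :: "real \<Rightarrow> real"
  assumes "a > 0" and "\<alpha> > 0"
    and "Vp \<in> borel_measurable lebesgue" and "Vm \<in> borel_measurable lebesgue"
    and "esssup lebesgue (\<lambda>x. ereal \<bar>Vp x\<bar>) < \<infinity>"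
    and "esssup lebesgue (\<lambda>x. ereal \<bar>Vm x\<bar>) < \<infinity>"
    and "((\<lambda>L. esssup (restrict_space lebesgue (- {-L..L})) (\<lambda>x. ereal \<bar>Vp x\<bar>)) \<longlongrightarrow> 0) at_top"
    and "((\<lambda>L. esssup (restrict_space lebesgue (- {-L..L})) (\<lambda>x. ereal \<bar>Vm x\<bar>)) \<longlongrightarrow> 0) at_top"
  shows "ess_spectrum (H_op \<alpha> Vp Vm a) = complex_of_real ` {xi0 \<alpha> a..}"
proof -
  obtain \<kappa> where k: "\<kappa> > 0" "\<kappa> * (1 + tanh (\<kappa> * a)) = \<alpha>" by (rule ex_kappa[OF assms(1,2)])
  obtain Mp where Mp: "Mp \<ge> 0" "AE x in lebesgue. \<bar>Vp x\<bar> \<le> Mp" using esssup_finite_imp_bound[OF assms(3,5)] by blast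
  obtain Mm where Mm: "Mm \<ge> 0" "AE x in lebesgue. \<bar>Vm x\<bar> \<le> Mm" using esssup_finite_imp_bound[OF assms(4,6)] by blast
  let ?p = "clip Mp Vp" and ?m = "clip Mm Vm"
  note cp = clip[OF Mp(1) assms(3)] and cm = clip[OF Mm(1) assms(4)]
  note dp = clip_decay[OF Mp(1) assms(3,7)] and dm = clip_decay[OF Mm(1) assms(4,8)]
  interpret leaky a \<alpha> \<kappa> ?p ?m "max Mp Mm"
  proof
    show "\<bar>?p x\<bar> \<le> max Mp Mm" "\<bar>?m x\<bar> \<le> max Mp Mm" for x using cp(2)[of x] cm(2)[of x] by auto
  qed (use assms(1,2) k cp(1) cm(1) dp dm in auto)
  have "form_H \<alpha> Vp Vm a \<phi> \<psi> = form_H \<alpha> ?p ?m a \<phi> \<psi>" if "W12 \<phi>" "W12 \<psi>" for \<phi> \<psi>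
  proof (rule form_H_cong_AE[OF assms(3) cp(1) _ assms(4) cm(1) _ that])
    show "AE x in lebesgue. Vp x = ?p x" using Mp(2) by eventually_elim (simp add: cp(4))
    show "AE x in lebesgue. Vm x = ?m x" using Mm(2) by eventually_elim (simp add: cm(4))
  qed
  then have "H_op \<alpha> Vp Vm a = H_op \<alpha> ?p ?m a" unfolding H_op_def by (auto simp: fun_eq_iff assoc_op_def)
  then show ?thesis using ess_spectrum_bounded xi0_eq by simp
qed

end
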